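(* Let $d\ge1$, $X=\mathbb{R}^d/\mathbb{Z}^d$. Let $(f_{\alpha(s)},A_s)$ be a one-parameter $C^\infty$ family of $C^\infty$ premonotonic cocycles; that is, $s$ ranges over an open interval of $\mathbb{R}$, $s\mapsto\alpha(s)\in\mathbb{R}^d$ and $(s,x)\mapsto A_s(x)\in\mathrm{SL}(2,\mathbb{R})$ are $C^\infty$, and $(f_{\alpha(s)},A_s)$ is premonotonic for every $s$. Then $s\mapsto L(f_{\alpha(s)},A_s)$ is $C^\infty$.
   Context: For $\alpha\in\mathbb{R}^d$, $f_\alpha:X\to X$ is $f_\alpha(x)=x+\alpha$. For $A:X\to\mathrm{SL}(2,\mathbb{R})$, the cocycle $(f_\alpha,A)$ is the skew-product $(x,w)\mapsto(x+\alpha,A(x)\cdot w)$ on $X\times\mathbb{R}^2$; put $A_n(x)=A(x+(n-1)\alpha)\cdots A(x)$ for $n\ge1$ (the $n$-th iterate products). The Lyapunov exponent is $L(f_\alpha,A)=\lim_{n\to\infty}\frac1n\int_X\ln\|A_n(x)\|\,dx$. $A\in C^1(X,\mathrm{SL}(2,\mathbb{R}))$ is called monotonic if there is $w\in\mathbb{R}^d$ such that for every $x\in X$ and $y\in\mathbb{R}^2\setminus\{0\}$, (any continuous determination of) the argument of $A(x+tw)\cdot y$, $t\in\mathbb{R}$, has positive derivative with respect to $t$. The cocycle $(f_\alpha,A)$ with $A\in C^1$ is premonotonic if there are $n\ge1$ and $B\in C^1(X,\mathrm{SL}(2,\mathbb{R}))$ such that $x\mapsto B(x+n\alpha)A_n(x)B(x)^{-1}$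 is monotonic. *)

theory Defs
  imports "HOL-Analysis.Analysis"
begin

text \<open>
  Maps of class C^k on an open set \<open>S\<close> of a finite-dimensional space: all iterated directional
  derivatives up to order \<open>k\<close> exist (in the Frechet sense) and are continuous.  Since the
  source is finite-dimensional, asking for continuity of \<open>x \<mapsto> Df(x) v\<close> for every fixed \<open>v\<close> is the
  same as asking for continuity of \<open>x \<mapsto> Df(x)\<close> in operator norm.
\<close>

primrec Ck_on :: "nat \<Rightarrow> ('a::euclidean_space \<Rightarrow> 'b::real_normed_vector) \<Rightarrow> 'a set \<Rightarrow> bool" where
  "Ck_on 0 f S \<longleftrightarrow> continuous_on S f"
| "Ck_on (Suc k) f S \<longleftrightarrow>
     (\<forall>x\<in>S. f differentiable (at x)) \<and>
     (\<forall>v. Ck_on k (\<lambda>x. frechet_derivative f (at x) v) S)"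

definition smooth_on :: "('a::euclidean_space \<Rightarrow> 'b::real_normed_vector) \<Rightarrow> 'a set \<Rightarrow> bool" where
  "smooth_on f S \<longleftrightarrow> (\<forall>k. Ck_on k f S)"

text \<open>
  Maps on the torus \<open>X = R^d / Z^d\<close> are represented by their lifts, i.e. by \<open>Z^d\<close>-periodic maps on
  \<open>R^d\<close>; a map on \<open>X\<close> is C^k iff its lift is.
\<close>

definition torus_map :: "(real ^ 'd \<Rightarrow> 'b) \<Rightarrow> bool" where
  "torus_map f \<longleftrightarrow> (\<forall>x. \<forall>k :: int ^ 'd. f (x + (\<chi> i. of_int (k $ i))) = f x)"

definition SL2 :: "(real ^ 2 ^ 2) set" where
  "SL2 = {M. det M = 1}"

definition C1_cocycle_map :: "(real ^ 'd \<Rightarrow> real ^ 2 ^ 2) \<Rightarrow> bool" where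
  "C1_cocycle_map A \<longleftrightarrow> torus_map A \<and> range A \<subseteq> SL2 \<and> Ck_on 1 A UNIV"

primrec iterate_prod ::
    "real ^ 'd \<Rightarrow> (real ^ 'd \<Rightarrow> real ^ 2 ^ 2) \<Rightarrow> nat \<Rightarrow> real ^ 'd \<Rightarrow> real ^ 2 ^ 2" where
  "iterate_prod \<alpha> A 0 x = mat 1"
| "iterate_prod \<alpha> A (Suc n) x = A (x + real n *\<^sub>R \<alpha>) ** iterate_prod \<alpha> A n x"

text \<open>
  Integration over \<open>X\<close> is Lebesgue integration over the fundamental domain \<open>[0,1]^d\<close>.  The matrix
  norm is the operator norm; the library's \<open>norm\<close> on matrices would be the Frobenius norm.
\<close>

definition lyapunov_exponent :: "real ^ 'd \<Rightarrow> (real ^ 'd \<Rightarrow> real ^ 2 ^ 2) \<Rightarrow> real" where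
  "lyapunov_exponent \<alpha> A =
     lim (\<lambda>n. 1 / real n *
       (LINT x : cbox 0 One | lborel. ln (onorm (\<lambda>w. iterate_prod \<alpha> A n x *v w))))"

definition continuous_argument :: "(real \<Rightarrow> real) \<Rightarrow> (real \<Rightarrow> real ^ 2) \<Rightarrow> bool" where
  "continuous_argument \<theta> \<gamma> \<longleftrightarrow>
     continuous_on UNIV \<theta> \<and>
     (\<forall>t. \<gamma> t = norm (\<gamma> t) *\<^sub>R vector [cos (\<theta> t), sin (\<theta> t)])"

text \<open>
  For \<open>y \<noteq> 0\<close> the curve \<open>t \<mapsto> A (x + t w) y\<close> is continuous and avoids the origin, so a continuous
  determination of its argument exists and is unique up to a constant in \<open>2 \<pi> Z\<close>; the quantifier
  over \<open>\<theta>\<close> below is therefore never vacuous.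
\<close>

definition monotonic :: "(real ^ 'd \<Rightarrow> real ^ 2 ^ 2) \<Rightarrow> bool" where
  "monotonic A \<longleftrightarrow> C1_cocycle_map A \<and>
     (\<exists>w. \<forall>x y \<theta>. y \<noteq> 0 \<longrightarrow> continuous_argument \<theta> (\<lambda>t. A (x + t *\<^sub>R w) *v y) \<longrightarrow>
        (\<forall>t. \<exists>D>0. (\<theta> has_real_derivative D) (at t)))"

definition premonotonic :: "real ^ 'd \<Rightarrow> (real ^ 'd \<Rightarrow> real ^ 2 ^ 2) \<Rightarrow> bool" where
  "premonotonic \<alpha> A \<longleftrightarrow> C1_cocycle_map A \<and>
     (\<exists>n\<ge>1. \<exists>B. C1_cocycle_map B \<and>
        monotonic (\<lambda>x. B (x + real n *\<^sub>R \<alpha>) ** iterate_prod \<alpha> A n x ** matrix_inv (B x)))"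

end

theory Submission
  imports Defs "HOL-Complex_Analysis.Complex_Analysis"
begin

text \<open>
  \<^bold>\<open>Disc coordinates.\<close> With \<open>\<real>\<^sup>2 = \<complex>\<close>, a real matrix of positive determinant is \<open>z \<mapsto> a z + b (cnj z)\<close>
  with \<open>\<bar>b\<bar> < \<bar>a\<bar>\<close>, and it acts on \<open>m = z / cnj z\<close> by the Moebius map
  \<open>m \<mapsto> (a m + b) / (cnj b m + cnj a)\<close>, which preserves the unit disc. If \<open>m\<^sub>j\<close> is the orbit of \<open>0\<close> under
  the maps along \<open>x, x + \<alpha>, x + 2 \<alpha>, \<dots>\<close>, the growth of the products is the product of the
  denominators at the \<open>m\<^sub>j\<close>. After integration over the torus the exponent is therefore, up to an explicit
  constant, the limit of the integrals \<open>U\<^sub>j\<close> of the logarithms of the \<open>j\<close>-th denominators.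

  \<^bold>\<open>Height.\<close> These maps are isometries of the hyperbolic disc and do not contract it. Monotonicity says that moving \<open>x\<close> along \<open>w\<close>
  rotates every direction positively; consequently moving \<open>x\<close> to \<open>x + i \<eta> w\<close> pushes the unit
  circle inside the disc of radius \<open>1 - \<kappa> \<eta>\<close> (\<open>cone_contraction\<close>). A smooth family has no values at complex points, so
  \<open>M(x + i \<eta> w)\<close> is replaced by its Taylor polynomial of degree \<open>N\<close> in \<open>i \<eta>\<close>. This lift is holomorphic
  up to an error of order \<open>\<eta>\<^sup>N\<close>, and this is what makes the method work: the derivative of \<open>U\<^sub>j\<close> in the
  height is \<open>i\<close> times the integral of a derivative along \<open>w\<close>, which vanishes on the torus, plus the effect
  of the error. Hence \<open>U\<^sub>j\<close> at height \<open>\<eta>\<close> differs from \<open>U\<^sub>j\<close> at height \<open>0\<close> by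
  \<open>O(\<eta>\<^sup>N)\<close>, uniformly in \<open>j\<close> and in the parameter (\<open>height_independence\<close>). At height \<open>\<eta>\<close>,
  an orbit forgets its past at the rate \<open>1 - \<kappa> \<eta>\<close>, so the \<open>U\<^sub>j\<close> converge, and \<open>U\<^sub>p\<close> at height \<open>\<eta>\<close>
  with \<open>p\<close> of size \<open>1 / \<eta>\<^sup>2\<close> approximates the limit up to \<open>O(\<eta>\<^sup>N)\<close> (\<open>U_limit_approx\<close>).

  \<^bold>\<open>Estimates.\<close> Long chains are never differentiated term by term. A chain that stays in the disc for all
  perturbations of size \<open>\<rho>\<close> of its matrices is a bounded holomorphic function of them, and the Cauchy inequality bounds its
  derivatives by \<open>1 / \<rho>\<close>, whatever its length (\<open>dlterm_bound\<close>, \<open>lterm_perturb\<close>); the Schwarz lemma, applied to an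
  auxiliary scaling of the maps, gives the loss of memory (\<open>orb_contract\<close>).

  \<^bold>\<open>Parameter.\<close> For the smoothness in \<open>s\<close>, translate \<open>x\<close> so that the chain ends at \<open>x\<close>; its factor at distance \<open>n\<close> from
  the end sits at \<open>x - n \<alpha>(s)\<close>, and its \<open>s\<close>-derivatives of order \<open>l\<close> are \<open>O(n\<^sup>l)\<close>. Taylor polynomials of
  the factors turn \<open>U\<^sub>p\<close> into a bounded holomorphic function on a complex disc of radius of order
  \<open>\<eta> / p\<close> around a given parameter, and so into a polynomial of bounded degree. With \<open>\<eta> = h\<^bsup>1/4\<^esup>\<close> this disc
  has radius of order \<open>h\<^bsup>3/4\<^esup>\<close>, much larger than \<open>h\<close>, and the exponent is approximated by polynomials up to \<open>O(h\<^sup>n)\<close>, for every \<open>n\<close>, on all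
  intervals of radius \<open>h\<close> (\<open>U_limit_poly_approximable\<close>). A function with this property is smooth
  (\<open>poly_approximable_imp_smooth_on\<close>).

  \<^bold>\<open>Reduction.\<close> Premonotonicity at one parameter provides a conjugacy \<open>B\<close> of class \<open>C\<^sup>1\<close> of some iterate to a monotonic cocycle. A convolution makes it smooth and
  keeps the monotonicity, an open condition (\<open>smooth_monotonic_conjugacy\<close>), at the price of a determinant that is
  positive but in general not \<open>1\<close>; this shifts the exponent by the constant integral of \<open>ln (det B)\<close>
  (\<open>lyapunov_exponent_conj\<close>). The same conjugacy serves all nearby parameters.
\<close>

(* Keep the dollar sign for the components of vectors and matrices. *)
no_notation fps_nth (infixl "$" 75)

section \<open>Calculus of smooth maps\<close>

lemma Ck_on_cong:
  assumes "open S" "\<And>x. x \<in> S \<Longrightarrow> f x = g x"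
  shows "Ck_on k f S \<longleftrightarrow> Ck_on k g S"
proof -
  have *: "Ck_on k f S \<Longrightarrow> Ck_on k g S" if "\<And>x. x \<in> S \<Longrightarrow> f x = g x"
    for f g :: "'a \<Rightarrow> 'b"
    using that
  proof (induction k arbitrary: f g)
    case 0 then show ?case by (metis Ck_on.simps(1) continuous_on_cong)
  next
    case (Suc k)
    have d: "g differentiable (at x)" if "x \<in> S" for x
    proof -
      have "f differentiable (at x)" using Suc.prems(1) that by auto
      then obtain D where "(f has_derivative D) (at x)" by (auto simp: differentiable_def)
      then have "(g has_derivative D) (at x)"
        by (rule has_derivative_transform_within_open[OF _ assms(1) that]) (use Suc.prems(2) in auto)
      then show ?thesis by (auto simp: differentiable_def)
    qed
    have "Ck_on k (\<lambda>x. frechet_derivative g (at x) v) S" for v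
    proof (rule Suc.IH)
      show "Ck_on k (\<lambda>x. frechet_derivative f (at x) v) S" using Suc.prems(1) by auto
      show "frechet_derivative f (at x) v = frechet_derivative g (at x) v" if "x \<in> S" for x
        using frechet_derivative_transform_within_open[of f x S g] Suc.prems assms(1) that by auto
    qed
    with d show ?case by auto
  qed
  show ?thesis using *[of f g] *[of g f] assms(2) by auto
qed

text \<open>
  \<open>Ck_on\<close> is phrased with the chosen derivative \<open>frechet_derivative\<close>; this rule admits any explicit derivative.
\<close>

lemma Ck_on_SucI:
  assumes "open S" "\<And>x. x \<in> S \<Longrightarrow> (f has_derivative D x) (at x)"
    "\<And>v. Ck_on k (\<lambda>x. D x v) S"
  shows "Ck_on (Suc k) f S"
proof -
  have "Ck_on k (\<lambda>x. frechet_derivative f (at x) v) S" for v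
    using assms(3)[of v] Ck_on_cong[OF assms(1), of "\<lambda>x. D x v" "\<lambda>x. frechet_derivative f (at x) v" k]
      frechet_derivative_at[OF assms(2)] by auto
  then show ?thesis using assms(2) by (auto simp: differentiable_def)
qed

lemma Ck_on_Suc_D: "Ck_on (Suc k) f S \<Longrightarrow> Ck_on k f S"
proof (induction k arbitrary: f)
  case 0
  then show ?case
    by (auto intro!: continuous_at_imp_continuous_on differentiable_imp_continuous_within)
next
  case (Suc k)
  then show ?case by (metis Ck_on.simps(2))
qed

lemma Ck_on_imp_continuous_on: "Ck_on k f S \<Longrightarrow> continuous_on S f"
  by (induction k) (auto dest: Ck_on_Suc_D simp del: Ck_on.simps(2) simp: Ck_on.simps(1))

lemma Ck_on_const: "open S \<Longrightarrow> Ck_on k (\<lambda>x. c) S"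
  by (induction k arbitrary: c) (auto intro!: Ck_on_SucI[where D = "\<lambda>_ _. 0"] simp del: Ck_on.simps(2))

lemma Ck_on_linear:
  assumes "open S" "bounded_linear L" shows "Ck_on k L S"
proof (cases k)
  case 0
  then show ?thesis using assms by (auto intro: linear_continuous_on)
next
  case (Suc n)
  show ?thesis unfolding Suc
    by (rule Ck_on_SucI[OF assms(1), where D = "\<lambda>_. L"])
      (auto intro: bounded_linear_imp_has_derivative assms Ck_on_const)
qed

lemma Ck_on_add:
  assumes "open S" "Ck_on k f S" "Ck_on k g S"
  shows "Ck_on k (\<lambda>x. f x + g x) S"
  using assms(2,3)
proof (induction k arbitrary: f g)
  case 0 then show ?case by (auto intro: continuous_on_add)
next
  case (Suc k)
  show ?case
    by (rule Ck_on_SucI[OF assms(1), where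
        D = "\<lambda>x v. frechet_derivative f (at x) v + frechet_derivative g (at x) v"])
      (use Suc in \<open>auto intro!: has_derivative_add simp: frechet_derivative_works\<close>)
qed

lemma Ck_on_sum:
  assumes "open S" "finite B" "\<And>b. b \<in> B \<Longrightarrow> Ck_on k (f b) S"
  shows "Ck_on k (\<lambda>x. \<Sum>b\<in>B. f b x) S"
  using assms(2,3) by (induction B) (auto intro: Ck_on_const Ck_on_add assms(1))

lemma Ck_on_bilinear:
  assumes "open S" "bounded_bilinear p" "Ck_on k f S" "Ck_on k g S"
  shows "Ck_on k (\<lambda>x. p (f x) (g x)) S"
  using assms(3,4)
proof (induction k arbitrary: f g)
  case 0 then show ?case using bounded_bilinear.continuous_on[OF assms(2)] by auto
next
  case (Suc k)
  show ?case
    by (rule Ck_on_SucI[OF assms(1), where D = "\<lambda>x v. p (f x) (frechet_derivative g (at x) v)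
        + p (frechet_derivative f (at x) v) (g x)"])
      (use Suc Ck_on_Suc_D[OF Suc.prems(1)] Ck_on_Suc_D[OF Suc.prems(2)] in
        \<open>auto intro!: bounded_bilinear.FDERIV[OF assms(2)] Ck_on_add assms(1)
          simp: frechet_derivative_works\<close>)
qed

text \<open>
  Induction on the order: by the chain rule a directional derivative of the composite is a finite sum, over a
  basis, of products of composites of lower order.
\<close>

lemma Ck_on_compose:
  fixes g :: "'a::euclidean_space \<Rightarrow> 'b::euclidean_space" and f :: "'b \<Rightarrow> 'c::real_normed_vector"
  assumes "open S" "open T" "g ` S \<subseteq> T" "Ck_on k f T" "Ck_on k g S"
  shows "Ck_on k (\<lambda>x. f (g x)) S"
  using assms(4,5)
proof (induction k arbitrary: f)
  case 0 then show ?case using assms(3) by (auto intro: continuous_on_compose2)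
next
  case (Suc k)
  have g: "(g has_derivative frechet_derivative g (at x)) (at x)" if "x \<in> S" for x
    using Suc.prems that by (simp add: frechet_derivative_works)
  have f: "(f has_derivative frechet_derivative f (at y)) (at y)" if "y \<in> T" for y
    using Suc.prems that by (simp add: frechet_derivative_works)
  show ?case
  proof (rule Ck_on_SucI[OF assms(1)])
    show "((\<lambda>x. f (g x)) has_derivative
      (\<lambda>v. \<Sum>b\<in>Basis. (frechet_derivative g (at x) v \<bullet> b) *\<^sub>R frechet_derivative f (at (g x)) b)) (at x)"
      if "x \<in> S" for x
    proof -
      have fx: "(f has_derivative frechet_derivative f (at (g x))) (at (g x))"
        using f that assms(3) by auto
      have 1: "((\<lambda>x. f (g x)) has_derivative
        (\<lambda>v. frechet_derivative f (at (g x)) (frechet_derivative g (at x) v))) (at x)"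
        using has_derivative_compose[OF g[OF that] fx] .
      have eq: "frechet_derivative f (at (g x)) w =
         (\<Sum>b\<in>Basis. (w \<bullet> b) *\<^sub>R frechet_derivative f (at (g x)) b)" for w
      proof -
        have l: "linear (frechet_derivative f (at (g x)))"
          using fx has_derivative_linear by blast
        have "frechet_derivative f (at (g x)) w = frechet_derivative f (at (g x)) (\<Sum>b\<in>Basis. (w \<bullet> b) *\<^sub>R b)"
          by (simp add: euclidean_representation)
        also have "\<dots> = (\<Sum>b\<in>Basis. (w \<bullet> b) *\<^sub>R frechet_derivative f (at (g x)) b)"
          using l by (simp add: linear_sum linear_scale)
        finally show ?thesis .
      qed
      have "(\<lambda>v. frechet_derivative f (at (g x)) (frechet_derivative g (at x) v)) =
        (\<lambda>v. \<Sum>b\<in>Basis. (frechet_derivative g (at x) v \<bullet> b) *\<^sub>R frechet_derivative f (at (g x)) b)"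
        by (rule ext, rule eq)
      with 1 show ?thesis by metis
    qed
    show "Ck_on k (\<lambda>x. \<Sum>b\<in>Basis. (frechet_derivative g (at x) v \<bullet> b) *\<^sub>R frechet_derivative f (at (g x)) b) S" for v
    proof (intro Ck_on_sum assms(1) finite_Basis Ck_on_bilinear[OF _ bounded_bilinear_scaleR])
      fix b :: 'b
      have "Ck_on k (\<lambda>x. frechet_derivative g (at x) v) S" using Suc.prems by auto
      from Ck_on_bilinear[OF assms(1) bounded_bilinear_inner this Ck_on_const[OF assms(1)]]
      show "Ck_on k (\<lambda>x. frechet_derivative g (at x) v \<bullet> b) S" .
      show "Ck_on k (\<lambda>x. frechet_derivative f (at (g x)) b) S"
        using Suc.IH[of "\<lambda>y. frechet_derivative f (at y) b"] Suc.prems Ck_on_Suc_D by auto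
    qed
  qed
qed

text \<open>
  The final theorem is proved near one parameter at a time, with constructions that depend on that parameter; this glues the results.
\<close>

lemma Ck_on_local:
  assumes "\<And>x. x \<in> S \<Longrightarrow> \<exists>T. x \<in> T \<and> open T \<and> Ck_on k f T"
  shows "Ck_on k f S"
  using assms
proof (induction k arbitrary: f)
  case 0
  have "isCont f x" if "x \<in> S" for x
    using 0[OF that] by (auto simp: continuous_on_eq_continuous_at)
  then show ?case by (simp add: continuous_at_imp_continuous_on)
next
  case (Suc k)
  have "f differentiable (at x)" if "x \<in> S" for x
    using Suc.prems[OF that] by auto
  moreover have "Ck_on k (\<lambda>x. frechet_derivative f (at x) v) S" for v
  proof (rule Suc.IH)
    fix x assume "x \<in> S"
    then obtain T where "x \<in> T" "open T" "Ck_on (Suc k) f T" using Suc.prems by blast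
    then show "\<exists>T. x \<in> T \<and> open T \<and> Ck_on k (\<lambda>x. frechet_derivative f (at x) v) T"
      by (intro exI[of _ T]) auto
  qed
  ultimately show ?case by simp
qed

lemma smooth_on_cong:
  "open S \<Longrightarrow> (\<And>x. x \<in> S \<Longrightarrow> f x = g x) \<Longrightarrow> smooth_on f S \<Longrightarrow> smooth_on g S"
  unfolding smooth_on_def using Ck_on_cong by metis

lemma smooth_on_local:
  assumes "\<And>x. x \<in> S \<Longrightarrow> \<exists>T. x \<in> T \<and> open T \<and> smooth_on f T"
  shows "smooth_on f S"
  using assms unfolding smooth_on_def by (intro allI Ck_on_local) blast

lemma smooth_on_const: "open S \<Longrightarrow> smooth_on (\<lambda>x. c) S"
  unfolding smooth_on_def using Ck_on_const by blast

lemma smooth_on_linear: "open S \<Longrightarrow> bounded_linear L \<Longrightarrow> smooth_on L S"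
  unfolding smooth_on_def using Ck_on_linear by blast

lemma smooth_on_add: "open S \<Longrightarrow> smooth_on f S \<Longrightarrow> smooth_on g S \<Longrightarrow> smooth_on (\<lambda>x. f x + g x) S"
  unfolding smooth_on_def using Ck_on_add by blast

lemma smooth_on_sum:
  "open S \<Longrightarrow> finite B \<Longrightarrow> (\<And>b. b \<in> B \<Longrightarrow> smooth_on (f b) S) \<Longrightarrow> smooth_on (\<lambda>x. \<Sum>b\<in>B. f b x) S"
  unfolding smooth_on_def using Ck_on_sum by blast

lemma smooth_on_bilinear:
  "bounded_bilinear p \<Longrightarrow> open S \<Longrightarrow> smooth_on f S \<Longrightarrow> smooth_on g S \<Longrightarrow> smooth_on (\<lambda>x. p (f x) (g x)) S"
  unfolding smooth_on_def using Ck_on_bilinear by blast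

lemmas smooth_on_mult = smooth_on_bilinear[OF bounded_bilinear_mult]
lemmas smooth_on_scaleR = smooth_on_bilinear[OF bounded_bilinear_scaleR]
lemmas smooth_on_inner = smooth_on_bilinear[OF bounded_bilinear_inner]

lemma smooth_on_compose:
  fixes g :: "'a::euclidean_space \<Rightarrow> 'b::euclidean_space"
  shows "open S \<Longrightarrow> open T \<Longrightarrow> g ` S \<subseteq> T \<Longrightarrow> smooth_on f T \<Longrightarrow> smooth_on g S \<Longrightarrow> smooth_on (\<lambda>x. f (g x)) S"
  unfolding smooth_on_def using Ck_on_compose by blast

lemma Ck_on_compose_linear:
  assumes "open S" "bounded_linear L" "Ck_on k f S"
  shows "Ck_on k (\<lambda>x. L (f x)) S"
  using assms(3)
proof (induction k arbitrary: f)
  case 0 then show ?case using assms(2) by (simp add: bounded_linear.continuous_on)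
next
  case (Suc k)
  show ?case
    by (rule Ck_on_SucI[OF assms(1), where D = "\<lambda>x v. L (frechet_derivative f (at x) v)"])
      (use Suc in \<open>auto intro!: bounded_linear.has_derivative[OF assms(2)] simp: frechet_derivative_works\<close>)
qed

lemma smooth_on_compose_linear:
  "open S \<Longrightarrow> bounded_linear L \<Longrightarrow> smooth_on f S \<Longrightarrow> smooth_on (\<lambda>x. L (f x)) S"
  unfolding smooth_on_def using Ck_on_compose_linear by blast

lemma smooth_on_imp_continuous_on: "smooth_on f S \<Longrightarrow> continuous_on S f"
  unfolding smooth_on_def by (metis Ck_on.simps(1))

lemma smooth_on_has_derivative:
  "smooth_on f S \<Longrightarrow> x \<in> S \<Longrightarrow> (f has_derivative frechet_derivative f (at x)) (at x)"
  unfolding smooth_on_def using Ck_on.simps(2) frechet_derivative_works by blast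

lemma smooth_on_frechet: "smooth_on f S \<Longrightarrow> smooth_on (\<lambda>x. frechet_derivative f (at x) v) S"
  unfolding smooth_on_def using Ck_on.simps(2) by blast

section \<open>Integration over the torus\<close>

text \<open>
  The shifted cube overhangs the old one by a slab of width \<open>t\<close>; periodicity moves this slab back to
  the slab that was left, which requires the slab to be no wider than the cube.
\<close>

lemma integral_periodic_shift_step:
  fixes f :: "'a::euclidean_space \<Rightarrow> 'b::banach"
  assumes cont: "continuous_on UNIV f" and per: "\<And>x. f (x + k) = f x"
    and k: "k \<in> Basis" and t: "0 \<le> t" "t \<le> 1"
  shows "integral (cbox (a + t *\<^sub>R k) (a + t *\<^sub>R k + One)) f = integral (cbox a (a + One)) f"
proof -
  have i: "f integrable_on cbox u v" for u v
    using cont by (intro integrable_continuous) (auto intro: continuous_on_subset)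
  have kb: "k \<bullet> b = (if b = k then 1 else 0)" if "b \<in> Basis" for b
    using k that by (auto simp: inner_Basis)
  have box: "x \<in> cbox p q \<longleftrightarrow> (p \<bullet> k \<le> x \<bullet> k \<and> x \<bullet> k \<le> q \<bullet> k) \<and>
      (\<forall>b\<in>Basis - {k}. p \<bullet> b \<le> x \<bullet> b \<and> x \<bullet> b \<le> q \<bullet> b)" for x p q
    using k by (auto simp: mem_box)
  let ?c = "a \<bullet> k + 1" and ?c' = "a \<bullet> k + t"
  have L: "cbox (a + t *\<^sub>R k) (a + t *\<^sub>R k + One) \<inter> {x. x \<bullet> k \<le> ?c} = cbox (a + t *\<^sub>R k) (a + One)"
    using k t by (intro set_eqI) (auto simp: box inner_add_left inner_diff_left kb)
  have R: "cbox (a + t *\<^sub>R k) (a + t *\<^sub>R k + One) \<inter> {x. x \<bullet> k \<ge> ?c} = cbox (a + k) (a + t *\<^sub>R k + One)"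
    using k t by (intro set_eqI) (auto simp: box inner_add_left inner_diff_left kb)
  have L': "cbox a (a + One) \<inter> {x. x \<bullet> k \<le> ?c'} = cbox a (a + t *\<^sub>R k + One - k)"
    using k t by (intro set_eqI) (auto simp: box inner_add_left inner_diff_left kb)
  have R': "cbox a (a + One) \<inter> {x. x \<bullet> k \<ge> ?c'} = cbox (a + t *\<^sub>R k) (a + One)"
    using k t by (intro set_eqI) (auto simp: box inner_add_left inner_diff_left kb)
  have "integral (cbox (a + t *\<^sub>R k) (a + t *\<^sub>R k + One)) f
      = integral (cbox (a + t *\<^sub>R k) (a + One)) f + integral (cbox (a + k) (a + t *\<^sub>R k + One)) f"
    using integral_split[OF i k, of "a + t *\<^sub>R k" "a + t *\<^sub>R k + One" ?c] L R by simp
  moreover have "integral (cbox a (a + One)) f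
      = integral (cbox a (a + t *\<^sub>R k + One - k)) f + integral (cbox (a + t *\<^sub>R k) (a + One)) f"
    using integral_split[OF i k, of a "a + One" ?c'] L' R' by simp
  moreover have "integral (cbox a (a + t *\<^sub>R k + One - k)) f = integral (cbox (a + k) (a + t *\<^sub>R k + One)) f"
    using integral_shift_cbox[of "a + k" k "a + t *\<^sub>R k + One" f] per by simp
  ultimately show ?thesis by simp
qed

lemma integral_periodic_shift_basis:
  fixes f :: "'a::euclidean_space \<Rightarrow> 'b::banach"
  assumes cont: "continuous_on UNIV f" and per: "\<And>x. f (x + k) = f x" and k: "k \<in> Basis"
  shows "integral (cbox (a + t *\<^sub>R k) (a + t *\<^sub>R k + One)) f = integral (cbox a (a + One)) f"
proof -
  have pos: "integral (cbox (a + t *\<^sub>R k) (a + t *\<^sub>R k + One)) f = integral (cbox a (a + One)) f"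
    if "t \<ge> 0" for t a
  proof -
    obtain n :: nat where n: "t \<le> real n" "n > 0"
      by (metis gr0I le_less_trans less_eq_real_def of_nat_0 of_nat_0_less_iff real_arch_simple reals_Archimedean2 that)
    define u where "u = t / real n"
    have u: "0 \<le> u" "u \<le> 1" using n that by (auto simp: u_def field_simps)
    have "integral (cbox (a + (real m * u) *\<^sub>R k) (a + (real m * u) *\<^sub>R k + One)) f
        = integral (cbox a (a + One)) f" for m
    proof (induction m)
      case (Suc m)
      show ?case
        using integral_periodic_shift_step[OF cont per k u, of "a + (real m * u) *\<^sub>R k"] Suc
        by (simp add: algebra_simps)
    qed simp
    from this[of n] show ?thesis using n by (simp add: u_def)
  qed
  show ?thesis
  proof (cases "t \<ge> 0")
    case False
    then show ?thesis using pos[of "-t" "a + t *\<^sub>R k"] by simp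
  qed (rule pos)
qed

lemma integral_periodic_shift:
  fixes f :: "'a::euclidean_space \<Rightarrow> 'b::banach"
  assumes cont: "continuous_on UNIV f" and per: "\<And>x k. k \<in> Basis \<Longrightarrow> f (x + k) = f x"
  shows "integral (cbox v (v + One)) f = integral (cbox 0 One) f"
proof -
  have "integral (cbox (\<Sum>k\<in>B. (v \<bullet> k) *\<^sub>R k) ((\<Sum>k\<in>B. (v \<bullet> k) *\<^sub>R k) + One)) f = integral (cbox 0 One) f"
    if "B \<subseteq> Basis" for B
    using finite_subset[OF that finite_Basis] that
  proof (induction B)
    case (insert k B)
    then show ?case
      using integral_periodic_shift_basis[OF cont per, of k "\<Sum>k\<in>B. (v \<bullet> k) *\<^sub>R k" "v \<bullet> k"]
      by (simp add: add.commute)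
  qed simp
  from this[of Basis] show ?thesis by (simp add: euclidean_representation)
qed

lemma torus_map_Basis: "torus_map f \<Longrightarrow> k \<in> Basis \<Longrightarrow> f (x + k) = f x"
proof -
  assume f: "torus_map f" and "k \<in> Basis"
  then obtain i where k: "k = axis i 1" by (auto simp: Basis_vec_def)
  have "k = (\<chi> j. of_int ((\<chi> l. if l = i then (1::int) else 0) $ j))"
    by (auto simp: k axis_def vec_eq_iff)
  then show ?thesis using f unfolding torus_map_def by metis
qed

lemma integral_torus_shift:
  fixes f :: "real^'d \<Rightarrow> 'b::banach"
  assumes "continuous_on UNIV f" "torus_map f"
  shows "integral (cbox 0 One) (\<lambda>x. f (x + v)) = integral (cbox 0 One) f"
  using integral_periodic_shift[OF assms(1) torus_map_Basis[OF assms(2)], of v]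
    integral_shift_cbox[of v v "v + One" f] by simp

text \<open>
  One point of the cube represents \<open>x\<close> for all functions on the torus at once, so that several functions can be transported together.
\<close>

lemma torus_representative:
  fixes x :: "real^'d"
  obtains y where "y \<in> cbox 0 One" "\<And>f :: real^'d \<Rightarrow> 'b. torus_map f \<Longrightarrow> f x = f y"
proof
  let ?k = "\<chi> i. floor (x $ i) :: int ^ 'd"
  let ?y = "x + (\<chi> i. of_int ((- ?k) $ i))"
  show "?y \<in> cbox 0 One"
  proof (unfold mem_box, intro ballI)
    fix b :: "real^'d" assume b: "b \<in> Basis"
    then obtain i where i: "b = axis i 1" by (auto simp: Basis_vec_def)
    show "0 \<bullet> b \<le> ?y \<bullet> b \<and> ?y \<bullet> b \<le> One \<bullet> b"
      using b by (simp add: inner_sum_left_Basis) (simp add: i inner_axis, linarith)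
  qed
  show "f x = f ?y" if "torus_map f" for f :: "real^'d \<Rightarrow> 'b"
    using that unfolding torus_map_def by metis
qed

lemma torus_map_shift:
  fixes f :: "real^'d \<Rightarrow> 'b"
  assumes "torus_map f" shows "torus_map (\<lambda>x. f (x + v))"
  unfolding torus_map_def
proof (intro allI)
  fix x and k :: "int^'d"
  have "x + (\<chi> i. of_int (k $ i)) + v = (x + v) + (\<chi> i. of_int (k $ i))" by (simp add: add_ac)
  then show "f (x + (\<chi> i. of_int (k $ i)) + v) = f (x + v)" using assms unfolding torus_map_def by metis
qed

section \<open>Chains of Moebius maps of the unit disc\<close>

text \<open>
  Numerator and denominator of the Moebius map of a matrix are kept apart: the map moves points of the
  disc, and the denominator carries the growth of the products.
\<close>

definition mnum :: "complex^2^2 \<Rightarrow> complex \<Rightarrow> complex" where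
  "mnum M m = M$1$1 * m + M$1$2"

definition mden :: "complex^2^2 \<Rightarrow> complex \<Rightarrow> complex" where
  "mden M m = M$2$1 * m + M$2$2"

primrec orb :: "(nat \<Rightarrow> complex^2^2) \<Rightarrow> complex \<Rightarrow> nat \<Rightarrow> complex" where
  "orb M w 0 = w"
| "orb M w (Suc j) = mnum (M j) (orb M w j) / mden (M j) (orb M w j)"

text \<open>
  The logarithm of the \<open>j\<close>-th denominator relative to a reference value \<open>e j\<close>. The reference keeps the quotient in
  a disc around \<open>1\<close>, where the principal branch of the logarithm is holomorphic.
\<close>

definition lterm :: "(nat \<Rightarrow> complex^2^2) \<Rightarrow> (nat \<Rightarrow> complex) \<Rightarrow> nat \<Rightarrow> complex" where
  "lterm M e j = Ln (mden (M j) (orb M 0 j) / e j)"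

text \<open>
  Admissibility: the Moebius map sends the unit disc into the disc of radius \<open>r\<close>, and on the unit disc its
  denominator stays relatively \<open>q\<close>-close to \<open>e\<close>. For \<open>r = 1\<close> and \<open>q < 1\<close> chains of such maps are defined,
  bounded, and holomorphic in their matrices; \<open>r < 1\<close> makes them contract.
\<close>

definition adm :: "real \<Rightarrow> real \<Rightarrow> complex^2^2 \<Rightarrow> complex \<Rightarrow> bool" where
  "adm r q M e \<longleftrightarrow> e \<noteq> 0 \<and> (\<forall>m. cmod m \<le> 1 \<longrightarrow>
     cmod (mden M m - e) \<le> q * cmod e \<and> cmod (mnum M m) \<le> r * cmod (mden M m))"

lemma adm_den_ge: "adm r q M e \<Longrightarrow> cmod m \<le> 1 \<Longrightarrow> (1 - q) * cmod e \<le> cmod (mden M m)"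
  using norm_triangle_ineq2[of e "e - mden M m"]
  by (force simp: adm_def norm_minus_commute algebra_simps)

lemma adm_den_nz: "adm r q M e \<Longrightarrow> q < 1 \<Longrightarrow> cmod m \<le> 1 \<Longrightarrow> mden M m \<noteq> 0"
  using adm_den_ge[of r q M e m] by (auto simp: adm_def mult_le_0_iff)

lemma adm_mono: "adm r q M e \<Longrightarrow> r \<le> r' \<Longrightarrow> q \<le> q' \<Longrightarrow> adm r' q' M e"
  unfolding adm_def by (meson mult_right_mono norm_ge_zero order_trans)

lemma orb_bound:
  assumes "\<And>j. j < n \<Longrightarrow> adm 1 q (M j) (e j)" "q < 1" "cmod w \<le> 1"
  shows "cmod (orb M w n) \<le> 1"
  using assms(1)
proof (induction n)
  case (Suc n)
  then have 1: "cmod (orb M w n) \<le> 1" by simp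
  have "adm 1 q (M n) (e n)" using Suc.prems by simp
  then have "mden (M n) (orb M w n) \<noteq> 0" "cmod (mnum (M n) (orb M w n)) \<le> cmod (mden (M n) (orb M w n))"
    using adm_den_nz[of 1 q "M n" "e n", OF _ assms(2) 1] 1 by (blast, simp add: adm_def)
  then show ?case by (simp add: norm_divide divide_le_eq_1)
qed (use assms in simp)

lemma orb_den_nz:
  assumes "\<And>j. j \<le> n \<Longrightarrow> adm 1 q (M j) (e j)" "q < 1" "cmod w \<le> 1" "j \<le> n"
  shows "mden (M j) (orb M w j) \<noteq> 0"
  by (rule adm_den_nz[OF assms(1)[OF assms(4)] assms(2)], rule orb_bound[where q = q and e = e])
    (use assms in auto)

lemma quot_near_1:
  assumes "adm 1 q M e" "cmod m \<le> 1"
  shows "cmod (mden M m / e - 1) \<le> q"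
proof -
  have "e \<noteq> 0" "cmod (mden M m - e) \<le> q * cmod e" using assms by (auto simp: adm_def)
  then show ?thesis by (simp add: divide_simps norm_divide diff_divide_eq_iff)
qed

lemma near_1_Re: "cmod (u - 1) \<le> q \<Longrightarrow> q < 1 \<Longrightarrow> Re u > 0"
  using abs_Re_le_cmod[of "u - 1"] by auto

lemma near_1_slit: "cmod (u - 1) \<le> q \<Longrightarrow> q < 1 \<Longrightarrow> u \<notin> \<real>\<^sub>\<le>\<^sub>0"
  using near_1_Re[of u q] by (auto simp: complex_nonpos_Reals_iff)

text \<open>
  A bound for \<open>\<bar>Ln u\<bar>\<close> on the disc \<open>\<bar>u - 1\<bar> \<le> q\<close>.
\<close>

definition lbound :: "real \<Rightarrow> real" where "lbound q = pi - ln (1 - q)"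

lemma lbound_pos: "0 \<le> q \<Longrightarrow> q < 1 \<Longrightarrow> lbound q > 0"
  unfolding lbound_def using pi_gt_zero by (smt (verit) ln_le_zero_iff)

lemma near_1_Ln:
  assumes "cmod (u - 1) \<le> q" "q < 1"
  shows "cmod (Ln u) \<le> lbound q"
proof -
  have q: "0 \<le> q" using assms(1) norm_ge_zero order_trans by blast
  have nz: "u \<noteq> 0" using near_1_slit[OF assms] by auto
  have lo: "1 - q \<le> cmod u" using assms norm_triangle_ineq2[of 1 "1 - u"] by (simp add: norm_minus_commute)
  have hi: "cmod u \<le> 1 + q" using assms norm_triangle_ineq2[of u 1] by simp
  have "ln (1 - q) \<le> ln (cmod u)" using lo assms(2) nz by simp
  moreover have "ln (cmod u) \<le> - ln (1 - q)"
  proof -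
    have "cmod u \<le> 1 / (1 - q)"
    proof (rule order_trans[OF hi])
      have "(1 + q) * (1 - q) \<le> 1" by (simp add: algebra_simps)
      then show "1 + q \<le> 1 / (1 - q)" using assms(2) by (simp add: field_simps)
    qed
    then have "ln (cmod u) \<le> ln (1 / (1 - q))" using nz assms(2) by (subst ln_le_cancel_iff) auto
    then show ?thesis using assms(2) by (simp add: ln_div)
  qed
  ultimately have "\<bar>Re (Ln u)\<bar> \<le> - ln (1 - q)" using nz by simp
  moreover have "\<bar>Im (Ln u)\<bar> \<le> pi" using nz mpi_less_Im_Ln[of u] Im_Ln_le_pi[of u] by auto
  ultimately show ?thesis using cmod_le[of "Ln u"] by (simp add: lbound_def)
qed

lemma lterm_near_1:
  assumes "\<And>j. j \<le> n \<Longrightarrow> adm 1 q (M j) (e j)" "q < 1"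
  shows "cmod (mden (M n) (orb M 0 n) / e n - 1) \<le> q"
  by (rule quot_near_1[OF assms(1)[of n]], simp, rule orb_bound[where q = q and e = e]) (use assms in auto)

lemma lterm_bound:
  assumes "\<And>j. j \<le> n \<Longrightarrow> adm 1 q (M j) (e j)" "q < 1"
  shows "cmod (lterm M e n) \<le> lbound q"
  unfolding lterm_def by (rule near_1_Ln[OF lterm_near_1[OF assms] assms(2)])

text \<open>
  The derivative of the orbit point when the matrices \<open>M j\<close> vary with velocities \<open>M' j\<close>, by the quotient rule.
  It is linear in \<open>M'\<close>, over the complex numbers as well (\<open>dorb_linear\<close>); this allows one formula to serve for the real derivatives
  in height and base point and for the complex derivative in an auxiliary variable.
\<close>

primrec dorb :: "(nat \<Rightarrow> complex^2^2) \<Rightarrow> (nat \<Rightarrow> complex^2^2) \<Rightarrow> nat \<Rightarrow> complex" where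
  "dorb M M' 0 = 0"
| "dorb M M' (Suc j) =
    ((mnum (M' j) (orb M 0 j) + M j $1$1 * dorb M M' j) * mden (M j) (orb M 0 j)
     - mnum (M j) (orb M 0 j) * (mden (M' j) (orb M 0 j) + M j $2$1 * dorb M M' j))
    / (mden (M j) (orb M 0 j) * mden (M j) (orb M 0 j))"

definition dlterm where
  "dlterm M M' e e' j =
    (mden (M' j) (orb M 0 j) + M j $2$1 * dorb M M' j) / mden (M j) (orb M 0 j) - e' j / e j"

lemma orb_has_derivative:
  fixes M M' :: "nat \<Rightarrow> 'v::real_normed_vector \<Rightarrow> complex^2^2"
  assumes "\<And>j i k. j < n \<Longrightarrow> ((\<lambda>z. M j z $ i $ k) has_derivative (\<lambda>h. M' j h $ i $ k)) (at z within S)"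
    and "\<And>j. j < n \<Longrightarrow> mden (M j z) (orb (\<lambda>j. M j z) 0 j) \<noteq> 0"
  shows "((\<lambda>z. orb (\<lambda>j. M j z) 0 n) has_derivative (\<lambda>h. dorb (\<lambda>j. M j z) (\<lambda>j. M' j h) n)) (at z within S)"
  using assms
proof (induction n)
  case (Suc n)
  have IH: "((\<lambda>z. orb (\<lambda>j. M j z) 0 n) has_derivative (\<lambda>h. dorb (\<lambda>j. M j z) (\<lambda>j. M' j h) n)) (at z within S)"
    using Suc by simp
  note d = Suc.prems(1)[OF lessI]
  have nz: "M n z $ 2 $ 1 * orb (\<lambda>j. M j z) 0 n + M n z $ 2 $ 2 \<noteq> 0"
    using Suc.prems(2)[OF lessI] by (simp add: mden_def)
  show ?case
    unfolding orb.simps dorb.simps mnum_def mden_def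
    by (rule has_derivative_eq_rhs, rule has_derivative_divide'[OF
          has_derivative_add[OF has_derivative_mult[OF d IH] d]
          has_derivative_add[OF has_derivative_mult[OF d IH] d] nz])
      (simp add: fun_eq_iff algebra_simps)
qed simp

lemma lterm_has_derivative:
  fixes M M' :: "nat \<Rightarrow> 'v::real_normed_vector \<Rightarrow> complex^2^2"
  assumes M: "\<And>j i k. j \<le> n \<Longrightarrow> ((\<lambda>z. M j z $ i $ k) has_derivative (\<lambda>h. M' j h $ i $ k)) (at z within S)"
    and e: "((\<lambda>z. e n z) has_derivative (\<lambda>h. e' n h)) (at z within S)"
    and a: "\<And>j. j \<le> n \<Longrightarrow> adm 1 q (M j z) (e j z)" and q: "q < 1"
  shows "((\<lambda>z. lterm (\<lambda>j. M j z) (\<lambda>j. e j z) n) has_derivative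
    (\<lambda>h. dlterm (\<lambda>j. M j z) (\<lambda>j. M' j h) (\<lambda>j. e j z) (\<lambda>j. e' j h) n)) (at z within S)"
proof -
  let ?m = "orb (\<lambda>j. M j z) 0"
  have nz: "mden (M j z) (?m j) \<noteq> 0" if "j \<le> n" for j
    using orb_den_nz[of n q "\<lambda>j. M j z" "\<lambda>j. e j z" 0 j] a q that by auto
  have orb: "((\<lambda>z. orb (\<lambda>j. M j z) 0 n) has_derivative (\<lambda>h. dorb (\<lambda>j. M j z) (\<lambda>j. M' j h) n)) (at z within S)"
    by (rule orb_has_derivative) (use M nz in auto)
  have enz: "e n z \<noteq> 0" using a[of n] by (auto simp: adm_def)
  let ?D = "mden (M n z) (?m n)"
  let ?D' = "\<lambda>h. mden (M' n h) (?m n) + M n z $ 2 $ 1 * dorb (\<lambda>j. M j z) (\<lambda>j. M' j h) n"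
  have den: "((\<lambda>z. mden (M n z) (orb (\<lambda>j. M j z) 0 n)) has_derivative ?D') (at z within S)"
    unfolding mden_def
    by (rule has_derivative_eq_rhs, rule has_derivative_add[OF has_derivative_mult[OF M[OF le_refl] orb] M[OF le_refl]])
      (simp add: fun_eq_iff algebra_simps)
  have quot: "((\<lambda>z. mden (M n z) (orb (\<lambda>j. M j z) 0 n) / e n z) has_derivative
     (\<lambda>h. (?D' h * e n z - ?D * e' n h) / (e n z * e n z))) (at z within S)"
    by (rule has_derivative_divide'[OF den e enz])
  have u: "?D / e n z \<notin> \<real>\<^sub>\<le>\<^sub>0"
    by (rule near_1_slit[OF lterm_near_1[where M = "\<lambda>j. M j z" and e = "\<lambda>j. e j z"] q]) (use a q in auto)
  have Ln: "(Ln has_derivative (\<lambda>h. inverse (?D / e n z) * h)) (at (?D / e n z))"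
    by (rule has_field_derivative_Ln[OF u, unfolded has_field_derivative_def])
  have "((\<lambda>z. Ln (mden (M n z) (orb (\<lambda>j. M j z) 0 n) / e n z)) has_derivative
      (\<lambda>h. inverse (?D / e n z) * ((?D' h * e n z - ?D * e' n h) / (e n z * e n z)))) (at z within S)"
    by (rule has_derivative_compose[OF quot Ln])
  moreover have "inverse (?D / e n z) * ((?D' h * e n z - ?D * e' n h) / (e n z * e n z)) = ?D' h / ?D - e' n h / e n z" for h
    using enz nz[of n] by (simp add: field_simps)
  ultimately show ?thesis unfolding lterm_def dlterm_def by simp
qed

lemma dorb_linear:
  fixes X Y Z :: "nat \<Rightarrow> complex^2^2"
  assumes "\<And>j i k. j < n \<Longrightarrow> X j $ i $ k = Y j $ i $ k + c * Z j $ i $ k"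
  shows "dorb M X n = dorb M Y n + c * dorb M Z n"
  using assms
proof (induction n)
  case (Suc n)
  have IH: "dorb M X n = dorb M Y n + c * dorb M Z n" using Suc by simp
  have X: "X n $ i $ k = Y n $ i $ k + c * Z n $ i $ k" for i k using Suc.prems by simp
  have s: "a / d = b / d + c * (b' / d)" if "a = b + c * b'" for a b b' d :: complex
    using that by (simp add: add_divide_distrib)
  show ?case unfolding dorb.simps
    by (rule s) (simp add: mnum_def mden_def IH X algebra_simps)
qed simp

lemma dlterm_linear:
  fixes X Y Z :: "nat \<Rightarrow> complex^2^2"
  assumes "\<And>j i k. j \<le> n \<Longrightarrow> X j $ i $ k = Y j $ i $ k + c * Z j $ i $ k"
    and "x n = y n + c * z n"
  shows "dlterm M X e x n = dlterm M Y e y n + c * dlterm M Z e z n"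
proof -
  have 1: "dorb M X n = dorb M Y n + c * dorb M Z n" by (rule dorb_linear) (use assms in auto)
  have X: "X n $ i $ k = Y n $ i $ k + c * Z n $ i $ k" for i k using assms by simp
  have s: "a / d - u / v = (b / d - y' / v) + c * (b' / d - z' / v)"
    if "a = b + c * b'" "u = y' + c * z'" for a b b' d u v y' z' :: complex
    by (simp add: that add_divide_distrib right_diff_distrib)
  show ?thesis unfolding dlterm_def
    by (rule s[OF _ assms(2)]) (simp add: mden_def 1 X algebra_simps)
qed

lemma orb_continuous_on:
  fixes M :: "nat \<Rightarrow> 'v::topological_space \<Rightarrow> complex^2^2"
  assumes "\<And>j i k. j < n \<Longrightarrow> continuous_on S (\<lambda>y. M j y $ i $ k)"
    and "\<And>j y. j < n \<Longrightarrow> y \<in> S \<Longrightarrow> mden (M j y) (orb (\<lambda>j. M j y) 0 j) \<noteq> 0"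
  shows "continuous_on S (\<lambda>y. orb (\<lambda>j. M j y) 0 n)"
  using assms
proof (induction n)
  case (Suc n)
  have IH: "continuous_on S (\<lambda>y. orb (\<lambda>j. M j y) 0 n)" using Suc by simp
  note c = Suc.prems(1)[OF lessI]
  show ?case unfolding orb.simps
    by (rule continuous_on_divide) (use Suc.prems(2)[OF lessI] in \<open>auto simp: mnum_def mden_def intro!: continuous_intros IH c\<close>)
qed simp

lemma dorb_continuous_on:
  fixes M M' :: "nat \<Rightarrow> 'v::topological_space \<Rightarrow> complex^2^2"
  assumes "\<And>j i k. j < n \<Longrightarrow> continuous_on S (\<lambda>y. M j y $ i $ k)"
    and "\<And>j i k. j < n \<Longrightarrow> continuous_on S (\<lambda>y. M' j y $ i $ k)"
    and "\<And>j y. j < n \<Longrightarrow> y \<in> S \<Longrightarrow> mden (M j y) (orb (\<lambda>j. M j y) 0 j) \<noteq> 0"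
  shows "continuous_on S (\<lambda>y. dorb (\<lambda>j. M j y) (\<lambda>j. M' j y) n)"
  using assms
proof (induction n)
  case (Suc n)
  have IH: "continuous_on S (\<lambda>y. dorb (\<lambda>j. M j y) (\<lambda>j. M' j y) n)" using Suc by simp
  have o: "continuous_on S (\<lambda>y. orb (\<lambda>j. M j y) 0 n)"
    by (rule orb_continuous_on) (use Suc.prems in auto)
  note c = Suc.prems(1)[OF lessI] Suc.prems(2)[OF lessI]
  show ?case unfolding dorb.simps
    by (rule continuous_on_divide) (use Suc.prems(3)[OF lessI] in \<open>auto simp: mnum_def mden_def intro!: continuous_intros IH c o\<close>)
qed simp

lemma adm_lterm_continuous_on:
  fixes M :: "nat \<Rightarrow> 'v::topological_space \<Rightarrow> complex^2^2"
  assumes M: "\<And>j i k. j \<le> n \<Longrightarrow> continuous_on S (\<lambda>y. M j y $ i $ k)"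
    and e: "continuous_on S (\<lambda>y. e n y)"
    and a: "\<And>j y. j \<le> n \<Longrightarrow> y \<in> S \<Longrightarrow> adm 1 q (M j y) (e j y)" and q: "q < 1"
  shows "continuous_on S (\<lambda>y. lterm (\<lambda>j. M j y) (\<lambda>j. e j y) n)"
proof -
  have nz: "mden (M j y) (orb (\<lambda>j. M j y) 0 j) \<noteq> 0" if "j \<le> n" "y \<in> S" for j y
    using orb_den_nz[of n q "\<lambda>j. M j y" "\<lambda>j. e j y" 0 j] a q that by auto
  have o: "continuous_on S (\<lambda>y. orb (\<lambda>j. M j y) 0 n)"
    by (rule orb_continuous_on) (use M nz in auto)
  have enz: "e n y \<noteq> 0" if "y \<in> S" for y using a[of n y] that by (auto simp: adm_def)
  show ?thesis unfolding lterm_def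
  proof (rule continuous_on_Ln')
    show "continuous_on S (\<lambda>y. mden (M n y) (orb (\<lambda>j. M j y) 0 n) / e n y)"
      unfolding mden_def by (intro continuous_intros M o e) (use enz in auto)
    show "mden (M n y) (orb (\<lambda>j. M j y) 0 n) / e n y \<notin> \<real>\<^sub>\<le>\<^sub>0" if "y \<in> S" for y
      by (rule near_1_slit[OF lterm_near_1[where M = "\<lambda>j. M j y" and e = "\<lambda>j. e j y"] q]) (use a q that in auto)
  qed
qed

lemma adm_dlterm_continuous_on:
  fixes M M' :: "nat \<Rightarrow> 'v::topological_space \<Rightarrow> complex^2^2"
  assumes M: "\<And>j i k. j \<le> n \<Longrightarrow> continuous_on S (\<lambda>y. M j y $ i $ k)"
    and M': "\<And>j i k. j \<le> n \<Longrightarrow> continuous_on S (\<lambda>y. M' j y $ i $ k)"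
    and e: "continuous_on S (\<lambda>y. e n y)" and e': "continuous_on S (\<lambda>y. e' n y)"
    and a: "\<And>j y. j \<le> n \<Longrightarrow> y \<in> S \<Longrightarrow> adm 1 q (M j y) (e j y)" and q: "q < 1"
  shows "continuous_on S (\<lambda>y. dlterm (\<lambda>j. M j y) (\<lambda>j. M' j y) (\<lambda>j. e j y) (\<lambda>j. e' j y) n)"
proof -
  have nz: "mden (M j y) (orb (\<lambda>j. M j y) 0 j) \<noteq> 0" if "j \<le> n" "y \<in> S" for j y
    using orb_den_nz[of n q "\<lambda>j. M j y" "\<lambda>j. e j y" 0 j] a q that by auto
  have o: "continuous_on S (\<lambda>y. orb (\<lambda>j. M j y) 0 n)"
    by (rule orb_continuous_on) (use M nz in auto)
  have d: "continuous_on S (\<lambda>y. dorb (\<lambda>j. M j y) (\<lambda>j. M' j y) n)"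
    by (rule dorb_continuous_on) (use M M' nz in auto)
  have enz: "e n y \<noteq> 0" if "y \<in> S" for y using a[of n y] that by (auto simp: adm_def)
  have "continuous_on S (\<lambda>y. mden (M n y) (orb (\<lambda>j. M j y) 0 n))"
    unfolding mden_def by (intro continuous_on_add continuous_on_mult M o order_refl)
  moreover have "continuous_on S (\<lambda>y. mden (M' n y) (orb (\<lambda>j. M j y) 0 n)
      + M n y $ 2 $ 1 * dorb (\<lambda>j. M j y) (\<lambda>j. M' j y) n)"
    unfolding mden_def by (intro continuous_on_add continuous_on_mult M M' o d order_refl)
  ultimately show ?thesis unfolding dlterm_def
    by (intro continuous_on_diff continuous_on_divide e e') (use nz enz in auto)
qed

lemma orb_holomorphic_on:
  fixes M :: "nat \<Rightarrow> complex \<Rightarrow> complex^2^2"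
  assumes "\<And>j i k. j < n \<Longrightarrow> (\<lambda>y. M j y $ i $ k) holomorphic_on S"
    and "\<And>j y. j < n \<Longrightarrow> y \<in> S \<Longrightarrow> mden (M j y) (orb (\<lambda>j. M j y) (w y) j) \<noteq> 0"
    and "w holomorphic_on S"
  shows "(\<lambda>y. orb (\<lambda>j. M j y) (w y) n) holomorphic_on S"
  using assms(1,2)
proof (induction n)
  case (Suc n)
  have IH: "(\<lambda>y. orb (\<lambda>j. M j y) (w y) n) holomorphic_on S" using Suc by simp
  note c = Suc.prems(1)[OF lessI]
  show ?case unfolding orb.simps
    by (rule holomorphic_on_divide) (use Suc.prems(2)[OF lessI] in \<open>auto simp: mnum_def mden_def intro!: holomorphic_intros IH c\<close>)
qed (use assms(3) in simp)

lemma adm_lterm_holomorphic_on: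
  fixes M :: "nat \<Rightarrow> complex \<Rightarrow> complex^2^2"
  assumes M: "\<And>j i k. j \<le> n \<Longrightarrow> (\<lambda>y. M j y $ i $ k) holomorphic_on S"
    and e: "(\<lambda>y. e n y) holomorphic_on S"
    and a: "\<And>j y. j \<le> n \<Longrightarrow> y \<in> S \<Longrightarrow> adm 1 q (M j y) (e j y)" and q: "q < 1"
  shows "(\<lambda>y. lterm (\<lambda>j. M j y) (\<lambda>j. e j y) n) holomorphic_on S"
proof -
  have nz: "mden (M j y) (orb (\<lambda>j. M j y) 0 j) \<noteq> 0" if "j \<le> n" "y \<in> S" for j y
    using orb_den_nz[of n q "\<lambda>j. M j y" "\<lambda>j. e j y" 0 j] a q that by auto
  have o: "(\<lambda>y. orb (\<lambda>j. M j y) 0 n) holomorphic_on S"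
    by (rule orb_holomorphic_on) (use M nz in auto)
  have enz: "e n y \<noteq> 0" if "y \<in> S" for y using a[of n y] that by (auto simp: adm_def)
  show ?thesis unfolding lterm_def
  proof (rule holomorphic_on_Ln')
    show "(\<lambda>y. mden (M n y) (orb (\<lambda>j. M j y) 0 n) / e n y) holomorphic_on S"
      unfolding mden_def by (intro holomorphic_intros M o e) (use enz in auto)
    show "mden (M n y) (orb (\<lambda>j. M j y) 0 n) / e n y \<notin> \<real>\<^sub>\<le>\<^sub>0" if "y \<in> S" for y
      by (rule near_1_slit[OF lterm_near_1[where M = "\<lambda>j. M j y" and e = "\<lambda>j. e j y"] q]) (use a q that in auto)
  qed
qed

text \<open>
  A ball of radius \<open>\<rho>\<close> of admissible pairs around \<open>(M, e)\<close>: the polydisc on which Cauchy's inequality is applied.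
\<close>

definition robust :: "real \<Rightarrow> real \<Rightarrow> complex^2^2 \<Rightarrow> complex \<Rightarrow> bool" where
  "robust \<rho> q M e \<longleftrightarrow> (\<forall>M' e'. (\<forall>i k. cmod (M' $ i $ k - M $ i $ k) \<le> \<rho>) \<longrightarrow> cmod (e' - e) \<le> \<rho> \<longrightarrow> adm 1 q M' e')"

lemma Cauchy_deriv_bound:
  assumes "f holomorphic_on ball z R" "0 < R" "\<And>w. w \<in> ball z R \<Longrightarrow> cmod (f w) \<le> B"
  shows "cmod (deriv f z) \<le> 2 * B / R"
proof -
  have sub: "cball z (R/2) \<subseteq> ball z R" using assms(2) by (auto simp: subset_iff)
  have "cmod ((deriv ^^ 1) f z) \<le> fact 1 * B / (R/2) ^ 1"
  proof (rule Cauchy_inequality)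
    show "f holomorphic_on ball z (R/2)" using assms(1,2) by (auto intro: holomorphic_on_subset)
    show "continuous_on (cball z (R/2)) f"
      using assms(1) sub holomorphic_on_imp_continuous_on continuous_on_subset by blast
    show "cmod (f x) \<le> B" if "cmod (z - x) = R/2" for x
      using that assms(2) by (intro assms(3)) (simp add: dist_norm)
  qed (use assms in auto)
  then show ?thesis by (simp add: mult.commute)
qed

text \<open>
  The bound does not depend on the length of the chain. The chain with matrices \<open>M + z (M' - M)\<close> is a bounded holomorphic function of
  \<open>z\<close> on the disc of radius \<open>R\<close>, and \<open>M\<close> and \<open>M'\<close> are its values at \<open>0\<close> and \<open>1\<close>, far from the boundary.
\<close>

lemma lterm_perturb:
  assumes rob: "\<And>j. j \<le> n \<Longrightarrow> robust \<rho> q (M j) (e j)" and q: "0 \<le> q" "q < 1" and \<rho>: "0 \<le> \<rho>"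
    and R: "4 \<le> R" and d: "\<And>j i k. j \<le> n \<Longrightarrow> R * cmod (M' j $ i $ k - M j $ i $ k) \<le> \<rho>"
  shows "cmod (lterm M' e n - lterm M e n) \<le> 4 * lbound q / R"
proof -
  define L where "L j z = (\<chi> i k. M j $ i $ k + z * (M' j $ i $ k - M j $ i $ k))" for j and z :: complex
  have a: "adm 1 q (L j z) (e j)" if "j \<le> n" "z \<in> ball 0 R" for j z
  proof -
    have "cmod (z * (M' j $ i $ k - M j $ i $ k)) \<le> \<rho>" for i k
      using mult_right_mono[of "cmod z" R "cmod (M' j $ i $ k - M j $ i $ k)"] that d[of j i k]
      by (auto simp: norm_mult)
    then show ?thesis using rob[OF that(1)] \<rho> unfolding robust_def L_def by simp
  qed
  let ?g = "\<lambda>z. lterm (\<lambda>j. L j z) e n"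
  have hol: "?g holomorphic_on ball 0 R"
    by (rule adm_lterm_holomorphic_on[where e = "\<lambda>j z. e j"])
      (use a q in \<open>auto simp: L_def intro!: holomorphic_intros\<close>)
  have bd: "cmod (?g z) \<le> lbound q" if "z \<in> ball 0 R" for z
    by (rule lterm_bound) (use a that q in auto)
  \<comment> \<open>Points of the unit disc have distance at least \<open>R / 2\<close> from the boundary, since \<open>R \<ge> 4\<close>.\<close>
  have der: "cmod (deriv ?g z) \<le> 4 * lbound q / R" if "cmod z \<le> 1" for z
  proof -
    have sub: "ball z (R/2) \<subseteq> ball 0 R"
    proof
      fix x assume "x \<in> ball z (R/2)"
      then have "cmod (z - x) < R/2" by (simp add: dist_norm)
      then show "x \<in> ball 0 R" using that R norm_triangle_ineq4[of z "z - x"] by simp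
    qed
    have "cmod (deriv ?g z) \<le> 2 * lbound q / (R/2)"
      by (rule Cauchy_deriv_bound) (use R bd sub holomorphic_on_subset[OF hol sub] in auto)
    then show ?thesis by simp
  qed
  have "cmod (?g 1 - ?g 0) \<le> 4 * lbound q / R * cmod (1 - 0)"
  proof (rule field_differentiable_bound[where S = "cball 0 1" and f' = "deriv ?g"])
    show "(?g has_field_derivative deriv ?g z) (at z within cball 0 1)" if "z \<in> cball 0 1" for z
      by (rule has_field_derivative_at_within, rule holomorphic_derivI[OF hol]) (use that R in auto)
  qed (use der in auto)
  moreover have "(\<lambda>j. L j 0) = M" "(\<lambda>j. L j 1) = M'" by (auto simp: L_def fun_eq_iff vec_eq_iff)
  ultimately show ?thesis by simp
qed

text \<open>
  Again independent of the length of the chain: \<open>dlterm\<close> is the derivative at \<open>0\<close> of the bounded holomorphic function obtained from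
  \<open>M + z M'\<close> and \<open>e + z e'\<close> on the disc of radius \<open>R\<close>.
\<close>

lemma dlterm_bound:
  assumes rob: "\<And>j. j \<le> n \<Longrightarrow> robust \<rho> q (M j) (e j)" and q: "q < 1" and R: "0 < R"
    and d: "\<And>j i k. j \<le> n \<Longrightarrow> R * cmod (M' j $ i $ k) \<le> \<rho>" and d': "\<And>j. j \<le> n \<Longrightarrow> R * cmod (e' j) \<le> \<rho>"
  shows "cmod (dlterm M M' e e' n) \<le> 2 * lbound q / R"
proof -
  define L where "L j z = (\<chi> i k. M j $ i $ k + z * M' j $ i $ k)" for j and z :: complex
  define E where "E j z = e j + z * e' j" for j and z :: complex
  have a: "adm 1 q (L j z) (E j z)" if "j \<le> n" "z \<in> ball 0 R" for j z
  proof -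
    have "cmod (z * x) \<le> \<rho>" if "R * cmod x \<le> \<rho>" for x
      using mult_right_mono[of "cmod z" R "cmod x"] \<open>z \<in> _\<close> that
      by (auto simp: norm_mult)
    then have "cmod (z * M' j $ i $ k) \<le> \<rho>" "cmod (z * e' j) \<le> \<rho>" for i k
      using d[of j i k] d'[of j] that by auto
    then show ?thesis using rob[OF that(1)] unfolding robust_def L_def E_def by simp
  qed
  let ?g = "\<lambda>z. lterm (\<lambda>j. L j z) (\<lambda>j. E j z) n"
  have hol: "?g holomorphic_on ball 0 R"
    by (rule adm_lterm_holomorphic_on)
      (use a q in \<open>auto simp: L_def E_def intro!: holomorphic_intros\<close>)
  have bd: "cmod (?g z) \<le> lbound q" if "z \<in> ball 0 R" for z
    by (rule lterm_bound) (use a that q in auto)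
  have L0: "(\<lambda>j. L j 0) = M" "(\<lambda>j. E j 0) = e" by (auto simp: L_def E_def fun_eq_iff vec_eq_iff)
  have "(?g has_derivative (\<lambda>h. dlterm (\<lambda>j. L j 0) (\<lambda>j. \<chi> i k. h * M' j $ i $ k) (\<lambda>j. E j 0) (\<lambda>j. h * e' j) n)) (at 0)"
    by (rule lterm_has_derivative[where q = q])
      (use a[of _ 0] q R in \<open>auto simp: L_def E_def intro!: derivative_eq_intros\<close>)
  moreover have "dlterm M (\<lambda>j. \<chi> i k. h * M' j $ i $ k) e (\<lambda>j. h * e' j) n = h * dlterm M M' e e' n" for h
    using dlterm_linear[of n "\<lambda>j. \<chi> i k. h * M' j $ i $ k" "\<lambda>j. 0" h M' "\<lambda>j. h * e' j" "\<lambda>j. 0" e' M e]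
      dlterm_linear[of n "\<lambda>j. 0" "\<lambda>j. 0" "-1" "\<lambda>j. 0" "\<lambda>j. 0" "\<lambda>j. 0" "\<lambda>j. 0" M e] by simp
  ultimately have "(?g has_derivative (\<lambda>h. h * dlterm M M' e e' n)) (at 0)"
    by (simp add: L0)
  moreover have "(\<lambda>h. h * dlterm M M' e e' n) = (*) (dlterm M M' e e' n)"
    by (auto simp: mult.commute)
  ultimately have "(?g has_field_derivative dlterm M M' e e' n) (at 0)"
    unfolding has_field_derivative_def by simp
  then have "deriv ?g 0 = dlterm M M' e e' n" by (rule DERIV_imp_deriv)
  with Cauchy_deriv_bound[OF hol R bd] show ?thesis by simp
qed

lemma mob_diff:
  assumes "mden M z \<noteq> 0" "mden M w \<noteq> 0"
  shows "mnum M z / mden M z - mnum M w / mden M w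
    = (M$1$1 * M$2$2 - M$1$2 * M$2$1) / (mden M z * mden M w) * (z - w)"
  using assms by (simp add: diff_frac_eq) (simp add: mnum_def mden_def algebra_simps)

text \<open>
  Orbits forget their starting point at the rate \<open>r\<close>. Multiply every numerator by \<open>z\<close>: the chain remains in the unit disc for \<open>\<bar>z\<bar> \<le> 1 / r\<close>, while the
  difference of the two orbits has a zero of order \<open>n\<close> at \<open>z = 0\<close>, since each map contributes a factor \<open>z\<close>
  (\<open>mob_diff\<close>). As in the Schwarz lemma, the maximum modulus principle for the quotient by \<open>z\<^sup>n\<close> gives the factor \<open>r\<^sup>n\<close> at \<open>z = 1\<close>.
\<close>

lemma orb_contract:
  assumes a: "\<And>j. j < n \<Longrightarrow> adm r q (M j) (e j)" and r: "0 < r" "r < 1" and q: "q < 1" and w: "cmod w \<le> 1"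
  shows "cmod (orb M w n - orb M 0 n) \<le> 2 * r ^ n"
proof -
  \<comment> \<open>\<open>z\<close> multiplies the first row, that is, the numerator.\<close>
  define L where "L j z = (\<chi> i k. (if i = 1 then z else 1) * M j $ i $ k)" for j and z :: complex
  have Ln: "mnum (L j z) m = z * mnum (M j) m" "mden (L j z) m = mden (M j) m" for j z m
    by (auto simp: L_def mnum_def mden_def algebra_simps)
  have la: "adm 1 q (L j z) (e j)" if "j < n" "z \<in> cball 0 (1/r)" for j z
    unfolding adm_def Ln
  proof (intro conjI allI impI)
    fix m :: complex assume m: "cmod m \<le> 1"
    have "r * cmod z \<le> 1" using that r by (simp add: field_simps)
    then have "r * cmod z * cmod (mden (M j) m) \<le> 1 * cmod (mden (M j) m)" by (intro mult_right_mono) auto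
    moreover have "cmod z * cmod (mnum (M j) m) \<le> cmod z * (r * cmod (mden (M j) m))"
      using a[OF that(1)] m by (intro mult_left_mono) (auto simp: adm_def)
    ultimately show "cmod (z * mnum (M j) m) \<le> 1 * cmod (mden (M j) m)"
      by (simp add: norm_mult mult_ac)
  qed (use a[OF that(1)] in \<open>auto simp: adm_def\<close>)
  have ob: "cmod (orb (\<lambda>j. L j z) v j) \<le> 1" if "j \<le> n" "z \<in> cball 0 (1/r)" "cmod v \<le> 1" for j z v
    by (rule orb_bound[where q = q and e = e]) (use la that q in auto)
  have nz: "mden (M j) (orb (\<lambda>j. L j z) v j) \<noteq> 0" if "j < n" "z \<in> cball 0 (1/r)" "cmod v \<le> 1" for j z v
    by (rule adm_den_nz[OF a[OF that(1)] q ob]) (use that in auto)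
  \<comment> \<open>The cofactor of \<open>z\<^sup>n\<close> in the difference of the two orbits, in closed form, hence holomorphic also at \<open>0\<close>.\<close>
  define K where "K z = w * (\<Prod>j<n. (M j$1$1 * M j$2$2 - M j$1$2 * M j$2$1) /
     (mden (M j) (orb (\<lambda>j. L j z) w j) * mden (M j) (orb (\<lambda>j. L j z) 0 j)))" for z
  have FK: "orb (\<lambda>j. L j z) w n - orb (\<lambda>j. L j z) 0 n = z ^ n * K z" if z: "z \<in> cball 0 (1/r)" for z
  proof -
    have "orb (\<lambda>j. L j z) w k - orb (\<lambda>j. L j z) 0 k = z ^ k * w * (\<Prod>j<k. (M j$1$1 * M j$2$2 - M j$1$2 * M j$2$1) /
     (mden (M j) (orb (\<lambda>j. L j z) w j) * mden (M j) (orb (\<lambda>j. L j z) 0 j)))" if "k \<le> n" for k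
      using that
    proof (induction k)
      case (Suc k)
      have "orb (\<lambda>j. L j z) w (Suc k) - orb (\<lambda>j. L j z) 0 (Suc k) =
         z * (mnum (M k) (orb (\<lambda>j. L j z) w k) / mden (M k) (orb (\<lambda>j. L j z) w k)
            - mnum (M k) (orb (\<lambda>j. L j z) 0 k) / mden (M k) (orb (\<lambda>j. L j z) 0 k))"
        by (simp add: Ln right_diff_distrib)
      also have "\<dots> = z * ((M k$1$1 * M k$2$2 - M k$1$2 * M k$2$1) /
           (mden (M k) (orb (\<lambda>j. L j z) w k) * mden (M k) (orb (\<lambda>j. L j z) 0 k))
           * (orb (\<lambda>j. L j z) w k - orb (\<lambda>j. L j z) 0 k))"
        by (subst mob_diff) (use nz[of k z w] nz[of k z 0] Suc.prems z w in auto)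
      also have "orb (\<lambda>j. L j z) w k - orb (\<lambda>j. L j z) 0 k = z ^ k * w * (\<Prod>j<k. (M j$1$1 * M j$2$2 - M j$1$2 * M j$2$1) /
     (mden (M j) (orb (\<lambda>j. L j z) w j) * mden (M j) (orb (\<lambda>j. L j z) 0 j)))"
        using Suc by simp
      finally show ?case by (simp add: mult_ac)
    qed simp
    from this[of n] show ?thesis by (simp add: K_def)
  qed
  have oh: "(\<lambda>z. orb (\<lambda>j. L j z) v j) holomorphic_on cball 0 (1/r)" if "cmod v \<le> 1" "j \<le> n" for v j
  proof (rule orb_holomorphic_on[where w = "\<lambda>_. v"])
    show "(\<lambda>y. L i y $ a $ b) holomorphic_on cball 0 (1/r)" for i a b
      by (cases "a = 1") (auto simp: L_def intro!: holomorphic_intros)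
    show "mden (L i y) (orb (\<lambda>j. L j y) v i) \<noteq> 0" if "i < j" "y \<in> cball 0 (1/r)" for i y
      unfolding Ln by (rule nz) (use that \<open>j \<le> n\<close> \<open>cmod v \<le> 1\<close> in auto)
  qed simp
  have Kh: "K holomorphic_on cball 0 (1/r)"
  proof -
    have hd: "(\<lambda>z. mden (M j) (orb (\<lambda>j. L j z) v j)) holomorphic_on cball 0 (1/r)"
      if "j \<in> {..<n}" "cmod v \<le> 1" for j v
      unfolding mden_def
      by (intro holomorphic_on_add holomorphic_on_mult holomorphic_on_const oh) (use that in auto)
    show ?thesis
      unfolding K_def
      by (intro holomorphic_on_mult holomorphic_on_const holomorphic_on_prod holomorphic_on_divide hd)
        (use nz w in auto)
  qed
  have "cmod (K 1) \<le> 2 * r ^ n"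
  proof (rule maximum_modulus_frontier[of K "cball 0 (1/r)"])
    show "K holomorphic_on interior (cball 0 (1/r))" using Kh by (rule holomorphic_on_subset) (simp add: interior_subset)
    show "continuous_on (closure (cball 0 (1/r))) K" using Kh by (simp add: holomorphic_on_imp_continuous_on)
    fix z :: complex assume "z \<in> frontier (cball 0 (1/r))"
    then have z: "cmod z = 1/r" using r by (simp add: frontier_cball sphere_def)
    then have zc: "z \<in> cball 0 (1/r)" by simp
    have "cmod (z ^ n * K z) \<le> 2"
      unfolding FK[OF zc, symmetric]
      using norm_triangle_ineq4[of "orb (\<lambda>j. L j z) w n" "orb (\<lambda>j. L j z) 0 n"] ob[OF le_refl zc w] ob[OF le_refl zc, of 0]
      by simp
    then show "cmod (K z) \<le> 2 * r ^ n"
      using r by (simp add: norm_mult norm_power z power_one_over field_simps)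
  qed (use r in auto)
  moreover have "(\<lambda>j. L j 1) = M" by (auto simp: L_def fun_eq_iff vec_eq_iff)
  ultimately show ?thesis using FK[of 1] r by simp
qed

lemma orb_shift: "orb M w (Suc n) = orb (\<lambda>j. M (Suc j)) (orb M w 1) n"
  by (induction n) auto

text \<open>
  Dropping the first map of a chain changes the starting point of the rest only, an effect damped by \<open>orb_contract\<close>.
\<close>

lemma lterm_contract:
  assumes a: "\<And>j. j \<le> Suc n \<Longrightarrow> adm r q (M j) (e j)" and r: "0 < r" "r < 1" and q: "q < 1"
  shows "cmod (lterm M e (Suc n) - lterm (\<lambda>j. M (Suc j)) (\<lambda>j. e (Suc j)) n) \<le> 2 / (1 - q) * r ^ n"
proof -
  let ?N = "M (Suc n)" and ?e = "e (Suc n)"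
  let ?m = "orb M 0 (Suc n)" and ?m' = "orb (\<lambda>j. M (Suc j)) 0 n"
  have a1: "adm 1 q (M j) (e j)" if "j \<le> Suc n" for j using adm_mono[OF a[OF that]] r by simp
  have m: "cmod ?m \<le> 1" by (rule orb_bound[where q = q and e = e]) (use a1 q in auto)
  have m': "cmod ?m' \<le> 1" by (rule orb_bound[where q = q and e = "\<lambda>j. e (Suc j)"]) (use a1 q in auto)
  have w: "cmod (orb M 0 1) \<le> 1" by (rule orb_bound[where q = q and e = e]) (use a1 q in auto)
  have dm: "cmod (?m - ?m') \<le> 2 * r ^ n"
    unfolding orb_shift[of M 0 n]
    by (rule orb_contract[where q = q and e = "\<lambda>j. e (Suc j)"]) (use a r q w in auto)
  have enz: "?e \<noteq> 0" using a[of "Suc n"] by (simp add: adm_def)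
  \<comment> \<open>The lower left entry is controlled by comparing the denominators at \<open>1\<close> and \<open>-1\<close>.\<close>
  have c: "cmod (?N $ 2 $ 1) \<le> q * cmod ?e"
  proof -
    have "cmod (mden ?N 1 - ?e) \<le> q * cmod ?e" "cmod (mden ?N (-1) - ?e) \<le> q * cmod ?e"
      using a[of "Suc n"] by (auto simp: adm_def)
    then have "cmod ((mden ?N 1 - ?e) - (mden ?N (-1) - ?e)) \<le> 2 * (q * cmod ?e)"
      using norm_triangle_ineq4[of "mden ?N 1 - ?e" "mden ?N (-1) - ?e"] by linarith
    also have "(mden ?N 1 - ?e) - (mden ?N (-1) - ?e) = 2 * ?N $ 2 $ 1" by (simp add: mden_def)
    finally show ?thesis by simp
  qed
  have q0: "0 \<le> q" using c enz by (smt (verit) mult_neg_pos norm_ge_zero zero_less_norm_iff)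
  have dq: "cmod (mden ?N ?m / ?e - mden ?N ?m' / ?e) \<le> 2 * r ^ n"
  proof -
    have "mden ?N ?m / ?e - mden ?N ?m' / ?e = ?N $ 2 $ 1 / ?e * (?m - ?m')"
      by (simp add: mden_def diff_divide_distrib[symmetric] algebra_simps del: orb.simps)
    then have "cmod (mden ?N ?m / ?e - mden ?N ?m' / ?e) = cmod (?N $ 2 $ 1) / cmod ?e * cmod (?m - ?m')"
      by (simp add: norm_mult norm_divide del: orb.simps)
    also have "\<dots> \<le> 1 * (2 * r ^ n)"
    proof (rule mult_mono[OF _ dm])
      have "cmod (?N $ 2 $ 1) \<le> 1 * cmod ?e"
        by (rule order_trans[OF c]) (use q mult_right_mono[of q 1 "cmod ?e"] in auto)
      then show "cmod (?N $ 2 $ 1) / cmod ?e \<le> 1" using enz by (simp add: divide_le_eq)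
    qed auto
    finally show ?thesis by simp
  qed
  have "cmod (Ln (mden ?N ?m / ?e) - Ln (mden ?N ?m' / ?e)) \<le> 1 / (1 - q) * cmod (mden ?N ?m / ?e - mden ?N ?m' / ?e)"
  proof (rule field_differentiable_bound[where S = "cball 1 q" and f' = inverse])
    fix z :: complex assume "z \<in> cball 1 q"
    then have z: "cmod (z - 1) \<le> q" by (simp add: dist_norm norm_minus_commute)
    show "(Ln has_field_derivative inverse z) (at z within cball 1 q)"
      by (rule has_field_derivative_at_within[OF has_field_derivative_Ln[OF near_1_slit[OF z q]]])
    have "1 - q \<le> cmod z" using z norm_triangle_ineq2[of 1 "1 - z"] by (simp add: norm_minus_commute)
    then show "cmod (inverse z) \<le> 1 / (1 - q)" using q by (simp add: inverse_eq_divide norm_divide frac_le)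
  next
    show "mden ?N ?m / ?e \<in> cball 1 q"
      using quot_near_1[OF a1[of "Suc n"] m] by (simp add: dist_norm norm_minus_commute del: orb.simps)
    show "mden ?N ?m' / ?e \<in> cball 1 q"
      using quot_near_1[OF a1[of "Suc n"] m'] by (simp add: dist_norm norm_minus_commute)
  qed auto
  also have "\<dots> \<le> 1 / (1 - q) * (2 * r ^ n)" using dq q by (intro mult_left_mono) auto
  finally show ?thesis unfolding lterm_def by simp
qed

section \<open>Smoothness from polynomial approximation at all scales\<close>

text \<open>
  A Campanato-type condition: to every order \<open>N\<close> there is one degree \<open>D\<close> such that on all small intervals of radius \<open>h\<close> the function is \<open>O(h\<^sup>N)\<close>-close to
  a polynomial of degree \<open>D\<close>. The degree may exceed \<open>N\<close>. The factor \<open>m\<close> leaves room around the interval, so that the condition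
  passes to derivatives on the same open set.
\<close>

definition poly_approximable :: "(real \<Rightarrow> real) \<Rightarrow> real set \<Rightarrow> bool" where
  "poly_approximable f S \<longleftrightarrow> (\<forall>N::nat. \<exists>C D h0 m. C > 0 \<and> h0 > 0 \<and> m \<ge> 1 \<and>
     (\<forall>s h. 0 < h \<longrightarrow> h \<le> h0 \<longrightarrow> cball s (m * h) \<subseteq> S \<longrightarrow>
        (\<exists>q. degree q \<le> D \<and> (\<forall>t. \<bar>t - s\<bar> \<le> h \<longrightarrow> \<bar>f t - poly q t\<bar> \<le> C * h ^ N))))"

text \<open>
  Induction on the degree: divide \<open>q - q(a)\<close> by \<open>t - a\<close> and apply the induction hypothesis on the right half of the
  interval, where \<open>t - a\<close> is bounded below.
\<close>

lemma Markov_bound_aux: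
  fixes a b X :: real
  assumes "a < b"
  shows "\<exists>C\<ge>0. \<forall>q :: real poly. degree q \<le> D \<longrightarrow> (\<forall>t\<in>{a..b}. \<bar>poly q t\<bar> \<le> 1) \<longrightarrow>
     (\<forall>t. \<bar>t\<bar> \<le> X \<longrightarrow> \<bar>poly q t\<bar> \<le> C \<and> \<bar>poly (pderiv q) t\<bar> \<le> C)"
  using assms
proof (induction D arbitrary: a b)
  case 0
  show ?case
  proof (intro exI[of _ 1] conjI allI impI)
    fix q :: "real poly" and t
    assume q: "degree q \<le> 0" "\<forall>t\<in>{a..b}. \<bar>poly q t\<bar> \<le> 1"
    then obtain c where "q = [:c:]" by (auto elim: degree_eq_zeroE)
    then show "\<bar>poly q t\<bar> \<le> 1" "\<bar>poly (pderiv q) t\<bar> \<le> 1" using q 0 by (auto simp: pderiv_pCons)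
  qed simp
next
  case (Suc D)
  define c where "c = (a + b) / 2"
  have c: "a < c" "c < b" using Suc.prems by (auto simp: c_def)
  obtain C where C: "C \<ge> 0" and IH: "\<And>q t. degree q \<le> D \<Longrightarrow> (\<forall>t\<in>{c..b}. \<bar>poly q t\<bar> \<le> 1) \<Longrightarrow>
     \<bar>t\<bar> \<le> X \<Longrightarrow> \<bar>poly q t\<bar> \<le> C \<and> \<bar>poly (pderiv q) t\<bar> \<le> C"
    using Suc.IH[OF c(2)] by blast
  define K where "K = 4 / (b - a) * C"
  have K: "K \<ge> 0" using C Suc.prems by (simp add: K_def)
  show ?case
  proof (intro exI[of _ "1 + K + (\<bar>X\<bar> + \<bar>a\<bar>) * K"] conjI allI impI)
    show "0 \<le> 1 + K + (\<bar>X\<bar> + \<bar>a\<bar>) * K" using K by (intro add_nonneg_nonneg mult_nonneg_nonneg) auto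
    fix q :: "real poly" and t
    assume q: "degree q \<le> Suc D" "\<forall>t\<in>{a..b}. \<bar>poly q t\<bar> \<le> 1" and t: "\<bar>t\<bar> \<le> X"
    define r where "r = synthetic_div q a"
    have qr: "q = [:- a, 1:] * r + [:poly q a:]" unfolding r_def by (simp only: synthetic_div_correct')
    have qt: "poly q t = (t - a) * poly r t + poly q a" for t
      by (subst qr) (simp add: algebra_simps)
    have pq: "poly (pderiv q) t = poly r t + (t - a) * poly (pderiv r) t" for t
    proof -
      have "pderiv (p * r + [:c:]) = p * pderiv r + r * pderiv p" for p c
        by (simp add: pderiv_add pderiv_mult pderiv_pCons)
      then have "pderiv q = [:- a, 1:] * pderiv r + r * pderiv [:- a, 1:]" by (metis qr)
      then have "poly (pderiv q) t = poly ([:- a, 1:] * pderiv r + r * pderiv [:- a, 1:]) t"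
        by (rule arg_cong[of _ _ "\<lambda>p. poly p t"])
      then show ?thesis by (simp add: pderiv_pCons algebra_simps)
    qed
    have qa: "\<bar>poly q a\<bar> \<le> 1" using q(2) Suc.prems by auto
    have r1: "\<bar>poly (smult ((b - a) / 4) r) u\<bar> \<le> 1" if u: "u \<in> {c..b}" for u
    proof -
      have 1: "(b - a) / 2 \<le> u - a" using u by (auto simp: c_def field_simps)
      have "\<bar>(u - a) * poly r u\<bar> \<le> 2"
        using qt[of u] q(2) u c qa by (smt (verit) atLeastAtMost_iff)
      moreover have "(b - a) / 2 * \<bar>poly r u\<bar> \<le> \<bar>(u - a) * poly r u\<bar>"
        unfolding abs_mult using 1 Suc.prems by (intro mult_right_mono) auto
      ultimately show ?thesis using Suc.prems by (simp add: abs_mult)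
    qed
    have "degree (smult ((b - a) / 4) r) \<le> D"
      using q(1) by (auto simp: r_def degree_synthetic_div)
    from IH[OF this ballI[OF r1] t]
    have r: "(b - a) / 4 * \<bar>poly r t\<bar> \<le> C" "(b - a) / 4 * \<bar>poly (pderiv r) t\<bar> \<le> C"
      using Suc.prems by (auto simp: abs_mult pderiv_smult)
    have r: "\<bar>poly r t\<bar> \<le> K" "\<bar>poly (pderiv r) t\<bar> \<le> K"
      using r Suc.prems by (auto simp: K_def field_simps)
    have ta: "\<bar>t - a\<bar> \<le> \<bar>X\<bar> + \<bar>a\<bar>" using t by auto
    have m: "\<bar>(t - a) * poly r t\<bar> \<le> (\<bar>X\<bar> + \<bar>a\<bar>) * K" "\<bar>(t - a) * poly (pderiv r) t\<bar> \<le> (\<bar>X\<bar> + \<bar>a\<bar>) * K"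
      unfolding abs_mult using ta r by (auto intro!: mult_mono)
    show "\<bar>poly q t\<bar> \<le> 1 + K + (\<bar>X\<bar> + \<bar>a\<bar>) * K" using qt[of t] m qa K by linarith
    show "\<bar>poly (pderiv q) t\<bar> \<le> 1 + K + (\<bar>X\<bar> + \<bar>a\<bar>) * K" using pq[of t] m r K by linarith
  qed
qed

text \<open>
  A Markov inequality with an unspecified constant: rescaling reduces the interval to \<open>[-1, 1]\<close>.
\<close>

lemma Markov_inequality:
  obtains K :: real where "K > 0" "\<And>(q :: real poly) s h \<epsilon> t. degree q \<le> D \<Longrightarrow> h > 0 \<Longrightarrow> \<epsilon> > 0 \<Longrightarrow>
     (\<And>t. \<bar>t - s\<bar> \<le> h \<Longrightarrow> \<bar>poly q t\<bar> \<le> \<epsilon>) \<Longrightarrow> \<bar>t - s\<bar> \<le> h \<Longrightarrow> \<bar>poly (pderiv q) t\<bar> \<le> K * \<epsilon> / h"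
proof -
  obtain C where C: "C \<ge> 0" and b: "\<And>q :: real poly. \<And>t. degree q \<le> D \<Longrightarrow> (\<forall>t\<in>{-1..1}. \<bar>poly q t\<bar> \<le> 1) \<Longrightarrow>
     \<bar>t\<bar> \<le> 1 \<Longrightarrow> \<bar>poly (pderiv q) t\<bar> \<le> C"
    using Markov_bound_aux[of "-1" 1 D 1] by auto
  show ?thesis
  proof
    show "C + 1 > 0" using C by simp
    fix q :: "real poly" and s h \<epsilon> t :: real
    assume q: "degree q \<le> D" "h > 0" "\<epsilon> > 0" "\<And>t. \<bar>t - s\<bar> \<le> h \<Longrightarrow> \<bar>poly q t\<bar> \<le> \<epsilon>" and t: "\<bar>t - s\<bar> \<le> h"
    define p where "p = smult (1 / \<epsilon>) (pcompose q [:s, h:])"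
    have "degree p \<le> D" using q by (simp add: p_def degree_pcompose)
    moreover have "\<forall>u\<in>{-1..1}. \<bar>poly p u\<bar> \<le> 1"
    proof
      fix u :: real assume "u \<in> {-1..1}"
      then have "\<bar>u * h\<bar> \<le> h" using q(2) by (auto simp: abs_mult intro!: mult_left_le_one_le)
      then have "\<bar>poly q (s + u * h)\<bar> \<le> \<epsilon>" by (intro q(4)) simp
      then show "\<bar>poly p u\<bar> \<le> 1" using q(3) by (simp add: p_def poly_pcompose)
    qed
    moreover have "\<bar>(t - s) / h\<bar> \<le> 1" using t q(2) by simp
    ultimately have "\<bar>poly (pderiv p) ((t - s) / h)\<bar> \<le> C" by (rule b)
    then have "\<bar>poly (pderiv q) t\<bar> * h / \<epsilon> \<le> C"
      using q by (simp add: p_def pderiv_smult pderiv_pcompose poly_pcompose pderiv_pCons abs_mult mult.commute)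
    then have "\<bar>poly (pderiv q) t\<bar> \<le> C * \<epsilon> / h" using q by (simp add: field_simps)
    also have "\<dots> \<le> (C + 1) * \<epsilon> / h" using q by (intro divide_right_mono mult_right_mono) auto
    finally show "\<bar>poly (pderiv q) t\<bar> \<le> (C + 1) * \<epsilon> / h" .
  qed
qed

lemma poly_Taylor2:
  fixes q :: "real poly"
  assumes "\<And>u. \<bar>u - s\<bar> \<le> \<bar>t - s\<bar> \<Longrightarrow> \<bar>poly (pderiv (pderiv q)) u\<bar> \<le> B"
  shows "\<bar>poly q t - poly q s - poly (pderiv q) s * (t - s)\<bar> \<le> B * (t - s)^2"
proof -
  have "\<bar>poly q t - (\<Sum>i\<le>1. (poly ((pderiv ^^ i) q) s) * (t - s) ^ i / fact i)\<bar> \<le> B * \<bar>t - s\<bar> ^ Suc 1 / fact 1"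
    using field_Taylor[of "closed_segment s t" 1 "\<lambda>i. poly ((pderiv ^^ i) q)" B s t]
  proof -
    have 1: "(poly ((pderiv ^^ i) q) has_field_derivative poly ((pderiv ^^ Suc i) q) x) (at x within closed_segment s t)" for i x
      using poly_DERIV[of "(pderiv ^^ i) q" x] by (simp add: has_field_derivative_at_within)
    have 2: "norm (poly ((pderiv ^^ Suc 1) q) x) \<le> B" if "x \<in> closed_segment s t" for x
      using assms[of x] that by (simp add: closed_segment_eq_real_ivl split: if_splits)
    show ?thesis
      using field_Taylor[of "closed_segment s t" 1 "\<lambda>i. poly ((pderiv ^^ i) q)" B s t, OF _ 1 2] by simp
  qed
  moreover have "(\<Sum>i\<le>1. (poly ((pderiv ^^ i) q) s) * (t - s) ^ i / fact i) = poly q s + poly (pderiv q) s * (t - s)"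
    by simp
  moreover have "\<bar>t - s\<bar> ^ Suc 1 = (t - s)^2" by (simp add: power2_eq_square)
  ultimately show ?thesis by (simp add: diff_diff_add)
qed

text \<open>
  Halve the scale repeatedly. Consecutive approximating polynomials differ by \<open>O(H\<^sup>N)\<close> at scale \<open>H\<close>, so by the Markov inequality
  their first and second derivatives differ by \<open>O(H\<^bsup>N-1\<^esup>)\<close> and \<open>O(H\<^bsup>N-2\<^esup>)\<close>. For \<open>N \<ge> 3\<close> both series converge:
  the slopes at \<open>t\<close> converge to some \<open>L\<close>, and the second derivatives stay bounded, which gives a quadratic error for the
  approximation of \<open>f\<close> by its tangent of slope \<open>L\<close>.
\<close>

lemma approx_derivative:
  assumes K: "K > 0" "\<And>q s h \<epsilon> t. degree q \<le> D \<Longrightarrow> h > 0 \<Longrightarrow> \<epsilon> > 0 \<Longrightarrow>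
     (\<And>t. \<bar>t - s\<bar> \<le> h \<Longrightarrow> \<bar>poly q t\<bar> \<le> \<epsilon>) \<Longrightarrow> \<bar>t - s\<bar> \<le> h \<Longrightarrow> \<bar>poly (pderiv q) t\<bar> \<le> K * \<epsilon> / h"
    and N: "N \<ge> 3" and C: "C > 0" and h: "h > 0" "h \<le> 1"
    and apx: "\<And>h'. 0 < h' \<Longrightarrow> h' \<le> h \<Longrightarrow> \<exists>q. degree q \<le> D \<and> (\<forall>u. \<bar>u - t\<bar> \<le> h' \<longrightarrow> \<bar>f u - poly q u\<bar> \<le> C * h' ^ N)"
    and q: "degree q \<le> D" "\<And>u. \<bar>u - t\<bar> \<le> h \<Longrightarrow> \<bar>f u - poly q u\<bar> \<le> C * h ^ N"
  shows "\<exists>L. (f has_real_derivative L) (at t) \<and> \<bar>L - poly (pderiv q) t\<bar> \<le> 8 * K * C * h ^ (N - 1)"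
proof -
  define H where "H j = h / 2 ^ j" for j :: nat
  have H: "0 < H j" "H j \<le> h" "H j \<le> 1" "H (Suc j) = H j / 2" for j
    using h by (auto simp: H_def field_simps intro: order_trans[OF _ one_le_power])
  obtain p' where p': "\<And>j. degree (p' j) \<le> D \<and> (\<forall>u. \<bar>u - t\<bar> \<le> H j \<longrightarrow> \<bar>f u - poly (p' j) u\<bar> \<le> C * H j ^ N)"
    using apx[OF H(1,2)] by metis
  \<comment> \<open>At the top scale the prescribed polynomial \<open>q\<close> is used, so that \<open>L\<close> can be compared with the slope of \<open>q\<close>.\<close>
  define p where "p j = (if j = 0 then q else p' j)" for j
  have p: "degree (p j) \<le> D" "\<And>u. \<bar>u - t\<bar> \<le> H j \<Longrightarrow> \<bar>f u - poly (p j) u\<bar> \<le> C * H j ^ N" for j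
    using p'[of j] q by (auto simp: p_def H_def)
  define E where "E = 4 * K * C"
  have E: "E > 0" using K C by (simp add: E_def)
  have d0: "\<bar>poly (p (Suc j) - p j) u\<bar> \<le> 2 * C * H j ^ N" if "\<bar>u - t\<bar> \<le> H (Suc j)" for u j
  proof -
    have "H (Suc j) ^ N \<le> H j ^ N" using H[of j] H[of "Suc j"] by (intro power_mono) auto
    then have "C * H (Suc j) ^ N \<le> C * H j ^ N" using C by simp
    moreover have "\<bar>u - t\<bar> \<le> H j" using that H[of j] by simp
    ultimately show ?thesis using p(2)[of u j] p(2)[OF that] by simp
  qed
  have dg: "degree (p (Suc j) - p j) \<le> D" for j using p(1) by (simp add: degree_diff_le)
  have d1: "\<bar>poly (pderiv (p (Suc j) - p j)) u\<bar> \<le> E * H j ^ (N - 1)" if "\<bar>u - t\<bar> \<le> H (Suc j)" for u j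
  proof -
    have "\<bar>poly (pderiv (p (Suc j) - p j)) u\<bar> \<le> K * (2 * C * H j ^ N) / H (Suc j)"
      by (rule K(2)[OF dg H(1) _ d0 that]) (use C H[of j] in auto)
    also have "\<dots> = E * H j ^ (N - 1)"
      using H(1)[of j] N by (cases N) (auto simp: H(4) E_def field_simps)
    finally show ?thesis .
  qed
  have d2: "\<bar>poly (pderiv (pderiv (p (Suc j) - p j))) u\<bar> \<le> 2 * K * E * H j" if "\<bar>u - t\<bar> \<le> H (Suc j)" for u j
  proof -
    have "\<bar>poly (pderiv (pderiv (p (Suc j) - p j))) u\<bar> \<le> K * (E * H j ^ (N - 1)) / H (Suc j)"
    proof (rule K(2)[OF _ H(1) _ d1 that])
      show "degree (pderiv (p (Suc j) - p j)) \<le> D" using dg[of j] by (simp add: degree_pderiv)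
    qed (use E H[of j] in auto)
    also have "\<dots> = 2 * K * E * H j ^ (N - 2)"
    proof -
      define n where "n = N - 2"
      have n: "N = Suc (Suc n)" using N by (simp add: n_def)
      show ?thesis using H(1)[of j] by (simp add: n H(4) field_simps)
    qed
    also have "\<dots> \<le> 2 * K * E * H j ^ 1"
      using K E H(1)[of j] H(3)[of j] N by (intro mult_left_mono power_decreasing) auto
    finally show ?thesis by simp
  qed
  have sumH: "(\<Sum>i<n. H i ^ k) \<le> 2 * h ^ k" if "k \<ge> 1" for n k
  proof -
    have "(\<Sum>i<n. H i ^ k) \<le> (\<Sum>i<n. h ^ k * (1/2) ^ i)"
    proof (rule sum_mono)
      fix i
      have "H i ^ k = h ^ k * ((1/2) ^ i) ^ k" by (simp add: H_def power_divide)
      also have "((1/2::real) ^ i) ^ k \<le> ((1/2) ^ i) ^ 1" by (rule power_decreasing[OF that]) (auto simp: power_le_one)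
      finally show "H i ^ k \<le> h ^ k * (1/2) ^ i" using h by (simp add: mult_left_mono)
    qed
    also have "\<dots> = h ^ k * (\<Sum>i<n. (1/2) ^ i)" by (simp add: sum_distrib_left)
    also have "(\<Sum>i<n. (1/2::real) ^ i) = 2 - 2 * (1/2) ^ n" by (induction n) auto
    also have "h ^ k * (2 - 2 * (1/2) ^ n) \<le> h ^ k * 2" using h by (intro mult_left_mono) auto
    finally show ?thesis by simp
  qed
  define l where "l j = poly (pderiv (p j)) t" for j
  have lstep: "\<bar>l (Suc j) - l j\<bar> \<le> E * H j ^ (N - 1)" for j
    using d1[of t j] H(1)[of "Suc j"] by (simp add: l_def pderiv_diff)
  have ltail: "\<bar>l (k + n) - l k\<bar> \<le> 2 * E * H k ^ (N - 1)" for k n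
  proof -
    have "\<bar>l (k + n) - l k\<bar> \<le> (\<Sum>i<n. E * H (k + i) ^ (N - 1))"
    proof (induction n)
      case (Suc n) then show ?case using lstep[of "k + n"] by simp
    qed simp
    also have "\<dots> = E * (H k / h) ^ (N - 1) * (\<Sum>i<n. H i ^ (N - 1))"
    proof -
      have "H (k + i) = H k / h * H i" for i using h by (simp add: H_def power_add)
      then have "E * H (k + i) ^ (N - 1) = E * (H k / h) ^ (N - 1) * H i ^ (N - 1)" for i
        by (simp only: power_mult_distrib mult.assoc)
      then show ?thesis by (simp only: sum_distrib_left)
    qed
    also have "\<dots> \<le> E * (H k / h) ^ (N - 1) * (2 * h ^ (N - 1))"
      using E H(1)[of k] h N by (intro mult_left_mono sumH) auto
    also have "\<dots> = 2 * E * H k ^ (N - 1)" using h by (simp add: power_divide)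
    finally show ?thesis .
  qed
  have Hlim: "(\<lambda>k. 2 * E * H k ^ (N - 1)) \<longlonglongrightarrow> 0"
  proof -
    have "H \<longlonglongrightarrow> 0" unfolding H_def using LIMSEQ_divide_realpow_zero[of 2 h] by simp
    then have "(\<lambda>k. 2 * E * H k ^ (N - 1)) \<longlonglongrightarrow> 2 * E * 0 ^ (N - 1)" by (intro tendsto_intros)
    then show ?thesis using N by (simp add: zero_power)
  qed
  have "Cauchy l"
  proof (rule metric_CauchyI)
    fix e :: real assume "e > 0"
    then have "eventually (\<lambda>k. 2 * E * H k ^ (N - 1) < e / 2) sequentially"
      using order_tendstoD(2)[OF Hlim, of "e/2"] by simp
    then obtain k where k: "2 * E * H k ^ (N - 1) < e / 2" by (meson eventually_sequentially order_refl)
    show "\<exists>M. \<forall>m\<ge>M. \<forall>n\<ge>M. dist (l m) (l n) < e"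
    proof (intro exI[of _ k] allI impI)
      fix m n assume "k \<le> m" "k \<le> n"
      then show "dist (l m) (l n) < e"
        using ltail[of k "m - k"] ltail[of k "n - k"] k by (simp add: dist_real_def)
    qed
  qed
  then obtain L where L: "l \<longlonglongrightarrow> L" by (auto simp: Cauchy_convergent_iff convergent_def)
  have Lk: "\<bar>L - l k\<bar> \<le> 2 * E * H k ^ (N - 1)" for k
  proof (rule LIMSEQ_le_const2[where X = "\<lambda>n. \<bar>l (k + n) - l k\<bar>"])
    have "(\<lambda>n. l (n + k)) \<longlonglongrightarrow> L" using L by (rule LIMSEQ_ignore_initial_segment)
    then show "(\<lambda>n. \<bar>l (k + n) - l k\<bar>) \<longlonglongrightarrow> \<bar>L - l k\<bar>" by (intro tendsto_intros) (simp add: add.commute)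
  qed (use ltail in auto)
  obtain B0 where B0: "\<And>u. u \<in> cball t h \<Longrightarrow> \<bar>poly (pderiv (pderiv q)) u\<bar> \<le> B0"
  proof -
    have "compact ((\<lambda>u. \<bar>poly (pderiv (pderiv q)) u\<bar>) ` cball t h)"
      by (intro compact_continuous_image continuous_intros) auto
    then have "\<exists>b. \<forall>u\<in>cball t h. \<bar>poly (pderiv (pderiv q)) u\<bar> \<le> b"
      by (auto dest!: compact_imp_bounded simp: bounded_iff)
    then show ?thesis using that by blast
  qed
  define B where "B = B0 + 2 * K * E * (2 * h)"
  have B: "\<bar>poly (pderiv (pderiv (p j))) u\<bar> \<le> B" if "\<bar>u - t\<bar> \<le> H j" for j u
  proof -
    have "\<bar>poly (pderiv (pderiv (p j))) u\<bar> \<le> B0 + (\<Sum>i<j. 2 * K * E * H i)" if "\<bar>u - t\<bar> \<le> H j" for j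
      using that
    proof (induction j)
      case 0 then show ?case using B0[of u] by (simp add: p_def H_def dist_real_def abs_minus_commute)
    next
      case (Suc j)
      have "\<bar>poly (pderiv (pderiv (p j))) u\<bar> \<le> B0 + (\<Sum>i<j. 2 * K * E * H i)"
        using Suc H[of j] by simp
      then show ?case using d2[OF Suc.prems] by (simp add: pderiv_diff)
    qed
    also have "(\<Sum>i<j. 2 * K * E * H i) \<le> 2 * K * E * (2 * h)"
      using sumH[of 1 j] K E by (simp add: sum_distrib_left[symmetric])
    finally show ?thesis using that by (simp add: B_def)
  qed
  define Q where "Q = 16 * C + B + 8 * E"
  have quad: "\<bar>f u - f t - L * (u - t)\<bar> \<le> Q * (u - t)^2" if u: "\<bar>u - t\<bar> \<le> h" "u \<noteq> t" for u
  proof -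
    have "\<exists>j. H j < \<bar>u - t\<bar>"
    proof -
      have "H \<longlonglongrightarrow> 0" unfolding H_def using LIMSEQ_divide_realpow_zero[of 2 h] by simp
      then have "eventually (\<lambda>j. H j < \<bar>u - t\<bar>) sequentially" using u by (intro order_tendstoD(2)) auto
      then show ?thesis by (meson eventually_sequentially order_refl)
    qed
    \<comment> \<open>The last scale that still contains \<open>u\<close> is comparable to \<open>\<bar>u - t\<bar>\<close>.\<close>
    define j' where "j' = (LEAST j. H j < \<bar>u - t\<bar>)"
    have j': "H j' < \<bar>u - t\<bar>" unfolding j'_def using \<open>\<exists>j. H j < \<bar>u - t\<bar>\<close> by (rule LeastI_ex)
    have "j' \<noteq> 0" using j' u(1) by (cases "j' = 0") (auto simp: H_def)
    then obtain j where j: "j' = Suc j" by (cases j') auto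
    have 1: "\<bar>u - t\<bar> \<le> H j" using not_less_Least[of j "\<lambda>j. H j < \<bar>u - t\<bar>"] j unfolding j'_def by simp
    have 2: "H j \<le> 2 * \<bar>u - t\<bar>" using j' j H(4)[of j] by simp
    have HN: "H j ^ N \<le> 4 * (u - t)^2" "H j ^ (N - 1) * \<bar>u - t\<bar> \<le> 4 * (u - t)^2"
    proof -
      have "H j ^ N \<le> H j ^ 2" "H j ^ (N - 1) \<le> H j ^ 1" "H j ^ (N - 1) \<le> H j ^ 2"
        using power_decreasing[of 2 N "H j"] power_decreasing[of 1 "N - 1" "H j"]
          power_decreasing[of 2 "N - 1" "H j"] N H(1)[of j] H(3)[of j] by auto
      moreover have s: "H j ^ 2 \<le> (2 * \<bar>u - t\<bar>)^2" using 2 H(1)[of j] by (intro power_mono) auto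
      ultimately show "H j ^ N \<le> 4 * (u - t)^2" by simp
      have "H j ^ (N - 1) * \<bar>u - t\<bar> \<le> H j * \<bar>u - t\<bar>"
        using \<open>H j ^ (N - 1) \<le> H j ^ 1\<close> by (intro mult_right_mono) auto
      also have "\<dots> \<le> (2 * \<bar>u - t\<bar>) * \<bar>u - t\<bar>" using 2 by (intro mult_right_mono) auto
      also have "\<dots> \<le> 4 * (u - t)^2" by (simp add: power2_eq_square abs_mult_self_eq)
      finally show "H j ^ (N - 1) * \<bar>u - t\<bar> \<le> 4 * (u - t)^2" .
    qed
    have T: "\<bar>poly (p j) u - poly (p j) t - l j * (u - t)\<bar> \<le> B * (u - t)^2"
      unfolding l_def by (rule poly_Taylor2) (use 1 B in auto)
    have F: "\<bar>f u - poly (p j) u\<bar> \<le> C * H j ^ N" "\<bar>f t - poly (p j) t\<bar> \<le> C * H j ^ N"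
      using p(2)[OF 1] p(2)[of t j] H(1)[of j] by auto
    have CN: "C * H j ^ N \<le> C * (4 * (u - t)^2)" using HN(1) C by (intro mult_left_mono) auto
    have LL: "\<bar>(L - l j) * (u - t)\<bar> \<le> 8 * E * (u - t)^2"
    proof -
      have "\<bar>(L - l j) * (u - t)\<bar> \<le> 2 * E * H j ^ (N - 1) * \<bar>u - t\<bar>"
        unfolding abs_mult using Lk[of j] by (intro mult_right_mono) auto
      also have "\<dots> \<le> 2 * E * (4 * (u - t)^2)"
        using HN(2) E by (simp only: mult.assoc) (intro mult_left_mono, auto)
      finally show ?thesis by simp
    qed
    have "f u - f t - L * (u - t) = (f u - poly (p j) u) - (f t - poly (p j) t)
       + (poly (p j) u - poly (p j) t - l j * (u - t)) - (L - l j) * (u - t)" by (simp add: algebra_simps)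
    then have "\<bar>f u - f t - L * (u - t)\<bar> \<le> 8 * C * (u - t)^2 + B * (u - t)^2 + 8 * E * (u - t)^2"
      using F CN T LL by linarith
    also have "\<dots> \<le> Q * (u - t)^2"
      using C by (simp add: Q_def ring_distribs)
    finally show ?thesis .
  qed
  have "(f has_real_derivative L) (at t)"
    unfolding has_field_derivative_iff
  proof (rule Lim_transform_bound[where g = "\<lambda>u. Q * \<bar>u - t\<bar>" and f = "\<lambda>u. (f u - f t) / (u - t) - L", THEN LIM_zero_cancel])
    show "eventually (\<lambda>u. norm ((f u - f t) / (u - t) - L) \<le> norm (Q * \<bar>u - t\<bar>)) (at t)"
      unfolding eventually_at
    proof (intro exI[of _ h] conjI ballI impI)
      fix u assume u: "u \<noteq> t \<and> dist u t < h"
      have "\<bar>(f u - f t) / (u - t) - L\<bar> = \<bar>f u - f t - L * (u - t)\<bar> / \<bar>u - t\<bar>"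
        using u by (simp add: abs_divide[symmetric] diff_divide_distrib del: abs_divide)
      also have "\<dots> \<le> Q * (u - t)^2 / \<bar>u - t\<bar>" using quad[of u] u by (intro divide_right_mono) (auto simp: dist_real_def)
      also have "\<dots> = Q * \<bar>u - t\<bar>"
      proof -
        have "(u - t)^2 = \<bar>u - t\<bar> * \<bar>u - t\<bar>" by (simp add: power2_eq_square abs_mult_self_eq)
        then show ?thesis using u by (simp del: abs_mult_self_eq)
      qed
      finally show "norm ((f u - f t) / (u - t) - L) \<le> norm (Q * \<bar>u - t\<bar>)" by simp
    qed (use h in auto)
    have "((\<lambda>u. Q * \<bar>u - t\<bar>) \<longlongrightarrow> Q * \<bar>t - t\<bar>) (at t)" by (intro tendsto_intros)
    then show "((\<lambda>u. Q * \<bar>u - t\<bar>) \<longlongrightarrow> 0) (at t)" by simp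
  qed
  moreover have "\<bar>L - poly (pderiv q) t\<bar> \<le> 8 * K * C * h ^ (N - 1)"
    using Lk[of 0] by (simp add: l_def p_def H_def E_def)
  ultimately show ?thesis by blast
qed

text \<open>
  Three orders of approximation are spent: the polynomials for order \<open>N + 3\<close> have derivatives that approximate \<open>f'\<close> to order \<open>N\<close>.
\<close>

lemma poly_approximable_derivative:
  assumes f: "poly_approximable f S" and S: "open S"
  obtains f' where "\<And>s. s \<in> S \<Longrightarrow> (f has_real_derivative f' s) (at s)" "poly_approximable f' S"
proof -
  have key: "\<exists>C D h0 m. C > 0 \<and> h0 > 0 \<and> m \<ge> 1 \<and>
     (\<forall>s h. 0 < h \<longrightarrow> h \<le> h0 \<longrightarrow> cball s (m * h) \<subseteq> S \<longrightarrow>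
        (\<exists>q. degree q \<le> D \<and> (\<forall>t. \<bar>t - s\<bar> \<le> h \<longrightarrow>
            (\<exists>L. (f has_real_derivative L) (at t) \<and> \<bar>L - poly q t\<bar> \<le> C * h ^ N))))" for N
  proof -
    obtain C D h0 m where c: "C > 0" "h0 > 0" "m \<ge> 1" and
      apx: "\<And>s h. 0 < h \<Longrightarrow> h \<le> h0 \<Longrightarrow> cball s (m * h) \<subseteq> S \<Longrightarrow>
        (\<exists>q. degree q \<le> D \<and> (\<forall>t. \<bar>t - s\<bar> \<le> h \<longrightarrow> \<bar>f t - poly q t\<bar> \<le> C * h ^ (N + 3)))"
      using f[unfolded poly_approximable_def, rule_format, of "N + 3"] by blast
    obtain K where K: "K > 0" "\<And>(q :: real poly) s h \<epsilon> t. degree q \<le> D \<Longrightarrow> h > 0 \<Longrightarrow> \<epsilon> > 0 \<Longrightarrow>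
     (\<And>t. \<bar>t - s\<bar> \<le> h \<Longrightarrow> \<bar>poly q t\<bar> \<le> \<epsilon>) \<Longrightarrow> \<bar>t - s\<bar> \<le> h \<Longrightarrow> \<bar>poly (pderiv q) t\<bar> \<le> K * \<epsilon> / h"
      by (rule Markov_inequality[of D]) blast
    \<comment> \<open>The polynomial is taken on an interval of radius \<open>2 h\<close>, which contains the intervals of radius \<open>h\<close> around all relevant \<open>t\<close>.\<close>
    define C1 where "C1 = C * 2 ^ (N + 3)"
    have C1: "C1 > 0" "C \<le> C1"
    proof -
      show "C1 > 0" using c by (simp add: C1_def)
      have "C * 1 \<le> C * 2 ^ (N + 3)" using c by (intro mult_left_mono one_le_power) auto
      then show "C \<le> C1" by (simp add: C1_def)
    qed
    show ?thesis
    proof (rule exI[of _ "8 * K * C1"], rule exI[of _ D], rule exI[of _ "min (h0 / 2) (1/2)"], rule exI[of _ "2 * m"],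
        intro conjI allI impI)
      fix s h assume h: "0 < h" "h \<le> min (h0 / 2) (1/2)" and sub: "cball s (2 * m * h) \<subseteq> S"
      obtain q where q: "degree q \<le> D" "\<And>t. \<bar>t - s\<bar> \<le> 2 * h \<Longrightarrow> \<bar>f t - poly q t\<bar> \<le> C * (2 * h) ^ (N + 3)"
        using apx[of "2 * h" s] h sub by (auto simp: mult_ac)
      show "\<exists>q. degree q \<le> D \<and> (\<forall>t. \<bar>t - s\<bar> \<le> h \<longrightarrow>
            (\<exists>L. (f has_real_derivative L) (at t) \<and> \<bar>L - poly q t\<bar> \<le> 8 * K * C1 * h ^ N))"
      proof (intro exI[of _ "pderiv q"] conjI allI impI)
        show "degree (pderiv q) \<le> D" using q by (simp add: degree_pderiv)
        fix t assume t: "\<bar>t - s\<bar> \<le> h"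
        have "\<exists>L. (f has_real_derivative L) (at t) \<and> \<bar>L - poly (pderiv q) t\<bar> \<le> 8 * K * C1 * h ^ (N + 3 - 1)"
        proof (rule approx_derivative[OF K _ C1(1) h(1), where D = D])
          show "h \<le> 1" using h by simp
          show "degree q \<le> D" by (rule q)
          show "\<bar>f u - poly q u\<bar> \<le> C1 * h ^ (N + 3)" if "\<bar>u - t\<bar> \<le> h" for u
            using q(2)[of u] that t by (simp add: C1_def power_mult_distrib power_add mult_ac)
          fix h' assume h': "0 < h'" "h' \<le> h"
          have "cball t (m * h') \<subseteq> cball s (2 * m * h)"
          proof
            fix x assume x: "x \<in> cball t (m * h')"
            have "m * h' \<le> m * h" "1 * h \<le> m * h" using h' c h by (auto intro: mult_mono)
            then show "x \<in> cball s (2 * m * h)" using x t by (auto simp: dist_real_def)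
          qed
          then obtain q' where q': "degree q' \<le> D" "\<And>u. \<bar>u - t\<bar> \<le> h' \<Longrightarrow> \<bar>f u - poly q' u\<bar> \<le> C * h' ^ (N + 3)"
            using apx[of h' t] h' h sub by auto
          have "C * h' ^ (N + 3) \<le> C1 * h' ^ (N + 3)" using C1 h' by (intro mult_right_mono) auto
          then show "\<exists>q. degree q \<le> D \<and> (\<forall>u. \<bar>u - t\<bar> \<le> h' \<longrightarrow> \<bar>f u - poly q u\<bar> \<le> C1 * h' ^ (N + 3))"
            using q' by (meson order_trans)
        qed auto
        moreover have "8 * K * C1 * h ^ (N + 3 - 1) \<le> 8 * K * C1 * h ^ N"
          using K C1 h by (intro mult_left_mono power_decreasing) auto
        ultimately show "\<exists>L. (f has_real_derivative L) (at t) \<and> \<bar>L - poly (pderiv q) t\<bar> \<le> 8 * K * C1 * h ^ N"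
          by (meson order_trans)
      qed
    qed (use K C1 c in auto)
  qed
  have diff: "\<exists>L. (f has_real_derivative L) (at s)" if s: "s \<in> S" for s
  proof -
    obtain C D h0 m where c: "C > 0" "h0 > 0" "m \<ge> 1" and
      b: "\<And>s h. 0 < h \<Longrightarrow> h \<le> h0 \<Longrightarrow> cball s (m * h) \<subseteq> S \<Longrightarrow>
        (\<exists>q. degree q \<le> D \<and> (\<forall>t. \<bar>t - s\<bar> \<le> h \<longrightarrow>
            (\<exists>L. (f has_real_derivative L) (at t) \<and> \<bar>L - poly q t\<bar> \<le> C * h ^ 0)))"
      using key[of 0] by blast
    obtain e where e: "e > 0" "cball s e \<subseteq> S" using S s open_contains_cball by blast
    define h where "h = min h0 (e / m)"
    have "0 < h" "h \<le> h0" "m * h \<le> e" using c e by (auto simp: h_def min_def field_simps)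
    moreover have "cball s (m * h) \<subseteq> S" using \<open>m * h \<le> e\<close> e by (auto simp: subset_iff)
    ultimately obtain q where "\<forall>t. \<bar>t - s\<bar> \<le> h \<longrightarrow> (\<exists>L. (f has_real_derivative L) (at t) \<and> \<bar>L - poly q t\<bar> \<le> C * h ^ 0)"
      using b[of h s] by blast
    moreover have "\<bar>s - s\<bar> \<le> h" using \<open>0 < h\<close> by simp
    ultimately show ?thesis by blast
  qed
  define f' where "f' = deriv f"
  have f': "(f has_real_derivative f' s) (at s)" if "s \<in> S" for s
    using diff[OF that] unfolding f'_def by (metis DERIV_imp_deriv)
  have f'u: "L = f' s" if "(f has_real_derivative L) (at s)" for L s
    using DERIV_imp_deriv[OF that] by (simp add: f'_def)
  have "poly_approximable f' S"
    unfolding poly_approximable_def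
  proof
    fix N
    show "\<exists>C D h0 m. C > 0 \<and> h0 > 0 \<and> m \<ge> 1 \<and>
     (\<forall>s h. 0 < h \<longrightarrow> h \<le> h0 \<longrightarrow> cball s (m * h) \<subseteq> S \<longrightarrow>
        (\<exists>q. degree q \<le> D \<and> (\<forall>t. \<bar>t - s\<bar> \<le> h \<longrightarrow> \<bar>f' t - poly q t\<bar> \<le> C * h ^ N)))"
    proof -
      obtain C D h0 m where c: "C > 0" "h0 > 0" "m \<ge> 1" and
        b: "\<And>s h. 0 < h \<Longrightarrow> h \<le> h0 \<Longrightarrow> cball s (m * h) \<subseteq> S \<Longrightarrow>
          (\<exists>q. degree q \<le> D \<and> (\<forall>t. \<bar>t - s\<bar> \<le> h \<longrightarrow>
            (\<exists>L. (f has_real_derivative L) (at t) \<and> \<bar>L - poly q t\<bar> \<le> C * h ^ N)))"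
        using key[of N] by blast
      show ?thesis
      proof (rule exI[of _ C], rule exI[of _ D], rule exI[of _ h0], rule exI[of _ m], intro conjI allI impI c)
        fix s h assume "0 < h" "h \<le> h0" "cball s (m * h) \<subseteq> S"
        then obtain q where "degree q \<le> D" "\<And>t. \<bar>t - s\<bar> \<le> h \<Longrightarrow>
            (\<exists>L. (f has_real_derivative L) (at t) \<and> \<bar>L - poly q t\<bar> \<le> C * h ^ N)" using b by blast
        then show "\<exists>q. degree q \<le> D \<and> (\<forall>t. \<bar>t - s\<bar> \<le> h \<longrightarrow> \<bar>f' t - poly q t\<bar> \<le> C * h ^ N)"
          using f'u by blast
      qed
    qed
  qed
  with f' show ?thesis using that by blast
qed

theorem poly_approximable_imp_smooth_on:
  assumes "poly_approximable f S" "open S"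
  shows "smooth_on f S"
  unfolding smooth_on_def
proof
  fix k show "Ck_on k f S"
    using assms(1)
  proof (induction k arbitrary: f)
    case 0
    from poly_approximable_derivative[OF 0 assms(2)]
    obtain f' where "\<And>s. s \<in> S \<Longrightarrow> (f has_real_derivative f' s) (at s)" by blast
    then show ?case by (auto intro!: continuous_at_imp_continuous_on DERIV_isCont)
  next
    case (Suc k)
    from poly_approximable_derivative[OF Suc.prems assms(2)]
    obtain f' where f': "\<And>s. s \<in> S \<Longrightarrow> (f has_real_derivative f' s) (at s)" "poly_approximable f' S"
      by blast
    show ?case
    proof (rule Ck_on_SucI[OF assms(2)])
      show "(f has_derivative (*) (f' x)) (at x)" if "x \<in> S" for x
        using f'(1)[OF that] by (simp add: has_field_derivative_def)
      show "Ck_on k (\<lambda>x. f' x * v) S" for v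
        by (rule Ck_on_bilinear[OF assms(2) bounded_bilinear_mult Suc.IH[OF f'(2)] Ck_on_const[OF assms(2)]])
    qed
  qed
qed

section \<open>Complex heights and almost holomorphic lifts\<close>

lemma lterm_has_vector_derivative:
  fixes M :: "nat \<Rightarrow> real \<Rightarrow> complex^2^2" and M' :: "nat \<Rightarrow> complex^2^2"
  assumes M: "\<And>j i k. j \<le> n \<Longrightarrow> ((\<lambda>z. M j z $ i $ k) has_vector_derivative (M' j $ i $ k)) (at z within S)"
    and e: "((\<lambda>z. e n z) has_vector_derivative (e' n)) (at z within S)"
    and a: "\<And>j. j \<le> n \<Longrightarrow> adm 1 q (M j z) (e j z)" and q: "q < 1"
  shows "((\<lambda>z. lterm (\<lambda>j. M j z) (\<lambda>j. e j z) n) has_vector_derivative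
    dlterm (\<lambda>j. M j z) M' (\<lambda>j. e j z) e' n) (at z within S)"
proof -
  have "((\<lambda>z. lterm (\<lambda>j. M j z) (\<lambda>j. e j z) n) has_derivative
    (\<lambda>h. dlterm (\<lambda>j. M j z) (\<lambda>j. \<chi> i k. of_real h * M' j $ i $ k) (\<lambda>j. e j z) (\<lambda>j. of_real h * e' j) n)) (at z within S)"
    by (rule lterm_has_derivative[where M' = "\<lambda>j h. \<chi> i k. of_real h * M' j $ i $ k"
          and e' = "\<lambda>j h. of_real h * e' j" and q = q, OF _ _ _ q])
      (use M e a in \<open>auto simp: has_vector_derivative_def scaleR_conv_of_real\<close>)
  moreover have "dlterm N (\<lambda>j. \<chi> i k. of_real h * M' j $ i $ k) E (\<lambda>j. of_real h * e' j) n = h *\<^sub>R dlterm N M' E e' n" for h N E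
    using dlterm_linear[of n "\<lambda>j. \<chi> i k. of_real h * M' j $ i $ k" "\<lambda>j. 0" "of_real h" M' "\<lambda>j. of_real h * e' j" "\<lambda>j. 0" e' N E]
      dlterm_linear[of n "\<lambda>j. 0" "\<lambda>j. 0" "-1" "\<lambda>j. 0" "\<lambda>j. 0" "\<lambda>j. 0" "\<lambda>j. 0" N E] by (simp add: scaleR_conv_of_real)
  ultimately show ?thesis by (simp add: has_vector_derivative_def)
qed

text \<open>
  If \<open>f k\<close> is the \<open>k\<close>-th derivative of \<open>f 0\<close> along \<open>w\<close>, this is the Taylor polynomial that stands for the value of \<open>f 0\<close> at \<open>x + i \<eta> w\<close>.
\<close>

definition lift_sum :: "nat \<Rightarrow> (nat \<Rightarrow> 'x \<Rightarrow> complex) \<Rightarrow> real \<Rightarrow> 'x \<Rightarrow> complex" where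
  "lift_sum N f \<eta> x = (\<Sum>k<N. (\<i> * of_real \<eta>) ^ k / fact k * f k x)"

definition lift_mat :: "nat \<Rightarrow> (nat \<Rightarrow> 'x \<Rightarrow> complex^2^2) \<Rightarrow> real \<Rightarrow> 'x \<Rightarrow> complex^2^2" where
  "lift_mat N P \<eta> x = (\<chi> i j. lift_sum N (\<lambda>k x. P k x $ i $ j) \<eta> x)"

text \<open>
  The lift is almost holomorphic: its derivative in the height is \<open>i\<close> times the lift of the derivatives along \<open>w\<close>,
  up to the single term of top order \<open>\<eta>\<^sup>n\<close>.
\<close>

lemma lift_sum_has_vector_derivative_height:
  "((\<lambda>\<eta>. lift_sum (Suc n) f \<eta> x) has_vector_derivative
     (- \<i> * (\<i> * of_real \<eta>) ^ n / fact n * f (Suc n) x + \<i> * lift_sum (Suc n) (\<lambda>k. f (Suc k)) \<eta> x)) (at \<eta> within S)"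
proof -
  have 1: "((\<lambda>\<eta>. (\<i> * of_real \<eta>) ^ k / fact k * c) has_vector_derivative
      (of_nat k * (\<i> * of_real \<eta>) ^ (k - 1) * \<i> / fact k * c)) (at \<eta> within S)" for k and c :: complex
  proof -
    have "((\<lambda>z. (\<i> * z) ^ k / fact k * c) has_field_derivative
      (of_nat k * (\<i> * of_real \<eta>) ^ (k - 1) * \<i> / fact k * c)) (at (of_real \<eta>) within of_real ` S)"
      by (auto intro!: derivative_eq_intros)
    from field_vector_diff_chain_within[OF has_vector_derivative_of_real[OF DERIV_ident] this]
    show ?thesis by (simp add: o_def)
  qed
  have "((\<lambda>\<eta>. lift_sum (Suc n) f \<eta> x) has_vector_derivative
     (\<Sum>k<Suc n. of_nat k * (\<i> * of_real \<eta>) ^ (k - 1) * \<i> / fact k * f k x)) (at \<eta> within S)"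
    unfolding lift_sum_def by (intro has_vector_derivative_sum 1)
  also have "(\<Sum>k<Suc n. of_nat k * (\<i> * of_real \<eta>) ^ (k - 1) * \<i> / fact k * f k x)
     = (\<Sum>k<n. \<i> * ((\<i> * of_real \<eta>) ^ k / fact k * f (Suc k) x))"
    by (subst sum.lessThan_Suc_shift) (auto simp: field_simps simp del: of_nat_Suc intro!: sum.cong)
  also have "\<dots> = - \<i> * (\<i> * of_real \<eta>) ^ n / fact n * f (Suc n) x + \<i> * lift_sum (Suc n) (\<lambda>k. f (Suc k)) \<eta> x"
    by (simp add: lift_sum_def sum_distrib_left algebra_simps)
  finally show ?thesis .
qed

lemma lift_sum_has_vector_derivative_base:
  assumes "\<And>k. k < N \<Longrightarrow> ((\<lambda>t. f k (g t)) has_vector_derivative f (Suc k) (g t)) (at t within S)"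
  shows "((\<lambda>t. lift_sum N f \<eta> (g t)) has_vector_derivative lift_sum N (\<lambda>k. f (Suc k)) \<eta> (g t)) (at t within S)"
  unfolding lift_sum_def
  by (intro has_vector_derivative_sum has_vector_derivative_mult_right assms) auto

lemma lift_sum_continuous_on:
  fixes f :: "nat \<Rightarrow> 'x::topological_space \<Rightarrow> complex" and h :: "'y::topological_space \<Rightarrow> real"
  assumes "\<And>k. k < N \<Longrightarrow> continuous_on UNIV (f k)" "continuous_on S h" "continuous_on S g"
  shows "continuous_on S (\<lambda>y. lift_sum N f (h y) (g y))"
  unfolding lift_sum_def
  by (intro continuous_intros continuous_on_compose2[OF assms(1) assms(3)] assms(2)) auto

lemma integral_unit_cube_bound:
  fixes f :: "real^'d \<Rightarrow> complex"
  assumes "continuous_on (cbox 0 One) f" "\<And>x. x \<in> cbox 0 One \<Longrightarrow> norm (f x) \<le> B"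
  shows "norm (integral (cbox 0 One) f) \<le> B"
proof -
  have "(0::real^'d) \<in> cbox 0 One" by (auto simp: mem_box)
  then have "0 \<le> B" using assms(2) norm_ge_zero order_trans by blast
  moreover have "(f has_integral integral (cbox 0 One) f) (cbox 0 One)"
    using assms(1) integrable_continuous integrable_integral by blast
  ultimately have "norm (integral (cbox 0 One) f) \<le> B * measure lborel (cbox 0 (One :: real^'d))"
    using assms(2) by (intro has_integral_bound) auto
  also have "measure lborel (cbox 0 (One :: real^'d)) = 1" by (simp add: content_cbox_if mem_box)
  finally show ?thesis by simp
qed

text \<open>
  For a truly holomorphic lift, \<open>U\<close> would be constant in the height, as the integral of a holomorphic function over horizontal tori. Here the derivative of \<open>U\<close> splits,
  by linearity of \<open>dlterm\<close>, into \<open>i\<close> times the integral of a derivative along \<open>w\<close>, which is \<open>0\<close> by translation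
  invariance, and the contribution of the top-order terms. These are of size \<open>\<eta>\<^sup>N\<close>, and the chain is robust at scale \<open>c \<eta>\<close>,
  so \<open>dlterm_bound\<close> yields \<open>O(\<eta>\<^bsup>N-1\<^esup>)\<close> for the derivative, uniformly in the length \<open>n\<close>.
\<close>

proposition height_independence:
  fixes P :: "nat \<Rightarrow> real^'d \<Rightarrow> complex^2^2" and E :: "nat \<Rightarrow> real^'d \<Rightarrow> complex"
    and \<alpha> w :: "real^'d" and n N :: nat
  assumes contP: "\<And>k i j. k \<le> Suc N \<Longrightarrow> continuous_on UNIV (\<lambda>x. P k x $ i $ j)"
    and contE: "\<And>k. k \<le> Suc N \<Longrightarrow> continuous_on UNIV (E k)"
    and perP: "\<And>k. k \<le> Suc N \<Longrightarrow> torus_map (P k)" and perE: "\<And>k. k \<le> Suc N \<Longrightarrow> torus_map (E k)"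
    and dP: "\<And>k i j x t. k \<le> N \<Longrightarrow> ((\<lambda>t. P k (x + t *\<^sub>R w) $ i $ j) has_vector_derivative P (Suc k) (x + t *\<^sub>R w) $ i $ j) (at t)"
    and dE: "\<And>k x t. k \<le> N \<Longrightarrow> ((\<lambda>t. E k (x + t *\<^sub>R w)) has_vector_derivative E (Suc k) (x + t *\<^sub>R w)) (at t)"
    and bP: "\<And>x i j. cmod (P (Suc N) x $ i $ j) \<le> B" and bE: "\<And>x. cmod (E (Suc N) x) \<le> B"
    and a: "\<And>\<eta> x. 0 \<le> \<eta> \<Longrightarrow> \<eta> \<le> \<eta>0 \<Longrightarrow> adm 1 q (lift_mat (Suc N) P \<eta> x) (lift_sum (Suc N) E \<eta> x)"
    and rob: "\<And>\<eta> x. 0 < \<eta> \<Longrightarrow> \<eta> \<le> \<eta>0 \<Longrightarrow> robust (c * \<eta>) q (lift_mat (Suc N) P \<eta> x) (lift_sum (Suc N) E \<eta> x)"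
    and N: "N \<ge> 1" and c: "c > 0" and q: "0 \<le> q" "q < 1" and B: "B > 0" and \<eta>: "0 < \<eta>" "\<eta> \<le> \<eta>0"
  defines "U \<equiv> \<lambda>\<eta>. integral (cbox 0 One) (\<lambda>x. lterm (\<lambda>j. lift_mat (Suc N) P \<eta> (x + real j *\<^sub>R \<alpha>))
        (\<lambda>j. lift_sum (Suc N) E \<eta> (x + real j *\<^sub>R \<alpha>)) n)"
  shows "cmod (U \<eta> - U 0) \<le> 2 * lbound q * B / c * \<eta> ^ N"
proof -
  let ?M = "\<lambda>\<eta> x j. lift_mat (Suc N) P \<eta> (x + real j *\<^sub>R \<alpha>)"
  let ?e = "\<lambda>\<eta> x j. lift_sum (Suc N) E \<eta> (x + real j *\<^sub>R \<alpha>)"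
  let ?F = "\<lambda>\<eta> x. lterm (?M \<eta> x) (?e \<eta> x) n"
  let ?Mt = "\<lambda>\<eta> x j. lift_mat (Suc N) (\<lambda>k. P (Suc k)) \<eta> (x + real j *\<^sub>R \<alpha>)"
  let ?et = "\<lambda>\<eta> x j. lift_sum (Suc N) (\<lambda>k. E (Suc k)) \<eta> (x + real j *\<^sub>R \<alpha>)"
  let ?r = "\<lambda>\<eta>. - \<i> * (\<i> * of_real \<eta>) ^ N / fact N"
  let ?Md = "\<lambda>\<eta> x j. (\<chi> i k. ?r \<eta> * P (Suc N) (x + real j *\<^sub>R \<alpha>) $ i $ k) :: complex^2^2"
  let ?ed = "\<lambda>\<eta> x j. ?r \<eta> * E (Suc N) (x + real j *\<^sub>R \<alpha>)"
  let ?Mh = "\<lambda>\<eta> x j. (\<chi> i k. ?Md \<eta> x j $ i $ k + \<i> * ?Mt \<eta> x j $ i $ k) :: complex^2^2"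
  let ?eh = "\<lambda>\<eta> x j. ?ed \<eta> x j + \<i> * ?et \<eta> x j"
  let ?D = "\<lambda>M' e' \<eta> x. dlterm (?M \<eta> x) (M' \<eta> x) (?e \<eta> x) (e' \<eta> x) n"
  let ?Q = "cbox 0 One :: (real^'d) set"
  have cM: "continuous_on S (\<lambda>y. ?M (h y) (g y) j $ i $ k)" if "continuous_on S h" "continuous_on S g"
    for S :: "'y::topological_space set" and h g i k j
    unfolding lift_mat_def vec_lambda_beta
    by (rule lift_sum_continuous_on) (use that contP in \<open>auto intro!: continuous_intros\<close>)
  have cMt: "continuous_on S (\<lambda>y. ?Mt (h y) (g y) j $ i $ k)" if "continuous_on S h" "continuous_on S g"
    for S :: "'y::topological_space set" and h g i k j
    unfolding lift_mat_def vec_lambda_beta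
    by (rule lift_sum_continuous_on) (use that contP in \<open>auto intro!: continuous_intros\<close>)
  have ce: "continuous_on S (\<lambda>y. ?e (h y) (g y) j)" if "continuous_on S h" "continuous_on S g"
    for S :: "'y::topological_space set" and h g j
    by (rule lift_sum_continuous_on) (use that contE in \<open>auto intro!: continuous_intros\<close>)
  have cet: "continuous_on S (\<lambda>y. ?et (h y) (g y) j)" if "continuous_on S h" "continuous_on S g"
    for S :: "'y::topological_space set" and h g j
    by (rule lift_sum_continuous_on) (use that contE in \<open>auto intro!: continuous_intros\<close>)
  have cMd: "continuous_on S (\<lambda>y. ?Md (h y) (g y) j $ i $ k)" if "continuous_on S h" "continuous_on S g"
    for S :: "'y::topological_space set" and h g i k j
    unfolding vec_lambda_beta
    by (intro continuous_intros continuous_on_compose2[OF contP[OF order_refl]] that) auto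
  have ced: "continuous_on S (\<lambda>y. ?ed (h y) (g y) j)" if "continuous_on S h" "continuous_on S g"
    for S :: "'y::topological_space set" and h g j
    by (intro continuous_intros continuous_on_compose2[OF contE[OF order_refl]] that) auto
  have cMh: "continuous_on S (\<lambda>y. ?Mh (h y) (g y) j $ i $ k)" if "continuous_on S h" "continuous_on S g"
    for S :: "'y::topological_space set" and h g i k j
    unfolding vec_lambda_beta[of "\<lambda>i. \<chi> k. ?Md _ _ _ $ i $ k + _ i k"] vec_lambda_beta[of "\<lambda>k. ?Md _ _ _ $ _ $ k + _ k"]
    using continuous_on_add[OF cMd[OF that, of j i k] continuous_on_mult[OF continuous_on_const cMt[OF that, of j i k]], of \<i>]
    by simp
  have ceh: "continuous_on S (\<lambda>y. ?eh (h y) (g y) j)" if "continuous_on S h" "continuous_on S g"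
    for S :: "'y::topological_space set" and h g j
    by (intro continuous_on_add continuous_on_mult continuous_on_const cet that ced)
  have cF: "continuous_on S (\<lambda>y. ?F (h y) (g y))" if "continuous_on S h" "continuous_on S g" "\<And>y. y \<in> S \<Longrightarrow> h y \<in> {0..\<eta>0}"
    for S :: "'y::topological_space set" and h g
  proof (rule adm_lterm_continuous_on[where q = q])
    show "continuous_on S (\<lambda>y. ?M (h y) (g y) j $ i $ k)" for j i k by (rule cM[OF that(1,2)])
    show "continuous_on S (\<lambda>y. ?e (h y) (g y) n)" by (rule ce[OF that(1,2)])
    show "adm 1 q (?M (h y) (g y) j) (?e (h y) (g y) j)" if "y \<in> S" for j y
      using that(1) \<open>\<And>y. y \<in> S \<Longrightarrow> h y \<in> {0..\<eta>0}\<close> by (intro a) auto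
  qed (rule q)
  have cD: "continuous_on S (\<lambda>y. ?D M' e' (h y) (g y))"
    if "continuous_on S h" "continuous_on S g" "\<And>y. y \<in> S \<Longrightarrow> h y \<in> {0..\<eta>0}"
      "\<And>j i k. continuous_on S (\<lambda>y. M' (h y) (g y) j $ i $ k)" "continuous_on S (\<lambda>y. e' (h y) (g y) n)"
    for S :: "'y::topological_space set" and h g and M' :: "real \<Rightarrow> real^'d \<Rightarrow> nat \<Rightarrow> complex^2^2" and e'
  proof (rule adm_dlterm_continuous_on[where q = q])
    show "continuous_on S (\<lambda>y. ?M (h y) (g y) j $ i $ k)" for j i k by (rule cM[OF that(1,2)])
    show "continuous_on S (\<lambda>y. M' (h y) (g y) j $ i $ k)" for j i k by (rule that(4))
    show "continuous_on S (\<lambda>y. ?e (h y) (g y) n)" by (rule ce[OF that(1,2)])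
    show "continuous_on S (\<lambda>y. e' (h y) (g y) n)" by (rule that(5))
    show "adm 1 q (?M (h y) (g y) j) (?e (h y) (g y) j)" if "y \<in> S" for j y
      using that(1) \<open>\<And>y. y \<in> S \<Longrightarrow> h y \<in> {0..\<eta>0}\<close> by (intro a) auto
  qed (rule q)
  have prj: "continuous_on S fst" "continuous_on S snd" for S :: "(real \<times> (real^'d)) set"
    by (auto intro: continuous_intros)
  have dU: "(U has_vector_derivative integral ?Q (?D ?Mh ?eh u)) (at u within {0<..\<eta>0})" if u: "u \<in> {0<..\<eta>0}" for u
    unfolding U_def
  proof (rule leibniz_rule_vector_derivative[OF _ _ _ u])
    fix v x assume v: "v \<in> {0<..\<eta>0}" and "x \<in> ?Q"
    show "((\<lambda>v. ?F v x) has_vector_derivative ?D ?Mh ?eh v x) (at v within {0<..\<eta>0})"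
    proof (rule lterm_has_vector_derivative[OF _ _ _ q(2)])
      show "((\<lambda>v. ?M v x j $ i $ k) has_vector_derivative ?Mh v x j $ i $ k) (at v within {0<..\<eta>0})" for i j k
        using lift_sum_has_vector_derivative_height[of N "\<lambda>l y. P l y $ i $ k" "x + real j *\<^sub>R \<alpha>" v]
        unfolding lift_mat_def by simp
      show "((\<lambda>v. ?e v x n) has_vector_derivative ?eh v x n) (at v within {0<..\<eta>0})"
        using lift_sum_has_vector_derivative_height[of N E "x + real n *\<^sub>R \<alpha>" v] by simp
    qed (use v a in auto)
  next
    show "?F v integrable_on ?Q" if "v \<in> {0<..\<eta>0}" for v
      by (intro integrable_continuous cF[of _ "\<lambda>_. v" "\<lambda>x. x"]) (use that in auto)
    have "continuous_on ({0<..\<eta>0} \<times> ?Q) (\<lambda>y. ?D ?Mh ?eh (fst y) (snd y))"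
      by (intro cD cMh ceh prj) auto
    then show "continuous_on ({0<..\<eta>0} \<times> ?Q) (\<lambda>(v, x). ?D ?Mh ?eh v x)" by (simp add: case_prod_unfold)
  qed auto
  \<comment> \<open>The integral of the derivative along \<open>w\<close>: differentiate the constant function \<open>t \<mapsto> \<integral> F(x + t w) dx\<close>.\<close>
  have D0: "integral ?Q (?D ?Mt ?et u) = 0" if u: "u \<in> {0<..\<eta>0}" for u
  proof -
    have sh: "x + t *\<^sub>R w + real j *\<^sub>R \<alpha> = (x + real j *\<^sub>R \<alpha>) + t *\<^sub>R w" for x t j
      by (simp add: add_ac)
    have "((\<lambda>t. integral ?Q (\<lambda>x. ?F u (x + t *\<^sub>R w))) has_vector_derivative integral ?Q (\<lambda>x. ?D ?Mt ?et u (x + 0 *\<^sub>R w))) (at 0 within UNIV)"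
    proof (rule leibniz_rule_vector_derivative)
      fix t x
      show "((\<lambda>t. ?F u (x + t *\<^sub>R w)) has_vector_derivative ?D ?Mt ?et u (x + t *\<^sub>R w)) (at t within UNIV)"
      proof (rule lterm_has_vector_derivative[OF _ _ _ q(2)])
        show "((\<lambda>t. ?M u (x + t *\<^sub>R w) j $ i $ k) has_vector_derivative ?Mt u (x + t *\<^sub>R w) j $ i $ k) (at t within UNIV)" for i j k
          unfolding lift_mat_def vec_lambda_beta sh
          by (rule lift_sum_has_vector_derivative_base[of "Suc N" "\<lambda>l y. P l y $ i $ k"]) (use dP in auto)
        show "((\<lambda>t. ?e u (x + t *\<^sub>R w) n) has_vector_derivative ?et u (x + t *\<^sub>R w) n) (at t within UNIV)"
          unfolding sh by (rule lift_sum_has_vector_derivative_base) (use dE in auto)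
      qed (use u a in auto)
    next
      show "(\<lambda>x. ?F u (x + t *\<^sub>R w)) integrable_on ?Q" for t
        by (intro integrable_continuous cF[of _ "\<lambda>_. u" "\<lambda>x. x + t *\<^sub>R w"])
          (use u in \<open>auto intro!: continuous_intros\<close>)
      have "continuous_on (UNIV \<times> ?Q) (\<lambda>y. ?D ?Mt ?et u (snd y + fst y *\<^sub>R w))"
        by (intro cD[of _ "\<lambda>_. u"] cMt[of _ "\<lambda>_. u"] cet[of _ "\<lambda>_. u"] continuous_intros) (use u in auto)
      then show "continuous_on (UNIV \<times> ?Q) (\<lambda>(t, x). ?D ?Mt ?et u (x + t *\<^sub>R w))" by (simp add: case_prod_unfold)
    qed auto
    moreover have "integral ?Q (\<lambda>x. ?F u (x + t *\<^sub>R w)) = integral ?Q (?F u)" for t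
    proof (rule integral_torus_shift)
      show "continuous_on UNIV (?F u)"
        by (rule cF[of _ "\<lambda>_. u" "\<lambda>x. x"]) (use u in auto)
      have "?M u (x + v) j = ?M u x j" "?e u (x + v) j = ?e u x j" if "v = (\<chi> i. of_int (k $ i))" for x v j and k :: "int^'d"
      proof -
        have sh: "x + v + y = (x + y) + v" for y by (simp add: add_ac)
        show "?M u (x + v) j = ?M u x j" using perP that
          unfolding sh lift_mat_def lift_sum_def torus_map_def by (simp add: less_Suc_eq_le)
        show "?e u (x + v) j = ?e u x j" using perE that
          unfolding sh lift_sum_def torus_map_def by (simp add: less_Suc_eq_le)
      qed
      then show "torus_map (?F u)" unfolding torus_map_def by presburger
    qed
    ultimately have "((\<lambda>t::real. integral ?Q (?F u)) has_vector_derivative integral ?Q (?D ?Mt ?et u)) (at 0)"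
      by simp
    then show ?thesis using vector_derivative_unique_at has_vector_derivative_const by blast
  qed
  have bound: "cmod (integral ?Q (?D ?Mh ?eh u)) \<le> 2 * lbound q * B / c * u ^ (N - 1)" if u: "u \<in> {0<..\<eta>0}" for u
  proof -
    have split: "?D ?Mh ?eh u x = ?D ?Md ?ed u x + \<i> * ?D ?Mt ?et u x" for x
      by (rule dlterm_linear) auto
    have i1: "?D ?Md ?ed u integrable_on ?Q"
      by (intro integrable_continuous cD[of _ "\<lambda>_. u" "\<lambda>x. x"] cMd[of _ "\<lambda>_. u"] ced[of _ "\<lambda>_. u"]) (use u in auto)
    have i2: "?D ?Mt ?et u integrable_on ?Q"
      by (intro integrable_continuous cD[of _ "\<lambda>_. u" "\<lambda>x. x"] cMt[of _ "\<lambda>_. u"] cet[of _ "\<lambda>_. u"]) (use u in auto)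
    have "integral ?Q (?D ?Mh ?eh u) = integral ?Q (?D ?Md ?ed u) + \<i> * integral ?Q (?D ?Mt ?et u)"
      unfolding split using i1 i2 by (subst integral_add) (auto intro: integrable_on_mult_right)
    then have "integral ?Q (?D ?Mh ?eh u) = integral ?Q (?D ?Md ?ed u)" using D0[OF u] by simp
    moreover have "cmod (integral ?Q (?D ?Md ?ed u)) \<le> 2 * lbound q * B / c * u ^ (N - 1)"
    proof (rule integral_unit_cube_bound)
      show "continuous_on ?Q (?D ?Md ?ed u)"
        by (intro cD[of _ "\<lambda>_. u" "\<lambda>x. x"] cMd[of _ "\<lambda>_. u"] ced[of _ "\<lambda>_. u"]) (use u in auto)
      fix x
      \<comment> \<open>The velocities are at most \<open>B u\<^sup>N\<close>; scaled by \<open>R\<close> they fit into the robustness radius \<open>c u\<close>.\<close>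
      define R where "R = c / (B * u ^ (N - 1))"
      have R: "R > 0" using c B u by (simp add: R_def)
      have r: "cmod (?r u) \<le> u ^ N" using u fact_ge_1[of N, where 'a = real]
        by (simp add: norm_mult norm_divide norm_power divide_le_eq mult_le_cancel_left1)
      have Rr: "R * cmod (?r u * y) \<le> c * u" if "cmod y \<le> B" for y
      proof -
        have "R * cmod (?r u * y) \<le> R * (u ^ N * B)"
          unfolding norm_mult[of "?r u" y] using r that R u by (intro mult_left_mono mult_mono) auto
        also have "\<dots> = c * u" using u B N by (cases N) (auto simp: R_def field_simps)
        finally show ?thesis .
      qed
      have "cmod (?D ?Md ?ed u x) \<le> 2 * lbound q / R"
        by (rule dlterm_bound[where \<rho> = "c * u" and q = q]) (use rob u q R Rr[OF bP] Rr[OF bE] in auto)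
      also have "\<dots> = 2 * lbound q * B / c * u ^ (N - 1)" using u by (simp add: R_def)
      finally show "cmod (?D ?Md ?ed u x) \<le> 2 * lbound q * B / c * u ^ (N - 1)" .
    qed
    ultimately show ?thesis by simp
  qed
  define G where "G u = integral ?Q (?D ?Mh ?eh u)" for u
  have cU: "continuous_on {0..\<eta>} U"
  proof -
    have "continuous_on ({0..\<eta>} \<times> ?Q) (\<lambda>y. ?F (fst y) (snd y))"
      by (intro cF prj) (use \<eta> in auto)
    then show ?thesis unfolding U_def
      by (intro integral_continuous_on_param) (simp add: case_prod_unfold)
  qed
  have dG: "(U has_derivative (\<lambda>h. h *\<^sub>R G u)) (at u)" if "0 < u" "u < \<eta>" for u
  proof -
    have "(U has_vector_derivative G u) (at u within {0<..<\<eta>})"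
      unfolding G_def by (rule has_vector_derivative_within_subset[OF dU]) (use that \<eta> in auto)
    moreover have "at u within {0<..<\<eta>} = at u" using that by (intro at_within_open) auto
    ultimately show ?thesis unfolding has_vector_derivative_def by simp
  qed
  obtain u where u: "u \<in> {0<..<\<eta>}" "norm (U \<eta> - U 0) \<le> norm ((\<eta> - 0) *\<^sub>R G u)"
    using mvt_general[OF \<eta>(1) cU dG] by blast
  note u(2)
  also have "norm ((\<eta> - 0) *\<^sub>R G u) \<le> \<eta> * (2 * lbound q * B / c * u ^ (N - 1))"
  proof -
    have "cmod (G u) \<le> 2 * lbound q * B / c * u ^ (N - 1)"
      unfolding G_def by (rule bound) (use u \<eta> in auto)
    then have "\<eta> * cmod (G u) \<le> \<eta> * (2 * lbound q * B / c * u ^ (N - 1))"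
      using \<eta> by (intro mult_left_mono) auto
    moreover have "norm ((\<eta> - 0) *\<^sub>R G u) = \<eta> * cmod (G u)" using \<eta> by (simp only: norm_scaleR) simp
    ultimately show ?thesis by (simp only:)
  qed
  also have "\<dots> \<le> \<eta> * (2 * lbound q * B / c * \<eta> ^ (N - 1))"
    using u \<eta> q c B lbound_pos[OF q] by (intro mult_left_mono power_mono) auto
  also have "\<dots> = 2 * lbound q * B / c * \<eta> ^ N" using N by (cases N) auto
  finally show ?thesis .
qed

section \<open>Parameter derivatives along a rotation\<close>

lemma torus_family_bounded:
  fixes F :: "real \<times> (real^'d) \<Rightarrow> complex"
  assumes "continuous_on (J \<times> UNIV) F" "\<And>s. s \<in> J \<Longrightarrow> torus_map (\<lambda>x. F (s, x))" "compact K" "K \<subseteq> J"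
  obtains C where "C > 0" "\<And>s x. s \<in> K \<Longrightarrow> cmod (F (s, x)) \<le> C"
proof -
  have "compact (F ` (K \<times> cbox 0 One))"
    using assms(3,4) by (intro compact_continuous_image continuous_on_subset[OF assms(1)] compact_Times) auto
  then have "\<exists>C. \<forall>s\<in>K. \<forall>y\<in>cbox 0 One. cmod (F (s, y)) \<le> C"
    by (auto dest!: compact_imp_bounded simp: bounded_iff)
  then obtain C where C: "\<And>s y. s \<in> K \<Longrightarrow> y \<in> cbox 0 One \<Longrightarrow> cmod (F (s, y)) \<le> C"
    by blast
  have "cmod (F (s, x)) \<le> \<bar>C\<bar> + 1" if "s \<in> K" for s x
  proof -
    obtain y where y: "y \<in> cbox 0 One" "\<And>f :: real^'d \<Rightarrow> complex. torus_map f \<Longrightarrow> f x = f y"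
      using torus_representative[of x] by blast
    have "F (s, x) = F (s, y)" using y(2)[OF assms(2)] that assms(4) by auto
    then show ?thesis using C[OF that y(1)] by simp
  qed
  then show ?thesis using that[of "\<bar>C\<bar> + 1"] by simp
qed

lemma torus_family_frechet:
  fixes F :: "real \<times> (real^'d) \<Rightarrow> 'b::real_normed_vector"
  assumes J: "open J" and F: "smooth_on F (J \<times> UNIV)" "\<And>s. s \<in> J \<Longrightarrow> torus_map (\<lambda>x. F (s, x))" and s: "s \<in> J"
  shows "torus_map (\<lambda>x. frechet_derivative F (at (s, x)) v)"
  unfolding torus_map_def
proof (intro allI)
  fix x and k :: "int^'d"
  let ?k = "(\<chi> i. of_int (k $ i)) :: real^'d"
  have o: "open (J \<times> (UNIV :: (real^'d) set))" using J by (intro open_Times) auto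
  have 1: "(F has_derivative frechet_derivative F (at (s, x + ?k))) (at (s, x + ?k))"
    using smooth_on_has_derivative[OF F(1)] s by simp
  have 2: "((\<lambda>p. p + (0, ?k)) has_derivative (\<lambda>h. h)) (at (s, x))"
    by (auto intro!: derivative_eq_intros)
  have "((\<lambda>p. F (p + (0, ?k))) has_derivative frechet_derivative F (at (s, x + ?k))) (at (s, x))"
    using has_derivative_compose[OF 2, of F "frechet_derivative F (at (s, x + ?k))"] 1 by simp
  then have "(F has_derivative frechet_derivative F (at (s, x + ?k))) (at (s, x))"
    by (rule has_derivative_transform_within_open[OF _ o])
      (use s F(2) in \<open>auto simp: torus_map_def\<close>)
  then show "frechet_derivative F (at (s, x + ?k)) v = frechet_derivative F (at (s, x)) v"
    by (simp add: frechet_derivative_at[symmetric])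
qed

text \<open>
  Each differentiation in \<open>s\<close> of \<open>F(s, x - k \<alpha>(s))\<close> either hits the explicit parameter or produces a factor \<open>k\<close>. The induction
  replaces \<open>F\<close> by the two families \<open>\<partial>\<^sub>s F\<close> and \<open>- D\<^sub>x F \<cdot> \<alpha>'\<close>, which are again smooth families on the torus; \<open>C\<close> does not depend on \<open>k\<close>.
\<close>

lemma shifted_family_derivatives:
  fixes F :: "real \<times> (real^'d) \<Rightarrow> complex" and \<alpha> :: "real \<Rightarrow> real^'d"
  assumes J: "open J" and \<alpha>: "smooth_on \<alpha> J" and K: "compact K" "K \<subseteq> J"
    and F: "smooth_on F (J \<times> UNIV)" "\<And>s. s \<in> J \<Longrightarrow> torus_map (\<lambda>x. F (s, x))"
  shows "\<exists>C>0. \<forall>k::nat. \<exists>h :: nat \<Rightarrow> real \<Rightarrow> real^'d \<Rightarrow> complex.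
     (\<forall>s x. h 0 s x = F (s, x - real k *\<^sub>R \<alpha> s)) \<and>
     (\<forall>i<D. \<forall>s\<in>J. \<forall>x. ((\<lambda>s. h i s x) has_vector_derivative h (Suc i) s x) (at s)) \<and>
     (\<forall>i\<le>D. \<forall>s\<in>K. \<forall>x. cmod (h i s x) \<le> C * (1 + real k) ^ i) \<and>
     (\<forall>i\<le>D. continuous_on (J \<times> UNIV) (\<lambda>(s, x). h i s x))"
  using F
proof (induction D arbitrary: F)
  case 0
  have oJ: "open (J \<times> (UNIV :: (real^'d) set))" using J by (intro open_Times) auto
  obtain C where C: "C > 0" "\<And>s x. s \<in> K \<Longrightarrow> cmod (F (s, x)) \<le> C"
    using torus_family_bounded[OF smooth_on_imp_continuous_on[OF 0(1)] 0(2) K] by blast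
  have "continuous_on (J \<times> UNIV) (\<lambda>p. F (fst p, snd p - real k *\<^sub>R \<alpha> (fst p)))" for k
    by (rule continuous_on_compose2[OF smooth_on_imp_continuous_on[OF 0(1)]])
      (auto intro!: continuous_intros continuous_on_compose2[OF smooth_on_imp_continuous_on[OF \<alpha>]])
  then show ?case
    by (intro exI[of _ C] conjI allI exI[of _ "\<lambda>i s x. F (s, x - real _ *\<^sub>R \<alpha> s)"])
      (use C in \<open>auto simp: case_prod_unfold\<close>)
next
  case (Suc D)
  have oJ: "open (J \<times> (UNIV :: (real^'d) set))" using J by (intro open_Times) auto
  define \<alpha>' where "\<alpha>' s = frechet_derivative \<alpha> (at s) 1" for s
  have d\<alpha>: "(\<alpha> has_vector_derivative \<alpha>' s) (at s)" if "s \<in> J" for s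
  proof -
    have 1: "(\<alpha> has_derivative frechet_derivative \<alpha> (at s)) (at s)"
      using smooth_on_has_derivative[OF \<alpha> that] .
    then have "frechet_derivative \<alpha> (at s) h = h *\<^sub>R \<alpha>' s" for h
      using linear_scale[OF has_derivative_linear[OF 1], of h 1] by (simp add: \<alpha>'_def)
    then have "frechet_derivative \<alpha> (at s) = (\<lambda>h. h *\<^sub>R \<alpha>' s)" by auto
    with 1 show ?thesis by (simp add: has_vector_derivative_def)
  qed
  define F1 where "F1 p = frechet_derivative F (at p) (1, 0)" for p
  \<comment> \<open>The coefficient of \<open>k\<close> in the \<open>s\<close>-derivative of \<open>F(s, x - k \<alpha>(s))\<close>.\<close>
  define F2 where "F2 p = frechet_derivative F (at p) (0, - \<alpha>' (fst p))" for p
  have F2: "F2 p = (\<Sum>b\<in>Basis. (- 1 * (\<alpha>' (fst p) \<bullet> b)) *\<^sub>R frechet_derivative F (at p) (0, b))" if "p \<in> J \<times> UNIV" for p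
  proof -
    have l: "linear (\<lambda>y. frechet_derivative F (at p) (0, y))"
      using linear_compose[of "\<lambda>y. (0, y)" "frechet_derivative F (at p)"]
        has_derivative_linear[OF smooth_on_has_derivative[OF Suc.prems(1) that]]
      by (simp add: o_def linear_iff)
    have "- \<alpha>' (fst p) = (\<Sum>b\<in>Basis. (- 1 * (\<alpha>' (fst p) \<bullet> b)) *\<^sub>R b)"
      by (simp add: sum_negf euclidean_representation)
    then have "F2 p = frechet_derivative F (at p) (0, (\<Sum>b\<in>Basis. (- 1 * (\<alpha>' (fst p) \<bullet> b)) *\<^sub>R b))"
      by (simp add: F2_def)
    also have "\<dots> = (\<Sum>b\<in>Basis. (- 1 * (\<alpha>' (fst p) \<bullet> b)) *\<^sub>R frechet_derivative F (at p) (0, b))"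
      using l by (simp only: linear_sum[OF l] linear_scale[OF l])
    finally show ?thesis .
  qed
  have sF1: "smooth_on F1 (J \<times> UNIV)" unfolding F1_def by (rule smooth_on_frechet[OF Suc.prems(1)])
  have s\<alpha>': "smooth_on (\<lambda>p. \<alpha>' (fst p)) (J \<times> (UNIV :: (real^'d) set))"
    by (rule smooth_on_compose[OF oJ J])
      (use smooth_on_frechet[OF \<alpha>] in \<open>auto simp: \<alpha>'_def[abs_def] intro!: smooth_on_linear oJ bounded_linear_fst\<close>)
  have "smooth_on (\<lambda>p. \<Sum>b\<in>Basis. (- 1 * (\<alpha>' (fst p) \<bullet> b)) *\<^sub>R frechet_derivative F (at p) (0, b)) (J \<times> UNIV)"
    by (intro smooth_on_sum smooth_on_scaleR smooth_on_mult smooth_on_inner smooth_on_const s\<alpha>' oJ finite_Basis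
        smooth_on_frechet Suc.prems(1))
  then have sF2: "smooth_on F2 (J \<times> UNIV)"
    by (rule smooth_on_cong[OF oJ, rotated]) (simp add: F2)
  have pF1: "torus_map (\<lambda>x. F1 (s, x))" if "s \<in> J" for s
    unfolding F1_def by (rule torus_family_frechet[OF J Suc.prems that])
  have pF2: "torus_map (\<lambda>x. F2 (s, x))" if "s \<in> J" for s
    unfolding F2_def fst_conv by (rule torus_family_frechet[OF J Suc.prems that])
  have dF: "((\<lambda>s. F (s, x - real k *\<^sub>R \<alpha> s)) has_vector_derivative
      F1 (s, x - real k *\<^sub>R \<alpha> s) + real k * F2 (s, x - real k *\<^sub>R \<alpha> s)) (at s)" if "s \<in> J" for s x k
  proof -
    let ?p = "(s, x - real k *\<^sub>R \<alpha> s)"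
    have 1: "(F has_derivative frechet_derivative F (at ?p)) (at ?p)"
      using smooth_on_has_derivative[OF Suc.prems(1)] that by simp
    have 2: "((\<lambda>s. (s, x - real k *\<^sub>R \<alpha> s)) has_derivative (\<lambda>h. (h, - (real k *\<^sub>R (h *\<^sub>R \<alpha>' s))))) (at s)"
      using d\<alpha>[OF that] unfolding has_vector_derivative_def by (auto intro!: derivative_eq_intros)
    have l: "linear (frechet_derivative F (at ?p))" using has_derivative_linear[OF 1] .
    have "frechet_derivative F (at ?p) (h, - (real k *\<^sub>R (h *\<^sub>R \<alpha>' s))) = h *\<^sub>R (F1 ?p + real k * F2 ?p)" for h
    proof -
      have "(h, - (real k *\<^sub>R (h *\<^sub>R \<alpha>' s))) = h *\<^sub>R ((1, 0) + real k *\<^sub>R (0, - \<alpha>' s))"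
        by (simp add: mult.commute)
      then show ?thesis
        by (simp only: linear_scale[OF l] linear_add[OF l]) (simp add: F1_def F2_def scaleR_conv_of_real)
    qed
    then show ?thesis
      using has_derivative_compose[OF 2 1] by (simp add: has_vector_derivative_def)
  qed
  obtain C0 where C0: "C0 > 0" "\<And>s x. s \<in> K \<Longrightarrow> cmod (F (s, x)) \<le> C0"
    using torus_family_bounded[OF smooth_on_imp_continuous_on[OF Suc.prems(1)] Suc.prems(2) K] by blast
  define G where "G F D C k h \<longleftrightarrow>
     (\<forall>s x. h 0 s x = F (s, x - real k *\<^sub>R \<alpha> s)) \<and>
     (\<forall>i<D. \<forall>s\<in>J. \<forall>x. ((\<lambda>s. h i s x) has_vector_derivative h (Suc i) s x) (at s)) \<and>
     (\<forall>i\<le>D. \<forall>s\<in>K. \<forall>x. cmod (h i s x) \<le> C * (1 + real k) ^ i) \<and>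
     (\<forall>i\<le>D. continuous_on (J \<times> UNIV) (\<lambda>(s, x). h i s x))"
    for F :: "real \<times> (real^'d) \<Rightarrow> complex" and D C k and h :: "nat \<Rightarrow> real \<Rightarrow> real^'d \<Rightarrow> complex"
  have IH: "\<exists>C>0. \<forall>k. \<exists>h. G F D C k h"
    if "smooth_on F (J \<times> UNIV)" "\<And>s. s \<in> J \<Longrightarrow> torus_map (\<lambda>x. F (s, x))" for F
    using Suc.IH[OF that] unfolding G_def .
  obtain C1 where C1: "C1 > 0" "\<And>k. \<exists>h. G F1 D C1 k h" using IH[OF sF1 pF1] by auto
  obtain C2 where C2: "C2 > 0" "\<And>k. \<exists>h. G F2 D C2 k h" using IH[OF sF2 pF2] by auto
  have "\<exists>h. G F (Suc D) (C0 + C1 + C2) k h" for k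
  proof -
    obtain h1 where h1: "G F1 D C1 k h1" using C1 by blast
    obtain h2 where h2: "G F2 D C2 k h2" using C2 by blast
    define h where "h i s x = (case i of 0 \<Rightarrow> F (s, x - real k *\<^sub>R \<alpha> s) | Suc i \<Rightarrow> h1 i s x + real k * h2 i s x)" for i s x
    have "G F (Suc D) (C0 + C1 + C2) k h"
      unfolding G_def
    proof (intro conjI allI impI ballI)
      show "h 0 s x = F (s, x - real k *\<^sub>R \<alpha> s)" for s x by (simp add: h_def)
      show "((\<lambda>s. h i s x) has_vector_derivative h (Suc i) s x) (at s)" if "i < Suc D" "s \<in> J" for i s x
      proof (cases i)
        case 0
        then show ?thesis using dF[OF that(2), of x k] h1 h2 by (simp add: h_def G_def)
      next
        case (Suc l)
        then have "((\<lambda>s. h1 l s x) has_vector_derivative h1 (Suc l) s x) (at s)"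
          "((\<lambda>s. h2 l s x) has_vector_derivative h2 (Suc l) s x) (at s)"
          using h1 h2 that by (auto simp: G_def)
        then show ?thesis unfolding Suc h_def
          by (auto intro!: derivative_eq_intros)
      qed
      show "cmod (h i s x) \<le> (C0 + C1 + C2) * (1 + real k) ^ i" if "i \<le> Suc D" "s \<in> K" for i s x
      proof (cases i)
        case 0
        then show ?thesis using C0(2)[OF that(2)] C1 C2 by (simp add: h_def add_increasing2)
      next
        case (Suc l)
        then have "cmod (h1 l s x) \<le> C1 * (1 + real k) ^ l" "cmod (h2 l s x) \<le> C2 * (1 + real k) ^ l"
          using h1 h2 that by (auto simp: G_def)
        then have "cmod (h i s x) \<le> C1 * (1 + real k) ^ l + real k * (C2 * (1 + real k) ^ l)"
          unfolding Suc h_def by (auto intro!: norm_triangle_le add_mono mult_left_mono simp: norm_mult)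
        also have "\<dots> \<le> (C0 + C1 + C2) * (1 + real k) ^ i"
        proof -
          have "C1 + real k * C2 \<le> (C0 + C1 + C2) * (1 + real k)"
            using C0 C1 C2 by (simp add: algebra_simps)
          then have "(C1 + real k * C2) * (1 + real k) ^ l \<le> (C0 + C1 + C2) * (1 + real k) * (1 + real k) ^ l"
            by (intro mult_right_mono) auto
          then show ?thesis by (simp add: Suc algebra_simps)
        qed
        finally show ?thesis .
      qed
      show "continuous_on (J \<times> UNIV) (\<lambda>(s, x). h i s x)" if "i \<le> Suc D" for i
      proof (cases i)
        case 0
        have "continuous_on (J \<times> UNIV) (\<lambda>p. F (fst p, snd p - real k *\<^sub>R \<alpha> (fst p)))"
          by (rule continuous_on_compose2[OF smooth_on_imp_continuous_on[OF Suc.prems(1)]])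
            (auto intro!: continuous_intros continuous_on_compose2[OF smooth_on_imp_continuous_on[OF \<alpha>]])
        then show ?thesis by (simp add: 0 h_def case_prod_unfold)
      next
        case (Suc l)
        then have "continuous_on (J \<times> UNIV) (\<lambda>(s, x). h1 l s x)" "continuous_on (J \<times> UNIV) (\<lambda>(s, x). h2 l s x)"
          using h1 h2 that by (auto simp: G_def)
        then show ?thesis unfolding Suc h_def by (auto simp: case_prod_unfold intro!: continuous_intros)
      qed
    qed
    then show ?thesis by blast
  qed
  then have "\<exists>C>0. \<forall>k. \<exists>h. G F (Suc D) C k h" using C0 C1 C2 by (intro exI[of _ "C0 + C1 + C2"]) auto
  then show ?case unfolding G_def .
qed

section \<open>Contraction of the disc at positive height\<close>

lemma mden_perturb:
  assumes "\<And>i k. cmod (M' $ i $ k - M $ i $ k) \<le> \<epsilon>" "cmod m \<le> 1"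
  shows "cmod (mden M' m - mden M m) \<le> 2 * \<epsilon>" "cmod (mnum M' m - mnum M m) \<le> 2 * \<epsilon>"
proof -
  have *: "cmod (a' * m + b' - (a * m + b)) \<le> 2 * \<epsilon>" if "cmod (a' - a) \<le> \<epsilon>" "cmod (b' - b) \<le> \<epsilon>" for a b a' b'
  proof -
    have eq: "a' * m + b' - (a * m + b) = (a' - a) * m + (b' - b)" by (simp add: algebra_simps)
    have "cmod ((a' - a) * m) \<le> \<epsilon> * 1"
      unfolding norm_mult using that assms(2) by (intro mult_mono) (auto intro: order_trans[OF norm_ge_zero])
    then show ?thesis unfolding eq using that norm_triangle_ineq[of "(a' - a) * m" "b' - b"] by linarith
  qed
  show "cmod (mden M' m - mden M m) \<le> 2 * \<epsilon>" "cmod (mnum M' m - mnum M m) \<le> 2 * \<epsilon>"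
    unfolding mden_def mnum_def by (intro * assms(1))+
qed

lemma adm_perturb:
  assumes a: "adm r q M e" and q: "0 \<le> q" "q \<le> q'" "q' < 1" and r: "r \<le> 1"
    and e: "0 < em" "em \<le> cmod e" and \<epsilon>: "0 \<le> \<epsilon>" "8 * \<epsilon> \<le> (q' - q) * em" "8 * \<epsilon> \<le> (r' - r) * (1 - q') * em"
    and M: "\<And>i k. cmod (M' $ i $ k - M $ i $ k) \<le> \<epsilon>" "cmod (e' - e) \<le> \<epsilon>"
  shows "adm r' q' M' e'"
proof -
  have \<epsilon>e: "8 * \<epsilon> \<le> em"
    by (rule order_trans[OF \<epsilon>(2)]) (use q e in \<open>auto intro!: mult_left_le_one_le\<close>)
  have e': "cmod e' \<ge> em / 2" using norm_triangle_ineq2[of e "e - e'"] M(2) e \<epsilon>e by (simp add: norm_minus_commute)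
  have ee: "cmod e \<le> cmod e' + \<epsilon>" using norm_triangle_ineq2[of e e'] M(2) by (simp add: norm_minus_commute)
  have qd: "(q' - q) * (em / 2) \<le> (q' - q) * cmod e'" using e' q by (intro mult_left_mono) auto
  show ?thesis unfolding adm_def
  proof (intro conjI allI impI)
    show "e' \<noteq> 0" using e' e by auto
    fix m :: complex assume m: "cmod m \<le> 1"
    note p = mden_perturb[OF M(1) m]
    have A: "cmod (mden M m - e) \<le> q * cmod e" "cmod (mnum M m) \<le> r * cmod (mden M m)"
      using a m by (auto simp: adm_def)
    have "cmod (mden M' m - e') \<le> cmod (mden M' m - mden M m) + cmod (mden M m - e) + cmod (e - e')"
      using norm_triangle_ineq[of "mden M' m - mden M m" "mden M m - e"]
        norm_triangle_ineq[of "mden M' m - e" "e - e'"] by simp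
    also have "\<dots> \<le> 2 * \<epsilon> + q * (cmod e' + \<epsilon>) + \<epsilon>"
      using p A(1) M(2) mult_left_mono[OF ee q(1)] by (simp add: norm_minus_commute)
    also have "\<dots> \<le> q * cmod e' + 4 * \<epsilon>"
      using mult_left_le_one_le[of \<epsilon> q] q \<epsilon> by (simp add: algebra_simps)
    also have "\<dots> \<le> q * cmod e' + (q' - q) * cmod e'"
    proof -
      have "4 * \<epsilon> \<le> (q' - q) * (em / 2)" using \<epsilon>(2) by simp
      then show ?thesis using qd by linarith
    qed
    also have "\<dots> = q' * cmod e'" by (simp add: algebra_simps)
    finally show D: "cmod (mden M' m - e') \<le> q' * cmod e'" .
    have "(1 - q') * (em / 2) \<le> (1 - q') * cmod e'" using e' q by (intro mult_left_mono) auto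
    also have "\<dots> \<le> cmod (mden M' m)"
      using D norm_triangle_ineq2[of e' "e' - mden M' m"] by (simp add: norm_minus_commute algebra_simps)
    finally have dl: "(1 - q') * (em / 2) \<le> cmod (mden M' m)" .
    have rr: "0 \<le> r' - r"
    proof (rule ccontr)
      assume "\<not> 0 \<le> r' - r"
      then have "(r' - r) * ((1 - q') * em) < 0" using q e by (intro mult_neg_pos mult_pos_pos) auto
      then show False using \<epsilon> by (simp add: mult.assoc)
    qed
    have dd: "cmod (mden M m) \<le> cmod (mden M' m) + 2 * \<epsilon>"
      using p(1) norm_triangle_ineq2[of "mden M m" "mden M' m"] by (simp add: norm_minus_commute)
    have "r * cmod (mden M m) \<le> r * cmod (mden M' m) + 2 * \<epsilon>"
    proof (cases "r \<ge> 0")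
      case True
      then have "r * cmod (mden M m) \<le> r * cmod (mden M' m) + r * (2 * \<epsilon>)"
        unfolding distrib_left[symmetric] using dd by (intro mult_left_mono) auto
      moreover have "r * (2 * \<epsilon>) \<le> 2 * \<epsilon>" using True r \<epsilon> by (intro mult_left_le_one_le) auto
      ultimately show ?thesis by linarith
    next
      case False
      have "cmod (mden M' m) \<le> cmod (mden M m) + 2 * \<epsilon>"
        using p(1) norm_triangle_ineq2[of "mden M' m" "mden M m"] by simp
      moreover have "cmod (mnum M m) \<le> r * cmod (mden M m)" by (rule A)
      then have "r * cmod (mden M m) \<ge> 0" by (rule order_trans[OF norm_ge_zero])
      then have "mden M m = 0" using False by (simp add: zero_le_mult_iff)
      ultimately have "r * cmod (mden M' m) \<ge> r * (2 * \<epsilon>)" using False by (intro mult_left_mono_neg) auto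
      have "em * (1 - q') / 2 \<le> 2 * \<epsilon>" using dl \<open>cmod (mden M' m) \<le> _\<close> \<open>mden M m = 0\<close> by (simp add: mult.commute)
      moreover have "cmod e \<le> q * cmod e" using A(1) \<open>mden M m = 0\<close> by simp
      then have False using e q by (simp add: mult_le_cancel_right1)
      then show ?thesis ..
    qed
    then have "cmod (mnum M' m) \<le> r * cmod (mden M' m) + 4 * \<epsilon>"
      using p(2) A(2) norm_triangle_ineq2[of "mnum M' m" "mnum M m"] by simp
    also have "4 * \<epsilon> \<le> (r' - r) * ((1 - q') * (em / 2))" using \<epsilon>(3) by (simp add: mult.assoc)
    also have "\<dots> \<le> (r' - r) * cmod (mden M' m)" using dl rr by (intro mult_left_mono) auto
    finally show "cmod (mnum M' m) \<le> r' * cmod (mden M' m)" by (simp add: algebra_simps)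
  qed
qed

lemma adm_imp_robust:
  assumes "adm (1 - \<tau>) q M e" "0 \<le> q" "q \<le> q'" "q' < 1" "0 \<le> \<tau>" "0 < em" "em \<le> cmod e" "0 \<le> \<rho>"
    "8 * \<rho> \<le> (q' - q) * em" "8 * \<rho> \<le> \<tau> * (1 - q') * em"
  shows "robust \<rho> q' M e"
  unfolding robust_def
  by (intro allI impI, rule adm_perturb[OF assms(1), where em = em and \<epsilon> = \<rho>]) (use assms in auto)

text \<open>
  On the circle a matrix of the stated symmetry has \<open>\<bar>num\<bar> = \<bar>den\<bar>\<close>; adding \<open>i \<eta> P\<close> changes \<open>\<bar>den\<bar>\<^sup>2 - \<bar>num\<bar>\<^sup>2\<close> to exactly
  \<open>4 \<eta> Im (cnj (num M) num P)\<close>, which is positive of order \<open>\<eta>\<close> and dominates the error of order \<open>\<eta>\<^sup>2\<close>. The maximum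
  modulus principle carries the estimate into the disc.
\<close>

lemma cone_contraction:
  fixes M P M' :: "complex^2^2"
  assumes M: "M$2$1 = cnj (M$1$2)" "M$2$2 = cnj (M$1$1)" and P: "P$2$1 = cnj (P$1$2)" "P$2$2 = cnj (P$1$1)"
    and pos: "\<And>m. cmod m = 1 \<Longrightarrow> Im (cnj (mnum M m) * mnum P m) \<ge> c" and c: "c > 0"
    and B: "\<And>i k. cmod (M $ i $ k) \<le> B" "\<And>i k. cmod (P $ i $ k) \<le> B" "B > 0"
    and M': "\<And>i k. cmod (M' $ i $ k - M $ i $ k - \<i> * of_real \<eta> * P $ i $ k) \<le> B * \<eta>^2"
    and \<eta>: "0 < \<eta>" "\<eta> \<le> 1" "\<eta> \<le> c / (24 * B^2)" and nz: "\<And>m. cmod m \<le> 1 \<Longrightarrow> mden M' m \<noteq> 0" and m: "cmod m \<le> 1"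
  shows "cmod (mnum M' m) \<le> (1 - c / (36 * B^2) * \<eta>) * cmod (mden M' m)"
proof -
  define t where "t = c / (36 * B^2) * \<eta>"
  have t1: "t \<le> 1"
  proof -
    have c4: "c \<le> 4 * B^2"
    proof -
      have "c \<le> \<bar>Im (cnj (mnum M 1) * mnum P 1)\<bar>" using pos[of 1] by simp
      also have "\<dots> \<le> cmod (mnum M 1) * cmod (mnum P 1)"
        using abs_Im_le_cmod[of "cnj (mnum M 1) * mnum P 1"] by (simp add: norm_mult)
      also have "\<dots> \<le> (B + B) * (B + B)"
        unfolding mnum_def using B by (intro mult_mono norm_triangle_le add_mono) auto
      finally show ?thesis by (simp add: power2_eq_square)
    qed
    have "c * \<eta> \<le> 4 * B^2 * 1" using c4 \<eta> c by (intro mult_mono) auto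
    then have "c * \<eta> \<le> 36 * B^2" using zero_le_power2[of B] by linarith
    then show ?thesis using B by (simp add: t_def divide_le_eq)
  qed
  have t0: "0 \<le> t" using c \<eta> B by (simp add: t_def)
  have circle: "cmod (mnum M' m) \<le> (1 - t) * cmod (mden M' m)" if m: "cmod m = 1" for m
  proof -
    define N0 where "N0 = mnum M m"
    define N1 where "N1 = mnum P m"
    define A1 where "A1 = N0 + \<i> * of_real \<eta> * N1"
    define A2 where "A2 = m * (cnj N0 + \<i> * of_real \<eta> * cnj N1)"
    have mm: "m * cnj m = 1" using m by (simp add: complex_norm_square[symmetric])
    have D0: "mden M m = m * cnj N0" and D1: "mden P m = m * cnj N1"
      unfolding N0_def N1_def mden_def mnum_def using M P mm
      by (simp_all add: algebra_simps)
    have NB: "cmod N0 \<le> 2 * B" "cmod N1 \<le> 2 * B"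
      unfolding N0_def N1_def mnum_def
      by (rule norm_triangle_le, use B(1)[of 1 1] B(1)[of 1 2] B(2)[of 1 1] B(2)[of 1 2] m in \<open>simp add: norm_mult\<close>)+
    let ?L = "(\<chi> i k. M $ i $ k + \<i> * of_real \<eta> * P $ i $ k) :: complex^2^2"
    have L: "mnum ?L m = A1" "mden ?L m = A2"
    proof -
      have "mden ?L m = mden M m + \<i> * of_real \<eta> * mden P m" by (simp add: mden_def algebra_simps)
      then show "mden ?L m = A2" unfolding D0 D1 by (simp add: A2_def algebra_simps)
      show "mnum ?L m = A1" by (simp add: A1_def N0_def N1_def mnum_def algebra_simps)
    qed
    have "cmod (M' $ i $ k - ?L $ i $ k) \<le> B * \<eta>^2" for i k
      using M'[of i k] by (simp add: algebra_simps)
    from mden_perturb[OF this, of m] m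
    have p: "cmod (mnum M' m - A1) \<le> 2 * (B * \<eta>^2)" "cmod (mden M' m - A2) \<le> 2 * (B * \<eta>^2)"
      unfolding L by auto
    have e2: "\<eta>^2 \<le> 1" using \<eta> by (simp add: power_le_one)
    have A1: "cmod A1 \<le> 4 * B"
    proof -
      have "cmod (\<i> * of_real \<eta> * N1) \<le> 1 * (2 * B)"
        unfolding norm_mult using \<eta> NB by (intro mult_mono) auto
      then show ?thesis unfolding A1_def using NB norm_triangle_ineq[of N0 "\<i> * of_real \<eta> * N1"] by simp
    qed
    have A2: "cmod A2 \<le> 4 * B"
    proof -
      have "cmod (\<i> * of_real \<eta> * cnj N1) \<le> 1 * (2 * B)"
        unfolding norm_mult using \<eta> NB by (intro mult_mono) auto
      then show ?thesis unfolding A2_def using m NB norm_triangle_ineq[of "cnj N0" "\<i> * of_real \<eta> * cnj N1"]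
        by (simp add: norm_mult)
    qed
    \<comment> \<open>Of the expanded squares only the cross terms survive, since numerator and denominator have equal modulus on the circle for \<open>M\<close> and for \<open>P\<close> alike.\<close>
    have diff: "(cmod A2)^2 - (cmod A1)^2 = 4 * \<eta> * Im (cnj N0 * N1)"
    proof -
      have A2n: "cmod A2 = cmod (cnj N0 + \<i> * of_real \<eta> * cnj N1)" by (simp add: A2_def norm_mult m)
      show ?thesis unfolding A1_def A2n cmod_power2
        by (simp add: power2_eq_square algebra_simps)
    qed
    let ?r = "2 * (B * \<eta>^2)"
    have r: "0 \<le> ?r" "?r \<le> 2 * B" using B \<eta> e2 by (auto simp: mult_left_le)
    have n: "cmod (mnum M' m) \<le> cmod A1 + ?r" using p(1) norm_triangle_ineq2[of "mnum M' m" A1] by simp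
    have d: "cmod A2 \<le> cmod (mden M' m) + ?r" using p(2) norm_triangle_ineq2[of A2 "mden M' m"] by (simp add: norm_minus_commute)
    have dB: "cmod (mden M' m) \<le> 6 * B" using p(2) norm_triangle_ineq2[of "mden M' m" A2] A2 r by simp
    have n2: "(cmod (mnum M' m))^2 \<le> (cmod A1)^2 + 10 * B * ?r"
    proof -
      have "(cmod (mnum M' m))^2 \<le> (cmod A1 + ?r)^2" using n by (intro power_mono) auto
      also have "\<dots> = (cmod A1)^2 + (2 * cmod A1 + ?r) * ?r" by (simp add: power2_eq_square algebra_simps)
      also have "\<dots> \<le> (cmod A1)^2 + (10 * B) * ?r" using A1 r by (intro add_left_mono mult_right_mono) auto
      finally show ?thesis .
    qed
    have d2: "(cmod A2)^2 \<le> (cmod (mden M' m))^2 + 14 * B * ?r"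
    proof -
      have "(cmod A2)^2 \<le> (cmod (mden M' m) + ?r)^2" using d by (intro power_mono) auto
      also have "\<dots> = (cmod (mden M' m))^2 + (2 * cmod (mden M' m) + ?r) * ?r" by (simp add: power2_eq_square algebra_simps)
      also have "\<dots> \<le> (cmod (mden M' m))^2 + (14 * B) * ?r" using dB r by (intro add_left_mono mult_right_mono) auto
      finally show ?thesis .
    qed
    have "4 * \<eta> * c \<le> 4 * \<eta> * Im (cnj N0 * N1)"
      using pos[OF m] \<eta> unfolding N0_def N1_def by (intro mult_left_mono) auto
    then have "(cmod (mnum M' m))^2 \<le> (cmod (mden M' m))^2 + 24 * B * ?r - 4 * \<eta> * c"
      using n2 d2 diff by (simp add: algebra_simps)
    also have "24 * B * ?r \<le> 2 * \<eta> * c"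
    proof -
      have "24 * B^2 * \<eta> \<le> c" using \<eta>(3) B by (simp add: field_simps)
      then have "24 * B^2 * \<eta> * (2 * \<eta>) \<le> c * (2 * \<eta>)" using \<eta> by (intro mult_right_mono) auto
      then show ?thesis by (simp add: power2_eq_square mult_ac)
    qed
    finally have "(cmod (mnum M' m))^2 \<le> (cmod (mden M' m))^2 - 2 * \<eta> * c" by simp
    also have "2 * \<eta> * c = 2 * t * (36 * B^2)" using B by (simp add: t_def)
    also have "(cmod (mden M' m))^2 - 2 * t * (36 * B^2) \<le> (cmod (mden M' m))^2 - 2 * t * (cmod (mden M' m))^2"
    proof -
      have "(cmod (mden M' m))^2 \<le> (6 * B)^2" using dB by (intro power_mono) auto
      then have "2 * t * (cmod (mden M' m))^2 \<le> 2 * t * (36 * B^2)"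
        using t0 by (intro mult_left_mono) (auto simp: power_mult_distrib)
      then show ?thesis by simp
    qed
    also have "\<dots> \<le> ((1 - t) * cmod (mden M' m))^2"
    proof -
      have "((1 - t) * cmod (mden M' m))^2 = (cmod (mden M' m))^2 - 2 * t * (cmod (mden M' m))^2 + (t * cmod (mden M' m))^2"
        by (simp add: power2_eq_square algebra_simps)
      then show ?thesis using zero_le_power2[of "t * cmod (mden M' m)"] by linarith
    qed
    finally show ?thesis by (rule power2_le_imp_le) (use t1 in auto)
  qed
  have "cmod (mnum M' m / mden M' m) \<le> 1 - t"
  proof (rule maximum_modulus_frontier[of "\<lambda>m. mnum M' m / mden M' m" "cball 0 1"])
    have h: "(\<lambda>m. mnum M' m / mden M' m) holomorphic_on cball 0 1"
      by (rule holomorphic_on_divide) (use nz in \<open>auto simp: mnum_def mden_def intro!: holomorphic_intros\<close>)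
    show "(\<lambda>m. mnum M' m / mden M' m) holomorphic_on interior (cball 0 1)"
      using h by (rule holomorphic_on_subset) (simp add: interior_subset)
    show "continuous_on (closure (cball 0 1)) (\<lambda>m. mnum M' m / mden M' m)"
      using h by (simp add: holomorphic_on_imp_continuous_on)
    fix z :: complex assume "z \<in> frontier (cball 0 1)"
    then have z: "cmod z = 1" by (simp add: frontier_cball sphere_def)
    then show "cmod (mnum M' z / mden M' z) \<le> 1 - t"
      using circle[OF z] nz[of z] by (simp add: norm_divide divide_le_eq)
  qed (use m in auto)
  then show ?thesis using nz[OF m] by (simp add: t_def norm_divide divide_le_eq)
qed

lemma lift_sum_order1:
  assumes "0 \<le> \<eta>" "\<eta> \<le> 1"
  shows "cmod (lift_sum (Suc N) f \<eta> x - f 0 x) \<le> \<eta> * (\<Sum>k<Suc N. cmod (f k x))"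
proof -
  have "lift_sum (Suc N) f \<eta> x - f 0 x = (\<Sum>k<N. (\<i> * of_real \<eta>) ^ Suc k / fact (Suc k) * f (Suc k) x)"
    unfolding lift_sum_def by (subst sum.lessThan_Suc_shift) simp
  also have "cmod \<dots> \<le> (\<Sum>k<N. \<eta> * cmod (f (Suc k) x))"
  proof (rule sum_norm_le)
    fix k
    have "\<eta> ^ Suc k / fact (Suc k) \<le> \<eta> / 1"
      using assms by (intro frac_le) (auto simp: mult_left_le power_le_one fact_ge_1 simp del: fact_Suc)
    then have "\<eta> ^ Suc k / fact (Suc k) * cmod (f (Suc k) x) \<le> \<eta> * cmod (f (Suc k) x)"
      by (intro mult_right_mono) auto
    then show "cmod ((\<i> * of_real \<eta>) ^ Suc k / fact (Suc k) * f (Suc k) x) \<le> \<eta> * cmod (f (Suc k) x)"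
      using assms by (simp add: norm_mult norm_divide norm_power power_mult_distrib del: fact_Suc)
  qed
  also have "\<dots> \<le> \<eta> * (\<Sum>k<Suc N. cmod (f k x))"
    using assms by (subst sum.lessThan_Suc_shift) (simp add: sum_distrib_left[symmetric] mult_left_mono)
  finally show ?thesis .
qed

lemma lift_sum_order2:
  assumes "0 \<le> \<eta>" "\<eta> \<le> 1" "N \<ge> 1"
  shows "cmod (lift_sum (Suc N) f \<eta> x - f 0 x - \<i> * of_real \<eta> * f 1 x) \<le> \<eta>^2 * (\<Sum>k<Suc N. cmod (f k x))"
proof -
  obtain n where n: "N = Suc n" using assms(3) by (cases N) auto
  have "lift_sum (Suc N) f \<eta> x - f 0 x - \<i> * of_real \<eta> * f 1 x = (\<Sum>k<n. (\<i> * of_real \<eta>) ^ Suc (Suc k) / fact (Suc (Suc k)) * f (Suc (Suc k)) x)"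
    unfolding lift_sum_def n by (subst sum.lessThan_Suc_shift, subst sum.lessThan_Suc_shift) simp
  also have "cmod \<dots> \<le> (\<Sum>k<n. \<eta>^2 * cmod (f (Suc (Suc k)) x))"
  proof (rule sum_norm_le)
    fix k
    have "\<eta> ^ Suc (Suc k) \<le> \<eta>^2" using assms by (intro power_decreasing) auto
    then have "\<eta> ^ Suc (Suc k) / fact (Suc (Suc k)) \<le> \<eta>^2 / 1"
      using assms by (intro frac_le fact_ge_1) auto
    then have "\<eta> ^ Suc (Suc k) / fact (Suc (Suc k)) * cmod (f (Suc (Suc k)) x) \<le> \<eta>^2 * cmod (f (Suc (Suc k)) x)"
      by (intro mult_right_mono) auto
    then show "cmod ((\<i> * of_real \<eta>) ^ Suc (Suc k) / fact (Suc (Suc k)) * f (Suc (Suc k)) x) \<le> \<eta>^2 * cmod (f (Suc (Suc k)) x)"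
      using assms by (simp add: norm_mult norm_divide norm_power power_mult_distrib del: fact_Suc)
  qed
  also have "\<dots> \<le> \<eta>^2 * (\<Sum>k<Suc N. cmod (f k x))"
    unfolding n using assms
    by (subst sum.lessThan_Suc_shift, subst sum.lessThan_Suc_shift) (simp add: sum_distrib_left[symmetric] mult_left_mono)
  finally show ?thesis .
qed

text \<open>
  The tube lemma: strict positivity at one parameter over a compact set persists, with a uniform bound, for nearby parameters.
\<close>

lemma compact_tube_pos:
  fixes f :: "real \<times> 'k::metric_space \<Rightarrow> real"
  assumes J: "open J" "s \<in> J" and K: "compact K" "K \<noteq> {}" and f: "continuous_on (J \<times> K) f" "\<And>k. k \<in> K \<Longrightarrow> f (s, k) > 0"
  obtains \<rho> c where "\<rho> > 0" "c > 0" "cball s \<rho> \<subseteq> J" "\<And>t k. t \<in> cball s \<rho> \<Longrightarrow> k \<in> K \<Longrightarrow> f (t, k) \<ge> c"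
proof -
  obtain \<rho>1 where \<rho>1: "\<rho>1 > 0" "cball s \<rho>1 \<subseteq> J" using J open_contains_cball by blast
  have c1: "continuous_on (cball s \<rho>1 \<times> K) f" by (rule continuous_on_subset[OF f(1)]) (use \<rho>1 in auto)
  have u: "uniformly_continuous_on (cball s \<rho>1 \<times> K) f"
    by (rule compact_uniformly_continuous[OF c1]) (intro compact_Times compact_cball K)
  have "continuous_on K (\<lambda>k. f (s, k))"
    by (rule continuous_on_compose2[OF f(1)]) (use J in \<open>auto intro!: continuous_intros\<close>)
  from continuous_attains_inf[OF K this] obtain k0 where k0: "k0 \<in> K" "\<And>k. k \<in> K \<Longrightarrow> f (s, k0) \<le> f (s, k)" by blast
  define c where "c = f (s, k0) / 2"
  have c: "c > 0" using f(2)[OF k0(1)] by (simp add: c_def)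
  obtain d where d: "d > 0" "\<And>x y. x \<in> cball s \<rho>1 \<times> K \<Longrightarrow> y \<in> cball s \<rho>1 \<times> K \<Longrightarrow> dist y x < d \<Longrightarrow> dist (f y) (f x) < c"
    using u c unfolding uniformly_continuous_on_def by metis
  show ?thesis
  proof (rule that[of "min \<rho>1 (d / 2)" c])
    show "f (t, k) \<ge> c" if "t \<in> cball s (min \<rho>1 (d / 2))" "k \<in> K" for t k
    proof -
      have "dist (t, k) (s, k) < d" using that d(1) by (simp add: dist_Pair_Pair dist_commute)
      then have "dist (f (t, k)) (f (s, k)) < c" using that \<rho>1 by (intro d(2)) auto
      then show ?thesis using k0(2)[OF that(2)] unfolding dist_real_def c_def by linarith
    qed
  qed (use \<rho>1 d c in auto)
qed

section \<open>Monotone families in disc coordinates\<close>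

definition wder :: "real^'d \<Rightarrow> (real \<times> (real^'d) \<Rightarrow> complex) \<Rightarrow> real \<times> (real^'d) \<Rightarrow> complex" where
  "wder w F p = frechet_derivative F (at p) (0, w)"

text \<open>
  \<open>M\<close> is a smooth family of matrices in disc coordinates (\<open>M_real\<close>), orientation preserving (\<open>M_orient\<close>) and monotone along
  \<open>w\<close> (\<open>M_mono\<close>) at the single parameter \<open>sc\<close>. \<open>P k\<close> abbreviates the \<open>k\<close>-th derivative of \<open>M\<close> along \<open>w\<close>.
\<close>

locale monotone_family =
  fixes J :: "real set" and sc :: real and \<alpha> :: "real \<Rightarrow> real^'d"
    and M :: "real \<times> (real^'d) \<Rightarrow> complex^2^2" and w :: "real^'d" and P
  assumes J: "open J" "sc \<in> J" and \<alpha>: "smooth_on \<alpha> J"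
    and M_smooth: "\<And>i j. smooth_on (\<lambda>p. M p $ i $ j) (J \<times> UNIV)"
    and M_torus: "\<And>s. s \<in> J \<Longrightarrow> torus_map (\<lambda>x. M (s, x))"
    and M_real: "\<And>s x. s \<in> J \<Longrightarrow> M (s, x) $2$1 = cnj (M (s, x) $1$2)" "\<And>s x. s \<in> J \<Longrightarrow> M (s, x) $2$2 = cnj (M (s, x) $1$1)"
    and M_orient: "\<And>x. cmod (M (sc, x) $1$2) < cmod (M (sc, x) $1$1)"
    and P_def: "P = (\<lambda>k p. \<chi> i j. (wder w ^^ k) (\<lambda>p. M p $ i $ j) p)"
    and M_mono: "\<And>x m. cmod m = 1 \<Longrightarrow> 0 < Im (cnj (mnum (M (sc, x)) m) * mnum (P (1::nat) (sc, x)) m)"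
begin

text \<open>
  The lift of order \<open>N\<close> of the family, and the reference denominators. The latter are taken at \<open>sc\<close> for all parameters, so that they
  do not depend on \<open>s\<close>.
\<close>

abbreviation "L N \<eta> s x \<equiv> lift_mat (Suc N) (\<lambda>k x. P k (s, x)) \<eta> x"
abbreviation "Le N \<eta> x \<equiv> lift_sum (Suc N) (\<lambda>k x. P k (sc, x) $2$2) \<eta> x"

lemma P_0 [simp]: "P 0 p = M p" by (simp add: P_def vec_eq_iff)

lemma P_Suc: "P (Suc k) p $ i $ j = wder w (\<lambda>p. P k p $ i $ j) p"
  by (simp add: P_def eta_contract_eq)

lemma P_smooth: "smooth_on (\<lambda>p. P k p $ i $ j) (J \<times> UNIV)"
proof (induction k)
  case (Suc k)
  show ?case unfolding P_Suc wder_def by (rule smooth_on_frechet[OF Suc])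
qed (use M_smooth in simp)

lemma P_continuous: "continuous_on (J \<times> UNIV) (\<lambda>p. P k p $ i $ j)"
  by (rule smooth_on_imp_continuous_on[OF P_smooth])

lemma P_torus_entry: "s \<in> J \<Longrightarrow> torus_map (\<lambda>x. P k (s, x) $ i $ j)"
proof (induction k arbitrary: s)
  case (Suc k)
  show ?case unfolding P_Suc wder_def by (rule torus_family_frechet[OF J(1) P_smooth Suc.IH Suc.prems])
qed (use M_torus in \<open>simp add: torus_map_def\<close>)

lemma P_torus: "s \<in> J \<Longrightarrow> torus_map (\<lambda>x. P k (s, x))"
  using P_torus_entry[of s k] by (auto simp: torus_map_def vec_eq_iff)

lemma P_deriv:
  assumes "s \<in> J"
  shows "((\<lambda>t. P k (s, x + t *\<^sub>R w) $ i $ j) has_vector_derivative P (Suc k) (s, x + t *\<^sub>R w) $ i $ j) (at t)"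
proof -
  let ?F = "\<lambda>p. P k p $ i $ j" and ?p = "(s, x + t *\<^sub>R w)"
  have 1: "(?F has_derivative frechet_derivative ?F (at ?p)) (at ?p)"
    by (rule smooth_on_has_derivative[OF P_smooth]) (use assms in simp)
  have 2: "((\<lambda>t. (s, x + t *\<^sub>R w)) has_derivative (\<lambda>h. h *\<^sub>R (0, w))) (at t)"
    by (auto intro!: derivative_eq_intros)
  have "frechet_derivative ?F (at ?p) (h *\<^sub>R (0, w)) = h *\<^sub>R frechet_derivative ?F (at ?p) (0, w)" for h
    by (rule linear_scale[OF has_derivative_linear[OF 1]])
  then show ?thesis
    using has_derivative_compose[OF 2 1] by (simp add: has_vector_derivative_def P_Suc wder_def)
qed

lemma P1_real:
  assumes "s \<in> J"
  shows "P 1 (s, x) $2$1 = cnj (P 1 (s, x) $1$2)" "P 1 (s, x) $2$2 = cnj (P 1 (s, x) $1$1)"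
proof -
  have *: "P 1 (s, x) $ i $ j = cnj (P 1 (s, x) $ k $ l)" if "\<And>y. M (s, y) $ i $ j = cnj (M (s, y) $ k $ l)" for i j k l
  proof (rule vector_derivative_unique_at)
    show "((\<lambda>t. M (s, x + t *\<^sub>R w) $ i $ j) has_vector_derivative P 1 (s, x) $ i $ j) (at 0)"
      using P_deriv[OF assms, of 0 x i j 0] by simp
    show "((\<lambda>t. M (s, x + t *\<^sub>R w) $ i $ j) has_vector_derivative cnj (P 1 (s, x) $ k $ l)) (at 0)"
      unfolding that using has_vector_derivative_cnj[OF P_deriv[OF assms, of 0 x k l 0]] by simp
  qed
  show "P 1 (s, x) $2$1 = cnj (P 1 (s, x) $1$2)" "P 1 (s, x) $2$2 = cnj (P 1 (s, x) $1$1)"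
    by (rule *, use M_real assms in simp)+
qed

lemma tube_all_x:
  fixes f :: "real \<times> (real^'d) \<Rightarrow> real"
  assumes "continuous_on (J \<times> UNIV) f" "\<And>s. s \<in> J \<Longrightarrow> torus_map (\<lambda>x. f (s, x))" "\<And>x. f (sc, x) > 0"
  obtains \<rho> c where "\<rho> > 0" "c > 0" "cball sc \<rho> \<subseteq> J" "\<And>s x. s \<in> cball sc \<rho> \<Longrightarrow> f (s, x) \<ge> c"
proof -
  have "(0 :: real^'d) \<in> cbox 0 One" by (auto simp: mem_box)
  then have ne: "cbox 0 One \<noteq> ({} :: (real^'d) set)" by blast
  have c0: "continuous_on (J \<times> cbox 0 One) f" by (rule continuous_on_subset[OF assms(1)]) auto
  obtain \<rho> c where *: "\<rho> > 0" "c > 0" "cball sc \<rho> \<subseteq> J" "\<And>s x. s \<in> cball sc \<rho> \<Longrightarrow> x \<in> cbox 0 One \<Longrightarrow> f (s, x) \<ge> c"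
    by (rule compact_tube_pos[OF J compact_cbox ne c0]) (use assms(3) in auto)
  have "f (s, x) \<ge> c" if s: "s \<in> cball sc \<rho>" for s x
  proof -
    obtain y where y: "y \<in> cbox 0 One" "\<And>f :: real^'d \<Rightarrow> real. torus_map f \<Longrightarrow> f x = f y"
      using torus_representative[of x] by blast
    have "s \<in> J" using s *(3) by blast
    then have "f (s, x) = f (s, y)" using y(2)[OF assms(2)] by blast
    then show ?thesis using *(4)[OF s y(1)] by simp
  qed
  then show ?thesis using that * by blast
qed

lemma P_bounded:
  assumes "compact K" "K \<subseteq> J"
  obtains B where "B > 0" "\<And>s x i j. s \<in> K \<Longrightarrow> (\<Sum>k<n. cmod (P k (s, x) $ i $ j)) \<le> B"
proof -
  let ?F = "\<lambda>p. of_real (\<Sum>i\<in>UNIV. \<Sum>j\<in>UNIV. \<Sum>k<n. cmod (P k p $ i $ j)) :: complex"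
  have "continuous_on (J \<times> UNIV) ?F"
    by (intro continuous_intros P_continuous)
  moreover have "torus_map (\<lambda>x. ?F (s, x))" if "s \<in> J" for s
    using P_torus[OF that] by (simp add: torus_map_def)
  ultimately obtain B where B: "B > 0" "\<And>s x. s \<in> K \<Longrightarrow> cmod (?F (s, x)) \<le> B"
    using torus_family_bounded[of J ?F K] assms by blast
  have "(\<Sum>k<n. cmod (P k (s, x) $ i $ j)) \<le> B" if "s \<in> K" for s x i j
  proof -
    have "(\<Sum>k<n. cmod (P k (s, x) $ i $ j)) \<le> (\<Sum>j\<in>UNIV. \<Sum>k<n. cmod (P k (s, x) $ i $ j))"
      by (rule member_le_sum[of j UNIV "\<lambda>j. \<Sum>k<n. cmod (P k (s, x) $ i $ j)"]) (auto intro!: sum_nonneg)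
    also have "\<dots> \<le> (\<Sum>i\<in>UNIV. \<Sum>j\<in>UNIV. \<Sum>k<n. cmod (P k (s, x) $ i $ j))"
      by (rule member_le_sum[of i UNIV "\<lambda>i. \<Sum>j\<in>UNIV. \<Sum>k<n. cmod (P k (s, x) $ i $ j)"]) (auto intro!: sum_nonneg)
    also have "\<dots> \<le> B" using B(2)[OF that, of x] unfolding norm_of_real by (rule order_trans[OF abs_ge_self])
    finally show ?thesis .
  qed
  then show ?thesis using that B(1) by blast
qed

text \<open>
  The quantitative hypotheses on which all later estimates rest: admissibility at height \<open>0\<close>, and at heights \<open>\<eta> \<le> \<eta>0\<close> contraction by \<open>1 - \<kappa> \<eta>\<close> with
  robustness at the scale \<open>c \<eta>\<close>.
\<close>

definition fam_ok :: "real \<Rightarrow> nat \<Rightarrow> real \<Rightarrow> real \<Rightarrow> real \<Rightarrow> real \<Rightarrow> bool" where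
  "fam_ok \<rho> N q \<eta>0 c \<kappa> \<longleftrightarrow> 0 \<le> q \<and> q < 1 \<and> 0 < \<eta>0 \<and> \<eta>0 \<le> 1 \<and> c > 0 \<and> \<kappa> > 0 \<and> \<kappa> * \<eta>0 \<le> 1/2 \<and>
    (\<forall>s\<in>cball sc \<rho>. \<forall>x. adm 1 q (M (s, x)) (M (sc, x) $2$2)) \<and>
    (\<forall>s\<in>cball sc \<rho>. \<forall>x \<eta>. 0 < \<eta> \<longrightarrow> \<eta> \<le> \<eta>0 \<longrightarrow>
       adm (1 - \<kappa> * \<eta>) q (L N \<eta> s x) (Le N \<eta> x) \<and> robust (c * \<eta>) q (L N \<eta> s x) (Le N \<eta> x))"

text \<open>
  By compactness the hypotheses at \<open>sc\<close> hold with uniform constants on a ball of parameters. It is chosen independently of \<open>N\<close>, since all orders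
  of approximation are needed on the same ball.
\<close>

lemma adm_family:
  obtains \<rho> where "\<rho> > 0" "cball sc \<rho> \<subseteq> J" "\<And>N. N \<ge> 1 \<Longrightarrow> \<exists>q \<eta>0 c \<kappa>. fam_ok \<rho> N q \<eta>0 c \<kappa>"
proof -
  have cM: "continuous_on (J \<times> UNIV) (\<lambda>p. M p $ i $ j)" for i j using P_continuous[of 0] by simp
  have tM: "torus_map (\<lambda>x. M (s, x))" if "s \<in> J" for s by (rule M_torus[OF that])
  obtain \<rho>1 \<mu> where 1: "\<rho>1 > 0" "\<mu> > 0" "cball sc \<rho>1 \<subseteq> J"
    "\<And>s x. s \<in> cball sc \<rho>1 \<Longrightarrow> cmod (M (s, x) $1$1) - cmod (M (s, x) $1$2) \<ge> \<mu>"
  proof (rule tube_all_x[of "\<lambda>p. cmod (M p $1$1) - cmod (M p $1$2)"])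
    show "continuous_on (J \<times> UNIV) (\<lambda>p. cmod (M p $1$1) - cmod (M p $1$2))" by (intro continuous_intros cM)
    show "torus_map (\<lambda>x. cmod (M (s, x) $1$1) - cmod (M (s, x) $1$2))" if "s \<in> J" for s
      using tM[OF that] by (simp add: torus_map_def)
  qed (use M_orient in auto)
  obtain \<rho>2 \<mu>' where 2: "\<rho>2 > 0" "\<mu>' > 0" "cball sc \<rho>2 \<subseteq> J"
    "\<And>s x. s \<in> cball sc \<rho>2 \<Longrightarrow> \<mu> / 8 - cmod (M (s, x) $2$2 - M (sc, x) $2$2) \<ge> \<mu>'"
  proof (rule tube_all_x[of "\<lambda>p. \<mu> / 8 - cmod (M p $2$2 - M (sc, snd p) $2$2)"])
    show "continuous_on (J \<times> UNIV) (\<lambda>p. \<mu> / 8 - cmod (M p $2$2 - M (sc, snd p) $2$2))"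
      by (intro continuous_intros cM continuous_on_compose2[OF cM, of _ "\<lambda>p. (sc, snd p)"]) (use J in auto)
    show "torus_map (\<lambda>x. \<mu> / 8 - cmod (M (s, x) $2$2 - M (sc, snd (s, x)) $2$2))" if "s \<in> J" for s
      using tM[OF that] tM[OF J(2)] by (simp add: torus_map_def)
  qed (use 1 in auto)
  obtain \<rho>3 c3 where 3: "\<rho>3 > 0" "c3 > 0" "cball sc \<rho>3 \<subseteq> J"
    "\<And>s x m. s \<in> cball sc \<rho>3 \<Longrightarrow> cmod m = 1 \<Longrightarrow> Im (cnj (mnum (M (s, x)) m) * mnum (P 1 (s, x)) m) \<ge> c3"
  proof -
    let ?f = "\<lambda>z. Im (cnj (mnum (M (fst z, fst (snd z))) (snd (snd z))) * mnum (P 1 (fst z, fst (snd z))) (snd (snd z)))"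
    let ?K = "cbox 0 One \<times> sphere 0 1 :: ((real^'d) \<times> complex) set"
    have "(0, 1) \<in> ?K" by (auto simp: mem_box)
    then have ne: "?K \<noteq> {}" by blast
    have cP: "continuous_on (J \<times> ?K) (\<lambda>z. P k (fst z, fst (snd z)) $ i $ j)" for k i j
      by (rule continuous_on_compose2[OF P_continuous]) (auto intro!: continuous_intros)
    have cont: "continuous_on (J \<times> ?K) ?f"
      unfolding mnum_def by (intro continuous_intros cP cP[of 0, unfolded P_0])
    obtain \<rho>3 c3 where *: "\<rho>3 > 0" "c3 > 0" "cball sc \<rho>3 \<subseteq> J" "\<And>s k. s \<in> cball sc \<rho>3 \<Longrightarrow> k \<in> ?K \<Longrightarrow> ?f (s, k) \<ge> c3"
      by (rule compact_tube_pos[OF J _ ne cont]) (use M_mono in \<open>auto intro!: compact_Times\<close>)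
    have "Im (cnj (mnum (M (s, x)) m) * mnum (P 1 (s, x)) m) \<ge> c3" if s: "s \<in> cball sc \<rho>3" and m: "cmod m = 1" for s x m
    proof -
      obtain y where y: "y \<in> cbox 0 One" "\<And>f :: real^'d \<Rightarrow> complex^2^2. torus_map f \<Longrightarrow> f x = f y"
        using torus_representative[of x] by blast
      have "s \<in> J" using s *(3) by blast
      then have "P k (s, x) = P k (s, y)" for k using y(2)[OF P_torus] by blast
      from this[of 0] this[of 1] show ?thesis using *(4)[OF s, of "(y, m)"] y(1) m by simp
    qed
    then show ?thesis using that * by blast
  qed
  define \<rho> where "\<rho> = min \<rho>1 (min \<rho>2 \<rho>3)"
  have \<rho>: "\<rho> > 0" "cball sc \<rho> \<subseteq> J" using 1 2 3 by (auto simp: \<rho>_def)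
  have main: "\<exists>q \<eta>0 c \<kappa>. fam_ok \<rho> N q \<eta>0 c \<kappa>" if N: "N \<ge> 1" for N
  proof -
  obtain B where B: "B > 0" "\<And>s x i j. s \<in> cball sc \<rho> \<Longrightarrow> (\<Sum>k<Suc N. cmod (P k (s, x) $ i $ j)) \<le> B"
    using P_bounded[OF compact_cball \<rho>(2)] by blast
  have sc: "sc \<in> cball sc \<rho>" using \<rho> by simp
  have BP: "cmod (P k (s, x) $ i $ j) \<le> B" if "s \<in> cball sc \<rho>" "k \<le> N" for s x k i j
    using B(2)[OF that(1), of x i j] member_le_sum[of k "{..<Suc N}" "\<lambda>k. cmod (P k (s, x) $ i $ j)"] that(2)
    by (force simp del: sum.lessThan_Suc)
  have BM: "cmod (M (s, x) $ i $ j) \<le> B" if "s \<in> cball sc \<rho>" for s x i j using BP[OF that, of 0] by simp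
  have e0: "\<mu> \<le> cmod (M (sc, x) $2$2)" "cmod (M (sc, x) $2$2) \<le> B" for x
  proof -
    have "cmod (M (sc, x) $2$2) = cmod (M (sc, x) $1$1)" using M_real(2)[OF J(2)] by simp
    then show "\<mu> \<le> cmod (M (sc, x) $2$2)" using 1(4)[of sc x] 1(1) by simp (smt (verit) norm_ge_zero)
    show "cmod (M (sc, x) $2$2) \<le> B" by (rule BM[OF sc])
  qed
  have \<mu>B: "\<mu> \<le> B" using e0[of 0] by simp
  \<comment> \<open>Three margins: at height \<open>0\<close>, at small heights, and for perturbations of the latter.\<close>
  define q0 where "q0 = 1 - 3 * \<mu> / (4 * B)"
  define q1 where "q1 = 1 - \<mu> / (2 * B)"
  define q2 where "q2 = 1 - \<mu> / (4 * B)"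
  have q: "0 \<le> q0" "q1 - q0 = \<mu> / (4 * B)" "q2 - q1 = \<mu> / (4 * B)" "q2 < 1" "q1 < 1" "0 \<le> q1" "q0 \<le> q1" "q1 \<le> q2" "q0 \<le> q2" "0 \<le> q2"
    using \<mu>B B(1) 1(2) by (auto simp: q0_def q1_def q2_def field_simps)
  define \<kappa> where "\<kappa> = c3 / (36 * B^2)"
  define c where "c = \<kappa> * \<mu>^2 / (64 * B)"
  have \<kappa>c: "\<kappa> > 0" "c > 0" using 3(2) B(1) 1(2) by (auto simp: \<kappa>_def c_def)
  define \<eta>0 where "\<eta>0 = min 1 (min (\<mu>^2 / (32 * B^2)) (min (c3 / (24 * B^2)) (1 / (2 * \<kappa>))))"
  have \<eta>0: "\<eta>0 > 0" "\<eta>0 \<le> 1" "\<eta>0 \<le> \<mu>^2 / (32 * B^2)" "\<eta>0 \<le> c3 / (24 * B^2)" "\<eta>0 \<le> 1 / (2 * \<kappa>)"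
    using 1 3 B \<kappa>c by (auto simp: \<eta>0_def)
  have \<kappa>\<eta>: "\<kappa> * \<eta>0 \<le> 1 / 2" using \<eta>0(5) \<kappa>c by (simp add: field_simps)
  have a0: "adm 1 q0 (M (s, x)) (M (sc, x) $2$2)" if s: "s \<in> cball sc \<rho>" for s x
    unfolding adm_def
  proof (intro conjI allI impI)
    have sJ: "s \<in> J" using s \<rho> by blast
    show "M (sc, x) $2$2 \<noteq> 0" using e0(1)[of x] 1(2) by auto
    fix m :: complex assume m: "cmod m \<le> 1"
    let ?a = "M (s, x) $1$1" and ?b = "M (s, x) $1$2" and ?e = "M (sc, x) $2$2"
    have s1: "s \<in> cball sc \<rho>1" "s \<in> cball sc \<rho>2" using s by (auto simp: \<rho>_def)
    have ab: "cmod ?a - cmod ?b \<ge> \<mu>" by (rule 1(4)[OF s1(1)])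
    have ae: "cmod (M (s, x) $2$2 - ?e) \<le> \<mu> / 8" using 2(4)[OF s1(2), of x] 2(2) by simp
    have "cmod ?a = cmod (M (s, x) $2$2)" using M_real(2)[OF sJ] by simp
    then have "cmod ?a \<le> cmod ?e + \<mu> / 8" using ae norm_triangle_ineq2[of "M (s, x) $2$2" ?e] by simp
    moreover have eq: "mden (M (s, x)) m - ?e = M (s, x) $2$1 * m + (M (s, x) $2$2 - ?e)" by (simp add: mden_def)
    moreover have "cmod (M (s, x) $2$1 * m) \<le> cmod ?b * 1"
      unfolding norm_mult M_real(1)[OF sJ] using m by (intro mult_mono) auto
    ultimately have "cmod (mden (M (s, x)) m - ?e) \<le> cmod ?e - 3 * \<mu> / 4"
      unfolding eq using ae ab norm_triangle_ineq[of "M (s, x) $2$1 * m" "M (s, x) $2$2 - ?e"] by linarith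
    also have "\<dots> \<le> q0 * cmod ?e"
    proof -
      have "3 * \<mu> / (4 * B) * cmod ?e \<le> 3 * \<mu> / (4 * B) * B"
        using e0(2)[of x] B 1 by (intro mult_left_mono) auto
      then show ?thesis using B(1) by (simp add: q0_def left_diff_distrib)
    qed
    finally show "cmod (mden (M (s, x)) m - ?e) \<le> q0 * cmod ?e" .
    have "(cmod (cnj ?b * m + cnj ?a))^2 - (cmod (?a * m + ?b))^2 = ((cmod ?a)^2 - (cmod ?b)^2) * (1 - (cmod m)^2)"
      unfolding cmod_power2 by (simp add: power2_eq_square algebra_simps)
    moreover have "\<dots> \<ge> 0"
      using ab 1(2) m by (intro mult_nonneg_nonneg) (auto intro!: power_mono simp: power_le_one)
    ultimately have "(cmod (?a * m + ?b))^2 \<le> (cmod (cnj ?b * m + cnj ?a))^2" by linarith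
    then have "cmod (?a * m + ?b) \<le> cmod (cnj ?b * m + cnj ?a)" by (rule power2_le_imp_le) simp
    then show "cmod (mnum (M (s, x)) m) \<le> 1 * cmod (mden (M (s, x)) m)"
      by (simp add: mnum_def mden_def M_real[OF sJ])
  qed
  have a1: "adm (1 - \<kappa> * \<eta>) q1 (L N \<eta> s x) (Le N \<eta> x)" "cmod (Le N \<eta> x) \<ge> \<mu> / 2"
    if s: "s \<in> cball sc \<rho>" and \<eta>: "0 < \<eta>" "\<eta> \<le> \<eta>0" for s x \<eta>
  proof -
    have sJ: "s \<in> J" using s \<rho> by blast
    have \<eta>1: "0 \<le> \<eta>" "\<eta> \<le> 1" using \<eta> \<eta>0 by auto
    have dL: "cmod (L N \<eta> s x $ i $ k - M (s, x) $ i $ k) \<le> \<eta> * B" for i k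
    proof -
      have "cmod (L N \<eta> s x $ i $ k - P 0 (s, x) $ i $ k) \<le> \<eta> * (\<Sum>l<Suc N. cmod (P l (s, x) $ i $ k))"
        unfolding lift_mat_def using lift_sum_order1[OF \<eta>1, of N "\<lambda>l x. P l (s, x) $ i $ k" x] by simp
      also have "\<dots> \<le> \<eta> * B" using B(2)[OF s] \<eta>1 by (intro mult_left_mono) auto
      finally show ?thesis by simp
    qed
    have dE: "cmod (Le N \<eta> x - M (sc, x) $2$2) \<le> \<eta> * B"
    proof -
      have "cmod (Le N \<eta> x - P 0 (sc, x) $2$2) \<le> \<eta> * (\<Sum>l<Suc N. cmod (P l (sc, x) $2$2))"
        using lift_sum_order1[OF \<eta>1, of N "\<lambda>l x. P l (sc, x) $2$2" x] by simp
      also have "\<dots> \<le> \<eta> * B" using B(2)[OF sc] \<eta>1 by (intro mult_left_mono) auto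
      finally show ?thesis by simp
    qed
    have \<eta>B: "8 * (\<eta> * B) \<le> \<mu> / (4 * B) * \<mu>"
    proof -
      have "\<eta> \<le> \<mu>^2 / (32 * B^2)" using \<eta> \<eta>0 by simp
      then have "32 * (\<eta> * B^2) \<le> \<mu>^2" using B(1) by (simp add: field_simps)
      then show ?thesis using B(1) by (simp add: field_simps power2_eq_square)
    qed
    have "adm 2 q1 (L N \<eta> s x) (Le N \<eta> x)"
    proof (rule adm_perturb[OF a0[OF s], where em = \<mu> and \<epsilon> = "\<eta> * B"])
      show "8 * (\<eta> * B) \<le> (q1 - q0) * \<mu>" using \<eta>B q by simp
      have "\<mu> / (4 * B) * \<mu> \<le> \<mu> / (2 * B) * \<mu>" using B(1) 1(2) by (intro mult_right_mono frac_le) auto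
      then show "8 * (\<eta> * B) \<le> (2 - 1) * (1 - q1) * \<mu>" using \<eta>B by (simp add: q1_def)
    qed (use q e0 \<eta>1 B 1 dL dE in auto)
    note a2 = this
    have nz: "mden (L N \<eta> s x) m \<noteq> 0" if "cmod m \<le> 1" for m by (rule adm_den_nz[OF a2 q(5) that])
    have num: "cmod (mnum (L N \<eta> s x) m) \<le> (1 - c3 / (36 * B^2) * \<eta>) * cmod (mden (L N \<eta> s x) m)" if m: "cmod m \<le> 1" for m
    proof (rule cone_contraction[where M = "M (s, x)" and P = "P 1 (s, x)"])
      show "c3 \<le> Im (cnj (mnum (M (s, x)) m) * mnum (P 1 (s, x)) m)" if "cmod m = 1" for m
        by (rule 3(4)) (use s that in \<open>auto simp: \<rho>_def\<close>)
      show "cmod (L N \<eta> s x $ i $ k - M (s, x) $ i $ k - \<i> * of_real \<eta> * P 1 (s, x) $ i $ k) \<le> B * \<eta>^2" for i k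
      proof -
        have "cmod (L N \<eta> s x $ i $ k - P 0 (s, x) $ i $ k - \<i> * of_real \<eta> * P 1 (s, x) $ i $ k) \<le> \<eta>^2 * (\<Sum>l<Suc N. cmod (P l (s, x) $ i $ k))"
          unfolding lift_mat_def using lift_sum_order2[OF \<eta>1 N, of "\<lambda>l x. P l (s, x) $ i $ k" x] by simp
        also have "\<dots> \<le> \<eta>^2 * B" using B(2)[OF s] by (intro mult_left_mono) auto
        finally show ?thesis by (simp add: mult.commute)
      qed
    qed (use M_real[OF sJ] P1_real[OF sJ] 3(2) BM[OF s] BP[OF s N] B(1) \<eta> \<eta>0 nz m in auto)
    show "adm (1 - \<kappa> * \<eta>) q1 (L N \<eta> s x) (Le N \<eta> x)"
      using a2 num unfolding adm_def \<kappa>_def by blast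
    have "\<eta> * B \<le> \<mu> / 2"
    proof -
      have "\<mu> / (4 * B) * \<mu> \<le> 1 * \<mu>" using \<mu>B B(1) 1(2) by (intro mult_right_mono) auto
      then show ?thesis using \<eta>B 1(2) by linarith
    qed
    then show "cmod (Le N \<eta> x) \<ge> \<mu> / 2"
      using dE e0(1)[of x] norm_triangle_ineq2[of "M (sc, x) $2$2" "Le N \<eta> x"] by (simp add: norm_minus_commute)
  qed
    have A1: "adm 1 q2 (M (s, x)) (M (sc, x) $2$2)" if "s \<in> cball sc \<rho>" for s x
      by (rule adm_mono[OF a0[OF that]]) (use q in auto)
    have A2: "adm (1 - \<kappa> * \<eta>) q2 (L N \<eta> s x) (Le N \<eta> x)" if "s \<in> cball sc \<rho>" "0 < \<eta>" "\<eta> \<le> \<eta>0" for s x \<eta>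
      by (rule adm_mono[OF a1(1)[OF that]]) (use q in auto)
    have A3: "robust (c * \<eta>) q2 (L N \<eta> s x) (Le N \<eta> x)" if h: "s \<in> cball sc \<rho>" "0 < \<eta>" "\<eta> \<le> \<eta>0" for s x \<eta>
    proof (rule adm_imp_robust[OF a1(1)[OF h], where em = "\<mu> / 2"])
      have eq: "8 * (c * \<eta>) = \<kappa> * \<eta> * (\<mu> / (4 * B)) * (\<mu> / 2)"
        using B(1) by (simp add: c_def power2_eq_square)
      show "8 * (c * \<eta>) \<le> \<kappa> * \<eta> * (1 - q2) * (\<mu> / 2)" unfolding eq by (simp add: q2_def)
      have "\<kappa> * \<eta> \<le> \<kappa> * \<eta>0" using h \<kappa>c by simp
      then have "\<kappa> * \<eta> \<le> 1" using \<kappa>\<eta> by linarith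
      then have "\<kappa> * \<eta> * (\<mu> / (4 * B)) * (\<mu> / 2) \<le> 1 * (\<mu> / (4 * B)) * (\<mu> / 2)"
        using B(1) 1(2) by (intro mult_right_mono) auto
      then show "8 * (c * \<eta>) \<le> (q2 - q1) * (\<mu> / 2)" unfolding eq q by simp
    qed (use q \<kappa>c h 1 a1(2)[OF h] in auto)
    have "fam_ok \<rho> N q2 \<eta>0 c \<kappa>"
      unfolding fam_ok_def using q \<eta>0 \<kappa>c \<kappa>\<eta> A1 A2 A3 by blast
    then show ?thesis by blast
  qed
  show ?thesis by (rule that[OF \<rho> main])
qed

end

section \<open>The limit over long chains\<close>

lemma Cesaro_mean:
  fixes f :: "nat \<Rightarrow> real"
  assumes "f \<longlonglongrightarrow> l"
  shows "(\<lambda>n. (\<Sum>j<n. f j) / real n) \<longlonglongrightarrow> l"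
proof (rule LIMSEQ_I)
  fix r :: real assume r: "r > 0"
  obtain n0 where n0: "\<And>n. n \<ge> n0 \<Longrightarrow> \<bar>f n - l\<bar> < r / 2"
    using LIMSEQ_D[OF assms, of "r/2"] r by auto
  define A where "A = (\<Sum>j<n0. \<bar>f j - l\<bar>)"
  obtain n1 where n1: "2 * A / r < real n1" using reals_Archimedean2 by blast
  show "\<exists>no. \<forall>n\<ge>no. norm ((\<Sum>j<n. f j) / real n - l) < r"
  proof (intro exI[of _ "Suc (max n0 n1)"] allI impI)
    fix n assume n: "n \<ge> Suc (max n0 n1)"
    have "A < r / 2 * real n"
    proof -
      have "2 * A < r * real n1" using n1 r by (simp add: field_simps)
      also have "r * real n1 \<le> r * real n" using n r by (intro mult_left_mono) auto
      finally show ?thesis by simp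
    qed
    moreover have "\<bar>\<Sum>j<n. (f j - l)\<bar> \<le> A + r / 2 * real n"
    proof -
      have "\<bar>\<Sum>j<n. (f j - l)\<bar> \<le> (\<Sum>j<n. \<bar>f j - l\<bar>)" by (rule sum_abs)
      also have "(\<Sum>j<n. \<bar>f j - l\<bar>) = A + (\<Sum>j\<in>{n0..<n}. \<bar>f j - l\<bar>)"
        unfolding A_def lessThan_atLeast0 using n by (subst sum.atLeastLessThan_concat) auto
      also have "(\<Sum>j\<in>{n0..<n}. \<bar>f j - l\<bar>) \<le> (\<Sum>j\<in>{n0..<n}. r / 2)"
        using n0 by (intro sum_mono) (auto intro: less_imp_le)
      also have "\<dots> \<le> r / 2 * real n" using r by (simp add: mult.commute mult_left_mono)
      finally show ?thesis by simp
    qed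
    ultimately have "\<bar>\<Sum>j<n. (f j - l)\<bar> < r * real n" by simp
    moreover have "(\<Sum>j<n. f j) / real n - l = (\<Sum>j<n. (f j - l)) / real n"
      using n by (simp add: sum_subtractf field_simps)
    ultimately show "norm ((\<Sum>j<n. f j) / real n - l) < r" using n by (simp add: divide_less_eq)
  qed
qed

lemma lift_sum_0: "lift_sum (Suc N) f 0 x = f 0 x"
  unfolding lift_sum_def by (subst sum.lessThan_Suc_shift) simp

lemma lterm_cong:
  assumes "\<And>i. i \<le> n \<Longrightarrow> M i = M' i" "e n = e' n"
  shows "lterm M e n = lterm M' e' n"
proof -
  have "orb M 0 k = orb M' 0 k" if "k \<le> n" for k
    using that by (induction k) (use assms in auto)
  then show ?thesis using assms by (simp add: lterm_def)
qed

context monotone_family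
begin

text \<open>
  The integrand for the factor number \<open>j\<close> of the chain that starts at \<open>x\<close>; its integral \<open>U\<close> over the torus is the contribution of
  this factor to the exponent.
\<close>

definition F where
  "F N \<eta> s j x = lterm (\<lambda>i. L N \<eta> s (x + real i *\<^sub>R \<alpha> s)) (\<lambda>i. Le N \<eta> (x + real i *\<^sub>R \<alpha> s)) j"

definition U where "U N \<eta> s j = integral (cbox 0 One) (F N \<eta> s j)"

lemma L_0: "L N 0 s x = M (s, x)" by (simp add: lift_mat_def lift_sum_0 vec_eq_iff)

lemma Le_0: "Le N 0 x = M (sc, x) $2$2" by (simp add: lift_sum_0)

lemma U_0: "U N 0 s j = U 1 0 s j" unfolding U_def F_def L_0 Le_0 ..

lemma P_cont_x: "s \<in> J \<Longrightarrow> continuous_on UNIV (\<lambda>x. P k (s, x) $ i $ j)"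
  by (rule continuous_on_compose2[OF P_continuous]) (auto intro!: continuous_intros)

lemma L_cont: "s \<in> J \<Longrightarrow> continuous_on S g \<Longrightarrow> continuous_on S (\<lambda>y. L N \<eta> s (g y) $ i $ j)"
  unfolding lift_mat_def vec_lambda_beta by (intro lift_sum_continuous_on P_cont_x continuous_intros)

lemma Le_cont: "continuous_on S g \<Longrightarrow> continuous_on S (\<lambda>y. Le N \<eta> (g y))"
  by (intro lift_sum_continuous_on P_cont_x continuous_intros J)

lemma L_torus: "s \<in> J \<Longrightarrow> torus_map (\<lambda>x. L N \<eta> s (x + v))"
  by (rule torus_map_shift) (use P_torus in \<open>simp add: torus_map_def lift_mat_def lift_sum_def\<close>)

lemma Le_torus: "torus_map (\<lambda>x. Le N \<eta> (x + v))"
  by (rule torus_map_shift) (use P_torus[OF J(2)] in \<open>simp add: torus_map_def lift_sum_def\<close>)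

context
  fixes \<rho> N q \<eta>0 c \<kappa>
  assumes ok: "fam_ok \<rho> N q \<eta>0 c \<kappa>" and \<rho>J: "cball sc \<rho> \<subseteq> J"
begin

lemma okD: "0 \<le> q" "q < 1" "0 < \<eta>0" "\<eta>0 \<le> 1" "c > 0" "\<kappa> > 0" "\<kappa> * \<eta>0 \<le> 1/2"
  using ok by (auto simp: fam_ok_def)

lemma ok_adm: "s \<in> cball sc \<rho> \<Longrightarrow> 0 < \<eta> \<Longrightarrow> \<eta> \<le> \<eta>0 \<Longrightarrow> adm (1 - \<kappa> * \<eta>) q (L N \<eta> s x) (Le N \<eta> x)"
  and ok_robust: "s \<in> cball sc \<rho> \<Longrightarrow> 0 < \<eta> \<Longrightarrow> \<eta> \<le> \<eta>0 \<Longrightarrow> robust (c * \<eta>) q (L N \<eta> s x) (Le N \<eta> x)"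
  using ok by (auto simp: fam_ok_def)

lemma ok_adm1: "s \<in> cball sc \<rho> \<Longrightarrow> 0 \<le> \<eta> \<Longrightarrow> \<eta> \<le> \<eta>0 \<Longrightarrow> adm 1 q (L N \<eta> s x) (Le N \<eta> x)"
proof (cases "\<eta> = 0")
  case True
  then show "s \<in> cball sc \<rho> \<Longrightarrow> 0 \<le> \<eta> \<Longrightarrow> \<eta> \<le> \<eta>0 \<Longrightarrow> adm 1 q (L N \<eta> s x) (Le N \<eta> x)"
    using ok by (auto simp: fam_ok_def L_0 Le_0)
next
  case False
  then show "s \<in> cball sc \<rho> \<Longrightarrow> 0 \<le> \<eta> \<Longrightarrow> \<eta> \<le> \<eta>0 \<Longrightarrow> adm 1 q (L N \<eta> s x) (Le N \<eta> x)"
    using ok_adm[of s \<eta> x] okD by (intro adm_mono[OF ok_adm]) auto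
qed

lemma F_cont:
  assumes s: "s \<in> cball sc \<rho>" and \<eta>: "0 \<le> \<eta>" "\<eta> \<le> \<eta>0"
  shows "continuous_on S (F N \<eta> s j)"
  unfolding F_def
proof (rule adm_lterm_continuous_on[where q = q])
  have sJ: "s \<in> J" using s \<rho>J by blast
  show "continuous_on S (\<lambda>x. L N \<eta> s (x + real i *\<^sub>R \<alpha> s) $ a $ b)" for i a b
    by (intro L_cont sJ continuous_intros)
  show "continuous_on S (\<lambda>x. Le N \<eta> (x + real j *\<^sub>R \<alpha> s))"
    by (intro Le_cont continuous_intros)
qed (use ok_adm1[OF s \<eta>] okD in auto)

lemma F_torus: "s \<in> J \<Longrightarrow> torus_map (F N \<eta> s j)"
  using L_torus Le_torus unfolding torus_map_def F_def by presburger

lemma height_error: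
  assumes N: "N \<ge> 1"
  obtains C where "C > 0" "\<And>s j \<eta>. s \<in> cball sc \<rho> \<Longrightarrow> 0 < \<eta> \<Longrightarrow> \<eta> \<le> \<eta>0 \<Longrightarrow> cmod (U N \<eta> s j - U 1 0 s j) \<le> C * \<eta> ^ N"
proof -
  obtain B where B: "B > 0" "\<And>s x i j. s \<in> cball sc \<rho> \<Longrightarrow> (\<Sum>k<N + 2. cmod (P k (s, x) $ i $ j)) \<le> B"
    using P_bounded[OF compact_cball \<rho>J] by blast
  have BP: "cmod (P (Suc N) (s, x) $ i $ j) \<le> B" if "s \<in> cball sc \<rho>" for s x i j
    using B(2)[OF that, of x i j] member_le_sum[of "Suc N" "{..<N + 2}" "\<lambda>k. cmod (P k (s, x) $ i $ j)"]
    by (force simp del: sum.lessThan_Suc)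
  show ?thesis
  proof (rule that[of "2 * lbound q * B / c"])
    show "2 * lbound q * B / c > 0" using lbound_pos okD B by auto
    fix s j \<eta> assume s: "s \<in> cball sc \<rho>" and \<eta>: "0 < \<eta>" "\<eta> \<le> \<eta>0"
    have sJ: "s \<in> J" "sc \<in> cball sc \<rho>" using s \<rho>J by (auto intro: order_trans[OF zero_le_dist])
    \<comment> \<open>The constant depends on the derivatives up to order \<open>N + 1\<close> only, not on \<open>s\<close> or \<open>j\<close>.\<close>
    have "cmod (integral (cbox 0 One) (\<lambda>x. lterm (\<lambda>j. L N \<eta> s (x + real j *\<^sub>R \<alpha> s)) (\<lambda>j. Le N \<eta> (x + real j *\<^sub>R \<alpha> s)) j)
       - integral (cbox 0 One) (\<lambda>x. lterm (\<lambda>j. L N 0 s (x + real j *\<^sub>R \<alpha> s)) (\<lambda>j. Le N 0 (x + real j *\<^sub>R \<alpha> s)) j))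
       \<le> 2 * lbound q * B / c * \<eta> ^ N"
      by (rule height_independence[where w = w and q = q and ?\<eta>0.0 = \<eta>0 and P = "\<lambda>k x. P k (s, x)"
            and E = "\<lambda>k x. P k (sc, x) $2$2" and \<alpha> = "\<alpha> s" and n = j and N = N and B = B and c = c and \<eta> = \<eta>])
        (use P_deriv[OF sJ(1)] P_deriv[OF J(2), of _ _ 2 2] BP[OF s] BP[OF sJ(2)] ok_adm1[OF s] ok_robust[OF s] P_cont_x sJ J
          P_torus[OF sJ(1)] P_torus_entry[OF J(2), of _ 2 2] N okD B \<eta> in auto)
    then show "cmod (U N \<eta> s j - U 1 0 s j) \<le> 2 * lbound q * B / c * \<eta> ^ N"
      unfolding U_0[of N, symmetric] unfolding U_def F_def .
  qed
qed

text \<open>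
  By translation invariance consecutive integrals compare a chain with the same chain without its first map; \<open>lterm_contract\<close> makes
  the differences a geometric series.
\<close>

lemma U_tail:
  assumes s: "s \<in> cball sc \<rho>" and \<eta>: "0 < \<eta>" "\<eta> \<le> \<eta>0"
  shows "cmod (U N \<eta> s (p + m) - U N \<eta> s p) \<le> 2 / (1 - q) * (1 - \<kappa> * \<eta>) ^ p / (\<kappa> * \<eta>)"
proof -
  let ?r = "1 - \<kappa> * \<eta>"
  have "\<kappa> * \<eta> \<le> \<kappa> * \<eta>0" using \<eta> okD by simp
  moreover have "0 < \<kappa> * \<eta>" using \<eta> okD by simp
  ultimately have r: "0 < ?r" "?r < 1" using okD by linarith+
  have sJ: "s \<in> J" using s \<rho>J by blast
  have step: "cmod (U N \<eta> s (Suc j) - U N \<eta> s j) \<le> 2 / (1 - q) * ?r ^ j" for j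
  proof -
    have c: "continuous_on S (F N \<eta> s j)" for j S by (rule F_cont) (use s \<eta> in auto)
    have sh: "U N \<eta> s j = integral (cbox 0 One) (\<lambda>x. F N \<eta> s j (x + \<alpha> s))"
      unfolding U_def by (rule integral_torus_shift[symmetric, OF c F_torus[OF sJ]])
    have c': "continuous_on S (\<lambda>x. F N \<eta> s j (x + \<alpha> s))" for S
      by (rule continuous_on_compose2[OF c]) (auto intro!: continuous_intros)
    have "U N \<eta> s (Suc j) - U N \<eta> s j = integral (cbox 0 One) (\<lambda>x. F N \<eta> s (Suc j) x - F N \<eta> s j (x + \<alpha> s))"
      unfolding sh U_def[of N \<eta> s "Suc j"] by (intro integral_diff[symmetric] integrable_continuous c c')
    also have "cmod \<dots> \<le> 2 / (1 - q) * ?r ^ j"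
    proof (rule integral_unit_cube_bound)
      show "continuous_on (cbox 0 One) (\<lambda>x. F N \<eta> s (Suc j) x - F N \<eta> s j (x + \<alpha> s))"
        by (intro continuous_intros c c')
      fix x
      have "F N \<eta> s j (x + \<alpha> s) = lterm (\<lambda>i. L N \<eta> s (x + real (Suc i) *\<^sub>R \<alpha> s)) (\<lambda>i. Le N \<eta> (x + real (Suc i) *\<^sub>R \<alpha> s)) j"
        by (simp add: F_def algebra_simps)
      then show "cmod (F N \<eta> s (Suc j) x - F N \<eta> s j (x + \<alpha> s)) \<le> 2 / (1 - q) * ?r ^ j"
        unfolding F_def[of N \<eta> s "Suc j"]
        by (simp only:) (rule lterm_contract, use ok_adm[OF s \<eta>] r okD in auto)
    qed
    finally show ?thesis .
  qed
  have "cmod (U N \<eta> s (p + m) - U N \<eta> s p) \<le> (\<Sum>i<m. 2 / (1 - q) * ?r ^ (p + i))"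
  proof (induction m)
    case (Suc m)
    have "cmod (U N \<eta> s (p + Suc m) - U N \<eta> s p) \<le> cmod (U N \<eta> s (Suc (p + m)) - U N \<eta> s (p + m)) + cmod (U N \<eta> s (p + m) - U N \<eta> s p)"
      using norm_triangle_ineq[of "U N \<eta> s (Suc (p + m)) - U N \<eta> s (p + m)" "U N \<eta> s (p + m) - U N \<eta> s p"] by simp
    then show ?case using Suc step[of "p + m"] by simp
  qed simp
  also have "\<dots> = 2 / (1 - q) * ?r ^ p * (\<Sum>i<m. ?r ^ i)" by (simp add: sum_distrib_left power_add mult.assoc)
  also have "\<dots> \<le> 2 / (1 - q) * ?r ^ p * (1 / (\<kappa> * \<eta>))"
  proof (rule mult_left_mono)
    have "(\<Sum>i<m. ?r ^ i) = (1 - ?r ^ m) / (\<kappa> * \<eta>)" using r \<eta>(1) okD(6) by (auto simp: sum_gp_strict)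
    also have "\<dots> \<le> 1 / (\<kappa> * \<eta>)" using r okD \<eta> by (intro divide_right_mono) auto
    finally show "(\<Sum>i<m. ?r ^ i) \<le> 1 / (\<kappa> * \<eta>)" .
  qed (use r okD in auto)
  finally show ?thesis by simp
qed

end

text \<open>
  Convergence is not evident from the definition, since nothing contracts at height \<open>0\<close>; see \<open>U_tendsto\<close>.
\<close>

definition U_limit :: "real \<Rightarrow> complex" where "U_limit s = lim (\<lambda>j. U 1 0 s j)"

text \<open>
  At a fixed small height the sequence is Cauchy, and it is uniformly close to the sequence at height \<open>0\<close>; let the height tend to \<open>0\<close>.
\<close>

lemma U_tendsto:
  assumes ok: "fam_ok \<rho> 1 q \<eta>0 c \<kappa>" and \<rho>J: "cball sc \<rho> \<subseteq> J" and s: "s \<in> cball sc \<rho>"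
  shows "(\<lambda>j. U 1 0 s j) \<longlonglongrightarrow> U_limit s"
proof -
  note D = okD[OF ok \<rho>J]
  obtain C where C: "C > 0" "\<And>s j \<eta>. s \<in> cball sc \<rho> \<Longrightarrow> 0 < \<eta> \<Longrightarrow> \<eta> \<le> \<eta>0 \<Longrightarrow> cmod (U 1 \<eta> s j - U 1 0 s j) \<le> C * \<eta> ^ 1"
    using height_error[OF ok \<rho>J] by auto
  have "Cauchy (\<lambda>j. U 1 0 s j)"
  proof (rule metric_CauchyI)
    fix e :: real assume e: "e > 0"
    define \<eta> where "\<eta> = min \<eta>0 (e / (8 * C))"
    have \<eta>: "0 < \<eta>" "\<eta> \<le> \<eta>0" "C * \<eta> \<le> e / 8" using e C D by (auto simp: \<eta>_def min_def field_simps)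
    let ?r = "1 - \<kappa> * \<eta>"
    have "\<kappa> * \<eta> \<le> \<kappa> * \<eta>0" using \<eta> D by simp
    moreover have "0 < \<kappa> * \<eta>" using \<eta> D by simp
    ultimately have r: "0 < ?r" "?r < 1" using D by linarith+
    have "(\<lambda>p. 2 / (1 - q) * ?r ^ p / (\<kappa> * \<eta>)) \<longlonglongrightarrow> 2 / (1 - q) * 0 / (\<kappa> * \<eta>)"
      using r by (intro tendsto_intros LIMSEQ_power_zero) (use \<eta> D in auto)
    then have "eventually (\<lambda>p. 2 / (1 - q) * ?r ^ p / (\<kappa> * \<eta>) < e / 8) sequentially"
      using e by (intro order_tendstoD(2)) auto
    then obtain p where p: "2 / (1 - q) * ?r ^ p / (\<kappa> * \<eta>) < e / 8" by (meson eventually_sequentially order_refl)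
    have near: "dist (U 1 0 s n) (U 1 \<eta> s p) < e / 4" if "n \<ge> p" for n
    proof -
      have "cmod (U 1 \<eta> s n - U 1 \<eta> s p) < e / 8"
        using U_tail[OF ok \<rho>J s \<eta>(1,2), of p "n - p"] p that by simp
      moreover have "cmod (U 1 \<eta> s n - U 1 0 s n) \<le> e / 8" using C(2)[OF s \<eta>(1,2), of n] \<eta> by simp
      ultimately show ?thesis
        using norm_triangle_ineq[of "U 1 0 s n - U 1 \<eta> s n" "U 1 \<eta> s n - U 1 \<eta> s p"]
        by (simp add: dist_norm norm_minus_commute)
    qed
    show "\<exists>M. \<forall>m\<ge>M. \<forall>n\<ge>M. dist (U 1 0 s m) (U 1 0 s n) < e"
    proof (intro exI[of _ p] allI impI)
      fix m n assume "p \<le> m" "p \<le> n"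
      then show "dist (U 1 0 s m) (U 1 0 s n) < e"
        using near[of m] near[of n] e dist_triangle2[of "U 1 0 s m" "U 1 0 s n" "U 1 \<eta> s p"] by linarith
    qed
  qed
  then show ?thesis by (simp add: U_limit_def Cauchy_convergent_iff convergent_LIMSEQ_iff)
qed

lemma U_limit_approx:
  assumes ok1: "fam_ok \<rho> 1 q1 \<eta>1 c1 \<kappa>1" and ok: "fam_ok \<rho> N q \<eta>0 c \<kappa>" and \<rho>J: "cball sc \<rho> \<subseteq> J" and N: "N \<ge> 1"
  obtains C where "C > 0" "\<And>s p \<eta>. s \<in> cball sc \<rho> \<Longrightarrow> 0 < \<eta> \<Longrightarrow> \<eta> \<le> \<eta>0 \<Longrightarrow>
    cmod (U_limit s - U N \<eta> s p) \<le> C * \<eta> ^ N + 2 / (1 - q) * (1 - \<kappa> * \<eta>) ^ p / (\<kappa> * \<eta>)"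
proof -
  obtain C where C: "C > 0" "\<And>s j \<eta>. s \<in> cball sc \<rho> \<Longrightarrow> 0 < \<eta> \<Longrightarrow> \<eta> \<le> \<eta>0 \<Longrightarrow> cmod (U N \<eta> s j - U 1 0 s j) \<le> C * \<eta> ^ N"
    using height_error[OF ok \<rho>J N] by auto
  show ?thesis
  proof (rule that[OF C(1)])
    fix s p \<eta> assume h: "s \<in> cball sc \<rho>" "0 < \<eta>" "\<eta> \<le> \<eta>0"
    let ?B = "C * \<eta> ^ N + 2 / (1 - q) * (1 - \<kappa> * \<eta>) ^ p / (\<kappa> * \<eta>)"
    have "(\<lambda>m. U 1 0 s (m + p)) \<longlonglongrightarrow> U_limit s"
      by (rule LIMSEQ_ignore_initial_segment[OF U_tendsto[OF ok1 \<rho>J h(1)]])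
    then have "(\<lambda>m. cmod (U 1 0 s (m + p) - U N \<eta> s p)) \<longlonglongrightarrow> cmod (U_limit s - U N \<eta> s p)"
      by (intro tendsto_intros)
    then show "cmod (U_limit s - U N \<eta> s p) \<le> ?B"
    proof (rule LIMSEQ_le_const2, intro exI[of _ 0] allI impI)
      fix m
      show "cmod (U 1 0 s (m + p) - U N \<eta> s p) \<le> ?B"
        using C(2)[OF h, of "m + p"] U_tail[OF ok \<rho>J h, of p m]
          norm_triangle_ineq[of "U 1 0 s (m + p) - U N \<eta> s (m + p)" "U N \<eta> s (m + p) - U N \<eta> s p"]
        by (simp add: norm_minus_commute add.commute)
    qed
  qed
qed

text \<open>
  The integral of the \<open>j\<close>-th summand converges by \<open>U_tendsto\<close>, hence so do the averages. The second term is
  the contribution of the reference denominators.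
\<close>

lemma log_average_limit:
  assumes ok: "fam_ok \<rho> 1 q \<eta>0 c \<kappa>" and \<rho>J: "cball sc \<rho> \<subseteq> J" and s: "s \<in> cball sc \<rho>"
  shows "(\<lambda>n. integral (cbox 0 One) (\<lambda>x. \<Sum>j<n. ln (cmod (mden (M (s, x + real j *\<^sub>R \<alpha> s)) (orb (\<lambda>i. M (s, x + real i *\<^sub>R \<alpha> s)) 0 j)))) / real n)
     \<longlonglongrightarrow> Re (U_limit s) + integral (cbox 0 One) (\<lambda>x. ln (cmod (M (sc, x) $2$2)))"
proof -
  note D = okD[OF ok \<rho>J]
  have sJ: "s \<in> J" using s \<rho>J by blast
  let ?Q = "cbox 0 One :: (real^'d) set"
  let ?l = "\<lambda>x. ln (cmod (M (sc, x) $2$2))"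
  let ?d = "\<lambda>j x. mden (M (s, x + real j *\<^sub>R \<alpha> s)) (orb (\<lambda>i. M (s, x + real i *\<^sub>R \<alpha> s)) 0 j)"
  have a: "adm 1 q (M (s, x)) (M (sc, x) $2$2)" for x using ok s by (auto simp: fam_ok_def)
  have enz: "M (sc, x) $2$2 \<noteq> 0" for x using a[of x] by (simp add: adm_def)
  have dnz: "?d j x \<noteq> 0" for j x
    by (rule orb_den_nz[where M = "\<lambda>i. M (s, x + real i *\<^sub>R \<alpha> s)" and e = "\<lambda>i. M (sc, x + real i *\<^sub>R \<alpha> s) $2$2" and q = q and n = j])
      (use a D in auto)
  have ReF: "ln (cmod (?d j x)) = Re (F 1 0 s j x) + ?l (x + real j *\<^sub>R \<alpha> s)" for j x
    unfolding F_def L_0 Le_0 lterm_def using dnz enz by (simp add: norm_divide ln_div)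
  have cF: "continuous_on S (F 1 0 s j)" for j S by (rule F_cont[OF ok \<rho>J s]) (use D in auto)
  have cM: "continuous_on S (\<lambda>x. M (sc, x) $2$2)" for S
    using continuous_on_subset[OF P_cont_x[OF J(2), of 0 2 2]] by auto
  have cl: "continuous_on S ?l" for S by (intro continuous_intros cM) (use enz in auto)
  have cl': "continuous_on S (\<lambda>x. ?l (x + v))" for S v
    by (rule continuous_on_compose2[OF cl]) (auto intro!: continuous_intros)
  have tl: "torus_map ?l" using M_torus[OF J(2)] by (simp add: torus_map_def)
  have one: "integral ?Q (\<lambda>x. ln (cmod (?d j x))) = Re (U 1 0 s j) + integral ?Q ?l" for j
  proof -
    have iF: "F 1 0 s j integrable_on ?Q" by (intro integrable_continuous cF)
    have "integral ?Q (\<lambda>x. ln (cmod (?d j x))) = integral ?Q (\<lambda>x. Re (F 1 0 s j x)) + integral ?Q (\<lambda>x. ?l (x + real j *\<^sub>R \<alpha> s))"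
      unfolding ReF by (intro integral_add integrable_continuous continuous_intros cF cl')
    also have "integral ?Q (\<lambda>x. Re (F 1 0 s j x)) = Re (U 1 0 s j)"
      unfolding U_def using integral_linear[OF iF bounded_linear_Re] by (simp add: o_def)
    also have "integral ?Q (\<lambda>x. ?l (x + real j *\<^sub>R \<alpha> s)) = integral ?Q ?l"
      by (rule integral_torus_shift[OF cl tl])
    finally show ?thesis .
  qed
  have "integral ?Q (\<lambda>x. \<Sum>j<n. ln (cmod (?d j x))) = (\<Sum>j<n. Re (U 1 0 s j) + integral ?Q ?l)" for n
  proof -
    have "continuous_on ?Q (\<lambda>x. ln (cmod (?d j x)))" for j
      unfolding ReF by (intro continuous_intros cF cl')
    then have "integral ?Q (\<lambda>x. \<Sum>j<n. ln (cmod (?d j x))) = (\<Sum>j<n. integral ?Q (\<lambda>x. ln (cmod (?d j x))))"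
      by (intro integral_sum integrable_continuous) auto
    then show ?thesis by (simp add: one)
  qed
  moreover have "(\<lambda>j. Re (U 1 0 s j) + integral ?Q ?l) \<longlonglongrightarrow> Re (U_limit s) + integral ?Q ?l"
    by (intro tendsto_intros U_tendsto[OF ok \<rho>J s])
  ultimately show ?thesis using Cesaro_mean by simp
qed

end

section \<open>Polynomial approximation in the parameter\<close>

lemma lterm_has_field_derivative:
  fixes M :: "nat \<Rightarrow> complex \<Rightarrow> complex^2^2" and M' :: "nat \<Rightarrow> complex^2^2"
  assumes M: "\<And>j i k. j \<le> n \<Longrightarrow> ((\<lambda>z. M j z $ i $ k) has_field_derivative (M' j $ i $ k)) (at z within S)"
    and e: "((\<lambda>z. e n z) has_field_derivative (e' n)) (at z within S)"
    and a: "\<And>j. j \<le> n \<Longrightarrow> adm 1 q (M j z) (e j z)" and q: "q < 1"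
  shows "((\<lambda>z. lterm (\<lambda>j. M j z) (\<lambda>j. e j z) n) has_field_derivative
    dlterm (\<lambda>j. M j z) M' (\<lambda>j. e j z) e' n) (at z within S)"
proof -
  have "((\<lambda>z. lterm (\<lambda>j. M j z) (\<lambda>j. e j z) n) has_derivative
    (\<lambda>h. dlterm (\<lambda>j. M j z) (\<lambda>j. \<chi> i k. h * M' j $ i $ k) (\<lambda>j. e j z) (\<lambda>j. h * e' j) n)) (at z within S)"
    by (rule lterm_has_derivative[where M' = "\<lambda>j h. \<chi> i k. h * M' j $ i $ k"
          and e' = "\<lambda>j h. h * e' j" and q = q, OF _ _ _ q])
      (use M e a in \<open>auto simp: has_field_derivative_def mult_commute_abs\<close>)
  moreover have "dlterm N (\<lambda>j. \<chi> i k. h * M' j $ i $ k) E (\<lambda>j. h * e' j) n = dlterm N M' E e' n * h" for h N E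
    using dlterm_linear[of n "\<lambda>j. \<chi> i k. h * M' j $ i $ k" "\<lambda>j. 0" h M' "\<lambda>j. h * e' j" "\<lambda>j. 0" e' N E]
      dlterm_linear[of n "\<lambda>j. 0" "\<lambda>j. 0" "-1" "\<lambda>j. 0" "\<lambda>j. 0" "\<lambda>j. 0" "\<lambda>j. 0" N E] by simp
  ultimately show ?thesis by (simp add: has_field_derivative_def)
qed

text \<open>
  The mean value form of Taylor's theorem is applied to real and imaginary part separately, whence the factor \<open>2\<close>.
\<close>

lemma complex_valued_Taylor:
  fixes f :: "nat \<Rightarrow> real \<Rightarrow> complex"
  assumes S: "convex S" and d: "\<And>i x. x \<in> S \<Longrightarrow> i \<le> n \<Longrightarrow> (f i has_vector_derivative f (Suc i) x) (at x)"
    and B: "\<And>x. x \<in> S \<Longrightarrow> cmod (f (Suc n) x) \<le> B" and w: "w \<in> S" and z: "z \<in> S"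
  shows "cmod (f 0 z - (\<Sum>i\<le>n. f i w * of_real (z - w) ^ i / fact i)) \<le> 2 * B * \<bar>z - w\<bar> ^ Suc n"
proof -
  let ?e = "f 0 z - (\<Sum>i\<le>n. f i w * of_real (z - w) ^ i / fact i)"
  have B0: "0 \<le> B" using B[OF w] norm_ge_zero order_trans by blast
  have le: "B * \<bar>z - w\<bar> ^ Suc n / fact n \<le> B * \<bar>z - w\<bar> ^ Suc n"
  proof -
    have "B * \<bar>z - w\<bar> ^ Suc n / fact n \<le> B * \<bar>z - w\<bar> ^ Suc n / 1"
      by (rule divide_left_mono) (use B0 fact_ge_1[of n, where 'a = real] in auto)
    then show ?thesis by simp
  qed
  have dRe: "((\<lambda>x. Re (f i x)) has_field_derivative Re (f (Suc i) x)) (at x within S)"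
    and dIm: "((\<lambda>x. Im (f i x)) has_field_derivative Im (f (Suc i) x)) (at x within S)" if "x \<in> S" "i \<le> n" for x i
    using bounded_linear.has_vector_derivative[OF bounded_linear_Re d[OF that]]
      bounded_linear.has_vector_derivative[OF bounded_linear_Im d[OF that]]
    by (auto simp: has_real_derivative_iff_has_vector_derivative intro: has_vector_derivative_at_within)
  have "norm (Re (f 0 z) - (\<Sum>i\<le>n. Re (f i w) * (z - w) ^ i / fact i)) \<le> B * norm (z - w) ^ Suc n / fact n"
    by (rule field_Taylor[OF S, where f = "\<lambda>i x. Re (f i x)"])
      (use B dRe w z in \<open>auto intro: order_trans[OF abs_Re_le_cmod]\<close>)
  moreover have "norm (Im (f 0 z) - (\<Sum>i\<le>n. Im (f i w) * (z - w) ^ i / fact i)) \<le> B * norm (z - w) ^ Suc n / fact n"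
    by (rule field_Taylor[OF S, where f = "\<lambda>i x. Im (f i x)"])
      (use B dIm w z in \<open>auto intro: order_trans[OF abs_Im_le_cmod]\<close>)
  moreover have "Re (f i w * of_real (z - w) ^ i / fact i) = Re (f i w) * (z - w) ^ i / fact i"
    "Im (f i w * of_real (z - w) ^ i / fact i) = Im (f i w) * (z - w) ^ i / fact i" for i
  proof -
    have "f i w * of_real (z - w) ^ i / fact i = of_real ((z - w) ^ i / fact i) * f i w" by simp
    then show "Re (f i w * of_real (z - w) ^ i / fact i) = Re (f i w) * (z - w) ^ i / fact i"
      "Im (f i w * of_real (z - w) ^ i / fact i) = Im (f i w) * (z - w) ^ i / fact i"
      by (simp_all only: Re_complex_of_real Im_complex_of_real times_complex.sel) simp_all
  qed
  ultimately have "\<bar>Re ?e\<bar> \<le> B * \<bar>z - w\<bar> ^ Suc n" "\<bar>Im ?e\<bar> \<le> B * \<bar>z - w\<bar> ^ Suc n"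
    using le by (auto simp del: power_Suc of_real_diff)
  then show ?thesis using cmod_le[of ?e] by simp
qed

text \<open>
  The Taylor polynomial at a real centre, with Cauchy's inequality for the remainder; its coefficients may be replaced by their real
  parts because only the real part of \<open>G\<close> at real points is wanted.
\<close>

lemma holomorphic_poly_approx:
  assumes G: "G holomorphic_on ball (of_real s0) \<delta>" "\<And>z. z \<in> ball (of_real s0) \<delta> \<Longrightarrow> cmod (G z) \<le> B" and \<delta>: "\<delta> > 0"
  obtains q :: "real poly" where "degree q \<le> D"
    "\<And>t. \<bar>t - s0\<bar> \<le> \<delta> / 4 \<Longrightarrow> \<bar>Re (G (of_real t)) - poly q t\<bar> \<le> real (Suc D) * B * (2 * \<bar>t - s0\<bar> / \<delta>) ^ Suc D"
proof -
  let ?z = "of_real s0 :: complex"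
  define b where "b i = Re ((deriv ^^ i) G ?z / fact i)" for i
  define q where "q = pcompose (\<Sum>i\<le>D. monom (b i) i) [:- s0, 1:]"
  have "degree (\<Sum>i\<le>D. monom (b i) i) \<le> D"
    by (rule degree_sum_le) (auto intro: order_trans[OF degree_monom_le])
  then have deg: "degree q \<le> D" by (simp add: q_def degree_pcompose)
  have pq: "poly q t = (\<Sum>i\<le>D. b i * (t - s0) ^ i)" for t
    by (simp add: q_def poly_pcompose poly_sum poly_monom)
  have hd: "(deriv ^^ i) G holomorphic_on ball ?z \<delta>" for i
    by (rule holomorphic_higher_deriv[OF G(1)]) simp
  have "\<bar>Re (G (of_real t)) - poly q t\<bar> \<le> real (Suc D) * B * (2 * \<bar>t - s0\<bar> / \<delta>) ^ Suc D" if t: "\<bar>t - s0\<bar> \<le> \<delta> / 4" for t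
  proof -
    let ?S = "cball ?z (\<delta> / 4)"
    have sub: "?S \<subseteq> ball ?z \<delta>" using \<delta> by auto
    let ?C = "fact (Suc D) * B / (\<delta> / 2) ^ Suc D"
    have b1: "cmod ((deriv ^^ 0) G (of_real t) - (\<Sum>i\<le>D. (deriv ^^ i) G ?z * (of_real t - ?z) ^ i / fact i)) \<le> ?C * cmod (of_real t - ?z) ^ Suc D / fact D"
    proof (rule complex_Taylor[where S = ?S and f = "\<lambda>i. (deriv ^^ i) G"])
      show "((deriv ^^ i) G has_field_derivative (deriv ^^ Suc i) G x) (at x within ?S)" if "x \<in> ?S" for i x
        using holomorphic_derivI[OF hd open_ball, of x i] that sub by (auto intro: has_field_derivative_at_within)
      show "cmod ((deriv ^^ Suc D) G x) \<le> ?C" if x: "x \<in> ?S" for x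
      proof -
        have cb: "cball x (\<delta> / 2) \<subseteq> ball ?z \<delta>"
        proof
          fix y assume "y \<in> cball x (\<delta> / 2)"
          then show "y \<in> ball ?z \<delta>" using x \<delta> dist_triangle[of ?z y x] by simp
        qed
        show ?thesis
        proof (rule Cauchy_inequality)
          have "ball x (\<delta>/2) \<subseteq> ball ?z \<delta>" using cb ball_subset_cball by blast
          then show "G holomorphic_on ball x (\<delta> / 2)" by (rule holomorphic_on_subset[OF G(1)])
          show "continuous_on (cball x (\<delta> / 2)) G"
            by (rule continuous_on_subset[OF holomorphic_on_imp_continuous_on[OF G(1)] cb])
          show "cmod (G y) \<le> B" if "cmod (x - y) = \<delta> / 2" for y
            using cb that by (intro G(2)) (auto simp: dist_norm)
        qed (use \<delta> in auto)
      qed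
      show "of_real t \<in> ?S" using t by (simp add: dist_norm of_real_diff[symmetric] abs_minus_commute del: of_real_diff)
    qed (use \<delta> in auto)
    have eq: "Re (G (of_real t)) - poly q t = Re ((deriv ^^ 0) G (of_real t) - (\<Sum>i\<le>D. (deriv ^^ i) G ?z * (of_real t - ?z) ^ i / fact i))"
    proof -
      have "Re ((deriv ^^ i) G ?z * (of_real t - ?z) ^ i / fact i) = b i * (t - s0) ^ i" for i
      proof -
        have "(deriv ^^ i) G ?z * (of_real t - ?z) ^ i / fact i = of_real ((t - s0) ^ i) * ((deriv ^^ i) G ?z / fact i)" by simp
        then show ?thesis by (simp only: b_def Re_complex_of_real Im_complex_of_real times_complex.sel) simp
      qed
      then show ?thesis by (simp add: pq)
    qed
    have ceq: "?C * cmod (of_real t - ?z) ^ Suc D / fact D = real (Suc D) * B * (2 * \<bar>t - s0\<bar> / \<delta>) ^ Suc D"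
    proof -
      have "cmod (of_real t - ?z) = \<bar>t - s0\<bar>" by (metis norm_of_real of_real_diff)
      moreover have "fact (Suc D) / fact D = real (Suc D)" by simp
      ultimately show ?thesis by (simp add: power_divide power_mult_distrib field_simps del: power_Suc fact_Suc of_nat_Suc)
    qed
    show ?thesis unfolding eq ceq[symmetric] by (rule order_trans[OF abs_Re_le_cmod b1])
  qed
  then show ?thesis using that deg by blast
qed

context monotone_family
begin

lemma L_shift_derivatives:
  assumes K: "compact K" "K \<subseteq> J"
  obtains C where "C > 0" "\<And>\<eta> i j n. 0 \<le> \<eta> \<Longrightarrow> \<eta> \<le> 1 \<Longrightarrow> \<exists>h :: nat \<Rightarrow> real \<Rightarrow> real^'d \<Rightarrow> complex.
     (\<forall>s x. h 0 s x = L N \<eta> s (x - real n *\<^sub>R \<alpha> s) $ i $ j) \<and>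
     (\<forall>l<D. \<forall>s\<in>J. \<forall>x. ((\<lambda>s. h l s x) has_vector_derivative h (Suc l) s x) (at s)) \<and>
     (\<forall>l\<le>D. \<forall>s\<in>K. \<forall>x. cmod (h l s x) \<le> C * (1 + real n) ^ l) \<and>
     (\<forall>l\<le>D. \<forall>s\<in>J. continuous_on UNIV (h l s))"
proof -
  define G where "G k i j C n h \<longleftrightarrow>
     (\<forall>s x. h 0 s x = P k (s, x - real n *\<^sub>R \<alpha> s) $ i $ j) \<and>
     (\<forall>l<D. \<forall>s\<in>J. \<forall>x. ((\<lambda>s. h l s x) has_vector_derivative h (Suc l) s x) (at s)) \<and>
     (\<forall>l\<le>D. \<forall>s\<in>K. \<forall>x. cmod (h l s x) \<le> C * (1 + real n) ^ l) \<and>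
     (\<forall>l\<le>D. continuous_on (J \<times> UNIV) (\<lambda>(s, x). h l s x))"
    for k i j C n and h :: "nat \<Rightarrow> real \<Rightarrow> real^'d \<Rightarrow> complex"
  have "\<exists>C>0. \<forall>n. \<exists>h. G k i j C n h" for k i j
    using shifted_family_derivatives[OF J(1) \<alpha> K P_smooth[of k i j] P_torus_entry, where D = D] unfolding G_def by simp
  then obtain Cf where Cf: "\<And>k i j. Cf k i j > 0" "\<And>k i j n. \<exists>h. G k i j (Cf k i j) n h" by metis
  define C where "C = (\<Sum>k<Suc N. \<Sum>i\<in>UNIV. \<Sum>j\<in>UNIV. Cf k i j)"
  have Cf0: "Cf k i j \<ge> 0" for k i j using Cf(1)[of k i j] by simp
  have CC: "(\<Sum>k<Suc N. Cf k i j) \<le> C" for i j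
    unfolding C_def
  proof (rule sum_mono)
    fix k
    have "Cf k i j \<le> (\<Sum>j\<in>UNIV. Cf k i j)"
      by (rule member_le_sum[of j UNIV "\<lambda>j. Cf k i j"]) (auto simp: Cf0)
    also have "\<dots> \<le> (\<Sum>i\<in>UNIV. \<Sum>j\<in>UNIV. Cf k i j)"
      by (rule member_le_sum[of i UNIV "\<lambda>i. \<Sum>j\<in>UNIV. Cf k i j"]) (auto intro!: sum_nonneg simp: Cf0)
    finally show "Cf k i j \<le> (\<Sum>i\<in>UNIV. \<Sum>j\<in>UNIV. Cf k i j)" .
  qed
  have C0: "C > 0"
    unfolding C_def by (intro sum_pos) (auto intro!: sum_pos Cf)
  show ?thesis
  proof (rule that[OF C0])
    fix \<eta> i j n assume \<eta>: "0 \<le> \<eta>" "\<eta> \<le> (1::real)"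
    obtain hf where hf: "\<And>k. G k i j (Cf k i j) n (hf k)"
      using choice[of "\<lambda>k h. G k i j (Cf k i j) n h"] Cf(2) by blast
    define h where "h l s x = lift_sum (Suc N) (\<lambda>k x. hf k l s x) \<eta> x" for l s x
    show "\<exists>h. (\<forall>s x. h 0 s x = L N \<eta> s (x - real n *\<^sub>R \<alpha> s) $ i $ j) \<and>
     (\<forall>l<D. \<forall>s\<in>J. \<forall>x. ((\<lambda>s. h l s x) has_vector_derivative h (Suc l) s x) (at s)) \<and>
     (\<forall>l\<le>D. \<forall>s\<in>K. \<forall>x. cmod (h l s x) \<le> C * (1 + real n) ^ l) \<and>
     (\<forall>l\<le>D. \<forall>s\<in>J. continuous_on UNIV (h l s))"
    proof (intro exI[of _ h] conjI allI impI ballI)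
      show "h 0 s x = L N \<eta> s (x - real n *\<^sub>R \<alpha> s) $ i $ j" for s x
        using hf unfolding G_def h_def lift_mat_def lift_sum_def by simp
      show "((\<lambda>s. h l s x) has_vector_derivative h (Suc l) s x) (at s)" if "l < D" "s \<in> J" for l s x
        unfolding h_def lift_sum_def
        by (intro has_vector_derivative_sum has_vector_derivative_mult_right)
          (use hf that in \<open>auto simp: G_def\<close>)
      show "continuous_on UNIV (h l s)" if "l \<le> D" "s \<in> J" for l s
      proof -
        have "continuous_on UNIV (\<lambda>x. hf k l s x)" for k
        proof -
          have "continuous_on (J \<times> UNIV) (\<lambda>(s, x). hf k l s x)" using hf[of k] that by (simp add: G_def)
          moreover have "continuous_on UNIV (\<lambda>x::real^'d. (s, x))" by (intro continuous_intros)
          ultimately have "continuous_on UNIV (\<lambda>x. case (s, x) of (s, x) \<Rightarrow> hf k l s x)"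
            by (rule continuous_on_compose2) (use that in auto)
          then show ?thesis by simp
        qed
        then show ?thesis unfolding h_def lift_sum_def by (intro continuous_intros)
      qed
      show "cmod (h l s x) \<le> C * (1 + real n) ^ l" if "l \<le> D" "s \<in> K" for l s x
      proof -
        have "cmod (h l s x) \<le> (\<Sum>k<Suc N. Cf k i j * (1 + real n) ^ l)"
          unfolding h_def lift_sum_def
        proof (rule sum_norm_le)
          fix k
          have "cmod ((\<i> * of_real \<eta>) ^ k / fact k) \<le> 1"
          proof -
            have "\<eta> ^ k / fact k \<le> 1 / 1" using \<eta> by (intro frac_le fact_ge_1) (auto simp: power_le_one)
            then show ?thesis using \<eta> by (simp add: norm_divide norm_power norm_mult)
          qed
          moreover have "cmod (hf k l s x) \<le> Cf k i j * (1 + real n) ^ l" using hf[of k] that by (auto simp: G_def)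
          ultimately have "cmod ((\<i> * of_real \<eta>) ^ k / fact k) * cmod (hf k l s x) \<le> 1 * (Cf k i j * (1 + real n) ^ l)"
            by (intro mult_mono) auto
          then show "cmod ((\<i> * of_real \<eta>) ^ k / fact k * hf k l s x) \<le> Cf k i j * (1 + real n) ^ l"
            unfolding norm_mult[of _ "hf k l s x"] by simp
        qed
        also have "\<dots> = (\<Sum>k<Suc N. Cf k i j) * (1 + real n) ^ l" by (simp only: sum_distrib_right)
        also have "\<dots> \<le> C * (1 + real n) ^ l" using CC by (intro mult_right_mono) auto
        finally show ?thesis .
      qed
    qed
  qed
qed

context
  fixes \<rho> N q \<eta>0 c \<kappa>
  assumes ok: "fam_ok \<rho> N q \<eta>0 c \<kappa>" and \<rho>J: "cball sc \<rho> \<subseteq> J"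
begin

text \<open>
  After translation the chain ends, rather than starts, at \<open>x\<close>: a small change of \<open>\<alpha>(s)\<close> now displaces the factors in proportion to their distance from the end.
\<close>

lemma U_shifted:
  assumes s: "s \<in> cball sc \<rho>" and \<eta>: "0 \<le> \<eta>" "\<eta> \<le> \<eta>0"
  shows "U N \<eta> s p = integral (cbox 0 One) (\<lambda>x. lterm (\<lambda>k. L N \<eta> s (x - real (p - k) *\<^sub>R \<alpha> s))
     (\<lambda>k. Le N \<eta> (x - real (p - k) *\<^sub>R \<alpha> s)) p)"
proof -
  have sJ: "s \<in> J" using s \<rho>J by blast
  have "U N \<eta> s p = integral (cbox 0 One) (\<lambda>x. F N \<eta> s p (x + - (real p *\<^sub>R \<alpha> s)))"
    unfolding U_def by (rule integral_torus_shift[symmetric, OF F_cont[OF ok \<rho>J s \<eta>] F_torus[OF ok \<rho>J sJ]])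
  also have "(\<lambda>x. F N \<eta> s p (x + - (real p *\<^sub>R \<alpha> s))) = (\<lambda>x. lterm (\<lambda>k. L N \<eta> s (x - real (p - k) *\<^sub>R \<alpha> s))
     (\<lambda>k. Le N \<eta> (x - real (p - k) *\<^sub>R \<alpha> s)) p)"
    unfolding F_def
  proof (intro ext lterm_cong)
    fix x and i assume "i \<le> p"
    then have eq: "x + - (real p *\<^sub>R \<alpha> s) + real i *\<^sub>R \<alpha> s = x - real (p - i) *\<^sub>R \<alpha> s"
      by (simp add: of_nat_diff algebra_simps)
    then show "L N \<eta> s (x + - (real p *\<^sub>R \<alpha> s) + real i *\<^sub>R \<alpha> s) = L N \<eta> s (x - real (p - i) *\<^sub>R \<alpha> s)"
      by (simp only: eq)
  qed simp
  finally show ?thesis .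
qed

text \<open>
  Replace every factor by its Taylor polynomial of degree \<open>D\<close> in \<open>s\<close> at \<open>s0\<close>, which has complex values at complex parameters. On the complex disc of
  radius \<open>a \<eta> / (1 + p)\<close> the factors move by at most \<open>c \<eta>\<close>, so the chain stays admissible and its integral \<open>G\<close> is holomorphic and
  bounded; \<open>G\<close> is then replaced by a polynomial of degree \<open>D'\<close>. The first error term comes from the Taylor polynomials of the factors through
  \<open>lterm_perturb\<close>, the second from that of \<open>G\<close>.
\<close>

lemma parameter_poly_approx:
  obtains C c2 where "C > 0" "c2 > 0" "\<And>s0 \<eta> p r. s0 \<in> cball sc \<rho> \<Longrightarrow> 0 < \<eta> \<Longrightarrow> \<eta> \<le> \<eta>0 \<Longrightarrow> 0 < r \<Longrightarrow> r * (1 + real p) \<le> c2 * \<eta> \<Longrightarrow>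
    \<exists>Q :: real poly. degree Q \<le> D' \<and> (\<forall>s\<in>cball sc \<rho>. \<bar>s - s0\<bar> \<le> r \<longrightarrow>
       \<bar>Re (U N \<eta> s p) - poly Q s\<bar> \<le> C * (((1 + real p) * r) ^ Suc D / \<eta> + ((1 + real p) * r / \<eta>) ^ Suc D'))"
proof -
  note od = okD[OF ok \<rho>J]
  note lb = lbound_pos[OF od(1,2)]
  obtain C where C: "C > 0" "\<And>\<eta> i j n. 0 \<le> \<eta> \<Longrightarrow> \<eta> \<le> 1 \<Longrightarrow> \<exists>h :: nat \<Rightarrow> real \<Rightarrow> real^'d \<Rightarrow> complex.
     (\<forall>s x. h 0 s x = L N \<eta> s (x - real n *\<^sub>R \<alpha> s) $ i $ j) \<and>
     (\<forall>l<Suc D. \<forall>s\<in>J. \<forall>x. ((\<lambda>s. h l s x) has_vector_derivative h (Suc l) s x) (at s)) \<and>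
     (\<forall>l\<le>Suc D. \<forall>s\<in>cball sc \<rho>. \<forall>x. cmod (h l s x) \<le> C * (1 + real n) ^ l) \<and>
     (\<forall>l\<le>Suc D. \<forall>s\<in>J. continuous_on UNIV (h l s))"
    by (rule L_shift_derivatives[OF compact_cball \<rho>J]) blast
  define a where "a = min 1 (c / (C * real (Suc D)))"
  define C' where "C' = C * real (Suc D)"
  have C': "C' > 0" using C(1) by (simp add: C'_def)
  have a: "0 < a" "a \<le> 1" "a * (C * real (Suc D)) \<le> c"
    unfolding a_def C'_def[symmetric] using C' od by (auto simp: min_def field_simps)
  define C1 where "C1 = 16 * lbound q * C / c"
  define C2 where "C2 = real (Suc D') * lbound q * (2 / a) ^ Suc D'"
  have C12: "C1 > 0" "C2 > 0" using lb C(1) od a by (auto simp: C1_def C2_def)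
  show ?thesis
  proof (rule that[of "C1 + C2" "a / 4"])
    fix s0 \<eta> r :: real and p
    assume s0: "s0 \<in> cball sc \<rho>" and \<eta>: "0 < \<eta>" "\<eta> \<le> \<eta>0" and r: "0 < r" "r * (1 + real p) \<le> a / 4 * \<eta>"
    have \<eta>1: "\<eta> \<le> 1" using \<eta> od by simp
    have s0J: "s0 \<in> J" using s0 \<rho>J by blast
    define \<delta> where "\<delta> = a * \<eta> / (1 + real p)"
    have \<delta>: "\<delta> > 0" "r \<le> \<delta> / 4" using a \<eta> r(2) by (auto simp: \<delta>_def field_simps)
    obtain h where h: "\<And>i j n s x. h i j n 0 s x = L N \<eta> s (x - real n *\<^sub>R \<alpha> s) $ i $ j"
      "\<And>i j n l s x. l < Suc D \<Longrightarrow> s \<in> J \<Longrightarrow> ((\<lambda>s. h i j n l s x) has_vector_derivative h i j n (Suc l) s x) (at s)"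
      "\<And>i j n l s x. l \<le> Suc D \<Longrightarrow> s \<in> cball sc \<rho> \<Longrightarrow> cmod (h i j n l s x) \<le> C * (1 + real n) ^ l"
      "\<And>i j n l s. l \<le> Suc D \<Longrightarrow> s \<in> J \<Longrightarrow> continuous_on UNIV (h i j n l s)"
    proof -
      define G where "G i j n h \<longleftrightarrow> (\<forall>s x. h 0 s x = L N \<eta> s (x - real n *\<^sub>R \<alpha> s) $ i $ j) \<and>
         (\<forall>l<Suc D. \<forall>s\<in>J. \<forall>x. ((\<lambda>s. h l s x) has_vector_derivative h (Suc l) s x) (at s)) \<and>
         (\<forall>l\<le>Suc D. \<forall>s\<in>cball sc \<rho>. \<forall>x. cmod (h l s x) \<le> C * (1 + real n) ^ l) \<and>
         (\<forall>l\<le>Suc D. \<forall>s\<in>J. continuous_on UNIV (h l s))" for i j n and h :: "nat \<Rightarrow> real \<Rightarrow> real^'d \<Rightarrow> complex"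
      have "\<exists>h. G i j n h" for i j n using C(2)[of \<eta> n i j] \<eta> \<eta>1 unfolding G_def by simp
      then obtain h where "\<And>i j n. G i j n (h i j n)" by metis
      then show ?thesis by (intro that[of h]) (auto simp: G_def)
    qed
    \<comment> \<open>Taylor polynomials of the shifted factors, and their derivatives, at a complex parameter \<open>\<sigma>\<close>. The shift of the reference \<open>e\<close> is frozen at \<open>s0\<close>; for the last factor it is \<open>0\<close> anyway.\<close>
    define T where "T n \<sigma> x = (\<chi> i j. \<Sum>l\<le>D. h i j n l s0 x * (\<sigma> - of_real s0) ^ l / fact l)" for n \<sigma> x
    define T' where "T' n \<sigma> x = (\<chi> i j. \<Sum>l\<le>D. h i j n l s0 x * (of_nat l * (\<sigma> - of_real s0) ^ (l - 1)) / fact l)" for n \<sigma> x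
    define e where "e k x = Le N \<eta> (x - real (p - k) *\<^sub>R \<alpha> s0)" for k x
    let ?B = "ball (of_real s0) \<delta> :: complex set" and ?Q = "cbox 0 One :: (real^'d) set"
    have Tn: "cmod (T n \<sigma> x $ i $ j - L N \<eta> s0 (x - real n *\<^sub>R \<alpha> s0) $ i $ j) \<le> c * \<eta>"
      if n: "n \<le> p" and \<sigma>: "\<sigma> \<in> ?B" for n \<sigma> x i j
    proof -
      define y where "y = (1 + real n) * cmod (\<sigma> - of_real s0)"
      have y: "0 \<le> y" "y \<le> a * \<eta>"
      proof -
        have "y \<le> (1 + real p) * \<delta>"
          unfolding y_def using n \<sigma> by (intro mult_mono) (auto simp: dist_norm norm_minus_commute)
        then show "y \<le> a * \<eta>" by (simp add: \<delta>_def)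
      qed (simp add: y_def)
      have y1: "y \<le> 1" using y(2) a \<eta> \<eta>1 mult_mono[of a 1 \<eta> 1] by simp
      have "T n \<sigma> x $ i $ j - L N \<eta> s0 (x - real n *\<^sub>R \<alpha> s0) $ i $ j = (\<Sum>l<D. h i j n (Suc l) s0 x * (\<sigma> - of_real s0) ^ Suc l / fact (Suc l))"
        unfolding T_def h(1)[of i j n s0 x, symmetric] by (simp add: sum.atMost_shift)
      also have "cmod \<dots> \<le> (\<Sum>l<D. C * y)"
      proof (rule sum_norm_le)
        fix l assume l: "l \<in> {..<D}"
        have "cmod (h i j n (Suc l) s0 x * (\<sigma> - of_real s0) ^ Suc l / fact (Suc l)) \<le> cmod (h i j n (Suc l) s0 x) * cmod (\<sigma> - of_real s0) ^ Suc l / 1"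
          unfolding norm_divide norm_mult norm_power norm_fact by (intro divide_left_mono fact_ge_1) auto
        also have "\<dots> \<le> C * (1 + real n) ^ Suc l * cmod (\<sigma> - of_real s0) ^ Suc l"
          using h(3)[of "Suc l" s0 i j n x] l s0 by (simp only: div_by_1) (intro mult_right_mono, auto)
        also have "\<dots> = C * y ^ Suc l" by (simp add: y_def power_mult_distrib)
        also have "\<dots> \<le> C * y ^ 1" using C(1) y y1 by (intro mult_left_mono power_decreasing) auto
        finally show "cmod (h i j n (Suc l) s0 x * (\<sigma> - of_real s0) ^ Suc l / fact (Suc l)) \<le> C * y" by simp
      qed
      also have "\<dots> = C * real D * y" by simp
      also have "\<dots> \<le> C * real (Suc D) * (a * \<eta>)" using C(1) y by (intro mult_mono) auto
      also have "\<dots> = a * (C * real (Suc D)) * \<eta>" by (simp only: mult_ac)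
      also have "\<dots> \<le> c * \<eta>" using a(3) \<eta> by (intro mult_right_mono) auto
      finally show ?thesis .
    qed
    have adm: "adm 1 q (T (p - k) \<sigma> x) (e k x)" if "\<sigma> \<in> ?B" for k \<sigma> x
      using ok_robust[OF ok \<rho>J s0 \<eta>, of "x - real (p - k) *\<^sub>R \<alpha> s0"] Tn[OF _ that, of "p - k" x] od \<eta>
      unfolding robust_def e_def by (metis diff_le_self diff_self norm_zero mult_nonneg_nonneg less_imp_le)
    define g where "g \<sigma> x = lterm (\<lambda>k. T (p - k) \<sigma> x) (\<lambda>k. e k x) p" for \<sigma> x
    define G where "G \<sigma> = integral ?Q (g \<sigma>)" for \<sigma>
    have ch: "continuous_on S (\<lambda>y. h i j n l s0 (f y))" if "l \<le> D" "continuous_on S f" for i j n l f and S :: "'y::topological_space set"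
      by (rule continuous_on_compose2[OF h(4)[of l s0] that(2)]) (use that s0J in auto)
    have cT: "continuous_on S (\<lambda>y. T n (u y) (f y) $ i $ j)" "continuous_on S (\<lambda>y. T' n (u y) (f y) $ i $ j)"
      if "continuous_on S u" "continuous_on S f" for n u f i j and S :: "'y::topological_space set"
      unfolding T_def T'_def vec_lambda_beta by (intro continuous_intros ch that; simp)+
    have ce: "continuous_on S (\<lambda>y. e k (f y))" if "continuous_on S f" for k f and S :: "'y::topological_space set"
      unfolding e_def by (intro Le_cont continuous_intros that)
    have cg: "continuous_on S (g \<sigma>)" if "\<sigma> \<in> ?B" for \<sigma> S
      unfolding g_def
    proof (rule adm_lterm_continuous_on[where q = q])
      show "continuous_on S (\<lambda>x. T (p - k) \<sigma> x $ i $ j)" for k i j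
        by (rule cT(1)) (intro continuous_intros)+
      show "continuous_on S (\<lambda>x. e p x)" by (rule ce) (intro continuous_intros)
    qed (use adm[OF that] od in auto)
    have hol: "G holomorphic_on ?B"
      unfolding G_def
    proof (rule leibniz_rule_holomorphic[where fx = "\<lambda>\<sigma> x. dlterm (\<lambda>k. T (p - k) \<sigma> x) (\<lambda>k. T' (p - k) \<sigma> x) (\<lambda>k. e k x) (\<lambda>k. 0) p"])
      fix \<sigma> x assume \<sigma>: "\<sigma> \<in> ?B"
      show "((\<lambda>\<sigma>. g \<sigma> x) has_field_derivative dlterm (\<lambda>k. T (p - k) \<sigma> x) (\<lambda>k. T' (p - k) \<sigma> x) (\<lambda>k. e k x) (\<lambda>k. 0) p) (at \<sigma> within ?B)"
        unfolding g_def
      proof (rule lterm_has_field_derivative[where e = "\<lambda>k \<sigma>. e k x" and q = q])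
        show "((\<lambda>\<sigma>. T (p - k) \<sigma> x $ i $ j) has_field_derivative T' (p - k) \<sigma> x $ i $ j) (at \<sigma> within ?B)" for k i j
          unfolding T_def T'_def vec_lambda_beta by (auto intro!: derivative_eq_intros simp: mult_ac)
      qed (use adm \<sigma> od in auto)
    next
      show "g \<sigma> integrable_on ?Q" if "\<sigma> \<in> ?B" for \<sigma> by (intro integrable_continuous cg that)
      have "continuous_on (?B \<times> ?Q) (\<lambda>y. dlterm (\<lambda>k. T (p - k) (fst y) (snd y)) (\<lambda>k. T' (p - k) (fst y) (snd y)) (\<lambda>k. e k (snd y)) (\<lambda>k. 0) p)"
      proof (rule adm_dlterm_continuous_on[where q = q and e' = "\<lambda>k y. 0"])
        show "continuous_on (?B \<times> ?Q) (\<lambda>y. T (p - k) (fst y) (snd y) $ i $ j)" for k i j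
          by (rule cT(1)) (intro continuous_intros)+
        show "continuous_on (?B \<times> ?Q) (\<lambda>y. T' (p - k) (fst y) (snd y) $ i $ j)" for k i j
          by (rule cT(2)) (intro continuous_intros)+
        show "continuous_on (?B \<times> ?Q) (\<lambda>y. e p (snd y))" by (rule ce) (intro continuous_intros)
      qed (use adm od in auto)
      then show "continuous_on (?B \<times> ?Q) (\<lambda>(\<sigma>, x). dlterm (\<lambda>k. T (p - k) \<sigma> x) (\<lambda>k. T' (p - k) \<sigma> x) (\<lambda>k. e k x) (\<lambda>k. 0) p)"
        by (simp add: case_prod_unfold)
    qed auto
    have bd: "cmod (G \<sigma>) \<le> lbound q" if "\<sigma> \<in> ?B" for \<sigma>
      unfolding G_def
    proof (rule integral_unit_cube_bound[OF cg[OF that]])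
      show "cmod (g \<sigma> x) \<le> lbound q" for x
        unfolding g_def by (rule lterm_bound) (use adm that od in auto)
    qed
    obtain Q where Q: "degree Q \<le> D'"
      "\<And>t. \<bar>t - s0\<bar> \<le> \<delta> / 4 \<Longrightarrow> \<bar>Re (G (of_real t)) - poly Q t\<bar> \<le> real (Suc D') * lbound q * (2 * \<bar>t - s0\<bar> / \<delta>) ^ Suc D'"
      using holomorphic_poly_approx[OF hol bd \<delta>(1), of D'] by blast
    let ?y = "(1 + real p) * r"
    show "\<exists>Q :: real poly. degree Q \<le> D' \<and> (\<forall>s\<in>cball sc \<rho>. \<bar>s - s0\<bar> \<le> r \<longrightarrow>
       \<bar>Re (U N \<eta> s p) - poly Q s\<bar> \<le> (C1 + C2) * (?y ^ Suc D / \<eta> + (?y / \<eta>) ^ Suc D'))"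
    proof (intro exI[of _ Q] conjI Q(1) ballI impI)
      fix s assume s: "s \<in> cball sc \<rho>" and sr: "\<bar>s - s0\<bar> \<le> r"
      have sB: "of_real s \<in> ?B"
        using sr \<delta> by (simp add: dist_norm of_real_diff[symmetric] abs_minus_commute del: of_real_diff)
      have sJ: "s \<in> J" using s \<rho>J by blast
      have y0: "0 < ?y" using r by simp
      \<comment> \<open>The error of the Taylor polynomials is at most \<open>c \<eta> / R\<close>. If \<open>R\<close> is small, the claimed bound exceeds the trivial bound \<open>2 * lbound q\<close>.\<close>
      define R where "R = c * \<eta> / (2 * C * ?y ^ Suc D)"
      have R: "R > 0" using y0 C(1) od \<eta> by (simp add: R_def)
      have TL: "R * cmod (T (p - k) (of_real s) x $ i $ j - L N \<eta> s (x - real (p - k) *\<^sub>R \<alpha> s) $ i $ j) \<le> c * \<eta>" for k x i j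
      proof -
        let ?n = "p - k"
        have "cmod (h i j ?n 0 s x - (\<Sum>l\<le>D. h i j ?n l s0 x * of_real (s - s0) ^ l / fact l)) \<le> 2 * (C * (1 + real ?n) ^ Suc D) * \<bar>s - s0\<bar> ^ Suc D"
        proof (rule complex_valued_Taylor[where S = "cball sc \<rho>" and f = "\<lambda>l s. h i j ?n l s x"])
          show "((\<lambda>s. h i j ?n l s x) has_vector_derivative h i j ?n (Suc l) t x) (at t)" if "t \<in> cball sc \<rho>" "l \<le> D" for l t
            using h(2)[of l t] that \<rho>J by auto
          show "cmod (h i j ?n (Suc D) t x) \<le> C * (1 + real ?n) ^ Suc D" if "t \<in> cball sc \<rho>" for t
            by (rule h(3)[OF order_refl that])
        qed (use s s0 in auto)
        then have "cmod (T ?n (of_real s) x $ i $ j - L N \<eta> s (x - real ?n *\<^sub>R \<alpha> s) $ i $ j) \<le> 2 * (C * (1 + real ?n) ^ Suc D) * \<bar>s - s0\<bar> ^ Suc D"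
          by (simp add: T_def h(1) norm_minus_commute)
        also have "\<dots> \<le> 2 * (C * (1 + real p) ^ Suc D) * r ^ Suc D"
          using C(1) sr by (intro mult_mono mult_left_mono power_mono) auto
        also have "\<dots> = 2 * C * ?y ^ Suc D" by (simp only: power_mult_distrib mult_ac)
        finally have "R * cmod (T ?n (of_real s) x $ i $ j - L N \<eta> s (x - real ?n *\<^sub>R \<alpha> s) $ i $ j) \<le> R * (2 * C * ?y ^ Suc D)"
          using R by (intro mult_left_mono) auto
        also have "\<dots> = c * \<eta>" using y0 C(1) r(1) by (simp add: R_def)
        finally show ?thesis .
      qed
      have pw: "cmod (g (of_real s) x - lterm (\<lambda>k. L N \<eta> s (x - real (p - k) *\<^sub>R \<alpha> s)) (\<lambda>k. Le N \<eta> (x - real (p - k) *\<^sub>R \<alpha> s)) p) \<le> 8 * lbound q / R" for x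
      proof -
        let ?M = "\<lambda>k. L N \<eta> s (x - real (p - k) *\<^sub>R \<alpha> s)" and ?e = "\<lambda>k. Le N \<eta> (x - real (p - k) *\<^sub>R \<alpha> s)"
        have ge: "g (of_real s) x = lterm (\<lambda>k. T (p - k) (of_real s) x) ?e p"
          unfolding g_def by (rule lterm_cong) (auto simp: e_def)
        show ?thesis
        proof (cases "R \<ge> 4")
          case True
          have "cmod (lterm (\<lambda>k. T (p - k) (of_real s) x) ?e p - lterm ?M ?e p) \<le> 4 * lbound q / R"
            by (rule lterm_perturb[where \<rho> = "c * \<eta>"])
              (use ok_robust[OF ok \<rho>J s \<eta>] od \<eta> True TL in \<open>auto simp del: of_nat_diff\<close>)
          also have "\<dots> \<le> 8 * lbound q / R" using lb R by (intro divide_right_mono) auto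
          finally show ?thesis unfolding ge .
        next
          case False
          have "cmod (g (of_real s) x) \<le> lbound q"
            unfolding g_def by (rule lterm_bound) (use adm sB od in auto)
          moreover have "cmod (lterm ?M ?e p) \<le> lbound q"
            by (rule lterm_bound) (use ok_adm1[OF ok \<rho>J s] \<eta> od in auto)
          moreover have "2 * lbound q \<le> 8 * lbound q / R" using False R lb by (simp add: field_simps)
          ultimately show ?thesis using norm_triangle_ineq4[of "g (of_real s) x" "lterm ?M ?e p"] by linarith
        qed
      qed
      have "cmod (G (of_real s) - U N \<eta> s p) \<le> 8 * lbound q / R"
      proof -
        let ?f = "\<lambda>x. lterm (\<lambda>k. L N \<eta> s (x - real (p - k) *\<^sub>R \<alpha> s)) (\<lambda>k. Le N \<eta> (x - real (p - k) *\<^sub>R \<alpha> s)) p"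
        have cf: "continuous_on ?Q ?f"
        proof (rule adm_lterm_continuous_on[where q = q])
          show "continuous_on ?Q (\<lambda>x. L N \<eta> s (x - real (p - k) *\<^sub>R \<alpha> s) $ i $ j)" for k i j
            by (intro L_cont sJ continuous_intros)
          show "continuous_on ?Q (\<lambda>x. Le N \<eta> (x - real (p - p) *\<^sub>R \<alpha> s))"
            by (intro Le_cont continuous_intros)
        qed (use ok_adm1[OF ok \<rho>J s] \<eta> od in auto)
        have "G (of_real s) - U N \<eta> s p = integral ?Q (\<lambda>x. g (of_real s) x - ?f x)"
          unfolding G_def U_shifted[OF s less_imp_le[OF \<eta>(1)] \<eta>(2)]
          by (intro integral_diff[symmetric] integrable_continuous cg sB cf)
        also have "cmod \<dots> \<le> 8 * lbound q / R"
          by (rule integral_unit_cube_bound) (use pw in \<open>auto intro!: continuous_on_diff cg sB cf\<close>)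
        finally show ?thesis .
      qed
      then have 1: "\<bar>Re (U N \<eta> s p) - Re (G (of_real s))\<bar> \<le> 8 * lbound q / R"
        using abs_Re_le_cmod[of "G (of_real s) - U N \<eta> s p"] by (simp add: abs_minus_commute)
      also have "8 * lbound q / R = C1 * (?y ^ Suc D / \<eta>)" using od \<eta> by (simp add: R_def C1_def)
      finally have 1: "\<bar>Re (U N \<eta> s p) - Re (G (of_real s))\<bar> \<le> C1 * (?y ^ Suc D / \<eta>)" .
      have "\<bar>Re (G (of_real s)) - poly Q s\<bar> \<le> real (Suc D') * lbound q * (2 * \<bar>s - s0\<bar> / \<delta>) ^ Suc D'"
        by (rule Q(2)) (use sr \<delta> in simp)
      also have "\<dots> \<le> real (Suc D') * lbound q * (2 / a * (?y / \<eta>)) ^ Suc D'"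
      proof (intro mult_left_mono power_mono)
        have "2 * \<bar>s - s0\<bar> / \<delta> \<le> 2 * r / \<delta>" using sr \<delta> by (intro divide_right_mono) auto
        also have "\<dots> = 2 / a * (?y / \<eta>)" by (simp add: \<delta>_def)
        finally show "2 * \<bar>s - s0\<bar> / \<delta> \<le> 2 / a * (?y / \<eta>)" .
      qed (use lb \<delta> in auto)
      also have "\<dots> = C2 * (?y / \<eta>) ^ Suc D'" by (simp only: C2_def power_mult_distrib mult.assoc)
      finally have 2: "\<bar>Re (G (of_real s)) - poly Q s\<bar> \<le> C2 * (?y / \<eta>) ^ Suc D'" .
      have "C1 * (?y ^ Suc D / \<eta>) + C2 * (?y / \<eta>) ^ Suc D' \<le> (C1 + C2) * (?y ^ Suc D / \<eta>) + (C1 + C2) * (?y / \<eta>) ^ Suc D'"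
        using C12 y0 \<eta> by (intro add_mono mult_right_mono) auto
      then show "\<bar>Re (U N \<eta> s p) - poly Q s\<bar> \<le> (C1 + C2) * (?y ^ Suc D / \<eta> + (?y / \<eta>) ^ Suc D')"
        unfolding distrib_left using 1 2 by linarith
    qed
  qed (use C12 a in auto)
qed

end

text \<open>
  For \<open>p \<ge> 1 / \<eta>\<^sup>2\<close> the power is at most \<open>exp (- \<kappa> / \<eta>)\<close>, smaller than every power of \<open>\<eta>\<close>.
\<close>

lemma power_exp_bound:
  assumes "0 < \<kappa>" "0 < \<eta>" "\<kappa> * \<eta> \<le> 1" "1 / \<eta>^2 \<le> real p"
  shows "(1 - \<kappa> * \<eta>) ^ p \<le> fact m / \<kappa> ^ m * \<eta> ^ m"
proof -
  have "(1 - \<kappa> * \<eta>) ^ p \<le> exp (- (\<kappa> * \<eta>)) ^ p"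
    using assms(3) exp_ge_add_one_self[of "- (\<kappa> * \<eta>)"] by (intro power_mono) auto
  also have "\<dots> = exp (- (\<kappa> * \<eta> * real p))" by (simp add: exp_of_nat_mult[symmetric] mult.commute)
  also have "\<dots> \<le> exp (- (\<kappa> / \<eta>))"
  proof -
    have "\<kappa> * \<eta> * (1 / \<eta>^2) \<le> \<kappa> * \<eta> * real p" using assms by (intro mult_left_mono) auto
    then show ?thesis using assms by (simp add: power2_eq_square)
  qed
  also have "\<dots> = 1 / exp (\<kappa> / \<eta>)" by (simp add: exp_minus inverse_eq_divide)
  also have "\<dots> \<le> 1 / ((\<kappa> / \<eta>) ^ m / fact m)"
  proof (rule divide_left_mono)
    show "(\<kappa> / \<eta>) ^ m / fact m \<le> exp (\<kappa> / \<eta>)"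
    proof -
      have s: "(\<lambda>n. (\<kappa> / \<eta>) ^ n /\<^sub>R fact n) sums exp (\<kappa> / \<eta>)" by (rule exp_converges)
      have "(\<Sum>n\<in>{m}. (\<kappa> / \<eta>) ^ n /\<^sub>R fact n) \<le> (\<Sum>n. (\<kappa> / \<eta>) ^ n /\<^sub>R fact n)"
        by (rule sum_le_suminf[OF sums_summable[OF s]]) (use assms in auto)
      then show ?thesis unfolding sums_unique[OF s, symmetric] by (simp add: divide_inverse mult.commute)
    qed
  qed (use assms in auto)
  also have "\<dots> = fact m / \<kappa> ^ m * \<eta> ^ m" by (simp add: power_divide)
  finally show ?thesis .
qed

text \<open>
  Balance of the errors at scale \<open>h\<close>: with \<open>\<eta> = h\<^bsup>1/4\<^esup>\<close> and \<open>p\<close> of size \<open>1 / \<eta>\<^sup>2\<close>, the height costs \<open>\<eta>\<^sup>N\<close>, the truncation at \<open>p\<close> is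
  exponentially small, and \<open>(1 + p) h\<close> is \<open>O(\<eta>\<^sup>2)\<close>. The errors of \<open>parameter_poly_approx\<close> are thus
  \<open>O(\<eta>\<^bsup>2 D + 1\<^esup>)\<close> and \<open>O(\<eta>\<^bsup>D' + 1\<^esup>)\<close>, and suitable \<open>N\<close>, \<open>D\<close>, \<open>D'\<close> bring everything below
  \<open>h\<^sup>n = \<eta>\<^bsup>4 n\<^esup>\<close>.
\<close>

lemma U_limit_poly_approximable:
  assumes ok: "\<And>N. N \<ge> 1 \<Longrightarrow> \<exists>q \<eta>0 c \<kappa>. fam_ok \<rho> N q \<eta>0 c \<kappa>" and \<rho>J: "cball sc \<rho> \<subseteq> J"
  shows "poly_approximable (\<lambda>s. Re (U_limit s)) (ball sc \<rho>)"
  unfolding poly_approximable_def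
proof
  fix n :: nat
  define N where "N = Suc (4 * n)"
  define D where "D = 2 * n"
  define D' where "D' = 4 * n"
  obtain q1 \<eta>1 c1 \<kappa>1 where ok1: "fam_ok \<rho> 1 q1 \<eta>1 c1 \<kappa>1" using ok by blast
  obtain q \<eta>0 c \<kappa> where okN: "fam_ok \<rho> N q \<eta>0 c \<kappa>" using ok[of N] by (auto simp: N_def)
  note od = okD[OF okN \<rho>J]
  obtain C where C: "C > 0" "\<And>s p \<eta>. s \<in> cball sc \<rho> \<Longrightarrow> 0 < \<eta> \<Longrightarrow> \<eta> \<le> \<eta>0 \<Longrightarrow>
    cmod (U_limit s - U N \<eta> s p) \<le> C * \<eta> ^ N + 2 / (1 - q) * (1 - \<kappa> * \<eta>) ^ p / (\<kappa> * \<eta>)"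
    by (rule U_limit_approx[OF ok1 okN \<rho>J]) (auto simp: N_def)
  obtain C3 c2 where C3: "C3 > 0" "c2 > 0" "\<And>s0 \<eta> p r. s0 \<in> cball sc \<rho> \<Longrightarrow> 0 < \<eta> \<Longrightarrow> \<eta> \<le> \<eta>0 \<Longrightarrow> 0 < r \<Longrightarrow> r * (1 + real p) \<le> c2 * \<eta> \<Longrightarrow>
    \<exists>Q :: real poly. degree Q \<le> D' \<and> (\<forall>s\<in>cball sc \<rho>. \<bar>s - s0\<bar> \<le> r \<longrightarrow>
       \<bar>Re (U N \<eta> s p) - poly Q s\<bar> \<le> C3 * (((1 + real p) * r) ^ Suc D / \<eta> + ((1 + real p) * r / \<eta>) ^ Suc D'))"
    using parameter_poly_approx[OF okN \<rho>J, where D = D and D' = D'] by blast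
  define E where "E = C + 2 / (1 - q) / \<kappa> * (fact N / \<kappa> ^ N) + C3 * (3 ^ Suc D + 3 ^ Suc D')"
  have E: "E > 0"
    unfolding E_def using C(1) C3(1) od by (intro add_pos_pos mult_pos_pos divide_pos_pos) auto
  define h0 where "h0 = (min \<eta>0 (c2 / 3)) ^ 4"
  show "\<exists>C D h0 m. C > 0 \<and> h0 > 0 \<and> m \<ge> 1 \<and>
     (\<forall>s h. 0 < h \<longrightarrow> h \<le> h0 \<longrightarrow> cball s (m * h) \<subseteq> ball sc \<rho> \<longrightarrow>
        (\<exists>q. degree q \<le> D \<and> (\<forall>t. \<bar>t - s\<bar> \<le> h \<longrightarrow> \<bar>Re (U_limit t) - poly q t\<bar> \<le> C * h ^ n)))"
  proof (rule exI[of _ E], rule exI[of _ D'], rule exI[of _ h0], rule exI[of _ 1], intro conjI allI impI)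
    show "E > 0" by (rule E)
    show "h0 > 0" using od C3 by (simp add: h0_def)
    fix s h :: real assume h: "0 < h" "h \<le> h0" and sub: "cball s (1 * h) \<subseteq> ball sc \<rho>"
    define \<eta> where "\<eta> = root 4 h"
    have \<eta>4: "\<eta> ^ 4 = h" using h by (simp add: \<eta>_def)
    have \<eta>: "0 < \<eta>" "\<eta> \<le> \<eta>0" "\<eta> \<le> c2 / 3" "\<eta> \<le> 1"
    proof -
      show "0 < \<eta>" using h by (simp add: \<eta>_def)
      have "\<eta> \<le> min \<eta>0 (c2 / 3)"
      proof (rule power_le_imp_le_base[of _ 3])
        show "\<eta> ^ Suc 3 \<le> min \<eta>0 (c2 / 3) ^ Suc 3" using \<eta>4 h(2) by (simp add: h0_def numeral_eq_Suc)
      qed (use od C3 in auto)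
      then show "\<eta> \<le> \<eta>0" "\<eta> \<le> c2 / 3" "\<eta> \<le> 1" using od by auto
    qed
    \<comment> \<open>\<open>p\<close> is large enough for the truncation and small enough to keep \<open>(1 + p) \<eta>\<^sup>2\<close> bounded.\<close>
    define p where "p = nat \<lceil>1 / \<eta>^2\<rceil>"
    have p: "1 / \<eta>^2 \<le> real p" unfolding p_def by linarith
    have \<eta>2: "\<eta>^2 \<le> 1" using \<eta> by (simp add: power_le_one)
    have p3: "(1 + real p) * \<eta>^2 \<le> 3"
    proof -
      have "0 \<le> 1 / \<eta>^2" by simp
      then have "real p \<le> 1 / \<eta>^2 + 1" unfolding p_def by linarith
      then have "(1 + real p) * \<eta>^2 \<le> (2 + 1 / \<eta>^2) * \<eta>^2" by (intro mult_right_mono) auto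
      also have "\<dots> = 2 * \<eta>^2 + 1" using \<eta> by (simp add: field_simps)
      finally show ?thesis using \<eta>2 by linarith
    qed
    have y: "(1 + real p) * h \<le> 3 * \<eta>^2"
    proof -
      have "(1 + real p) * h = (1 + real p) * \<eta>^2 * \<eta>^2" by (simp add: \<eta>4[symmetric] power_add[symmetric] mult.assoc)
      also have "\<dots> \<le> 3 * \<eta>^2" by (rule mult_right_mono[OF p3]) simp
      finally show ?thesis .
    qed
    have y0: "0 \<le> (1 + real p) * h" using h by simp
    have "s \<in> cball s (1 * h)" using h by simp
    then have s: "s \<in> cball sc \<rho>" using sub by (meson ball_subset_cball subsetD)
    have "h * (1 + real p) \<le> c2 * \<eta>"
    proof -
      have "h * (1 + real p) \<le> 3 * \<eta> * \<eta>" using y by (simp add: power2_eq_square mult.commute mult.left_commute)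
      also have "\<dots> \<le> c2 * \<eta>" using \<eta> by (intro mult_right_mono) auto
      finally show ?thesis .
    qed
    from C3(3)[OF s \<eta>(1,2) h(1) this] obtain Q where Q: "degree Q \<le> D'"
      "\<And>t. t \<in> cball sc \<rho> \<Longrightarrow> \<bar>t - s\<bar> \<le> h \<Longrightarrow>
       \<bar>Re (U N \<eta> t p) - poly Q t\<bar> \<le> C3 * (((1 + real p) * h) ^ Suc D / \<eta> + ((1 + real p) * h / \<eta>) ^ Suc D')" by blast
    have hn: "h ^ n = \<eta> ^ (4 * n)" by (simp add: \<eta>4[symmetric] power_mult[symmetric])
    have b1: "C * \<eta> ^ N \<le> C * h ^ n"
      unfolding hn N_def using \<eta> C(1) by (intro mult_left_mono power_decreasing) auto
    have b2: "2 / (1 - q) * (1 - \<kappa> * \<eta>) ^ p / (\<kappa> * \<eta>) \<le> 2 / (1 - q) / \<kappa> * (fact N / \<kappa> ^ N) * h ^ n"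
    proof -
      have "\<kappa> * \<eta> \<le> \<kappa> * \<eta>0" using \<eta> od by simp
      then have "\<kappa> * \<eta> \<le> 1" using od by linarith
      from power_exp_bound[OF od(6) \<eta>(1) this p, of N]
      have "2 / (1 - q) * (1 - \<kappa> * \<eta>) ^ p / (\<kappa> * \<eta>) \<le> 2 / (1 - q) * (fact N / \<kappa> ^ N * \<eta> ^ N) / (\<kappa> * \<eta>)"
        using od \<eta> by (intro divide_right_mono mult_left_mono) auto
      also have "\<dots> = 2 / (1 - q) / \<kappa> * (fact N / \<kappa> ^ N) * \<eta> ^ (4 * n)"
      proof -
        have eN: "\<eta> ^ N = \<eta> * \<eta> ^ (4 * n)" by (simp add: N_def)
        have gen: "A * (X * (\<eta> * Y)) / (\<kappa> * \<eta>) = A / \<kappa> * X * Y" for A X Y :: real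
          using \<eta>(1) by simp
        show ?thesis unfolding eN by (rule gen)
      qed
      finally show ?thesis by (simp add: hn)
    qed
    have b3: "((1 + real p) * h) ^ Suc D / \<eta> \<le> 3 ^ Suc D * h ^ n"
    proof -
      have "((1 + real p) * h) ^ Suc D / \<eta> \<le> (3 * \<eta>^2) ^ Suc D / \<eta>"
        using y y0 \<eta> by (intro divide_right_mono power_mono) auto
      also have "\<dots> = 3 ^ Suc D * \<eta> ^ Suc (4 * n)"
      proof -
        have "(\<eta>^2) ^ Suc D = \<eta> ^ (2 * Suc D)" by (simp only: power_mult)
        also have "2 * Suc D = Suc (Suc (4 * n))" by (simp add: D_def)
        finally have e: "(\<eta>^2) ^ Suc D = \<eta> ^ Suc (Suc (4 * n))" .
        show ?thesis unfolding power_mult_distrib e using \<eta>(1) by simp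
      qed
      also have "\<dots> \<le> 3 ^ Suc D * \<eta> ^ (4 * n)" using \<eta> by (intro mult_left_mono power_decreasing) auto
      finally show ?thesis by (simp add: hn)
    qed
    have b4: "((1 + real p) * h / \<eta>) ^ Suc D' \<le> 3 ^ Suc D' * h ^ n"
    proof -
      have "(1 + real p) * h / \<eta> \<le> 3 * \<eta>" using y \<eta>(1) by (simp add: divide_le_eq power2_eq_square mult.assoc)
      then have "((1 + real p) * h / \<eta>) ^ Suc D' \<le> (3 * \<eta>) ^ Suc D'" using y0 \<eta> by (intro power_mono) auto
      also have "\<dots> = 3 ^ Suc D' * \<eta> ^ Suc (4 * n)" by (simp only: power_mult_distrib D'_def)
      also have "\<dots> \<le> 3 ^ Suc D' * \<eta> ^ (4 * n)" using \<eta> by (intro mult_left_mono power_decreasing) auto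
      finally show ?thesis by (simp add: hn)
    qed
    show "\<exists>q. degree q \<le> D' \<and> (\<forall>t. \<bar>t - s\<bar> \<le> h \<longrightarrow> \<bar>Re (U_limit t) - poly q t\<bar> \<le> E * h ^ n)"
    proof (intro exI[of _ Q] conjI allI impI Q(1))
      fix t assume t: "\<bar>t - s\<bar> \<le> h"
      then have "t \<in> cball s (1 * h)" by (simp add: dist_real_def abs_minus_commute)
      then have tc: "t \<in> cball sc \<rho>" using sub by (meson ball_subset_cball subsetD)
      have "\<bar>Re (U_limit t) - Re (U N \<eta> t p)\<bar> \<le> cmod (U_limit t - U N \<eta> t p)"
        using abs_Re_le_cmod[of "U_limit t - U N \<eta> t p"] by simp
      also have "\<dots> \<le> C * h ^ n + 2 / (1 - q) / \<kappa> * (fact N / \<kappa> ^ N) * h ^ n"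
        using C(2)[OF tc \<eta>(1,2), of p] b1 b2 by linarith
      finally have 1: "\<bar>Re (U_limit t) - Re (U N \<eta> t p)\<bar> \<le> C * h ^ n + 2 / (1 - q) / \<kappa> * (fact N / \<kappa> ^ N) * h ^ n" .
      have "\<bar>Re (U N \<eta> t p) - poly Q t\<bar> \<le> C3 * (((1 + real p) * h) ^ Suc D / \<eta> + ((1 + real p) * h / \<eta>) ^ Suc D')"
        by (rule Q(2)[OF tc t])
      also have "\<dots> \<le> C3 * (3 ^ Suc D * h ^ n + 3 ^ Suc D' * h ^ n)"
        using C3(1) b3 b4 by (intro mult_left_mono add_mono) auto
      finally have 2: "\<bar>Re (U N \<eta> t p) - poly Q t\<bar> \<le> C3 * (3 ^ Suc D * h ^ n + 3 ^ Suc D' * h ^ n)" .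
      have "E * h ^ n = C * h ^ n + 2 / (1 - q) / \<kappa> * (fact N / \<kappa> ^ N) * h ^ n + C3 * (3 ^ Suc D * h ^ n + 3 ^ Suc D' * h ^ n)"
        by (simp only: E_def ring_distribs mult.assoc)
      then show "\<bar>Re (U_limit t) - poly Q t\<bar> \<le> E * h ^ n" using 1 2 by linarith
    qed
  qed simp
qed

end

section \<open>Monotonicity as positivity of a cross product\<close>

definition cross2 :: "real^2 \<Rightarrow> real^2 \<Rightarrow> real" where
  "cross2 u v = u$1 * v$2 - u$2 * v$1"

lemma bounded_linear_mv: "bounded_linear (\<lambda>M :: real^'n^'m. M *v y)"
  unfolding linear_conv_bounded_linear[symmetric]
  by (rule linearI) (simp_all add: matrix_vector_mult_add_rdistrib scaleR_matrix_vector_assoc)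

text \<open>
  The angular velocity of a curve \<open>\<gamma>\<close> is \<open>cross2 \<gamma> \<gamma>' / \<bar>\<gamma>\<bar>\<^sup>2\<close>. A continuous argument is built from a
  continuous logarithm, so that the hypothesis can be applied to it.
\<close>

lemma monotonic_imp_cross_pos:
  fixes A :: "real^'d \<Rightarrow> real^2^2"
  assumes mon: "\<And>\<theta>. continuous_argument \<theta> (\<lambda>t. A (x + t *\<^sub>R w) *v y) \<Longrightarrow> \<exists>D>0. (\<theta> has_real_derivative D) (at 0)"
    and det: "\<And>x. det (A x) = 1" and diff: "\<And>x. A differentiable (at x)" and y: "y \<noteq> 0"
  shows "cross2 (A x *v y) (frechet_derivative A (at x) w *v y) > 0"
proof -
  define \<gamma> where "\<gamma> t = A (x + t *\<^sub>R w) *v y" for t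
  define \<gamma>' where "\<gamma>' = frechet_derivative A (at x) w *v y"
  have d\<gamma>: "(\<gamma> has_vector_derivative \<gamma>') (at 0)"
  proof -
    have 1: "(A has_derivative frechet_derivative A (at (x + 0 *\<^sub>R w))) (at (x + 0 *\<^sub>R w))"
      using diff frechet_derivative_works by blast
    have 2: "((\<lambda>t. x + t *\<^sub>R w) has_derivative (\<lambda>h. h *\<^sub>R w)) (at 0)"
      by (auto intro!: derivative_eq_intros)
    have "((\<lambda>t. A (x + t *\<^sub>R w)) has_derivative (\<lambda>h. frechet_derivative A (at x) (h *\<^sub>R w))) (at 0)"
      using has_derivative_compose[OF 2 1] by simp
    moreover have "frechet_derivative A (at x) (h *\<^sub>R w) = h *\<^sub>R frechet_derivative A (at x) w" for h
      using linear_scale[OF has_derivative_linear[OF 1]] by simp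
    ultimately have "((\<lambda>t. A (x + t *\<^sub>R w)) has_vector_derivative frechet_derivative A (at x) w) (at 0)"
      by (simp add: has_vector_derivative_def)
    from bounded_linear.has_vector_derivative[OF bounded_linear_mv this]
    show ?thesis by (simp add: \<gamma>_def[abs_def] \<gamma>'_def)
  qed
  have cont: "continuous_on UNIV \<gamma>"
  proof -
    have "continuous_on UNIV A"
      by (intro continuous_at_imp_continuous_on ballI differentiable_imp_continuous_within diff)
    then have "continuous_on UNIV (\<lambda>t. A (x + t *\<^sub>R w))"
      by (rule continuous_on_compose2) (auto intro!: continuous_intros)
    from bounded_linear.continuous_on[OF bounded_linear_mv this] show ?thesis by (simp add: \<gamma>_def[abs_def])
  qed
  have nz: "\<gamma> t \<noteq> 0" for t
  proof
    assume "\<gamma> t = 0"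
    then have "A (x + t *\<^sub>R w) *v y = A (x + t *\<^sub>R w) *v 0" by (simp add: \<gamma>_def)
    moreover have "inj ((*v) (A (x + t *\<^sub>R w)))"
      by (rule inj_matrix_vector_mult) (simp add: invertible_det_nz det)
    ultimately show False using y by (meson injD)
  qed
  define g where "g t = of_real (\<gamma> t $ 1) + \<i> * of_real (\<gamma> t $ 2)" for t
  have gRI: "Re (g t) = \<gamma> t $ 1" "Im (g t) = \<gamma> t $ 2" for t by (simp_all add: g_def)
  have "continuous_on UNIV g"
    unfolding g_def by (intro continuous_intros continuous_on_component cont)
  moreover have "g t \<noteq> 0" for t
    using nz[of t] gRI[of t] by (auto simp: vec_eq_iff forall_2 complex_eq_iff)
  ultimately obtain h where h: "continuous_on UNIV h" "\<And>t. g t = exp (h t)"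
    using continuous_logarithm_on_contractible[of UNIV g] convex_imp_contractible[OF convex_UNIV] by (metis UNIV_I)
  define \<theta> where "\<theta> t = Im (h t)" for t
  have comp: "\<gamma> t $ 1 = exp (Re (h t)) * cos (\<theta> t)" "\<gamma> t $ 2 = exp (Re (h t)) * sin (\<theta> t)" for t
    using gRI[of t] by (simp_all add: h(2) Re_exp Im_exp \<theta>_def)
  have "continuous_argument \<theta> \<gamma>"
    unfolding continuous_argument_def
  proof (intro conjI allI)
    show "continuous_on UNIV \<theta>" unfolding \<theta>_def by (intro continuous_intros h)
    fix t
    have "(norm (\<gamma> t))\<^sup>2 = (exp (Re (h t)))\<^sup>2 * ((cos (\<theta> t))\<^sup>2 + (sin (\<theta> t))\<^sup>2)"
      unfolding power2_norm_eq_inner inner_vec_def sum_2 inner_real_def comp by algebra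
    then have "norm (\<gamma> t) = exp (Re (h t))" by simp
    then show "\<gamma> t = norm (\<gamma> t) *\<^sub>R vector [cos (\<theta> t), sin (\<theta> t)]"
      by (simp add: vec_eq_iff forall_2 comp)
  qed
  then obtain D where D: "D > 0" "(\<theta> has_real_derivative D) (at 0)"
    using mon unfolding \<gamma>_def by blast
  define r where "r = exp (Re (h 0))"
  have r: "r > 0" by (simp add: r_def)
  have d1: "((\<lambda>t. \<gamma> t $ i) has_real_derivative \<gamma>' $ i) (at 0)" for i
    using bounded_linear.has_vector_derivative[OF bounded_linear_vec_nth d\<gamma>]
    by (simp add: has_real_derivative_iff_has_vector_derivative)
  \<comment> \<open>Differentiate the identity \<open>\<gamma>\<^sub>1 sin \<theta> = \<gamma>\<^sub>2 cos \<theta>\<close>.\<close>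
  have "((\<lambda>t. \<gamma> t $ 1 * sin (\<theta> t) - \<gamma> t $ 2 * cos (\<theta> t)) has_real_derivative
     (\<gamma>' $ 1 * sin (\<theta> 0) + \<gamma> 0 $ 1 * (cos (\<theta> 0) * D) - (\<gamma>' $ 2 * cos (\<theta> 0) + \<gamma> 0 $ 2 * (- sin (\<theta> 0) * D)))) (at 0)"
    by (auto intro!: derivative_eq_intros d1 D(2))
  moreover have "(\<lambda>t. \<gamma> t $ 1 * sin (\<theta> t) - \<gamma> t $ 2 * cos (\<theta> t)) = (\<lambda>t. 0)"
    by (simp add: comp)
  ultimately have "((\<lambda>t::real. 0::real) has_real_derivative
     (\<gamma>' $ 1 * sin (\<theta> 0) + \<gamma> 0 $ 1 * (cos (\<theta> 0) * D) - (\<gamma>' $ 2 * cos (\<theta> 0) + \<gamma> 0 $ 2 * (- sin (\<theta> 0) * D)))) (at 0)"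
    by simp
  then have "\<gamma>' $ 1 * sin (\<theta> 0) + \<gamma> 0 $ 1 * (cos (\<theta> 0) * D) - (\<gamma>' $ 2 * cos (\<theta> 0) + \<gamma> 0 $ 2 * (- sin (\<theta> 0) * D)) = 0"
    using DERIV_unique DERIV_const by blast
  then have "\<gamma>' $ 2 * cos (\<theta> 0) - \<gamma>' $ 1 * sin (\<theta> 0) = r * D * ((cos (\<theta> 0))\<^sup>2 + (sin (\<theta> 0))\<^sup>2)"
    unfolding comp r_def by algebra
  then have "\<gamma>' $ 2 * cos (\<theta> 0) - \<gamma>' $ 1 * sin (\<theta> 0) = r * D" by simp
  moreover have "cross2 (\<gamma> 0) \<gamma>' = r * (\<gamma>' $ 2 * cos (\<theta> 0) - \<gamma>' $ 1 * sin (\<theta> 0))"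
    unfolding cross2_def comp r_def by (simp add: algebra_simps)
  ultimately have "cross2 (\<gamma> 0) \<gamma>' > 0" using r D by simp
  then show ?thesis by (simp add: \<gamma>_def \<gamma>'_def)
qed

section \<open>Smoothing of periodic C1 maps\<close>

lemma Ck_on_trig:
  "Ck_on k (\<lambda>x::real^'d. cos (c * x $ i)) UNIV" "Ck_on k (\<lambda>x::real^'d. sin (c * x $ i)) UNIV"
proof (induction k)
  case 0
  { case 1 show ?case by (auto intro!: continuous_intros) }
  { case 2 show ?case by (auto intro!: continuous_intros) }
next
  case (Suc k)
  note bm = Ck_on_bilinear[OF open_UNIV bounded_bilinear_mult]
  { case 1
    show ?case
    proof (rule Ck_on_SucI[OF open_UNIV])
      show "((\<lambda>x. cos (c * x $ i)) has_derivative (\<lambda>v. (- c * v $ i) * sin (c * x $ i))) (at x)" for x :: "real^'d"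
        by (auto intro!: derivative_eq_intros bounded_linear.has_derivative[OF bounded_linear_vec_nth] simp: algebra_simps)
      show "Ck_on k (\<lambda>x. (- c * v $ i) * sin (c * x $ i)) UNIV" for v :: "real^'d"
        by (intro bm Ck_on_const open_UNIV Suc)
    qed }
  { case 2
    show ?case
    proof (rule Ck_on_SucI[OF open_UNIV])
      show "((\<lambda>x. sin (c * x $ i)) has_derivative (\<lambda>v. (c * v $ i) * cos (c * x $ i))) (at x)" for x :: "real^'d"
        by (auto intro!: derivative_eq_intros bounded_linear.has_derivative[OF bounded_linear_vec_nth] simp: algebra_simps)
      show "Ck_on k (\<lambda>x. (c * v $ i) * cos (c * x $ i)) UNIV" for v :: "real^'d"
        by (intro bm Ck_on_const open_UNIV Suc)
    qed }
qed

text \<open>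
  Kernels of finite rank. Integration against such a kernel produces finite combinations of smooth functions, so smoothness of the convolution requires no differentiation under
  the integral sign.
\<close>

inductive separable :: "(real^'d \<Rightarrow> real^'d \<Rightarrow> real) \<Rightarrow> bool" where
  sep_prod: "smooth_on \<phi> UNIV \<Longrightarrow> continuous_on UNIV \<psi> \<Longrightarrow> separable (\<lambda>x y. \<phi> x * \<psi> y)"
| sep_add: "separable K \<Longrightarrow> separable L \<Longrightarrow> separable (\<lambda>x y. K x y + L x y)"

lemma separable_mult:
  assumes "separable K" "separable L" shows "separable (\<lambda>x y. K x y * L x y)"
  using assms(1)
proof induction
  case (sep_prod \<phi> \<psi>)
  from assms(2) show ?case
  proof induction
    case (sep_prod \<phi>' \<psi>')
    have "separable (\<lambda>x y. (\<phi> x * \<phi>' x) * (\<psi> y * \<psi>' y))"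
      by (intro separable.sep_prod smooth_on_mult open_UNIV continuous_on_mult)
        (use sep_prod \<open>smooth_on \<phi> UNIV\<close> \<open>continuous_on UNIV \<psi>\<close> in auto)
    then show ?case by (simp add: mult_ac)
  next
    case (sep_add K L)
    then show ?case using separable.sep_add[OF sep_add.IH] by (simp add: distrib_left)
  qed
next
  case (sep_add K L)
  then show ?case using separable.sep_add[OF sep_add.IH] by (simp add: distrib_right)
qed

lemma separable_integral_smooth:
  fixes B :: "real^'d \<Rightarrow> 'b::euclidean_space"
  assumes "separable K" "continuous_on UNIV B"
  shows "smooth_on (\<lambda>x. integral (cbox 0 One) (\<lambda>y. K x y *\<^sub>R B y)) UNIV"
    and "continuous_on UNIV (K x)"
proof -
  have "smooth_on (\<lambda>x. integral (cbox 0 One) (\<lambda>y. K x y *\<^sub>R B y)) UNIV \<and> (\<forall>x. continuous_on UNIV (K x))"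
    using assms(1)
  proof induction
    case (sep_prod \<phi> \<psi>)
    have "(\<lambda>x. integral (cbox 0 One) (\<lambda>y. (\<phi> x * \<psi> y) *\<^sub>R B y)) = (\<lambda>x. \<phi> x *\<^sub>R integral (cbox 0 One) (\<lambda>y. \<psi> y *\<^sub>R B y))"
      by (simp add: scaleR_scaleR[symmetric] del: scaleR_scaleR)
    then show ?case using sep_prod by (auto intro!: smooth_on_scaleR smooth_on_const continuous_intros)
  next
    case (sep_add K L)
    have c: "continuous_on UNIV (K x)" "continuous_on UNIV (L x)" for x using sep_add by auto
    have "integral (cbox 0 One) (\<lambda>y. (K x y + L x y) *\<^sub>R B y) =
       integral (cbox 0 One) (\<lambda>y. K x y *\<^sub>R B y) + integral (cbox 0 One) (\<lambda>y. L x y *\<^sub>R B y)" for x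
      unfolding scaleR_add_left
      by (intro integral_add integrable_continuous continuous_on_scaleR continuous_on_subset[OF c(1)]
          continuous_on_subset[OF c(2)] continuous_on_subset[OF assms(2)]) auto
    then show ?case using sep_add by (auto intro!: smooth_on_add continuous_intros)
  qed
  then show "smooth_on (\<lambda>x. integral (cbox 0 One) (\<lambda>y. K x y *\<^sub>R B y)) UNIV" "continuous_on UNIV (K x)" by auto
qed

text \<open>
  A trigonometric polynomial that equals \<open>1\<close> on the lattice and is smaller elsewhere; its normalised powers concentrate at the lattice points.
\<close>

definition kern :: "real^'d \<Rightarrow> real" where
  "kern u = (\<Sum>i\<in>UNIV. 1 + cos (2 * pi * u $ i)) / (2 * real CARD('d))"

lemma separable_const: "separable (\<lambda>x y. c)"
  using sep_prod[of "\<lambda>_. c" "\<lambda>_. 1"] by (simp add: smooth_on_const continuous_on_const)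

lemma separable_sum:
  "finite S \<Longrightarrow> (\<And>i. i \<in> S \<Longrightarrow> separable (K i)) \<Longrightarrow> separable (\<lambda>x y. \<Sum>i\<in>S. K i x y)"
proof (induction S rule: finite_induct)
  case empty then show ?case using separable_const[of 0] by simp
next
  case (insert i S) then show ?case using sep_add[of "K i" "\<lambda>x y. \<Sum>i\<in>S. K i x y"] by simp
qed

lemma separable_kern: "separable (\<lambda>x y :: real^'d. kern (y - x) ^ N)"
proof (induction N)
  case 0 then show ?case using separable_const[of 1] by simp
next
  case (Suc N)
  have "separable (\<lambda>x y :: real^'d. 1 / (2 * real CARD('d)) * (\<Sum>i\<in>UNIV. 1 + (cos (2 * pi * x $ i) * cos (2 * pi * y $ i) + sin (2 * pi * x $ i) * sin (2 * pi * y $ i))))"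
  proof (intro separable_mult[OF separable_const] separable_sum sep_add separable_const)
    fix i :: 'd
    show "separable (\<lambda>x y. cos (2 * pi * x $ i) * cos (2 * pi * y $ i))"
      by (rule sep_prod[of "\<lambda>x. cos (2 * pi * x $ i)" "\<lambda>y. cos (2 * pi * y $ i)"])
        (auto simp: smooth_on_def Ck_on_trig intro!: continuous_intros)
    show "separable (\<lambda>x y. sin (2 * pi * x $ i) * sin (2 * pi * y $ i))"
      by (rule sep_prod[of "\<lambda>x. sin (2 * pi * x $ i)" "\<lambda>y. sin (2 * pi * y $ i)"])
        (auto simp: smooth_on_def Ck_on_trig intro!: continuous_intros)
  qed auto
  moreover have "kern (y - x) = 1 / (2 * real CARD('d)) * (\<Sum>i\<in>UNIV. 1 + (cos (2 * pi * x $ i) * cos (2 * pi * y $ i) + sin (2 * pi * x $ i) * sin (2 * pi * y $ i)))" for x y :: "real^'d"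
    by (simp add: kern_def right_diff_distrib cos_diff mult.commute)
  ultimately have "separable (\<lambda>x y :: real^'d. kern (y - x))" by simp
  from separable_mult[OF this Suc] show ?case by simp
qed

lemma kern_bounds: "0 \<le> kern u" "kern u \<le> 1"
proof -
  have "0 \<le> 1 + cos (2 * pi * u $ i)" for i using cos_ge_minus_one[of "2 * pi * u $ i"] by linarith
  then have 0: "0 \<le> (\<Sum>i\<in>UNIV. 1 + cos (2 * pi * u $ i))" by (intro sum_nonneg) auto
  then show "0 \<le> kern u" by (simp add: kern_def)
  have "(\<Sum>i\<in>UNIV. 1 + cos (2 * pi * u $ i)) \<le> (\<Sum>i\<in>(UNIV :: 'a set). 2)"
    using cos_le_one by (intro sum_mono) (auto simp: add.commute)
  then show "kern u \<le> 1" by (simp add: kern_def divide_le_eq)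
qed

lemma kern_cont: "continuous_on S kern"
  unfolding kern_def by (intro continuous_intros) auto

lemma kern_0: "kern 0 = 1" by (simp add: kern_def)

lemma kern_less_1:
  fixes u :: "real^'d"
  assumes "u \<noteq> 0" "\<And>i. \<bar>u $ i\<bar> \<le> 1/2" shows "kern u < 1"
proof -
  obtain i where i: "u $ i \<noteq> 0" using assms(1) by (auto simp: vec_eq_iff)
  have "cos (2 * pi * u $ i) \<noteq> 1"
  proof
    assume "cos (2 * pi * u $ i) = 1"
    then obtain n :: int where "2 * pi * u $ i = real_of_int n * 2 * pi" using cos_one_2pi_int by blast
    then have "u $ i = n" by simp
    then have "\<bar>real_of_int n\<bar> \<le> 1/2" using assms(2)[of i] by simp
    then have "n = 0" by linarith
    then show False using i \<open>u $ i = n\<close> by simp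
  qed
  then have "cos (2 * pi * u $ i) < 1" using cos_le_one[of "2 * pi * u $ i"] by linarith
  then have "(\<Sum>i\<in>UNIV. 1 + cos (2 * pi * u $ i)) < (\<Sum>i\<in>(UNIV :: 'd set). 2)"
    by (intro sum_strict_mono_ex1) (auto simp: add.commute intro!: exI[of _ i] bexI[of _ i])
  then show ?thesis by (simp add: kern_def divide_less_eq)
qed

lemma kern_torus: "torus_map (\<lambda>y. kern (y + v))"
  unfolding torus_map_def
proof (intro allI)
  fix x and k :: "int^'a"
  have c: "cos (2 * pi * (x + (\<chi> i. of_int (k $ i)) + v) $ i) = cos (2 * pi * (x + v) $ i)" for i
  proof -
    have "2 * pi * (x + (\<chi> i. of_int (k $ i)) + v) $ i = 2 * pi * (x + v) $ i + 2 * pi * of_int (k $ i)"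
      by (simp add: algebra_simps)
    also have "cos \<dots> = cos (2 * pi * (x + v) $ i)"
      by (simp add: cos_add sin_int_2pin cos_int_2pin)
    finally show ?thesis .
  qed
  show "kern (x + (\<chi> i. of_int (k $ i)) + v) = kern (x + v)" unfolding kern_def by (simp only: c)
qed

abbreviation cube :: "(real^'d) set" where "cube \<equiv> cbox (- (1/2) *\<^sub>R One) ((1/2) *\<^sub>R One)"

definition kmass :: "'d::finite itself \<Rightarrow> nat \<Rightarrow> real" where
  "kmass _ N = integral cube (\<lambda>y::real^'d. kern y ^ N)"

definition kavg :: "nat \<Rightarrow> (real^'d \<Rightarrow> 'b::euclidean_space) \<Rightarrow> real^'d \<Rightarrow> 'b" where
  "kavg N f x = (1 / kmass TYPE('d) N) *\<^sub>R integral cube (\<lambda>y. kern y ^ N *\<^sub>R f (y + x))"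

lemma One_nth [simp]: "(One :: real^'d) $ i = 1"
  using inner_sum_left_Basis[of "axis i 1 :: real^'d"] by (simp add: cart_eq_inner_axis axis_in_Basis_iff)

lemma sum_Basis_nth [simp]: "(\<Sum>b\<in>(Basis :: (real^'d) set). b $ i) = 1"
  using One_nth[of i] by (simp only: sum_component)

lemma cube_iff: "y \<in> cube \<longleftrightarrow> (\<forall>i. \<bar>y $ i\<bar> \<le> 1/2)"
proof -
  have "y \<in> cube \<longleftrightarrow> (\<forall>i. - (1/2) \<le> y $ i \<and> y $ i \<le> 1/2)" by (simp add: mem_box_cart)
  also have "\<dots> \<longleftrightarrow> (\<forall>i. \<bar>y $ i\<bar> \<le> 1/2)" by (intro iff_allI) arith
  finally show ?thesis .
qed

lemma kern_pow_cont: "continuous_on S (\<lambda>y. kern y ^ N)" by (intro continuous_intros kern_cont)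

text \<open>
  The powers of the kernel lose mass more slowly than \<open>r\<^sup>N\<close> for every \<open>r < 1\<close>, because \<open>kern\<close> exceeds \<open>r\<close> near \<open>0\<close>.
\<close>

lemma kmass_lower:
  assumes "0 < r" "r < 1"
  obtains v where "v > 0" "\<And>N. kmass TYPE('d::finite) N \<ge> v * r ^ N"
proof -
  have "isCont (kern :: real^'d \<Rightarrow> real) 0" using kern_cont[of "UNIV :: (real^'d) set"] by (simp add: continuous_on_eq_continuous_at)
  then obtain d where d: "d > 0" "\<And>y :: real^'d. norm y < d \<Longrightarrow> \<bar>kern y - 1\<bar> < 1 - r"
    using assms unfolding continuous_at_eps_delta by (metis dist_norm dist_real_def diff_zero kern_0 diff_gt_0_iff_gt)
  define n where "n = norm (One :: real^'d)"
  define e where "e = min (1/2) (d / (2 * (n + 1)))"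
  have n: "n \<ge> 0" by (simp add: n_def)
  have e: "e > 0" "e \<le> 1/2" "e * n < d"
  proof -
    show "e > 0" using d n by (simp add: e_def)
    show "e \<le> 1/2" unfolding e_def by (rule min.cobounded1)
    have "e * n \<le> d / (2 * (n + 1)) * n" using n by (intro mult_right_mono) (auto simp: e_def)
    also have "\<dots> < d"
    proof -
      have "d * n < d * (2 * (n + 1))" using n d by (intro mult_strict_left_mono) auto
      then show ?thesis using n by (simp add: divide_less_eq)
    qed
    finally show "e * n < d" .
  qed
  let ?S = "cbox 0 (e *\<^sub>R One) :: (real^'d) set"
  have sub: "?S \<subseteq> cube"
  proof
    fix y assume "y \<in> ?S"
    then have "0 \<le> y $ i \<and> y $ i \<le> e" for i by (simp add: mem_box_cart)
    then have "\<bar>y $ i\<bar> \<le> 1/2" for i using e(2) by (smt (verit))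
    then show "y \<in> cube" using cube_iff by blast
  qed
  have S: "r \<le> kern y" if "y \<in> ?S" for y
  proof -
    have "norm y \<le> norm (e *\<^sub>R (One :: real^'d))"
      by (rule norm_le_componentwise_cart) (use that e in \<open>auto simp: mem_box_cart\<close>)
    also have "\<dots> < d" using e by (simp add: n_def[symmetric])
    finally show ?thesis using d(2)[of y] by (simp add: abs_less_iff)
  qed
  show ?thesis
  proof (rule that[of "measure lborel ?S"])
    have "measure lborel ?S = (\<Prod>b\<in>(Basis :: (real^'d) set). e)"
      using e by (subst content_cbox) (auto intro!: prod.cong)
    then show "measure lborel ?S > 0" using e by (simp add: prod_pos)
    fix N
    have "measure lborel ?S * r ^ N = integral ?S (\<lambda>y. r ^ N)" by (simp add: mult.commute)
    also have "\<dots> \<le> integral ?S (\<lambda>y. kern y ^ N)"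
      by (rule integral_le) (use assms S in \<open>auto intro!: integrable_continuous kern_pow_cont power_mono\<close>)
    also have "\<dots> \<le> kmass TYPE('d) N"
      unfolding kmass_def
      by (rule integral_subset_le[OF sub]) (auto intro!: integrable_continuous kern_pow_cont zero_le_power kern_bounds)
    finally show "measure lborel ?S * r ^ N \<le> kmass TYPE('d) N" .
  qed
qed

lemma kmass_pos: "kmass TYPE('d::finite) N > 0"
proof -
  obtain v where "v > 0" "\<And>N. kmass TYPE('d) N \<ge> v * (1/2) ^ N" by (rule kmass_lower[of "1/2"]) auto
  then show ?thesis by (meson less_le_trans mult_pos_pos zero_less_power half_gt_zero zero_less_one)
qed

text \<open>
  The same average as a convolution in which \<open>x\<close> occurs in the kernel only: this is where the smoothness in \<open>x\<close> comes from, while the definition is the form that can be compared with \<open>f\<close>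
  and differentiated under the integral.
\<close>

lemma kavg_Q:
  fixes f :: "real^'d \<Rightarrow> 'b::euclidean_space"
  assumes f: "continuous_on UNIV f" "torus_map f"
  shows "kavg N f x = (1 / kmass TYPE('d) N) *\<^sub>R integral (cbox 0 One) (\<lambda>y. kern (y - x) ^ N *\<^sub>R f y)"
proof -
  let ?g = "\<lambda>y. kern (y - x) ^ N *\<^sub>R f y"
  have cg: "continuous_on UNIV ?g"
    by (intro continuous_intros f continuous_on_compose2[OF kern_cont[of UNIV]]) auto
  have tg: "torus_map ?g"
    using kern_torus[of "-x"] f(2) unfolding torus_map_def by simp
  have "integral cube (\<lambda>y. kern y ^ N *\<^sub>R f (y + x)) = integral cube (\<lambda>y. ?g (y + x))" by simp
  also have "\<dots> = integral (cbox (x - (1/2) *\<^sub>R One) (x - (1/2) *\<^sub>R One + One)) ?g"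
  proof -
    have a: "x - (1/2) *\<^sub>R One + One - x = (1/2) *\<^sub>R (One :: real^'d)" by (simp add: vec_eq_iff)
    have b: "x - (1/2) *\<^sub>R One - x = - (1/2) *\<^sub>R (One :: real^'d)" by simp
    show ?thesis
      using integral_shift_cbox[of "x - (1/2) *\<^sub>R One" x "x - (1/2) *\<^sub>R One + One" ?g] unfolding a b .
  qed
  also have "\<dots> = integral (cbox 0 One) ?g"
    by (rule integral_periodic_shift[OF cg torus_map_Basis[OF tg]])
  finally show ?thesis by (simp add: kavg_def)
qed

lemma kavg_smooth:
  fixes f :: "real^'d \<Rightarrow> 'b::euclidean_space"
  assumes "continuous_on UNIV f" "torus_map f"
  shows "smooth_on (kavg N f) UNIV"
  unfolding kavg_Q[OF assms, abs_def]
  by (intro smooth_on_scaleR smooth_on_const open_UNIV separable_integral_smooth(1)[OF separable_kern assms(1)])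

lemma kavg_torus:
  assumes "torus_map f" shows "torus_map (kavg N f)"
  unfolding torus_map_def kavg_def using assms unfolding torus_map_def by (simp add: add.assoc[symmetric])

text \<open>
  Away from \<open>0\<close> the kernel is at most some \<open>q < 1\<close>; against a mass of at least \<open>v r\<^sup>N\<close> with \<open>q < r < 1\<close> this part is negligible.
\<close>

lemma kavg_close:
  fixes f :: "real^'d \<Rightarrow> 'b::euclidean_space"
  assumes f: "continuous_on UNIV f" "torus_map f" and e: "e > 0"
  shows "\<exists>N0. \<forall>N\<ge>N0. \<forall>x. norm (kavg N f x - f x) \<le> e"
proof -
  let ?Q = "cbox 0 One :: (real^'d) set" and ?big = "cbox (- One) (2 *\<^sub>R One) :: (real^'d) set"
  have "uniformly_continuous_on ?big f"
    by (rule compact_uniformly_continuous[OF continuous_on_subset[OF f(1)]]) auto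
  then obtain d where d: "d > 0" "\<And>x y. x \<in> ?big \<Longrightarrow> y \<in> ?big \<Longrightarrow> dist y x < d \<Longrightarrow> dist (f y) (f x) < e / 2"
    using e unfolding uniformly_continuous_on_def by (metis half_gt_zero)
  have "compact (f ` ?Q)" by (intro compact_continuous_image continuous_on_subset[OF f(1)]) auto
  then have "\<exists>C. \<forall>x\<in>?Q. norm (f x) \<le> C" by (auto dest!: compact_imp_bounded simp: bounded_iff)
  then obtain C where C: "\<And>x. x \<in> ?Q \<Longrightarrow> norm (f x) \<le> C" by blast
  have bf: "norm (f x) \<le> C" for x
  proof -
    obtain y where "y \<in> ?Q" "\<And>f :: real^'d \<Rightarrow> 'b. torus_map f \<Longrightarrow> f x = f y" using torus_representative[of x] by blast
    then show ?thesis using C f(2) by metis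
  qed
  have C0: "0 \<le> C" using bf[of 0] norm_ge_zero order_trans by blast
  have near: "norm (f (y + x) - f x) \<le> e / 2" if "y \<in> cube" "norm y < d" for x y
  proof -
    obtain z where z: "z \<in> ?Q" "\<And>g :: real^'d \<Rightarrow> real. torus_map g \<Longrightarrow> g x = g z" using torus_representative[of x] by blast
    have "torus_map (\<lambda>x. norm (f (y + x) - f x))"
      using f(2) unfolding torus_map_def by (simp add: add.assoc[symmetric])
    from z(2)[OF this] have eq: "norm (f (y + x) - f x) = norm (f (y + z) - f z)" .
    have y: "\<bar>y $ i\<bar> \<le> 1/2" for i using that cube_iff by blast
    have zi: "0 \<le> z $ i \<and> z $ i \<le> 1" for i using z(1) by (auto simp: mem_box_cart)
    have "z \<in> ?big" "y + z \<in> ?big"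
    proof -
      have "- 1 \<le> z $ i \<and> z $ i \<le> 2 \<and> - 1 \<le> y $ i + z $ i \<and> y $ i + z $ i \<le> 2" for i
        using y[of i] zi[of i] by linarith
      then show "z \<in> ?big" "y + z \<in> ?big" by (simp_all add: mem_box_cart)
    qed
    then have "dist (f (y + z)) (f z) < e / 2" using that by (intro d(2)) (auto simp: dist_norm)
    then show ?thesis by (simp add: eq dist_norm)
  qed
  define S where "S = cube \<inter> {y :: real^'d. norm y \<ge> d}"
  have S: "compact S" unfolding S_def by (intro compact_Int_closed compact_cbox closed_Collect_le continuous_intros)
  obtain q where q: "0 < q" "q < 1" "\<And>y. y \<in> S \<Longrightarrow> kern y \<le> q"
  proof (cases "S = {}")
    case True then show ?thesis using that[of "1/2"] by simp
  next
    case False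
    obtain y0 where y0: "y0 \<in> S" "\<And>y. y \<in> S \<Longrightarrow> kern y \<le> kern y0"
      using continuous_attains_sup[OF S False kern_cont] by blast
    have "y0 \<noteq> 0" using y0(1) d(1) by (auto simp: S_def)
    then have "kern y0 < 1" using y0(1) cube_iff by (intro kern_less_1) (auto simp: S_def)
    then show ?thesis
      by (intro that[of "max (1/2) (kern y0)"]) (auto intro: max.coboundedI2 y0(2))
  qed
  define r where "r = (1 + q) / 2"
  have r: "0 < r" "r < 1" "q < r" using q by (auto simp: r_def)
  obtain v where v: "v > 0" "\<And>N. kmass TYPE('d) N \<ge> v * r ^ N" using kmass_lower[OF r(1,2)] by blast
  have "(\<lambda>N. 2 * C / v * (q / r) ^ N) \<longlonglongrightarrow> 2 * C / v * 0"
    by (intro tendsto_intros LIMSEQ_power_zero) (use q r in auto)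
  then have "eventually (\<lambda>N. 2 * C / v * (q / r) ^ N < e / 2) sequentially"
    using e by (intro order_tendstoD(2)) auto
  then obtain N0 where N0: "\<And>N. N \<ge> N0 \<Longrightarrow> 2 * C / v * (q / r) ^ N < e / 2" by (auto simp: eventually_sequentially)
  show ?thesis
  proof (intro exI[of _ N0] allI impI)
    fix N x assume N: "N0 \<le> N"
    let ?I = "kmass TYPE('d) N"
    have I: "?I > 0" by (rule kmass_pos)
    have pw: "norm (kern y ^ N *\<^sub>R (f (y + x) - f x)) \<le> e / 2 * kern y ^ N + 2 * C * q ^ N" if y: "y \<in> cube" for y :: "real^'d"
    proof (cases "norm y < d")
      case True
      have "norm (kern y ^ N *\<^sub>R (f (y + x) - f x)) \<le> kern y ^ N * (e / 2)"
        using mult_left_mono[OF near[OF y True, of x], of "kern y ^ N"] kern_bounds[of y] by simp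
      moreover have "0 \<le> 2 * C * q ^ N" using C0 q by simp
      ultimately show ?thesis unfolding mult.commute[of "kern y ^ N" "e / 2"] by linarith
    next
      case False
      then have k: "kern y \<le> q" using y q(3) by (simp add: S_def)
      have "norm (f (y + x) - f x) \<le> 2 * C" using bf[of "y + x"] bf[of x] norm_triangle_ineq4[of "f (y + x)" "f x"] by simp
      then have "kern y ^ N * norm (f (y + x) - f x) \<le> q ^ N * (2 * C)"
        using k kern_bounds[of y] q C0 by (intro mult_mono power_mono) auto
      moreover have "0 \<le> e / 2 * kern y ^ N" using e kern_bounds[of y] by simp
      moreover have "norm (kern y ^ N *\<^sub>R (f (y + x) - f x)) = kern y ^ N * norm (f (y + x) - f x)"
        using kern_bounds[of y] by simp
      ultimately show ?thesis by (simp only: mult.commute[of "q ^ N"])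
    qed
    have cf: "continuous_on T (\<lambda>y. f (y + x))" for T
      by (rule continuous_on_compose2[OF f(1)]) (auto intro!: continuous_intros)
    have "kavg N f x - f x = (1 / ?I) *\<^sub>R integral cube (\<lambda>y. kern y ^ N *\<^sub>R (f (y + x) - f x))"
    proof -
      have "integral cube (\<lambda>y. kern y ^ N *\<^sub>R (f (y + x) - f x)) =
         integral cube (\<lambda>y. kern y ^ N *\<^sub>R f (y + x)) - integral cube (\<lambda>y :: real^'d. kern y ^ N *\<^sub>R f x)"
        unfolding scaleR_diff_right
      proof (rule Henstock_Kurzweil_Integration.integral_diff)
        show "(\<lambda>y. kern y ^ N *\<^sub>R f (y + x)) integrable_on cube"
          by (intro integrable_continuous continuous_on_scaleR kern_pow_cont cf)
        show "(\<lambda>y. kern y ^ N *\<^sub>R f x) integrable_on cube"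
          by (intro integrable_continuous continuous_on_scaleR kern_pow_cont continuous_on_const)
      qed
      also have "integral cube (\<lambda>y :: real^'d. kern y ^ N *\<^sub>R f x) = ?I *\<^sub>R f x"
        unfolding kmass_def
        by (rule integral_unique, rule has_integral_scaleR_left, rule integrable_integral, rule integrable_continuous, rule kern_pow_cont)
      finally show ?thesis using I by (simp add: kavg_def scaleR_diff_right)
    qed
    then have "norm (kavg N f x - f x) = 1 / ?I * norm (integral cube (\<lambda>y. kern y ^ N *\<^sub>R (f (y + x) - f x)))"
      using I by simp
    also have "\<dots> \<le> 1 / ?I * (e / 2 * ?I + 2 * C * q ^ N)"
    proof (rule mult_left_mono)
      have "norm (integral cube (\<lambda>y. kern y ^ N *\<^sub>R (f (y + x) - f x))) \<le> integral cube (\<lambda>y :: real^'d. e / 2 * kern y ^ N + 2 * C * q ^ N)"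
        by (rule integral_norm_bound_integral)
          (use pw in \<open>auto intro!: integrable_continuous continuous_intros kern_pow_cont cf\<close>)
      also have "\<dots> = e / 2 * ?I + 2 * C * q ^ N"
        unfolding kmass_def
        by (subst integral_add) (auto intro!: integrable_continuous continuous_intros kern_pow_cont)
      finally show "norm (integral cube (\<lambda>y. kern y ^ N *\<^sub>R (f (y + x) - f x))) \<le> e / 2 * ?I + 2 * C * q ^ N" .
    qed (use I in simp)
    also have "\<dots> = e / 2 + 2 * C * q ^ N / ?I" using I by (simp add: field_simps)
    also have "2 * C * q ^ N / ?I \<le> 2 * C * q ^ N / (v * r ^ N)"
      using v I r C0 q by (intro divide_left_mono) auto
    also have "\<dots> = 2 * C / v * (q / r) ^ N" by (simp add: power_divide)
    finally show "norm (kavg N f x - f x) \<le> e" using N0[OF N] by simp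
  qed
qed

lemma kavg_deriv:
  fixes f f' :: "real^'d \<Rightarrow> 'b::euclidean_space"
  assumes f: "continuous_on UNIV f" and f': "continuous_on UNIV f'"
    and d: "\<And>x t. ((\<lambda>t. f (x + t *\<^sub>R w)) has_vector_derivative f' (x + t *\<^sub>R w)) (at t)"
  shows "((\<lambda>t. kavg N f (x + t *\<^sub>R w)) has_vector_derivative kavg N f' x) (at 0)"
proof -
  have "((\<lambda>t. integral cube (\<lambda>y. kern y ^ N *\<^sub>R f (y + x + t *\<^sub>R w))) has_vector_derivative
     integral cube (\<lambda>y. kern y ^ N *\<^sub>R f' (y + x + 0 *\<^sub>R w))) (at 0 within UNIV)"
  proof (rule leibniz_rule_vector_derivative)
    show "((\<lambda>t. kern y ^ N *\<^sub>R f (y + x + t *\<^sub>R w)) has_vector_derivative kern y ^ N *\<^sub>R f' (y + x + t *\<^sub>R w)) (at t within UNIV)" for t y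
      using bounded_linear.has_vector_derivative[OF bounded_linear_scaleR_right d] by simp
    show "(\<lambda>y. kern y ^ N *\<^sub>R f (y + x + t *\<^sub>R w)) integrable_on cube" for t
      by (intro integrable_continuous continuous_on_scaleR kern_pow_cont continuous_on_compose2[OF f] continuous_intros) auto
    have "continuous_on (UNIV \<times> cube) (\<lambda>p. kern (snd p) ^ N *\<^sub>R f' (snd p + x + fst p *\<^sub>R w))"
      by (intro continuous_on_scaleR continuous_on_power continuous_on_compose2[OF kern_cont[of UNIV]]
          continuous_on_compose2[OF f'] continuous_intros) auto
    then show "continuous_on (UNIV \<times> cube) (\<lambda>(t, y). kern y ^ N *\<^sub>R f' (y + x + t *\<^sub>R w))" by (simp add: case_prod_unfold)
  qed auto
  from bounded_linear.has_vector_derivative[OF bounded_linear_scaleR_right this, of "1 / kmass TYPE('d) N"]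
  show ?thesis by (simp add: kavg_def add.assoc)
qed

lemma directional_derivative:
  assumes "(f has_derivative D) (at (x + t *\<^sub>R w))"
  shows "((\<lambda>t. f (x + t *\<^sub>R w)) has_vector_derivative D w) (at t)"
proof -
  have 2: "((\<lambda>t. x + t *\<^sub>R w) has_derivative (\<lambda>h. h *\<^sub>R w)) (at t)"
    by (auto intro!: derivative_eq_intros)
  show ?thesis
    using has_derivative_compose[OF 2 assms] linear_scale[OF has_derivative_linear[OF assms]]
    by (simp add: has_vector_derivative_def)
qed

lemma torus_map_frechet:
  fixes f :: "real^'d \<Rightarrow> 'b::real_normed_vector"
  assumes d: "\<And>x. f differentiable (at x)" and f: "torus_map f"
  shows "torus_map (\<lambda>x. frechet_derivative f (at x) v)"
  unfolding torus_map_def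
proof (intro allI)
  fix x and k :: "int^'d"
  let ?k = "(\<chi> i. of_int (k $ i)) :: real^'d"
  have 1: "(f has_derivative frechet_derivative f (at (x + ?k))) (at (x + ?k))"
    using d frechet_derivative_works by blast
  have 2: "((\<lambda>p. p + ?k) has_derivative (\<lambda>h. h)) (at x)" by (auto intro!: derivative_eq_intros)
  have "((\<lambda>p. f (p + ?k)) has_derivative frechet_derivative f (at (x + ?k))) (at x)"
    using has_derivative_compose[OF 2 1] by simp
  moreover have "(\<lambda>p. f (p + ?k)) = f" using f unfolding torus_map_def by auto
  ultimately show "frechet_derivative f (at (x + ?k)) v = frechet_derivative f (at x) v"
    by (metis frechet_derivative_at)
qed

text \<open>
  Averaging commutes with the derivative along \<open>w\<close>, so \<open>kavg_close\<close> applies to \<open>B\<close> and to its derivative.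
\<close>

theorem C1_smoothing:
  fixes B :: "real^'d \<Rightarrow> 'b::euclidean_space"
  assumes t: "torus_map B" and C1: "Ck_on 1 B UNIV" and e: "e > 0"
  obtains B' where "smooth_on B' UNIV" "torus_map B'" "\<And>x. norm (B' x - B x) \<le> e"
    "\<And>x. norm (frechet_derivative B' (at x) w - frechet_derivative B (at x) w) \<le> e"
proof -
  have d: "B differentiable (at x)" for x using C1 by simp
  have cB: "continuous_on UNIV B" by (rule Ck_on_imp_continuous_on[OF C1])
  define DB where "DB x = frechet_derivative B (at x) w" for x
  have cD: "continuous_on UNIV DB" using C1 by (simp add: DB_def[abs_def])
  have tD: "torus_map DB" unfolding DB_def by (rule torus_map_frechet[OF d t])
  obtain N1 where N1: "\<And>N x. N \<ge> N1 \<Longrightarrow> norm (kavg N B x - B x) \<le> e" using kavg_close[OF cB t e] by blast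
  obtain N2 where N2: "\<And>N x. N \<ge> N2 \<Longrightarrow> norm (kavg N DB x - DB x) \<le> e" using kavg_close[OF cD tD e] by blast
  define N where "N = max N1 N2"
  show ?thesis
  proof (rule that[of "kavg N B"])
    show "smooth_on (kavg N B) UNIV" by (rule kavg_smooth[OF cB t])
    show "torus_map (kavg N B)" by (rule kavg_torus[OF t])
    show "norm (kavg N B x - B x) \<le> e" for x by (rule N1) (simp add: N_def)
    show "norm (frechet_derivative (kavg N B) (at x) w - frechet_derivative B (at x) w) \<le> e" for x
    proof -
      have "((\<lambda>t. B (x + t *\<^sub>R w)) has_vector_derivative DB (x + t *\<^sub>R w)) (at t)" for x t
        unfolding DB_def by (rule directional_derivative) (use d frechet_derivative_works in blast)
      from kavg_deriv[OF cB cD this, of N x]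
      have 1: "((\<lambda>t. kavg N B (x + t *\<^sub>R w)) has_vector_derivative kavg N DB x) (at 0)" .
      have "((\<lambda>t. kavg N B (x + t *\<^sub>R w)) has_vector_derivative frechet_derivative (kavg N B) (at x) w) (at 0)"
        by (rule directional_derivative) (use smooth_on_has_derivative[OF kavg_smooth[OF cB t, of N], of x] in simp)
      then have "frechet_derivative (kavg N B) (at x) w = kavg N DB x"
        using 1 vector_derivative_unique_at by blast
      then show ?thesis using N2[of N x] by (simp add: N_def DB_def)
    qed
  qed
qed

section \<open>Real matrices acting on the disc\<close>

text \<open>
  The complex-linear and antilinear parts of a real matrix: \<open>A z = lin_part A * z + anti_part A * cnj z\<close> after the
  identification \<open>zvec\<close> of the plane with the complex numbers.
\<close>

definition lin_part :: "real^2^2 \<Rightarrow> complex" where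
  "lin_part A = Complex ((A$1$1 + A$2$2) / 2) ((A$2$1 - A$1$2) / 2)"

definition anti_part :: "real^2^2 \<Rightarrow> complex" where
  "anti_part A = Complex ((A$1$1 - A$2$2) / 2) ((A$2$1 + A$1$2) / 2)"

text \<open>
  The matrix of \<open>A\<close> in the coordinates \<open>(z, cnj z)\<close>; its Moebius map is the action of \<open>A\<close> on \<open>z / cnj z\<close>.
\<close>

definition cplx :: "real^2^2 \<Rightarrow> complex^2^2" where
  "cplx A = vector [vector [lin_part A, anti_part A], vector [cnj (anti_part A), cnj (lin_part A)]]"

definition zvec :: "real^2 \<Rightarrow> complex" where "zvec v = Complex (v$1) (v$2)"

lemma cplx_nth [simp]:
  "cplx A $1$1 = lin_part A" "cplx A $1$2 = anti_part A"
  "cplx A $2$1 = cnj (anti_part A)" "cplx A $2$2 = cnj (lin_part A)"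
  by (simp_all add: cplx_def)

lemma norm_zvec: "cmod (zvec v) = norm v"
  by (simp add: zvec_def cmod_def norm_vec_def L2_set_def sum_2)

lemma zvec_mult: "zvec (A *v v) = lin_part A * zvec v + anti_part A * cnj (zvec v)"
  by (simp add: zvec_def lin_part_def anti_part_def matrix_vector_mult_def sum_2 complex_eq_iff field_simps)

lemma lin_part_mult: "lin_part (A ** B) = lin_part A * lin_part B + anti_part A * cnj (anti_part B)"
  and anti_part_mult: "anti_part (A ** B) = lin_part A * anti_part B + anti_part A * cnj (lin_part B)"
  by (simp_all add: lin_part_def anti_part_def matrix_matrix_mult_def sum_2 complex_eq_iff field_simps)

lemma matrix_mult_nth_2: "(A ** B) $ i $ j = A $ i $ 1 * B $ 1 $ j + A $ i $ 2 * B $ 2 $ j"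
  for A B :: "'a::semiring_1^2^2"
  by (simp add: matrix_matrix_mult_def sum_2)

lemma cplx_mult: "cplx (A ** B) = cplx A ** cplx B"
  by (simp add: vec_eq_iff forall_2 matrix_mult_nth_2 lin_part_mult anti_part_mult)

lemma cplx_mat1: "cplx (mat 1) = mat 1"
  by (simp add: vec_eq_iff forall_2 lin_part_def anti_part_def mat_def complex_eq_iff)

lemma det_lin_anti: "det A = (cmod (lin_part A))\<^sup>2 - (cmod (anti_part A))\<^sup>2"
  unfolding det_2 cmod_power2 by (simp add: lin_part_def anti_part_def power2_eq_square field_simps)

lemma anti_less_lin: "det A > 0 \<Longrightarrow> cmod (anti_part A) < cmod (lin_part A)"
  using det_lin_anti[of A] by (intro power2_less_imp_less[of "cmod (anti_part A)"]) auto

text \<open>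
  The triangle inequality gives one direction. For the other, choose a unit vector \<open>z\<close> whose square aligns the arguments of the two terms.
\<close>

lemma onorm_eq_parts: "onorm (\<lambda>v. A *v v) = cmod (lin_part A) + cmod (anti_part A)"
proof (rule antisym)
  show "onorm (\<lambda>v. A *v v) \<le> cmod (lin_part A) + cmod (anti_part A)"
  proof (rule onorm_bound)
    fix v
    show "norm (A *v v) \<le> (cmod (lin_part A) + cmod (anti_part A)) * norm v"
      unfolding norm_zvec[symmetric] zvec_mult
      using norm_triangle_ineq[of "lin_part A * zvec v" "anti_part A * cnj (zvec v)"]
      by (simp add: norm_mult distrib_right)
  qed simp
  let ?a = "lin_part A" and ?b = "anti_part A"
  define u where "u = (if ?a = 0 \<or> ?b = 0 then 1 else ?b * cnj ?a / of_real (cmod ?a * cmod ?b))"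
  have u: "cmod u = 1" by (auto simp: u_def norm_mult norm_divide)
  have au: "cmod (?a * u + ?b) = cmod ?a + cmod ?b"
  proof (cases "?a = 0 \<or> ?b = 0")
    case False
    then have "?a * u + ?b = of_real ((cmod ?a + cmod ?b) / cmod ?b) * ?b"
      by (simp add: u_def field_simps) (simp add: complex_norm_square[symmetric] power2_eq_square mult_ac)
    then have "cmod (?a * u + ?b) = (cmod ?a + cmod ?b) / cmod ?b * cmod ?b"
      by (simp only: norm_mult norm_of_real) simp
    then show ?thesis using False by simp
  qed (auto simp: u_def)
  define z where "z = csqrt u"
  have z2: "z * z = u" by (simp add: z_def power2_eq_square[symmetric])
  then have z1: "cmod z = 1"
    using u by (metis norm_mult power2_eq_square norm_ge_zero power2_eq_1_iff abs_norm_cancel one_power2 abs_eq_iff)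
  define v :: "real^2" where "v = vector [Re z, Im z]"
  have zv: "zvec v = z" by (simp add: zvec_def v_def)
  have zz: "z * cnj z = 1" using z1 by (simp add: complex_norm_square[symmetric])
  have "cmod ?a + cmod ?b = cmod (?a * (z * z) + ?b * (z * cnj z))" by (simp add: z2 zz au)
  also have "\<dots> = cmod (z * (?a * z + ?b * cnj z))" by (simp add: algebra_simps)
  also have "\<dots> = norm (A *v v)" unfolding norm_zvec[symmetric] zvec_mult zv by (simp add: norm_mult z1)
  also have "\<dots> \<le> onorm (\<lambda>v. A *v v) * norm v"
    by (rule onorm) (rule matrix_vector_mul_bounded_linear)
  also have "norm v = 1" using z1 norm_zvec[of v] zv by simp
  finally show "cmod ?a + cmod ?b \<le> onorm (\<lambda>v. A *v v)" by simp
qed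

lemma bounded_linear_cplx: "bounded_linear (\<lambda>A. cplx A $ i $ j)"
proof -
  have "linear (\<lambda>A. cplx A $ i $ j)"
    by (rule linearI; use exhaust_2[of i] exhaust_2[of j] in \<open>elim disjE; simp add: lin_part_def anti_part_def complex_eq_iff field_simps\<close>)
  then show ?thesis by (simp add: linear_conv_bounded_linear)
qed

text \<open>
  A point \<open>m\<close> of the circle is \<open>z / cnj z = z\<^sup>2\<close> for a unit vector \<open>z\<close>. The numerator at \<open>m\<close> is then the image vector up to the
  phase \<open>z\<close>, which cancels in cross products.
\<close>

lemma unit_square_root:
  assumes "cmod m = 1"
  obtains v :: "real^2" where "v \<noteq> 0" "\<And>A. mnum (cplx A) m = zvec v * zvec (A *v v)" "cmod (zvec v) = 1"
proof -
  define z where "z = csqrt m"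
  have z2: "z * z = m" by (simp add: z_def power2_eq_square[symmetric])
  have "(cmod z)\<^sup>2 = 1\<^sup>2" using z2 assms by (metis norm_mult power2_eq_square one_power2)
  then have z1: "cmod z = 1" by (rule power2_eq_imp_eq) auto
  define v :: "real^2" where "v = vector [Re z, Im z]"
  have zv: "zvec v = z" by (simp add: zvec_def v_def)
  have zz: "z * cnj z = 1" using z1 by (simp add: complex_norm_square[symmetric])
  show ?thesis
  proof (rule that[of v])
    show "v \<noteq> 0" using z1 zv norm_zvec[of v] by auto
    show "cmod (zvec v) = 1" by (simp add: zv z1)
    fix A
    have "mnum (cplx A) m = lin_part A * (z * z) + anti_part A * (z * cnj z)" by (simp add: mnum_def z2 zz)
    then show "mnum (cplx A) m = zvec v * zvec (A *v v)" by (simp add: zvec_mult zv algebra_simps)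
  qed
qed

lemma cross2_zvec: "cross2 u v = Im (cnj (zvec u) * zvec v)"
  by (simp add: cross2_def zvec_def)

text \<open>
  The second column of a product of matrices is the image of \<open>(0, 1)\<close>: its direction is the orbit of \<open>0\<close>, its second component the product of the denominators.
\<close>

lemma orb_product:
  fixes M T :: "nat \<Rightarrow> complex^2^2"
  assumes "T 0 = mat 1" "\<And>n. T (Suc n) = M n ** T n" "\<And>n. mden (M n) (orb M 0 n) \<noteq> 0"
  shows "T n $2$2 = (\<Prod>j<n. mden (M j) (orb M 0 j)) \<and> T n $1$2 = orb M 0 n * (\<Prod>j<n. mden (M j) (orb M 0 j))"
proof (induction n)
  case 0 then show ?case by (simp add: assms mat_def)
next
  case (Suc n)
  let ?p = "\<Prod>j<n. mden (M j) (orb M 0 j)"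
  have "T (Suc n) $2$2 = mden (M n) (orb M 0 n) * ?p" "T (Suc n) $1$2 = mnum (M n) (orb M 0 n) * ?p"
    using Suc by (simp_all add: assms(2) matrix_matrix_mult_def sum_2 mden_def mnum_def algebra_simps)
  then show ?case using assms(3)[of n] by (simp add: mult.commute)
qed

text \<open>
  The entry \<open>(2, 2)\<close> of the product in disc coordinates is the conjugate of \<open>lin_part\<close> and a product of denominators, whose logarithmic averages
  converge to \<open>U_limit\<close> plus a constant.
\<close>

theorem monotone_family_log_growth:
  fixes J :: "real set" and \<alpha> :: "real \<Rightarrow> real^'d" and A :: "real \<times> (real^'d) \<Rightarrow> real^2^2"
  assumes J: "open J" "sc \<in> J" and \<alpha>: "smooth_on \<alpha> J" and A: "smooth_on A (J \<times> UNIV)"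
    and t: "\<And>s. s \<in> J \<Longrightarrow> torus_map (\<lambda>x. A (s, x))" and det: "\<And>s x. s \<in> J \<Longrightarrow> det (A (s, x)) > 0"
    and mono: "\<And>x y. y \<noteq> 0 \<Longrightarrow> cross2 (A (sc, x) *v y) (frechet_derivative A (at (sc, x)) (0, w) *v y) > 0"
  obtains \<rho> \<Lambda> where "\<rho> > 0" "ball sc \<rho> \<subseteq> J" "smooth_on \<Lambda> (ball sc \<rho>)"
    "\<And>s. s \<in> ball sc \<rho> \<Longrightarrow>
      (\<lambda>n. integral (cbox 0 One) (\<lambda>x. ln (cmod (lin_part (iterate_prod (\<alpha> s) (\<lambda>x. A (s, x)) n x)))) / real n) \<longlonglongrightarrow> \<Lambda> s"
proof -
  define P where "P = (\<lambda>k p. \<chi> i j. (wder w ^^ k) (\<lambda>p. cplx (A p) $ i $ j) p)"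
  have oJ: "open (J \<times> (UNIV :: (real^'d) set))" using J by (intro open_Times) auto
  have sm: "smooth_on (\<lambda>p. cplx (A p) $ i $ j) (J \<times> UNIV)" for i j
    by (rule smooth_on_compose_linear[OF oJ bounded_linear_cplx A])
  have P1: "P 1 (sc, x) = cplx (frechet_derivative A (at (sc, x)) (0, w))" for x
  proof -
    have dA: "(A has_derivative frechet_derivative A (at (sc, x))) (at (sc, x))"
      by (rule smooth_on_has_derivative[OF A]) (use J in simp)
    have "frechet_derivative (\<lambda>p. cplx (A p) $ i $ j) (at (sc, x)) = (\<lambda>h. cplx (frechet_derivative A (at (sc, x)) h) $ i $ j)" for i j
      using frechet_derivative_at[OF bounded_linear.has_derivative[OF bounded_linear_cplx dA]] by simp
    then show ?thesis by (simp add: P_def wder_def vec_eq_iff)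
  qed
  interpret monotone_family J sc \<alpha> "\<lambda>p. cplx (A p)" w P
  proof
    show "open J" "sc \<in> J" "smooth_on \<alpha> J" by (fact J \<alpha>)+
    show "smooth_on (\<lambda>p. cplx (A p) $ i $ j) (J \<times> UNIV)" for i j by (rule sm)
    show "torus_map (\<lambda>x. cplx (A (s, x)))" if "s \<in> J" for s using t[OF that] by (simp add: torus_map_def)
    show "cmod (cplx (A (sc, x)) $1$2) < cmod (cplx (A (sc, x)) $1$1)" for x
      using anti_less_lin[OF det[OF J(2)]] by simp
    show "P = (\<lambda>k p. \<chi> i j. (wder w ^^ k) (\<lambda>p. cplx (A p) $ i $ j) p)" by (rule P_def)
    show "0 < Im (cnj (mnum (cplx (A (sc, x))) m) * mnum (P 1 (sc, x)) m)" if m: "cmod m = 1" for x m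
    proof -
      obtain v :: "real^2" where v: "v \<noteq> 0" "\<And>A. mnum (cplx A) m = zvec v * zvec (A *v v)" "cmod (zvec v) = 1"
        using unit_square_root[OF m] by blast
      let ?A = "A (sc, x)" and ?D = "frechet_derivative A (at (sc, x)) (0, w)"
      have "cnj (zvec v * zvec (?A *v v)) * (zvec v * zvec (?D *v v)) = (zvec v * cnj (zvec v)) * (cnj (zvec (?A *v v)) * zvec (?D *v v))"
        by (simp add: mult_ac)
      also have "zvec v * cnj (zvec v) = 1" using v(3) by (simp add: complex_norm_square[symmetric])
      finally have "cnj (zvec v * zvec (?A *v v)) * (zvec v * zvec (?D *v v)) = cnj (zvec (?A *v v)) * zvec (?D *v v)"
        by (simp only: mult_1_left)
      then show ?thesis using mono[OF v(1), of x] unfolding P1 v(2) cross2_zvec by (simp only:)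
    qed
  qed (use J in auto)
  obtain \<rho> where \<rho>: "\<rho> > 0" "cball sc \<rho> \<subseteq> J" "\<And>N. N \<ge> 1 \<Longrightarrow> \<exists>q \<eta>0 c \<kappa>. fam_ok \<rho> N q \<eta>0 c \<kappa>"
    using adm_family by blast
  obtain q \<eta>0 c \<kappa> where ok: "fam_ok \<rho> 1 q \<eta>0 c \<kappa>" using \<rho>(3) by blast
  define \<Lambda> where "\<Lambda> s = Re (U_limit s) + integral (cbox 0 One) (\<lambda>x. ln (cmod (cplx (A (sc, x)) $2$2)))" for s
  show ?thesis
  proof (rule that[of \<rho> \<Lambda>])
    show "\<rho> > 0" by (rule \<rho>)
    show "ball sc \<rho> \<subseteq> J" using \<rho>(2) ball_subset_cball by blast
    show "smooth_on \<Lambda> (ball sc \<rho>)"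
      unfolding \<Lambda>_def
      by (intro smooth_on_add smooth_on_const open_ball poly_approximable_imp_smooth_on U_limit_poly_approximable[OF \<rho>(3) \<rho>(2)])
    fix s assume "s \<in> ball sc \<rho>"
    then have s: "s \<in> cball sc \<rho>" by simp
    have "ln (cmod (lin_part (iterate_prod (\<alpha> s) (\<lambda>x. A (s, x)) n x))) =
      (\<Sum>j<n. ln (cmod (mden (cplx (A (s, x + real j *\<^sub>R \<alpha> s))) (orb (\<lambda>i. cplx (A (s, x + real i *\<^sub>R \<alpha> s))) 0 j))))" for n x
    proof -
      let ?M = "\<lambda>i. cplx (A (s, x + real i *\<^sub>R \<alpha> s))"
      have nz: "mden (?M j) (orb ?M 0 j) \<noteq> 0" for j
      proof (rule orb_den_nz[where n = j])
        show "adm 1 q (?M i) (cplx (A (sc, x + real i *\<^sub>R \<alpha> s)) $2$2)" for i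
          using ok s unfolding fam_ok_def by blast
        show "q < 1" using ok unfolding fam_ok_def by blast
      qed simp_all
      have "cplx (iterate_prod (\<alpha> s) (\<lambda>x. A (s, x)) n x) $2$2 = (\<Prod>j<n. mden (?M j) (orb ?M 0 j))"
        using orb_product[of "\<lambda>n. cplx (iterate_prod (\<alpha> s) (\<lambda>x. A (s, x)) n x)" ?M n, OF _ _ nz]
        by (simp only: iterate_prod.simps cplx_mat1 cplx_mult)
      from arg_cong[OF this, of cmod]
      have "cmod (lin_part (iterate_prod (\<alpha> s) (\<lambda>x. A (s, x)) n x)) = (\<Prod>j<n. cmod (mden (?M j) (orb ?M 0 j)))"
        unfolding cplx_nth(4) complex_mod_cnj prod_norm .
      then show ?thesis using nz by (simp only: ln_prod[OF finite_lessThan] norm_eq_zero not_False_eq_True)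
    qed
    then show "(\<lambda>n. integral (cbox 0 One) (\<lambda>x. ln (cmod (lin_part (iterate_prod (\<alpha> s) (\<lambda>x. A (s, x)) n x)))) / real n) \<longlonglongrightarrow> \<Lambda> s"
      using log_average_limit[OF ok \<rho>(2) s] by (simp only: \<Lambda>_def)
  qed
qed

section \<open>A smooth conjugacy to a monotone cocycle\<close>

text \<open>
  The adjugate takes the place of the inverse: it is linear, and the determinant of a smoothed conjugacy need not be \<open>1\<close>.
\<close>

definition adj2 :: "real^2^2 \<Rightarrow> real^2^2" where
  "adj2 A = vector [vector [A$2$2, - A$1$2], vector [- A$2$1, A$1$1]]"

lemma adj2_nth [simp]:
  "adj2 A $1$1 = A$2$2" "adj2 A $1$2 = - A$1$2" "adj2 A $2$1 = - A$2$1" "adj2 A $2$2 = A$1$1"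
  by (simp_all add: adj2_def)

lemma adj2_mult: "adj2 A ** A = det A *\<^sub>R mat 1"
  by (simp add: vec_eq_iff forall_2 matrix_mult_nth_2 det_2 mat_def)

lemma mult_adj2: "A ** adj2 A = det A *\<^sub>R mat 1"
  by (simp add: vec_eq_iff forall_2 matrix_mult_nth_2 det_2 mat_def)

lemma det_adj2: "det (adj2 A) = det A"
  by (simp add: det_2)

lemma matrix_inv_adj2:
  assumes "det A = 1" shows "matrix_inv A = adj2 A"
proof -
  have "A ** adj2 A = mat 1 \<and> adj2 A ** A = mat 1" using assms by (simp add: adj2_mult mult_adj2)
  then have "matrix_inv A ** A = mat 1" unfolding matrix_inv_def by (rule someI2) simp
  then have "matrix_inv A ** A ** adj2 A = adj2 A" by simp
  then show ?thesis using assms by (simp add: matrix_mul_assoc[symmetric] mult_adj2)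
qed

lemma scaleR_matrix_mult: "(c *\<^sub>R A) ** B = c *\<^sub>R (A ** B)" "A ** (c *\<^sub>R B) = c *\<^sub>R (A ** B)"
  for A B :: "real^2^2"
  by (simp_all add: vec_eq_iff forall_2 matrix_mult_nth_2 algebra_simps)

lemma matrix_mult_add: "(A + B) ** C = A ** C + B ** C" "C ** (A + B) = C ** A + C ** B"
  for A B C :: "real^2^2"
  by (simp_all add: vec_eq_iff forall_2 matrix_mult_nth_2 algebra_simps)

lemma bounded_bilinear_matrix_mult: "bounded_bilinear ((**) :: real^2^2 \<Rightarrow> real^2^2 \<Rightarrow> real^2^2)"
  unfolding bilinear_conv_bounded_bilinear[symmetric] bilinear_def
  by (auto intro!: linearI simp: matrix_mult_add scaleR_matrix_mult)

lemma bounded_linear_adj2: "bounded_linear adj2"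
proof -
  have "linear adj2" by (rule linearI) (simp_all add: vec_eq_iff forall_2)
  then show ?thesis by (simp add: linear_conv_bounded_linear)
qed

lemmas continuous_on_matrix_mult = bounded_bilinear.continuous_on[OF bounded_bilinear_matrix_mult]
lemmas continuous_on_adj2 = bounded_linear.continuous_on[OF bounded_linear_adj2]

lemma frechet_derivative_conj:
  fixes B N :: "real^'d \<Rightarrow> real^2^2"
  assumes "B differentiable (at (x + v))" "B differentiable (at x)" "N differentiable (at x)"
  shows "frechet_derivative (\<lambda>x. B (x + v) ** N x ** adj2 (B x)) (at x) w =
     frechet_derivative B (at (x + v)) w ** N x ** adj2 (B x) +
     B (x + v) ** frechet_derivative N (at x) w ** adj2 (B x) +
     B (x + v) ** N x ** adj2 (frechet_derivative B (at x) w)"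
proof -
  have 1: "((\<lambda>x. B (x + v)) has_derivative frechet_derivative B (at (x + v))) (at x)"
  proof -
    have "((\<lambda>x. x + v) has_derivative (\<lambda>h. h)) (at x)" by (auto intro!: derivative_eq_intros)
    from has_derivative_compose[OF this, of B] show ?thesis
      using assms(1) by (simp add: frechet_derivative_works)
  qed
  have 2: "((\<lambda>x. adj2 (B x)) has_derivative (\<lambda>h. adj2 (frechet_derivative B (at x) h))) (at x)"
    by (rule bounded_linear.has_derivative[OF bounded_linear_adj2]) (use assms(2) in \<open>simp add: frechet_derivative_works\<close>)
  have 3: "(N has_derivative frechet_derivative N (at x)) (at x)" using assms(3) by (simp add: frechet_derivative_works)
  show ?thesis
    by (subst frechet_derivative_at[OF bounded_bilinear.FDERIV[OF bounded_bilinear_matrix_mult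
          bounded_bilinear.FDERIV[OF bounded_bilinear_matrix_mult 1 3] 2], symmetric])
      (simp add: matrix_mult_add add_ac)
qed

text \<open>
  The cross product that expresses monotonicity of \<open>b1 ** m ** adj2 b2\<close>, as a function of the values and velocities of the factors
  alone. Its continuity turns closeness of the conjugacies into positivity.
\<close>

definition conj_cross ::
  "(real^2^2) \<times> (real^2^2) \<times> (real^2^2) \<times> (real^2^2) \<Rightarrow> (real^2^2) \<times> (real^2^2) \<Rightarrow> real^2 \<Rightarrow> real" where
  "conj_cross = (\<lambda>(b1, d1, b2, d2) (m, m') y.
     cross2 ((b1 ** m ** adj2 b2) *v y) ((d1 ** m ** adj2 b2 + b1 ** m' ** adj2 b2 + b1 ** m ** adj2 d2) *v y))"

lemma continuous_conj_cross: "continuous_on UNIV (\<lambda>(p, q, y). conj_cross p q y)"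
proof -
  have mv: "continuous_on UNIV (\<lambda>z. f z *v g z)" if "continuous_on UNIV f" "continuous_on UNIV g"
    for f :: "'z::topological_space \<Rightarrow> real^2^2" and g
    unfolding matrix_vector_mult_def by (intro continuous_intros that)
  have cr: "continuous_on UNIV (\<lambda>z. cross2 (f z) (g z))" if "continuous_on UNIV f" "continuous_on UNIV g"
    for f g :: "'z::topological_space \<Rightarrow> real^2"
    unfolding cross2_def by (intro continuous_intros that)
  show ?thesis
    unfolding conj_cross_def case_prod_unfold
    by (intro cr mv continuous_on_add continuous_on_matrix_mult continuous_on_adj2 continuous_intros)
qed

lemma cross2_scale: "cross2 (M *v (c *\<^sub>R y)) (M' *v (c *\<^sub>R y)) = c\<^sup>2 * cross2 (M *v y) (M' *v y)"
  by (simp add: cross2_def matrix_vector_mult_scaleR power2_eq_square algebra_simps)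

text \<open>
  Monotonicity of the given conjugate is positivity of \<open>conj_cross\<close> on a compact set of values, which leaves room for a \<open>C\<^sup>1\<close>-small change of \<open>B\<close>.
\<close>

theorem smooth_monotonic_conjugacy:
  fixes B N :: "real^'d \<Rightarrow> real^2^2"
  assumes mono: "monotonic (\<lambda>x. B (x + v) ** N x ** matrix_inv (B x))"
    and B: "C1_cocycle_map B" and N: "torus_map N" "Ck_on 1 N UNIV"
  obtains B' w where "smooth_on B' UNIV" "torus_map B'" "\<And>x. det (B' x) > 0"
    "\<And>x y. y \<noteq> 0 \<Longrightarrow> cross2 ((B' (x + v) ** N x ** adj2 (B' x)) *v y)
       (frechet_derivative (\<lambda>x. B' (x + v) ** N x ** adj2 (B' x)) (at x) w *v y) > 0"
proof -
  have Bt: "torus_map B" and Bd: "\<And>x. det (B x) = 1" and B1: "Ck_on 1 B UNIV"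
    using B by (auto simp: C1_cocycle_map_def SL2_def)
  have dB: "B differentiable (at x)" for x using B1 by simp
  have dN: "N differentiable (at x)" for x using N(2) by simp
  let ?A = "\<lambda>x. B (x + v) ** N x ** adj2 (B x)"
  have eqA: "(\<lambda>x. B (x + v) ** N x ** matrix_inv (B x)) = ?A" using Bd by (simp add: matrix_inv_adj2)
  obtain w where A1: "C1_cocycle_map ?A"
    and w: "\<And>x y \<theta>. y \<noteq> 0 \<Longrightarrow> continuous_argument \<theta> (\<lambda>t. ?A (x + t *\<^sub>R w) *v y) \<Longrightarrow> \<exists>D>0. (\<theta> has_real_derivative D) (at 0)"
    using mono unfolding eqA monotonic_def by blast
  define DB where "DB x = frechet_derivative B (at x) w" for x
  define DN where "DN x = frechet_derivative N (at x) w" for x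
  have pos: "conj_cross (B (x + v), DB (x + v), B x, DB x) (N x, DN x) y > 0" if "y \<noteq> 0" for x y
  proof -
    have "cross2 (?A x *v y) (frechet_derivative ?A (at x) w *v y) > 0"
    proof (rule monotonic_imp_cross_pos)
      show "det (?A x) = 1" "?A differentiable (at x)" for x
        using A1 by (auto simp: C1_cocycle_map_def SL2_def)
    qed (use w that in auto)
    then show ?thesis unfolding frechet_derivative_conj[OF dB dB dN] by (simp add: conj_cross_def DB_def DN_def)
  qed
  let ?F = "\<lambda>x. ((B (x + v), DB (x + v), B x, DB x), (N x, DN x))"
  \<comment> \<open>All values that occur over the torus and the unit circle, and the open set on which monotonicity and orientation hold.\<close>
  define K where "K = (\<lambda>(x, y :: real^2). (fst (?F x), snd (?F x), y)) ` (cbox 0 One \<times> sphere 0 1)"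
  define S where "S = {p. case p of (p, q, y) \<Rightarrow> conj_cross p q y > 0} \<inter> {p. det (fst (snd (snd (fst p)))) > 0}"
  have c: "continuous_on T B" "continuous_on T DB" "continuous_on T N" "continuous_on T DN" for T
  proof -
    have "continuous_on UNIV DB" "continuous_on UNIV DN"
      using B1 N(2) by (simp_all add: DB_def[abs_def] DN_def[abs_def])
    then show "continuous_on T DB" "continuous_on T DN" using continuous_on_subset by blast+
    show "continuous_on T B" "continuous_on T N"
      using Ck_on_imp_continuous_on[OF B1] Ck_on_imp_continuous_on[OF N(2)] continuous_on_subset by blast+
  qed
  have "compact K"
    unfolding K_def case_prod_unfold
    by (intro compact_continuous_image compact_Times compact_cbox compact_sphere continuous_intros
        continuous_on_compose2[OF c(1)[of UNIV]] continuous_on_compose2[OF c(2)[of UNIV]]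
        continuous_on_compose2[OF c(3)[of UNIV]] continuous_on_compose2[OF c(4)[of UNIV]]) auto
  moreover have "open S"
  proof -
    have "open {p. 0 < (case p of (p, q, y) \<Rightarrow> conj_cross p q y)}"
      using continuous_conj_cross by (intro open_Collect_less continuous_on_const) auto
    moreover have "open {p :: (_ \<times> _ \<times> (real^2^2) \<times> _) \<times> _ \<times> _. 0 < det (fst (snd (snd (fst p))))}"
      unfolding det_2 by (intro open_Collect_less continuous_intros)
    ultimately show ?thesis unfolding S_def by (intro open_Int) (simp_all add: case_prod_unfold)
  qed
  moreover have "K \<subseteq> S" by (auto simp: K_def S_def Bd intro!: pos)
  ultimately obtain e where e: "e > 0" "(\<Union>p\<in>K. ball p e) \<subseteq> S" by (rule compact_subset_open_imp_ball_epsilon_subset)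
  \<comment> \<open>Four components move by at most \<open>e / 5\<close> each, hence together by less than \<open>e\<close>.\<close>
  obtain B' where B': "smooth_on B' UNIV" "torus_map B'" "\<And>x. norm (B' x - B x) \<le> e / 5"
    "\<And>x. norm (frechet_derivative B' (at x) w - frechet_derivative B (at x) w) \<le> e / 5"
    using C1_smoothing[OF Bt B1, of "e / 5" w] e(1) by auto
  define DB' where "DB' x = frechet_derivative B' (at x) w" for x
  have dB': "B' differentiable (at x)" for x
    using B'(1) unfolding smooth_on_def by (metis Ck_on.simps(2) UNIV_I)
  have inS: "((B' (x + v), DB' (x + v), B' x, DB' x), (N x, DN x), y) \<in> S" if y: "norm y = 1" for x y
  proof -
    have tF: "torus_map ?F"
      using Bt N(1) torus_map_frechet[OF dB Bt, of w] torus_map_frechet[OF dN N(1), of w]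
      unfolding torus_map_def DB_def DN_def by (simp add: add.assoc add.commute[of _ v] flip: add.assoc)
    obtain x' where x': "x' \<in> cbox 0 One"
      "\<And>f :: real^'d \<Rightarrow> ((real^2^2) \<times> (real^2^2) \<times> (real^2^2) \<times> (real^2^2)) \<times> (real^2^2) \<times> (real^2^2). torus_map f \<Longrightarrow> f x = f x'"
      using torus_representative[of x] by blast
    note Fx = x'(2)[OF tF]
    have "(fst (?F x), snd (?F x), y) \<in> K"
      unfolding K_def Fx by (intro image_eqI[of _ _ "(x', y)"]) (use y x'(1) in auto)
    moreover have "dist (fst (?F x), snd (?F x), y) ((B' (x + v), DB' (x + v), B' x, DB' x), (N x, DN x), y) < e"
    proof -
      have "norm (B (x + v) - B' (x + v), DB (x + v) - DB' (x + v), B x - B' x, DB x - DB' x) \<le>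
         norm (B (x + v) - B' (x + v)) + (norm (DB (x + v) - DB' (x + v)) + (norm (B x - B' x) + norm (DB x - DB' x)))"
        by (intro order_trans[OF norm_Pair_le] add_mono order_refl)
      also have "\<dots> \<le> e / 5 + (e / 5 + (e / 5 + e / 5))"
        using B'(3,4) by (intro add_mono) (simp_all add: DB_def DB'_def norm_minus_commute)
      also have "\<dots> < e" using e(1) by simp
      finally show ?thesis by (simp add: dist_norm norm_Pair)
    qed
    ultimately show ?thesis using e(2) by (auto simp: subset_eq)
  qed
  show ?thesis
  proof (rule that[OF B'(1,2)])
    obtain u :: "real^2" where "norm u = 1" using vector_choose_size[of 1] by auto
    then show "det (B' x) > 0" for x using inS[of u x] by (simp add: S_def)
    fix x and y :: "real^2" assume y: "y \<noteq> 0"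
    let ?u = "(1 / norm y) *\<^sub>R y"
    let ?M = "B' (x + v) ** N x ** adj2 (B' x)"
    let ?D = "frechet_derivative (\<lambda>x. B' (x + v) ** N x ** adj2 (B' x)) (at x) w"
    have "cross2 (?M *v ?u) (?D *v ?u) > 0"
      using inS[of ?u x] y unfolding frechet_derivative_conj[OF dB' dB' dN]
      by (simp add: S_def conj_cross_def DB'_def DN_def)
    then show "cross2 (?M *v y) (?D *v y) > 0"
      unfolding cross2_scale by (rule zero_less_mult_pos) (use y in simp)
  qed
qed

section \<open>Lyapunov exponents of conjugate cocycles\<close>

abbreviation opnorm :: "real^2^2 \<Rightarrow> real" where "opnorm A \<equiv> onorm (\<lambda>v. A *v v)"

lemma opnorm_mult: "opnorm (A ** B) \<le> opnorm A * opnorm B"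
  using onorm_compose[OF matrix_vector_mul_bounded_linear matrix_vector_mul_bounded_linear, of A B]
  by (simp add: o_def matrix_vector_mul_assoc)

lemma opnorm_scaleR: "opnorm (c *\<^sub>R A) = \<bar>c\<bar> * opnorm A"
  using onorm_scaleR[OF matrix_vector_mul_bounded_linear, of c A]
  by (simp add: scaleR_matrix_vector_assoc)

lemma opnorm_adj2: "opnorm (adj2 A) = opnorm A"
proof -
  have "lin_part (adj2 A) = cnj (lin_part A)" "anti_part (adj2 A) = - anti_part A"
    by (simp_all add: lin_part_def anti_part_def complex_eq_iff field_simps)
  then show ?thesis by (simp add: onorm_eq_parts)
qed

lemma opnorm_nonneg: "0 \<le> opnorm A" by (simp add: onorm_eq_parts)

text \<open>
  For positive determinant the linear part dominates, so it measures the norm up to a factor \<open>2\<close>.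
\<close>

lemma opnorm_lin_part:
  assumes "det A > 0"
  shows "0 < cmod (lin_part A)" "cmod (lin_part A) \<le> opnorm A" "opnorm A \<le> 2 * cmod (lin_part A)"
  using anti_less_lin[OF assms] unfolding onorm_eq_parts
  by (auto intro: le_less_trans[OF norm_ge_zero[of "anti_part A"]] simp del: zero_less_norm_iff)

lemma continuous_on_lin_part: "continuous_on S f \<Longrightarrow> continuous_on S (\<lambda>x. cmod (lin_part (f x)))"
  unfolding lin_part_def cmod_def by (auto intro!: continuous_intros)

lemma continuous_on_opnorm: "continuous_on S f \<Longrightarrow> continuous_on S (\<lambda>x. opnorm (f x))"
  unfolding onorm_eq_parts lin_part_def anti_part_def cmod_def by (auto intro!: continuous_intros)

lemma continuous_on_det_2: "continuous_on S f \<Longrightarrow> continuous_on S (\<lambda>x. det (f x :: real^2^2))"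
  unfolding det_2 by (intro continuous_intros)

lemma iterate_prod_add:
  "iterate_prod \<alpha> A (m + n) x = iterate_prod \<alpha> A m (x + real n *\<^sub>R \<alpha>) ** iterate_prod \<alpha> A n x"
proof (induction m)
  case (Suc m)
  have "x + real (m + n) *\<^sub>R \<alpha> = x + real n *\<^sub>R \<alpha> + real m *\<^sub>R \<alpha>" by (simp add: scaleR_add_left)
  then show ?case by (simp only: add_Suc iterate_prod.simps Suc matrix_mul_assoc)
qed simp

lemma continuous_on_iterate_prod:
  "continuous_on UNIV A \<Longrightarrow> continuous_on UNIV (iterate_prod \<alpha> A n)"
  by (induction n) (auto intro!: continuous_on_matrix_mult continuous_intros intro: continuous_on_compose2 simp: iterate_prod.simps[abs_def])

lemma det_iterate_prod: "(\<And>x. det (A x) = 1) \<Longrightarrow> det (iterate_prod \<alpha> A n x) = 1"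
  by (induction n) (simp_all add: det_mul)

lemma det_iterate_prod_pos: "(\<And>x. det (A x) > 0) \<Longrightarrow> det (iterate_prod \<alpha> A n x) > 0"
  by (induction n) (simp_all add: det_mul)

text \<open>
  The inner conjugacies telescope up to their determinants. The factor \<open>det (B x)\<close> on the left avoids a division and accounts for
  the empty product at \<open>l = 0\<close>.
\<close>

lemma iterate_prod_conj:
  fixes A B :: "real^'d \<Rightarrow> real^2^2" and \<alpha> :: "real^'d" and n :: nat
  defines "A' \<equiv> \<lambda>x. B (x + real n *\<^sub>R \<alpha>) ** iterate_prod \<alpha> A n x ** adj2 (B x)"
  shows "det (B x) *\<^sub>R iterate_prod (real n *\<^sub>R \<alpha>) A' l x =
    (\<Prod>j<l. det (B (x + real j *\<^sub>R (real n *\<^sub>R \<alpha>)))) *\<^sub>R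
      (B (x + real l *\<^sub>R (real n *\<^sub>R \<alpha>)) ** iterate_prod \<alpha> A (n * l) x ** adj2 (B x))"
proof (induction l)
  case 0
  then show ?case by (simp add: mult_adj2)
next
  case (Suc l)
  let ?y = "x + real l *\<^sub>R (real n *\<^sub>R \<alpha>)"
  let ?p = "\<Prod>j<l. det (B (x + real j *\<^sub>R (real n *\<^sub>R \<alpha>)))"
  have y: "x + real (n * l) *\<^sub>R \<alpha> = ?y" by (simp add: mult.commute)
  have y': "?y + real n *\<^sub>R \<alpha> = x + real (Suc l) *\<^sub>R (real n *\<^sub>R \<alpha>)" by (simp add: algebra_simps)
  have "det (B x) *\<^sub>R iterate_prod (real n *\<^sub>R \<alpha>) A' (Suc l) x =
      A' ?y ** (det (B x) *\<^sub>R iterate_prod (real n *\<^sub>R \<alpha>) A' l x)"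
    by (simp add: scaleR_matrix_mult)
  also have "\<dots> = ?p *\<^sub>R (B (?y + real n *\<^sub>R \<alpha>) ** iterate_prod \<alpha> A n ?y ** (adj2 (B ?y) ** B ?y)
      ** iterate_prod \<alpha> A (n * l) x ** adj2 (B x))"
    unfolding Suc by (simp add: A'_def scaleR_matrix_mult matrix_mul_assoc)
  also have "\<dots> = (?p * det (B ?y)) *\<^sub>R (B (?y + real n *\<^sub>R \<alpha>) **
      (iterate_prod \<alpha> A n ?y ** iterate_prod \<alpha> A (n * l) x) ** adj2 (B x))"
    by (simp add: adj2_mult scaleR_matrix_mult matrix_mul_assoc)
  also have "iterate_prod \<alpha> A n ?y ** iterate_prod \<alpha> A (n * l) x = iterate_prod \<alpha> A (n * Suc l) x"
    using iterate_prod_add[of \<alpha> A n "n * l" x] unfolding y by simp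
  finally show ?case unfolding y' by simp
qed

lemma abs_ln_diff_le:
  fixes a b :: real
  assumes "0 < a" "0 < b" "a \<le> E * b" "b \<le> E * a"
  shows "\<bar>ln a - ln b\<bar> \<le> ln E"
proof -
  have E: "E > 0" using assms by (metis less_le_trans zero_less_mult_pos2)
  have "ln a \<le> ln E + ln b" "ln b \<le> ln E + ln a"
    using assms E by (metis ln_mult_pos ln_mono mult_pos_pos)+
  then show ?thesis by linarith
qed

lemma abs_integral_diff_le:
  fixes f g :: "real^'d \<Rightarrow> real"
  assumes "continuous_on UNIV f" "continuous_on UNIV g" "\<And>x. \<bar>f x - g x\<bar> \<le> C"
  shows "\<bar>integral (cbox 0 One) f - integral (cbox 0 One) g\<bar> \<le> C"
proof -
  have i: "f integrable_on cbox 0 One" "g integrable_on cbox 0 One"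
    using assms(1,2) continuous_on_subset by (blast intro: integrable_continuous)+
  have "norm (integral (cbox 0 One) (\<lambda>x. f x - g x)) \<le> integral (cbox 0 One) (\<lambda>x :: real^'d. C)"
    by (rule integral_norm_bound_integral) (use assms(3) i in \<open>auto intro!: integrable_diff\<close>)
  moreover have "integral (cbox 0 One) (\<lambda>x :: real^'d. C) = C" by simp
  ultimately show ?thesis
    using Henstock_Kurzweil_Integration.integral_diff[OF i] by simp
qed

lemma torus_map_bounded:
  fixes f :: "real^'d \<Rightarrow> real"
  assumes "continuous_on UNIV f" "torus_map f"
  obtains K where "K \<ge> 1" "\<And>x. f x \<le> K"
proof -
  have "compact (f ` cbox 0 One)"
    by (intro compact_continuous_image continuous_on_subset[OF assms(1)]) auto
  then have "\<exists>C. \<forall>x\<in>cbox 0 One. \<bar>f x\<bar> \<le> C" by (auto dest!: compact_imp_bounded simp: bounded_iff)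
  then obtain C where C: "\<And>x. x \<in> cbox 0 One \<Longrightarrow> \<bar>f x\<bar> \<le> C" by blast
  show ?thesis
  proof (rule that[of "max 1 C"])
    fix x obtain y where "y \<in> cbox 0 One" "f x = f y" using torus_representative[of x] assms(2) by metis
    then show "f x \<le> max 1 C" using C[of y] by simp
  qed simp
qed

text \<open>
  A limit along multiples of \<open>n\<close> determines the limit of the averages if the sequence varies boundedly within blocks.
\<close>

lemma sequence_limit_from_blocks:
  fixes a :: "nat \<Rightarrow> real"
  assumes n: "n \<ge> 1" and C: "\<And>k. \<bar>a k - a (n * (k div n))\<bar> \<le> C"
    and lim: "(\<lambda>l. a (n * l) / real l) \<longlonglongrightarrow> c"
  shows "(\<lambda>k. a k / real k) \<longlonglongrightarrow> c / real n"
proof -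
  have f: "filterlim (\<lambda>k. k div n) at_top sequentially"
    unfolding filterlim_at_top
  proof
    fix Z
    show "\<forall>\<^sub>F k in sequentially. Z \<le> k div n"
      using eventually_ge_at_top[of "n * Z"] by eventually_elim (use n in \<open>simp add: less_eq_div_iff_mult_less_eq mult.commute\<close>)
  qed
  have z: "(\<lambda>k. D / real k) \<longlonglongrightarrow> 0" for D by real_asymp
  have r: "(\<lambda>k. real (k div n) / real k) \<longlonglongrightarrow> 1 / real n"
  proof (rule Lim_transform2[where f = "\<lambda>k. 1 / real n"])
    have "\<bar>1 / real n - real (k div n) / real k\<bar> \<le> 1 / real k" if "k > 0" for k
    proof -
      have "real k = real n * real (k div n) + real (k mod n)"
        by (metis of_nat_add of_nat_mult mult_div_mod_eq)
      then have eq: "1 / real n - real (k div n) / real k = (real (k mod n) / real n) / real k"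
        using n that by (simp add: field_simps)
      have "real (k mod n) / real n \<le> 1" using n by (simp add: less_imp_le)
      then have "(real (k mod n) / real n) / real k \<le> 1 / real k" by (intro divide_right_mono) auto
      moreover have "0 \<le> (real (k mod n) / real n) / real k" by simp
      ultimately show ?thesis unfolding eq by linarith
    qed
    then have "\<forall>\<^sub>F k in sequentially. \<bar>1 / real n - real (k div n) / real k\<bar> \<le> 1 / real k"
      using eventually_gt_at_top[of 0] by (rule eventually_mono[rotated])
    then show "(\<lambda>k. 1 / real n - real (k div n) / real k) \<longlonglongrightarrow> 0"
      by (intro tendsto_rabs_zero_cancel[OF tendsto_sandwich[OF _ _ tendsto_const z[of 1]]]) auto
  qed simp
  have "(\<lambda>k. a (n * (k div n)) / real (k div n) * (real (k div n) / real k)) \<longlonglongrightarrow> c * (1 / real n)"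
    by (intro tendsto_mult r filterlim_compose[OF lim f])
  moreover have "(\<lambda>k. (a k - a (n * (k div n))) / real k) \<longlonglongrightarrow> 0"
    by (rule tendsto_rabs_zero_cancel[OF tendsto_sandwich[OF _ _ tendsto_const z[of C]]])
      (use C in \<open>auto intro!: always_eventually divide_right_mono\<close>)
  ultimately have s: "(\<lambda>k. a (n * (k div n)) / real (k div n) * (real (k div n) / real k) + (a k - a (n * (k div n))) / real k)
      \<longlonglongrightarrow> c * (1 / real n) + 0" by (intro tendsto_add)
  have "\<forall>\<^sub>F k in sequentially. a (n * (k div n)) / real (k div n) * (real (k div n) / real k) + (a k - a (n * (k div n))) / real k = a k / real k"
    using eventually_ge_at_top[of n]
  proof eventually_elim
    case (elim k)
    then have "k div n > 0" "k > 0" using n by (simp_all add: div_greater_zero_iff)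
    then show ?case by (simp add: field_simps)
  qed
  from Lim_transform_eventually[OF s this] show ?thesis by simp
qed

lemma LINT_eq_integral:
  assumes "continuous_on UNIV f"
  shows "(LINT x : cbox 0 One | lborel. f x) = integral (cbox 0 One :: (real^'d) set) (f :: _ \<Rightarrow> real)"
proof (rule set_borel_integral_eq_integral)
  show "set_integrable lborel (cbox 0 One) f"
    unfolding set_integrable_def by (rule borel_integrable_compact[OF compact_cbox continuous_on_subset[OF assms]]) auto
qed

text \<open>
  All comparisons are pointwise up to bounded factors: products of length \<open>k\<close> with those of length \<open>n (k div n)\<close>, and the
  latter with the products of \<open>A'\<close>, corrected by the determinants of \<open>B\<close>. Bounded factors vanish in the
  exponential growth rate, and each determinant contributes the same integral by translation invariance.
\<close>

theorem lyapunov_exponent_conj: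
  fixes A B :: "real^'d \<Rightarrow> real^2^2" and \<alpha> :: "real^'d" and n :: nat
  defines "A' \<equiv> \<lambda>x. B (x + real n *\<^sub>R \<alpha>) ** iterate_prod \<alpha> A n x ** adj2 (B x)"
  assumes n: "n \<ge> 1"
    and A: "continuous_on UNIV A" "torus_map A" "\<And>x. det (A x) = 1"
    and B: "continuous_on UNIV B" "torus_map B" "\<And>x. det (B x) > 0"
    and lim: "(\<lambda>l. integral (cbox 0 One) (\<lambda>x. ln (cmod (lin_part (iterate_prod (real n *\<^sub>R \<alpha>) A' l x)))) / real l) \<longlonglongrightarrow> \<Lambda>"
  shows "lyapunov_exponent \<alpha> A = (\<Lambda> - integral (cbox 0 One) (\<lambda>x. ln (det (B x)))) / real n"
proof -
  let ?Q = "cbox 0 One :: (real^'d) set"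
  let ?P = "\<lambda>k x. iterate_prod \<alpha> A k x"
  let ?s = "\<lambda>x j. x + real j *\<^sub>R (real n *\<^sub>R \<alpha>)"
  have cP: "continuous_on UNIV (?P k)" for k by (rule continuous_on_iterate_prod[OF A(1)])
  have dP: "det (?P k x) = 1" for k x by (rule det_iterate_prod[OF A(3)])
  have Ppos: "opnorm (?P k x) > 0" for k x using less_le_trans[OF opnorm_lin_part(1,2)] dP[of k x] zero_less_one by metis
  have tv: "torus_map (\<lambda>x. g (f x))" if "torus_map f" for f :: "real^'d \<Rightarrow> real^2^2" and g :: "real^2^2 \<Rightarrow> real"
    using that by (simp add: torus_map_def)
  obtain K1 where K1: "K1 \<ge> 1" "\<And>x. opnorm (A x) \<le> K1"
    using torus_map_bounded[OF continuous_on_opnorm[OF A(1)] tv[OF A(2)]] by blast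
  obtain K where K: "K \<ge> 1" "\<And>x. opnorm (B x) \<le> K"
    using torus_map_bounded[OF continuous_on_opnorm[OF B(1)] tv[OF B(2)]] by blast
  have cd: "continuous_on UNIV (\<lambda>x. det (B x))" by (rule continuous_on_det_2[OF B(1)])
  have nz: "det (B x) \<noteq> 0" for x using B(3)[of x] by simp
  have "continuous_on UNIV (\<lambda>x. 1 / det (B x))" by (intro continuous_on_divide continuous_on_const cd ballI nz)
  then obtain D where D: "D \<ge> 1" "\<And>x. 1 / det (B x) \<le> D"
    using torus_map_bounded[OF _ tv[OF B(2), of "\<lambda>b. 1 / det b"]] by blast
  obtain D' where D': "D' \<ge> 1" "\<And>x. det (B x) \<le> D'"
    using torus_map_bounded[OF cd tv[OF B(2)]] by blast
  \<comment> \<open>Products of lengths \<open>k\<close> and \<open>n * (k div n)\<close> differ by fewer than \<open>n\<close> factors.\<close>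
  have Pr: "opnorm (?P r x) \<le> K1 ^ n" if "r \<le> n" for r x
  proof -
    have "opnorm (?P r x) \<le> K1 ^ r"
    proof (induction r)
      case 0
      show ?case by (simp add: onorm_eq_parts lin_part_def anti_part_def mat_def cmod_def)
    next
      case (Suc r)
      have "opnorm (?P (Suc r) x) \<le> opnorm (A (x + real r *\<^sub>R \<alpha>)) * opnorm (?P r x)" by (simp add: opnorm_mult)
      also have "\<dots> \<le> K1 * K1 ^ r" using K1 Suc by (intro mult_mono) (auto simp: opnorm_nonneg)
      finally show ?case by simp
    qed
    also have "\<dots> \<le> K1 ^ n" using K1(1) that by (intro power_increasing)
    finally show ?thesis .
  qed
  have c1: "\<bar>ln (opnorm (?P k x)) - ln (opnorm (?P (n * (k div n)) x))\<bar> \<le> ln (K1 ^ n)" for k x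
  proof (rule abs_ln_diff_le)
    define y where "y = x + real (n * (k div n)) *\<^sub>R \<alpha>"
    have split: "?P k x = ?P (k mod n) y ** ?P (n * (k div n)) x"
      using iterate_prod_add[of \<alpha> A "k mod n" "n * (k div n)" x] by (simp add: y_def)
    have r: "opnorm (?P (k mod n) y) \<le> K1 ^ n" using n by (intro Pr) (simp add: less_imp_le)
    show "opnorm (?P k x) \<le> K1 ^ n * opnorm (?P (n * (k div n)) x)"
      unfolding split by (intro order_trans[OF opnorm_mult] mult_right_mono r opnorm_nonneg)
    have "adj2 (?P (k mod n) y) ** ?P k x = ?P (n * (k div n)) x"
      unfolding split matrix_mul_assoc by (simp add: adj2_mult dP)
    then have "opnorm (?P (n * (k div n)) x) \<le> opnorm (?P (k mod n) y) * opnorm (?P k x)"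
      by (metis opnorm_mult opnorm_adj2)
    also have "\<dots> \<le> K1 ^ n * opnorm (?P k x)" by (intro mult_right_mono r opnorm_nonneg)
    finally show "opnorm (?P (n * (k div n)) x) \<le> K1 ^ n * opnorm (?P k x)" .
  qed (rule Ppos)+
  \<comment> \<open>Apart from the determinants collected in \<open>p\<close>, the conjugation costs a bounded factor only.\<close>
  have dA': "det (A' x) > 0" for x using B(3) by (simp add: A'_def det_mul dP det_adj2)
  let ?P' = "\<lambda>l x. iterate_prod (real n *\<^sub>R \<alpha>) A' l x"
  have cA': "continuous_on UNIV A'"
    unfolding A'_def by (intro continuous_on_matrix_mult continuous_on_adj2 cP B(1) continuous_on_compose2[OF B(1)] continuous_intros) auto
  have dP': "det (?P' l x) > 0" for l x by (rule det_iterate_prod_pos[OF dA'])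
  define p where "p l x = (\<Prod>j<l. det (B (?s x j)))" for l x
  have p: "p l x > 0" for l x unfolding p_def by (intro prod_pos) (use B(3) in auto)
  define E where "E = 2 * K\<^sup>2 * D\<^sup>2 * D'"
  have c2: "\<bar>ln (cmod (lin_part (?P' l x))) - ln (p l x * opnorm (?P (n * l) x))\<bar> \<le> ln E" for l x
  proof (rule abs_ln_diff_le)
    let ?l = "cmod (lin_part (?P' l x))" and ?b = "B (?s x l)" and ?N = "?P (n * l) x"
    note lp = opnorm_lin_part[OF dP', of l x]
    show "0 < ?l" by (rule lp)
    show "0 < p l x * opnorm ?N" using p Ppos by simp
    have id: "det (B x) *\<^sub>R ?P' l x = p l x *\<^sub>R (?b ** ?N ** adj2 (B x))"
      unfolding A'_def p_def by (rule iterate_prod_conj)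
    have o1: "det (B x) * opnorm (?P' l x) = p l x * opnorm (?b ** ?N ** adj2 (B x))"
      using arg_cong[OF id, of opnorm] B(3)[of x] p[of l x] by (simp add: opnorm_scaleR)
    have "opnorm (?b ** ?N ** adj2 (B x)) \<le> opnorm ?b * opnorm ?N * opnorm (adj2 (B x))"
      by (intro order_trans[OF opnorm_mult] mult_right_mono opnorm_mult opnorm_nonneg)
    also have "\<dots> \<le> K * opnorm ?N * K"
      using K by (intro mult_mono) (auto simp: opnorm_adj2 opnorm_nonneg)
    finally have o2: "opnorm (?b ** ?N ** adj2 (B x)) \<le> K\<^sup>2 * opnorm ?N" by (simp add: power2_eq_square mult_ac)
    have dx: "0 < det (B x)" "1 \<le> D * det (B x)" "0 < det ?b" "1 \<le> D * det ?b" "det (B x) \<le> D'"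
      using B(3)[of x] B(3)[of "?s x l"] D(2)[of x] D(2)[of "?s x l"] D'(2) by (simp_all add: field_simps)
    have E1: "K\<^sup>2 * D \<le> E"
    proof -
      have "1 * 1 \<le> (2 * D) * D'" using D(1) D'(1) by (intro mult_mono) auto
      then have "(K\<^sup>2 * D) * 1 \<le> (K\<^sup>2 * D) * ((2 * D) * D')" using D(1) by (intro mult_left_mono) auto
      then show ?thesis by (simp add: E_def power2_eq_square mult_ac)
    qed
    have "?l \<le> opnorm (?P' l x)" by (rule lp)
    also have "\<dots> \<le> (D * det (B x)) * opnorm (?P' l x)"
      using mult_right_mono[OF dx(2) opnorm_nonneg[of "?P' l x"]] by simp
    also have "\<dots> = D * (p l x * opnorm (?b ** ?N ** adj2 (B x)))" unfolding o1[symmetric] by simp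
    also have "\<dots> \<le> D * (p l x * (K\<^sup>2 * opnorm ?N))"
      using D(1) p[of l x] o2 by (intro mult_left_mono) auto
    also have "\<dots> = (K\<^sup>2 * D) * (p l x * opnorm ?N)" by simp
    also have "\<dots> \<le> E * (p l x * opnorm ?N)"
      using p[of l x] by (intro mult_right_mono E1) (auto simp: opnorm_nonneg)
    finally show "?l \<le> E * (p l x * opnorm ?N)" .
    have "adj2 ?b ** (?b ** ?N ** adj2 (B x)) ** B x = (adj2 ?b ** ?b) ** ?N ** (adj2 (B x) ** B x)"
      by (simp add: matrix_mul_assoc)
    also have "\<dots> = (det ?b * det (B x)) *\<^sub>R ?N" by (simp add: adj2_mult scaleR_matrix_mult mult.commute)
    finally have "(det ?b * det (B x)) * opnorm ?N = opnorm (adj2 ?b ** (?b ** ?N ** adj2 (B x)) ** B x)"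
      using dx by (simp add: opnorm_scaleR)
    also have "\<dots> \<le> opnorm (adj2 ?b) * opnorm (?b ** ?N ** adj2 (B x)) * opnorm (B x)"
      by (intro order_trans[OF opnorm_mult] mult_right_mono opnorm_mult opnorm_nonneg)
    also have "\<dots> \<le> K * opnorm (?b ** ?N ** adj2 (B x)) * K"
      using K by (intro mult_mono) (auto simp: opnorm_adj2 opnorm_nonneg)
    finally have o3: "(det ?b * det (B x)) * opnorm ?N \<le> K\<^sup>2 * opnorm (?b ** ?N ** adj2 (B x))" by (simp add: power2_eq_square mult_ac)
    have "1 * 1 \<le> (D * det ?b) * (D * det (B x))" using dx D(1) by (intro mult_mono) auto
    then have "p l x * opnorm ?N \<le> ((D * det ?b) * (D * det (B x))) * (p l x * opnorm ?N)"
      using mult_right_mono[of 1 "(D * det ?b) * (D * det (B x))" "p l x * opnorm ?N"] p[of l x] opnorm_nonneg[of ?N] by simp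
    also have "\<dots> = (D\<^sup>2 * p l x) * ((det ?b * det (B x)) * opnorm ?N)" by (simp add: power2_eq_square mult_ac)
    also have "\<dots> \<le> (D\<^sup>2 * p l x) * (K\<^sup>2 * opnorm (?b ** ?N ** adj2 (B x)))"
      using p[of l x] by (intro mult_left_mono o3) auto
    also have "\<dots> = D\<^sup>2 * K\<^sup>2 * (det (B x) * opnorm (?P' l x))" unfolding o1 by simp
    also have "\<dots> \<le> D\<^sup>2 * K\<^sup>2 * (D' * (2 * ?l))"
      using dx lp(3) by (intro mult_left_mono mult_mono) (auto simp: opnorm_nonneg)
    also have "\<dots> = E * ?l" by (simp add: E_def)
    finally show "p l x * opnorm ?N \<le> E * ?l" .
  qed
  define a where "a k = integral ?Q (\<lambda>x. ln (opnorm (?P k x)))" for k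
  define \<delta> where "\<delta> = integral ?Q (\<lambda>x. ln (det (B x)))"
  define b where "b l = integral ?Q (\<lambda>x. ln (cmod (lin_part (?P' l x))))" for l
  have ca: "continuous_on UNIV (\<lambda>x. ln (opnorm (?P k x)))" for k
    by (intro continuous_on_ln continuous_on_opnorm cP ballI less_imp_neq[THEN not_sym] Ppos)
  have cdet: "continuous_on UNIV (\<lambda>x. ln (det (B x)))"
    by (intro continuous_on_ln cd ballI nz)
  have cdet': "continuous_on UNIV (\<lambda>x. ln (det (B (?s x j))))" for j
    by (rule continuous_on_compose2[OF cdet]) (auto intro!: continuous_intros)
  have cb: "continuous_on UNIV (\<lambda>x. ln (cmod (lin_part (?P' l x))))" for l
    by (intro continuous_on_ln continuous_on_lin_part continuous_on_iterate_prod cA'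
        ballI less_imp_neq[THEN not_sym] opnorm_lin_part(1) dP')
  have ln_p: "ln (p l x * opnorm (?P (n * l) x)) = (\<Sum>j<l. ln (det (B (?s x j)))) + ln (opnorm (?P (n * l) x))" for l x
  proof -
    have "ln (p l x) = (\<Sum>j<l. ln (det (B (?s x j))))"
      unfolding p_def by (rule ln_prod) (simp_all add: nz)
    then show ?thesis using p[of l x] Ppos[of "n * l" x] by (simp add: ln_mult_pos)
  qed
  have int: "integral ?Q (\<lambda>x. (\<Sum>j<l. ln (det (B (?s x j)))) + ln (opnorm (?P (n * l) x))) = real l * \<delta> + a (n * l)" for l
  proof -
    have i: "(\<lambda>x. ln (det (B (?s x j)))) integrable_on ?Q" for j
      by (rule integrable_continuous[OF continuous_on_subset[OF cdet']]) simp
    have e: "integral ?Q (\<lambda>x. ln (det (B (?s x j)))) = \<delta>" for j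
      unfolding \<delta>_def by (rule integral_torus_shift[OF cdet tv[OF B(2), of "\<lambda>b. ln (det b)"]])
    have "integral ?Q (\<lambda>x. \<Sum>j<l. ln (det (B (?s x j)))) = (\<Sum>j<l. integral ?Q (\<lambda>x. ln (det (B (?s x j)))))"
      by (rule integral_sum[OF finite_lessThan i])
    also have "\<dots> = real l * \<delta>" unfolding e by simp
    finally have s: "integral ?Q (\<lambda>x. \<Sum>j<l. ln (det (B (?s x j)))) = real l * \<delta>" .
    have "integral ?Q (\<lambda>x. (\<Sum>j<l. ln (det (B (?s x j)))) + ln (opnorm (?P (n * l) x))) =
       integral ?Q (\<lambda>x. \<Sum>j<l. ln (det (B (?s x j)))) + integral ?Q (\<lambda>x. ln (opnorm (?P (n * l) x)))"
      by (intro Henstock_Kurzweil_Integration.integral_add integrable_sum finite_lessThan i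
          integrable_continuous[OF continuous_on_subset[OF ca]]) simp
    then show ?thesis unfolding s a_def .
  qed
  have ba: "\<bar>b l - (real l * \<delta> + a (n * l))\<bar> \<le> ln E" for l
    unfolding b_def int[symmetric]
    by (rule abs_integral_diff_le[OF cb continuous_on_add[OF continuous_on_sum[OF cdet'] ca] c2[unfolded ln_p]])
  have aa: "\<bar>a k - a (n * (k div n))\<bar> \<le> ln (K1 ^ n)" for k
    unfolding a_def by (rule abs_integral_diff_le[OF ca ca c1])
  have "(\<lambda>l. a (n * l) / real l) \<longlonglongrightarrow> \<Lambda> - \<delta>"
  proof -
    have z: "(\<lambda>l. ln E / real l) \<longlonglongrightarrow> 0" by real_asymp
    have "(\<lambda>l. (b l - (real l * \<delta> + a (n * l))) / real l) \<longlonglongrightarrow> 0"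
      by (rule tendsto_rabs_zero_cancel[OF tendsto_sandwich[OF _ _ tendsto_const z]])
        (use ba in \<open>auto intro!: always_eventually divide_right_mono\<close>)
    from tendsto_diff[OF tendsto_diff[OF lim[folded b_def] tendsto_const[of \<delta>]] this]
    have "(\<lambda>l. b l / real l - \<delta> - (b l - (real l * \<delta> + a (n * l))) / real l) \<longlonglongrightarrow> \<Lambda> - \<delta>" by simp
    moreover have "\<forall>\<^sub>F l in sequentially. b l / real l - \<delta> - (b l - (real l * \<delta> + a (n * l))) / real l = a (n * l) / real l"
      using eventually_gt_at_top[of 0] by eventually_elim (simp add: field_simps)
    ultimately show ?thesis by (rule Lim_transform_eventually)
  qed
  from sequence_limit_from_blocks[OF n aa this]
  have "(\<lambda>k. a k / real k) \<longlonglongrightarrow> (\<Lambda> - \<delta>) / real n" .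
  then have "lim (\<lambda>k. 1 / real k * (LINT x : ?Q | lborel. ln (opnorm (?P k x)))) = (\<Lambda> - \<delta>) / real n"
    unfolding LINT_eq_integral[OF ca] by (intro limI) (simp add: a_def)
  then show ?thesis by (simp only: lyapunov_exponent_def \<delta>_def)
qed

section \<open>Smooth dependence of the Lyapunov exponent\<close>

lemma smooth_on_Pair:
  assumes S: "open S" and f: "smooth_on f S" and g: "smooth_on g S"
  shows "smooth_on (\<lambda>x. (f x, g x)) S"
proof -
  have l: "bounded_linear (\<lambda>x. (x, 0 :: 'c))" "bounded_linear (\<lambda>y. (0 :: 'b, y))"
    for x :: "'b::real_normed_vector" and y :: "'c::real_normed_vector"
    by (intro bounded_linear_Pair bounded_linear_ident bounded_linear_zero)+
  have "smooth_on (\<lambda>x. (f x, 0) + (0, g x)) S"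
    by (intro smooth_on_add[OF S] smooth_on_compose_linear[OF S l(1) f] smooth_on_compose_linear[OF S l(2) g])
  then show ?thesis by simp
qed

lemma torus_map_iterate_prod:
  assumes "torus_map A" shows "torus_map (iterate_prod \<alpha> A n)"
proof (induction n)
  case (Suc n)
  then show ?case using torus_map_shift[OF assms, of "real n *\<^sub>R \<alpha>"] by (simp add: torus_map_def)
qed (simp add: torus_map_def)

lemma smooth_on_translate:
  fixes \<alpha> :: "real \<Rightarrow> real^'d"
  assumes I: "open I" and \<alpha>: "smooth_on \<alpha> I"
  shows "smooth_on (\<lambda>p. snd p + c *\<^sub>R \<alpha> (fst p)) (I \<times> UNIV)"
proof -
  have o: "open (I \<times> (UNIV :: (real^'d) set))" using I by (intro open_Times) auto
  have "smooth_on (\<lambda>p. \<alpha> (fst p)) (I \<times> (UNIV :: (real^'d) set))"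
    by (rule smooth_on_compose[OF o I _ \<alpha> smooth_on_linear[OF o bounded_linear_fst]]) auto
  then show ?thesis
    by (rule smooth_on_add[OF o smooth_on_linear[OF o bounded_linear_snd]
          smooth_on_scaleR[OF o smooth_on_const[OF o]]])
qed

lemma smooth_on_iterate_prod:
  fixes \<alpha> :: "real \<Rightarrow> real^'d" and A :: "real \<times> (real^'d) \<Rightarrow> real^2^2"
  assumes I: "open I" and \<alpha>: "smooth_on \<alpha> I" and A: "smooth_on A (I \<times> UNIV)"
  shows "smooth_on (\<lambda>p. iterate_prod (\<alpha> (fst p)) (\<lambda>x. A (fst p, x)) n (snd p)) (I \<times> UNIV)"
proof (induction n)
  case 0
  then show ?case using I by (simp add: smooth_on_const open_Times)
next
  case (Suc n)
  have o: "open (I \<times> (UNIV :: (real^'d) set))" using I by (intro open_Times) auto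
  have "smooth_on (\<lambda>p. A (fst p, snd p + real n *\<^sub>R \<alpha> (fst p))) (I \<times> UNIV)"
    by (rule smooth_on_compose[OF o o _ A smooth_on_Pair[OF o smooth_on_linear[OF o bounded_linear_fst] smooth_on_translate[OF I \<alpha>]]]) auto
  then show ?case unfolding iterate_prod.simps using Suc by (intro smooth_on_bilinear[OF bounded_bilinear_matrix_mult o])
qed

text \<open>
  The smoothed conjugacy obtained at the parameter \<open>sc\<close> is used for all parameters: the conjugated family is smooth and monotone at \<open>sc\<close>,
  which suffices for \<open>monotone_family_log_growth\<close>.
\<close>

theorem smooth_on_lyapunov_near:
  fixes I :: "real set" and \<alpha> :: "real \<Rightarrow> real^'d" and A :: "real \<times> (real^'d) \<Rightarrow> real^2^2"
  assumes I: "open I" and sc: "sc \<in> I" and \<alpha>: "smooth_on \<alpha> I" and A: "smooth_on A (I \<times> UNIV)"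
    and t: "\<And>s. s \<in> I \<Longrightarrow> torus_map (\<lambda>x. A (s, x))" and det: "\<And>s x. s \<in> I \<Longrightarrow> det (A (s, x)) = 1"
    and pre: "premonotonic (\<alpha> sc) (\<lambda>x. A (sc, x))"
  shows "\<exists>T. sc \<in> T \<and> open T \<and> smooth_on (\<lambda>s. lyapunov_exponent (\<alpha> s) (\<lambda>x. A (s, x))) T"
proof -
  have o: "open (I \<times> (UNIV :: (real^'d) set))" using I by (intro open_Times) auto
  obtain n B where n: "n \<ge> 1" and B: "C1_cocycle_map B"
    and mono: "monotonic (\<lambda>x. B (x + real n *\<^sub>R \<alpha> sc) ** iterate_prod (\<alpha> sc) (\<lambda>x. A (sc, x)) n x ** matrix_inv (B x))"
    using pre unfolding premonotonic_def by blast
  define N where "N p = iterate_prod (\<alpha> (fst p)) (\<lambda>x. A (fst p, x)) n (snd p)" for p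
  have N: "smooth_on N (I \<times> UNIV)" unfolding N_def by (rule smooth_on_iterate_prod[OF I \<alpha> A])
  have slice: "smooth_on (\<lambda>x. F (s, x)) UNIV" if "smooth_on F (I \<times> UNIV)" "s \<in> I" for F :: "real \<times> (real^'d) \<Rightarrow> real^2^2" and s
    by (rule smooth_on_compose[OF open_UNIV o _ that(1) smooth_on_Pair[OF open_UNIV smooth_on_const smooth_on_linear[OF open_UNIV bounded_linear_ident]]])
      (use that(2) in auto)
  have tN: "torus_map (\<lambda>x. N (s, x))" if "s \<in> I" for s
    unfolding N_def fst_conv snd_conv by (rule torus_map_iterate_prod[OF t[OF that]])
  have "Ck_on 1 (\<lambda>x. N (sc, x)) UNIV" using slice[OF N sc] by (simp add: smooth_on_def del: Ck_on.simps)
  moreover have "monotonic (\<lambda>x. B (x + real n *\<^sub>R \<alpha> sc) ** N (sc, x) ** matrix_inv (B x))"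
    using mono by (simp add: N_def)
  ultimately obtain B' w where B': "smooth_on B' UNIV" "torus_map B'" "\<And>x. det (B' x) > 0"
    "\<And>x y. y \<noteq> 0 \<Longrightarrow> cross2 ((B' (x + real n *\<^sub>R \<alpha> sc) ** N (sc, x) ** adj2 (B' x)) *v y)
       (frechet_derivative (\<lambda>x. B' (x + real n *\<^sub>R \<alpha> sc) ** N (sc, x) ** adj2 (B' x)) (at x) w *v y) > 0"
    using smooth_monotonic_conjugacy[OF _ B tN[OF sc]] by blast
  define A' where "A' p = B' (snd p + real n *\<^sub>R \<alpha> (fst p)) ** N p ** adj2 (B' (snd p))" for p
  have A'eq: "(\<lambda>x. A' (s, x)) = (\<lambda>x. B' (x + real n *\<^sub>R \<alpha> s) ** iterate_prod (\<alpha> s) (\<lambda>x. A (s, x)) n x ** adj2 (B' x))" for s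
    by (simp add: A'_def N_def)
  have A': "smooth_on A' (I \<times> UNIV)"
  proof -
    have b1: "smooth_on (\<lambda>p. B' (snd p + real n *\<^sub>R \<alpha> (fst p))) (I \<times> UNIV)"
      by (rule smooth_on_compose[OF o open_UNIV _ B'(1) smooth_on_translate[OF I \<alpha>]]) auto
    have b2: "smooth_on (\<lambda>p. B' (snd p)) (I \<times> UNIV)"
      by (rule smooth_on_compose[OF o open_UNIV _ B'(1) smooth_on_linear[OF o bounded_linear_snd]]) auto
    show ?thesis unfolding A'_def
      by (intro smooth_on_bilinear[OF bounded_bilinear_matrix_mult o] N smooth_on_compose_linear[OF o bounded_linear_adj2] b1 b2)
  qed
  have dN: "det (N (s, x)) = 1" if "s \<in> I" for s x
    unfolding N_def using det[OF that] by (simp add: det_iterate_prod)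
  have tA': "torus_map (\<lambda>x. A' (s, x))" if "s \<in> I" for s
    using tN[OF that] torus_map_shift[OF B'(2), of "real n *\<^sub>R \<alpha> s"] B'(2) unfolding A'_def torus_map_def by simp
  have cross: "cross2 (A' (sc, x) *v y) (frechet_derivative A' (at (sc, x)) (0, w) *v y) > 0" if "y \<noteq> 0" for x y
  proof -
    have d: "(A' has_derivative frechet_derivative A' (at (sc, x))) (at (sc, x))"
      by (rule smooth_on_has_derivative[OF A']) (use sc in simp)
    have "((\<lambda>x. (sc, x)) has_derivative (\<lambda>h. (0, h))) (at x)" by (auto intro!: derivative_eq_intros)
    from frechet_derivative_at[OF has_derivative_compose[OF this d]]
    have "frechet_derivative (\<lambda>x. A' (sc, x)) (at x) w = frechet_derivative A' (at (sc, x)) (0, w)" by metis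
    with B'(4)[OF that, of x] show ?thesis by (simp add: A'_def)
  qed
  have sn: "smooth_on (\<lambda>s. real n *\<^sub>R \<alpha> s) I"
    by (rule smooth_on_compose_linear[OF I bounded_linear_scaleR_right \<alpha>])
  have dA': "det (A' (s, x)) > 0" if "s \<in> I" for s x
    using B'(3) dN[OF that] by (simp add: A'_def det_mul det_adj2)
  obtain \<rho> \<Lambda> where \<rho>: "\<rho> > 0" "ball sc \<rho> \<subseteq> I" "smooth_on \<Lambda> (ball sc \<rho>)"
    and \<Lambda>: "\<And>s. s \<in> ball sc \<rho> \<Longrightarrow>
      (\<lambda>l. integral (cbox 0 One) (\<lambda>x. ln (cmod (lin_part (iterate_prod (real n *\<^sub>R \<alpha> s) (\<lambda>x. A' (s, x)) l x)))) / real l) \<longlonglongrightarrow> \<Lambda> s"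
    using monotone_family_log_growth[OF I sc sn A' tA' dA' cross] by blast
  define \<delta> where "\<delta> = integral (cbox 0 One) (\<lambda>x. ln (det (B' x)))"
  have L: "lyapunov_exponent (\<alpha> s) (\<lambda>x. A (s, x)) = (\<Lambda> s + - \<delta>) * (1 / real n)" if s: "s \<in> ball sc \<rho>" for s
  proof -
    have sI: "s \<in> I" using s \<rho>(2) by blast
    have "lyapunov_exponent (\<alpha> s) (\<lambda>x. A (s, x)) = (\<Lambda> s - integral (cbox 0 One) (\<lambda>x. ln (det (B' x)))) / real n"
    proof (rule lyapunov_exponent_conj[OF n _ t[OF sI] det[OF sI] _ B'(2,3)])
      show "continuous_on UNIV (\<lambda>x. A (s, x))" by (rule smooth_on_imp_continuous_on[OF slice[OF A sI]])
      show "continuous_on UNIV B'" by (rule smooth_on_imp_continuous_on[OF B'(1)])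
    qed (use \<Lambda>[OF s] in \<open>simp only: A'eq\<close>)
    then show ?thesis by (simp add: \<delta>_def)
  qed
  have "smooth_on (\<lambda>s. (\<Lambda> s + - \<delta>) * (1 / real n)) (ball sc \<rho>)"
    by (intro smooth_on_mult smooth_on_add smooth_on_const open_ball \<rho>(3))
  then have "smooth_on (\<lambda>s. lyapunov_exponent (\<alpha> s) (\<lambda>x. A (s, x))) (ball sc \<rho>)"
    by (rule smooth_on_cong[OF open_ball, rotated]) (simp add: L)
  then show ?thesis using \<rho>(1) by (intro exI[of _ "ball sc \<rho>"]) auto
qed

theorem theorem1p4:
  fixes I :: "real set"
    and \<alpha> :: "real \<Rightarrow> real ^ 'd"
    and A :: "real \<Rightarrow> real ^ 'd \<Rightarrow> real ^ 2 ^ 2"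
  assumes "open I" and "is_interval I"
    and "smooth_on \<alpha> I"
    and "\<And>s. s \<in> I \<Longrightarrow> torus_map (A s)"
    and "\<And>s x. s \<in> I \<Longrightarrow> A s x \<in> SL2"
    and "smooth_on (\<lambda>(s, x). A s x) (I \<times> UNIV)"
    and "\<And>s. s \<in> I \<Longrightarrow> premonotonic (\<alpha> s) (A s)"
  shows "smooth_on (\<lambda>s. lyapunov_exponent (\<alpha> s) (A s)) I"
proof (rule smooth_on_local)
  fix s assume s: "s \<in> I"
  show "\<exists>T. s \<in> T \<and> open T \<and> smooth_on (\<lambda>s. lyapunov_exponent (\<alpha> s) (A s)) T"
    using smooth_on_lyapunov_near[OF assms(1) s assms(3,6)] assms(4,5,7) s by (auto simp: SL2_def)
qed

end
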